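(* Let $d\ge2$, let $D\subset\mathbb{R}^d$ be a bounded domain of class $C^2$, and let $X$ be super-Brownian motion in $D$ with branching mechanism $$\psi(u)=\int n(dr)\,(e^{-ur}-1+ur),\qquad u\ge0,$$ where $n(dr)$ is a $\sigma$-finite measure on $(0,\infty)$ with $\int(r\wedge r^2)\,n(dr)<\infty$. Let $X^D$ be the exit measure of $X$ from $D$, let $\mu\in\mathcal{M}_F^D$, and for $\varepsilon>0$ set $$X_\varepsilon^D(dy)=\varepsilon^{-2}\int_0^\infty\mathbb{1}_{F_\varepsilon}(y)\,X_t(dy)\,dt,\qquad F_\varepsilon=\{x\in D:\operatorname{dist}(x,D^c)\le\varepsilon\}.$$ Then $X_\varepsilon^D$ converges weakly to $X^D$ as $\varepsilon\downarrow0$, in $\mathbb{P}_\mu$-probability (as finite measures on $\overline D$).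
   Context: Notation. $\mathcal{M}_F^D$ is the space of finite measures on $D$ with the weak topology. $\langle\mu,\phi\rangle=\int\phi\,d\mu$. $\mathcal{B}_b^+(E)$ denotes the nonnegative bounded Borel functions on $E$. Killed Brownian motion. $(\xi_t,t\ge0;\Pi_x,x\in D)$ is Brownian motion (generator $\frac12\Delta$) killed at its first exit time $\zeta$ from $D$. Super-Brownian motion. $X=(X_t,t\ge0)$ is the (càdlàg) time-homogeneous strong Markov process in $\mathcal{M}_F^D$, starting from $\mu$ under $\mathbb{P}_\mu$, such that for $\phi\in\mathcal{B}_b^+(D)$, $\mathbb{E}_\mu[e^{-\langle X_t,\phi\rangle}]=e^{-\langle\mu,u_t\rangle}$, where $(u_t(x),t\ge0,x\in D)$ is the unique nonnegative solution of $u_t(x)+\Pi_x[\int_0^{t\wedge\zeta}\psi(u_{t-s}(\xi_s))ds]=\Pi_x[\phi(\xi_t)\mathbb{1}_{\{t<\zeta\}}]$. Exit measure. $X^D$ is the exit measure of $X$ from $D$: a random finite measure on $\partial D$ (defined on the same space as $X$) whose joint law with $\int_0^\infty X_t\,dt$ is given, for $g\in\mathcal{B}_b^+(\partial D)$, $\phi\in\mathcal{B}_b^+(D)$ and $\mu\in\mathcal{M}_F^D$, by $\mathbb{E}_\mu[\exp(-\int_0^\infty\langle X_t,\phi\rangle dt-\langle X^D,g\rangle)]=e^{-\langle\mu,w\rangle}$, where $w\ge0$ solves $w(x)+\Pi_x[\int_0^\zeta\psi(w(\xi_t))dt]=\Pi_x[\int_0^\zeta\phi(\xi_t)dt+g(\xi_{\zeta-})]$,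 $x\in D$. Weak convergence in probability means: $\langle X_\varepsilon^D,\varphi\rangle\to\langle X^D,\varphi\rangle$ in $\mathbb{P}_\mu$-probability for every continuous function $\varphi$ on $\overline D$. *)

theory Defs
  imports "HOL-Probability.Probability"
begin

section \<open>Domains\<close>

definition C2_function :: "('a::euclidean_space \<Rightarrow> real) \<Rightarrow> bool" where
  "C2_function f \<longleftrightarrow> (\<exists>(g :: 'a \<Rightarrow> 'a) (H :: 'a \<Rightarrow> 'a \<Rightarrow>\<^sub>L 'a).
     (\<forall>x. (f has_derivative (\<lambda>h. g x \<bullet> h)) (at x)) \<and>
     (\<forall>x. (g has_derivative blinfun_apply (H x)) (at x)) \<and>
     continuous_on UNIV H)"

text \<open>Near each boundary point, \<open>D\<close> is the region strictly above the graph of a \<open>C\<^sup>2\<close> function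
  over the hyperplane orthogonal to some unit vector \<open>e\<close>. Only the values of \<open>f\<close> on that hyperplane
  matter, and every \<open>C\<^sup>2\<close> function on it extends to the whole space, constantly along \<open>e\<close>.\<close>

definition C2_domain :: "'a::euclidean_space set \<Rightarrow> bool" where
  "C2_domain D \<longleftrightarrow> open D \<and> connected D \<and> D \<noteq> {} \<and>
     (\<forall>z\<in>frontier D. \<exists>r>0. \<exists>e f. norm e = 1 \<and> C2_function f \<and>
        D \<inter> ball z r = {y \<in> ball z r. f (y - (y \<bullet> e) *\<^sub>R e) < y \<bullet> e})"

definition inner_strip :: "'a::euclidean_space set \<Rightarrow> real \<Rightarrow> 'a set" where
  "inner_strip D \<epsilon> = {x \<in> D. infdist x (- D) \<le> \<epsilon>}"

definition bounded_borel_nonneg :: "'a::euclidean_space set \<Rightarrow> ('a \<Rightarrow> real) set" where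
  "bounded_borel_nonneg E =
     {f \<in> borel_measurable (restrict_space borel E). (\<forall>x\<in>E. 0 \<le> f x) \<and> bounded (f ` E)}"

section \<open>Spaces of finite measures\<close>

definition finite_measures :: "'a::euclidean_space set \<Rightarrow> 'a measure set" where
  "finite_measures E = {\<mu>. sets \<mu> = sets (restrict_space borel E) \<and> finite_measure \<mu>}"

text \<open>The coarsest topology making \<open>\<mu> \<mapsto> \<integral>f d\<mu>\<close> continuous for all bounded continuous \<open>f\<close> on \<open>E\<close>.\<close>

definition weak_topology :: "'a::euclidean_space set \<Rightarrow> 'a measure topology" where
  "weak_topology E = pullback_topology (finite_measures E)
     (\<lambda>\<mu>. \<lambda>f \<in> {f. continuous_on E f \<and> bounded (f ` E)}. \<integral>x. f x \<partial>\<mu>)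
     (product_topology (\<lambda>_. euclideanreal) {f :: 'a \<Rightarrow> real. continuous_on E f \<and> bounded (f ` E)})"

text \<open>The sigma-algebra generated by the evaluations \<open>\<mu> \<mapsto> \<mu>(A)\<close>, as for \<^const>\<open>subprob_algebra\<close>;
  for Borel \<open>E\<close> it is the Borel sigma-algebra of the weak topology.\<close>

definition finite_measure_algebra :: "'a::euclidean_space set \<Rightarrow> 'a measure measure" where
  "finite_measure_algebra E =
     (SUP A \<in> sets (restrict_space borel E).
        vimage_algebra (finite_measures E) (\<lambda>\<mu>. emeasure \<mu> A) borel)"

section \<open>Brownian motion killed at the boundary\<close>

locale brownian_motion =
  fixes D :: "'a::euclidean_space set"
    and W :: "'a \<Rightarrow> 'v measure"
    and B :: "real \<Rightarrow> 'v \<Rightarrow> 'a"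
  assumes prob_space_W: "x \<in> D \<Longrightarrow> prob_space (W x)"
    and measurable_B: "x \<in> D \<Longrightarrow> 0 \<le> t \<Longrightarrow> B t \<in> borel_measurable (W x)"
    and continuous_paths: "x \<in> D \<Longrightarrow> \<omega> \<in> space (W x) \<Longrightarrow> continuous_on {0..} (\<lambda>t. B t \<omega>)"
    and start: "x \<in> D \<Longrightarrow> AE \<omega> in W x. B 0 \<omega> = x"
    and gaussian_increments: "x \<in> D \<Longrightarrow> 0 \<le> s \<Longrightarrow> s < t \<Longrightarrow>
      distributed (W x) lborel (\<lambda>\<omega>. B t \<omega> - B s \<omega>)
        (\<lambda>y. ennreal (\<Prod>b\<in>Basis. normal_density 0 (sqrt (t - s)) (y \<bullet> b)))"
    and independent_increments: "x \<in> D \<Longrightarrow> 0 \<le> \<tau> 0 \<Longrightarrow> incseq \<tau> \<Longrightarrow>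
      prob_space.indep_vars (W x) (\<lambda>_. borel)
        (\<lambda>(k::nat) \<omega>. B (\<tau> (Suc k)) \<omega> - B (\<tau> k) \<omega>) UNIV"

text \<open>\<open>W x\<close> is the law of a Brownian motion started at \<open>x\<close>, usually written \<open>\<Pi>\<^sub>x\<close>.
  The killed process is \<open>B\<close> restricted to the times before its exit time \<open>\<zeta>\<close> from \<open>D\<close>. Below,
  \<open>\<xi>\<^sub>t\<close> only enters for \<open>t < \<zeta>\<close>, and \<open>\<xi>\<^bsub>\<zeta>-\<^esub>\<close> is \<open>B\<^sub>\<zeta>\<close> by continuity of the paths.\<close>

definition exit_time :: "'a set \<Rightarrow> (real \<Rightarrow> 'v \<Rightarrow> 'a) \<Rightarrow> 'v \<Rightarrow> ereal" where
  "exit_time D B \<omega> = Inf (ereal ` {t. 0 \<le> t \<and> B t \<omega> \<notin> D})"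

section \<open>Super-Brownian motion and its exit measure\<close>

definition branching_mechanism :: "real measure \<Rightarrow> real \<Rightarrow> real" where
  "branching_mechanism n u = (\<integral>r. exp (- u * r) - 1 + u * r \<partial>n)"

text \<open>The following two integral equations involve nonnegative terms only and are stated in \<open>[0,\<infinity>]\<close>.
  Their right-hand sides are finite and \<open>\<psi> \<ge> 0\<close>, so all terms are finite and solutions are
  bounded on bounded domains. For a branching mechanism \<open>\<psi>\<close> (locally Lipschitz on \<open>[0,\<infinity>)\<close>)
  solutions are unique, so existence of a solution with a given property below speaks of the solution.\<close>

definition cumulant_equation ::
  "'a::euclidean_space set \<Rightarrow> (real \<Rightarrow> real) \<Rightarrow> ('a \<Rightarrow> 'v measure) \<Rightarrow> (real \<Rightarrow> 'v \<Rightarrow> 'a) \<Rightarrow>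
   ('a \<Rightarrow> real) \<Rightarrow> (real \<Rightarrow> 'a \<Rightarrow> real) \<Rightarrow> bool" where
  "cumulant_equation D \<psi> W B \<phi> u \<longleftrightarrow>
     (\<lambda>(t, x). u t x) \<in> borel_measurable (restrict_space borel ({0..} \<times> D)) \<and>
     (\<forall>t\<ge>0. \<forall>x\<in>D. 0 \<le> u t x \<and>
        ennreal (u t x) +
          (\<integral>\<^sup>+ \<omega>. (\<integral>\<^sup>+ s. ennreal (\<psi> (u (t - s) (B s \<omega>)))
              * indicator {s. 0 \<le> s \<and> s \<le> t \<and> ereal s < exit_time D B \<omega>} s \<partial>lborel) \<partial>W x)
        = (\<integral>\<^sup>+ \<omega>. ennreal (\<phi> (B t \<omega>)) * indicator {\<omega>. ereal t < exit_time D B \<omega>} \<omega> \<partial>W x))"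

definition exit_equation ::
  "'a::euclidean_space set \<Rightarrow> (real \<Rightarrow> real) \<Rightarrow> ('a \<Rightarrow> 'v measure) \<Rightarrow> (real \<Rightarrow> 'v \<Rightarrow> 'a) \<Rightarrow>
   ('a \<Rightarrow> real) \<Rightarrow> ('a \<Rightarrow> real) \<Rightarrow> ('a \<Rightarrow> real) \<Rightarrow> bool" where
  "exit_equation D \<psi> W B \<phi> g w \<longleftrightarrow>
     w \<in> borel_measurable (restrict_space borel D) \<and>
     (\<forall>x\<in>D. 0 \<le> w x \<and>
        ennreal (w x) +
          (\<integral>\<^sup>+ \<omega>. (\<integral>\<^sup>+ t. ennreal (\<psi> (w (B t \<omega>)))
              * indicator {t. 0 \<le> t \<and> ereal t < exit_time D B \<omega>} t \<partial>lborel) \<partial>W x)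
        = (\<integral>\<^sup>+ \<omega>. (\<integral>\<^sup>+ t. ennreal (\<phi> (B t \<omega>))
              * indicator {t. 0 \<le> t \<and> ereal t < exit_time D B \<omega>} t \<partial>lborel)
            + ennreal (g (B (real_of_ereal (exit_time D B \<omega>)) \<omega>))
              * indicator {\<omega>. exit_time D B \<omega> < \<infinity>} \<omega> \<partial>W x))"

text \<open>Indexed by extended times so that stopping times may be infinite.\<close>

definition natural_filtration ::
  "'w measure \<Rightarrow> 's measure \<Rightarrow> (real \<Rightarrow> 'w \<Rightarrow> 's) \<Rightarrow> ereal \<Rightarrow> 'w measure" where
  "natural_filtration M S X t =
     sigma (space M) {X s -` A \<inter> space M | s A. 0 \<le> s \<and> ereal s \<le> t \<and> A \<in> sets S}"

text \<open>\<open>M\<close> only provides the measurable space on which all the laws \<open>P \<mu>\<close> live.\<close>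

locale super_brownian_motion = brownian_motion D W B
  for D :: "'a::euclidean_space set" and W :: "'a \<Rightarrow> 'v measure" and B :: "real \<Rightarrow> 'v \<Rightarrow> 'a" +
  fixes \<psi> :: "real \<Rightarrow> real"
    and M :: "'w measure"
    and P :: "'a measure \<Rightarrow> 'w measure"
    and X :: "real \<Rightarrow> 'w \<Rightarrow> 'a measure"
  assumes prob_space_P: "\<mu> \<in> finite_measures D \<Longrightarrow> prob_space (P \<mu>)"
    and sets_P: "\<mu> \<in> finite_measures D \<Longrightarrow> sets (P \<mu>) = sets M"
    and measurable_X: "0 \<le> t \<Longrightarrow> X t \<in> M \<rightarrow>\<^sub>M finite_measure_algebra D"
    and right_continuous: "\<omega> \<in> space M \<Longrightarrow> 0 \<le> t \<Longrightarrow>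
      limitin (weak_topology D) (\<lambda>s. X s \<omega>) (X t \<omega>) (at_right t)"
    and left_limits: "\<omega> \<in> space M \<Longrightarrow> 0 < t \<Longrightarrow>
      \<exists>L. limitin (weak_topology D) (\<lambda>s. X s \<omega>) L (at_left t)"
    and start_X: "\<mu> \<in> finite_measures D \<Longrightarrow> AE \<omega> in P \<mu>. X 0 \<omega> = \<mu>"
    and transition_kernel: "0 \<le> t \<Longrightarrow>
      (\<lambda>\<mu>. distr (P \<mu>) (finite_measure_algebra D) (X t))
        \<in> finite_measure_algebra D \<rightarrow>\<^sub>M prob_algebra (finite_measure_algebra D)"
    and strong_markov: "\<mu> \<in> finite_measures D \<Longrightarrow>
      stopping_time (natural_filtration M (finite_measure_algebra D) X) \<tau> \<Longrightarrow>
      (\<And>\<omega>. \<omega> \<in> space M \<Longrightarrow> 0 \<le> \<tau> \<omega>) \<Longrightarrow>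
      A \<in> sets (filtration.pre_sigma (space M)
                  (natural_filtration M (finite_measure_algebra D) X) \<tau>) \<Longrightarrow>
      0 \<le> t \<Longrightarrow> F \<in> borel_measurable (finite_measure_algebra D) \<Longrightarrow>
      (\<integral>\<^sup>+ \<omega>. F (X (real_of_ereal (\<tau> \<omega>) + t) \<omega>) * indicator {\<omega> \<in> A. \<tau> \<omega> < \<infinity>} \<omega> \<partial>P \<mu>) =
      (\<integral>\<^sup>+ \<omega>. (\<integral>\<^sup>+ \<omega>'. F (X t \<omega>') \<partial>P (X (real_of_ereal (\<tau> \<omega>)) \<omega>))
          * indicator {\<omega> \<in> A. \<tau> \<omega> < \<infinity>} \<omega> \<partial>P \<mu>)"
    and laplace_functional: "\<phi> \<in> bounded_borel_nonneg D \<Longrightarrow>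
      \<exists>u. cumulant_equation D \<psi> W B \<phi> u \<and>
        (\<forall>\<mu>\<in>finite_measures D. \<forall>t\<ge>0.
           (\<integral>\<omega>. exp (- (\<integral>x. \<phi> x \<partial>X t \<omega>)) \<partial>P \<mu>) = exp (- (\<integral>x. u t x \<partial>\<mu>)))"

definition exp_neg :: "ennreal \<Rightarrow> real" where
  "exp_neg a = (if a = \<infinity> then 0 else exp (- enn2real a))"

locale exit_measure = super_brownian_motion D W B \<psi> M P X
  for D :: "'a::euclidean_space set" and W :: "'a \<Rightarrow> 'v measure" and B :: "real \<Rightarrow> 'v \<Rightarrow> 'a"
    and \<psi> :: "real \<Rightarrow> real" and M :: "'w measure" and P :: "'a measure \<Rightarrow> 'w measure"
    and X :: "real \<Rightarrow> 'w \<Rightarrow> 'a measure" +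
  fixes XD :: "'w \<Rightarrow> 'a measure"
  assumes measurable_XD: "XD \<in> M \<rightarrow>\<^sub>M finite_measure_algebra (frontier D)"
    and joint_law: "\<phi> \<in> bounded_borel_nonneg D \<Longrightarrow> g \<in> bounded_borel_nonneg (frontier D) \<Longrightarrow>
      \<exists>w. exit_equation D \<psi> W B \<phi> g w \<and>
        (\<forall>\<mu>\<in>finite_measures D.
           (\<integral>\<omega>. exp_neg ((\<integral>\<^sup>+ t. (\<integral>\<^sup>+ x. ennreal (\<phi> x) \<partial>X t \<omega>) * indicator {0..} t \<partial>lborel)
                          + (\<integral>\<^sup>+ x. ennreal (g x) \<partial>XD \<omega>)) \<partial>P \<mu>)
           = exp (- (\<integral>x. w x \<partial>\<mu>)))"

text \<open>\<open>X\<^sup>D\<^sub>\<epsilon>\<close>, as a measure on the closure of \<open>D\<close>.\<close>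

definition strip_occupation ::
  "'a::euclidean_space set \<Rightarrow> (real \<Rightarrow> 'w \<Rightarrow> 'a measure) \<Rightarrow> real \<Rightarrow> 'w \<Rightarrow> 'a measure" where
  "strip_occupation D X \<epsilon> \<omega> =
     measure_of (closure D) (sets (restrict_space borel (closure D)))
       (\<lambda>A. ennreal (1 / \<epsilon>\<^sup>2) *
          (\<integral>\<^sup>+ t. emeasure (X t \<omega>) (A \<inter> inner_strip D \<epsilon>) * indicator {0..} t \<partial>lborel))"

section \<open>Weak convergence in probability\<close>

definition converges_in_prob ::
  "'w measure \<Rightarrow> ('i \<Rightarrow> 'w \<Rightarrow> real) \<Rightarrow> ('w \<Rightarrow> real) \<Rightarrow> 'i filter \<Rightarrow> bool" where
  "converges_in_prob M Y Z F \<longleftrightarrow>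
     (\<forall>\<^sub>F i in F. Y i \<in> borel_measurable M) \<and> Z \<in> borel_measurable M \<and>
     (\<forall>\<delta>>0. ((\<lambda>i. measure M {\<omega> \<in> space M. \<delta> < \<bar>Y i \<omega> - Z \<omega>\<bar>}) \<longlongrightarrow> 0) F)"

text \<open>Almost sure finiteness is required because Bochner integrals with respect to infinite measures
  may be \<open>0\<close> by convention. The measures need not have all of \<open>K\<close> as underlying space: the limit of
  interest lives on the boundary.\<close>

definition weakly_converges_in_prob ::
  "'w measure \<Rightarrow> 'a::euclidean_space set \<Rightarrow> ('i \<Rightarrow> 'w \<Rightarrow> 'a measure) \<Rightarrow> ('w \<Rightarrow> 'a measure) \<Rightarrow>
   'i filter \<Rightarrow> bool" where
  "weakly_converges_in_prob M K Y Z F \<longleftrightarrow>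
     (\<forall>\<^sub>F i in F. AE \<omega> in M. finite_measure (Y i \<omega>)) \<and> (AE \<omega> in M. finite_measure (Z \<omega>)) \<and>
     (\<forall>\<phi> :: 'a \<Rightarrow> real. continuous_on K \<phi> \<longrightarrow>
        converges_in_prob M (\<lambda>i \<omega>. \<integral>x. \<phi> x \<partial>Y i \<omega>) (\<lambda>\<omega>. \<integral>x. \<phi> x \<partial>Z \<omega>) F)"

end

theory Submission
  imports Defs
begin

text \<open>For continuous \<open>\<phi> \<ge> 0\<close> put \<open>U\<^sub>\<epsilon> = \<integral>\<phi> dX\<^sup>D\<^sub>\<epsilon>\<close> and \<open>V = \<integral>\<phi> dX\<^sup>D\<close>. The plan is to show
  \<open>E (exp (- U\<^sub>\<epsilon>) - exp (- V))\<^sup>2 \<longlonglongrightarrow> 0\<close> as \<open>\<epsilon>\<close> decreases to \<open>0\<close>. Expanding the square leaves three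
  joint Laplace functionals \<open>E exp (- a U\<^sub>\<epsilon> - b V)\<close> with \<open>a + b = 2\<close>, and it suffices that each of
  them tends to \<open>E exp (- (a + b) V)\<close> (\<open>joint_laplace_tendsto\<close>). By the joint law of occupation
  and exit measure, these functionals are \<open>exp (- \<integral>w\<^sub>\<epsilon> d\<mu>)\<close>, where \<open>w\<^sub>\<epsilon> + G \<psi>(w\<^sub>\<epsilon>) = h\<^sub>\<epsilon>\<close>. Here \<open>G\<close> is
  the Green operator of Brownian motion killed at its exit from \<open>D\<close>, and \<open>h\<^sub>\<epsilon>\<close> is \<open>a \<epsilon>\<^sup>-\<^sup>2 G (1\<^bsub>F\<^esub> \<phi>)\<close>,
  with the strip \<open>F\<close> of width \<open>\<epsilon>\<close>, plus \<open>b\<close> times the mean of \<open>\<phi>\<close> at the exit point. Two facts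
  about Brownian motion remain.

  Linear part (\<open>strip_green_tendsto\<close>): \<open>\<epsilon>\<^sup>-\<^sup>2 G (1\<^bsub>F\<^esub> \<phi>)\<close> tends pointwise to the mean of \<open>\<phi>\<close> at the
  exit point, and remains bounded. A bounded \<open>C\<^sup>2\<close> domain has interior and exterior tangent balls
  of a fixed radius \<open>R\<close> at all its boundary points. Hence near the boundary the distance \<open>\<rho>\<close> to
  the complement satisfies \<open>\<rho>(y + v) = \<rho>(y) + n \<bullet> v\<close> up to \<open>\<bar>v\<bar>\<^sup>2 / R\<close>, with a unit vector \<open>n\<close>, and
  for the bump \<open>f = \<phi> (e - \<rho>)\<^sub>+\<^sup>3 / 3\<close> half the Laplacian is \<open>\<phi> (e - \<rho>)\<^sub>+\<close> up to \<open>O(e) (e - \<rho>)\<^sub>+\<close>. By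
  Dynkin's formula, \<open>G (\<phi> (e - \<rho>)\<^sub>+)\<close> is thus \<open>e\<^sup>3 / 3\<close> times the mean of \<open>\<phi>\<close> at the exit point, up
  to \<open>O(e\<^sup>4)\<close>. Since \<open>(e - \<rho>)\<^sub>+\<close> is the integral over \<open>\<epsilon> < e\<close> of the indicator of the strip of width
  \<open>\<epsilon>\<close>, a Tauberian argument with the monotone function \<open>\<epsilon> \<mapsto> G (1\<^bsub>F\<^esub> \<phi>)\<close> gives the claim.

  Nonlinear part (\<open>nonlinear_stability\<close>): if \<open>h\<^sub>n \<longlonglongrightarrow> h\<close> pointwise and boundedly, the solutions of
  \<open>w\<^sub>n + G \<psi>(w\<^sub>n) = h\<^sub>n\<close> converge pointwise to that of \<open>w + G \<psi>(w) = h\<close>. This rests on \<open>\<integral>g G g \<ge> 0\<close>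
  over \<open>D\<close> (\<open>green_positive\<close>) together with the monotonicity and local Lipschitz continuity of
  \<open>\<psi>\<close>.

  For signed \<open>\<phi>\<close>, positive and negative part are treated separately. The finiteness of \<open>X\<^sup>D\<^sub>\<epsilon>\<close> is
  again read off from Laplace functionals: \<open>E exp (- \<kappa> U\<^sub>\<epsilon>) \<longlonglongrightarrow> 1\<close> for \<open>\<phi> = 1\<close> as \<open>\<kappa>\<close> tends to \<open>0\<close>.

  Expectations over Brownian paths are computed on equidistant time grids, where independent
  Gaussian increments give the Markov property directly, and pass to the limit by path continuity.\<close>

section \<open>Gaussian increments\<close>

text \<open>Fubini over the standard basis, by which all Gaussian integrals below reduce to one dimension.\<close>

lemma lborel_prod_coordinates:
  fixes f :: "'a::euclidean_space \<Rightarrow> real \<Rightarrow> real"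
  assumes "\<And>b. b \<in> Basis \<Longrightarrow> integrable lborel (f b)"
  shows "integrable lborel (\<lambda>x. \<Prod>b\<in>Basis. f b (x \<bullet> b))"
    and "(\<integral>x. (\<Prod>b\<in>Basis. f b (x \<bullet> b)) \<partial>lborel) = (\<Prod>b\<in>Basis. \<integral>r. f b r \<partial>lborel)"
proof -
  interpret product_sigma_finite "\<lambda>_::'a. lborel :: real measure" ..
  have [measurable]: "\<And>b. b \<in> Basis \<Longrightarrow> f b \<in> borel_measurable borel"
    using assms by (auto dest!: borel_measurable_integrable)
  have "integrable (\<Pi>\<^sub>M b\<in>Basis. lborel) (\<lambda>y. \<Prod>b\<in>Basis. f b (y b))"
    by (rule product_integrable_prod) (use assms in auto)
  then have 1: "integrable (\<Pi>\<^sub>M b\<in>Basis. lborel)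
     (\<lambda>y. \<Prod>b\<in>Basis. f b ((\<Sum>c\<in>Basis. y c *\<^sub>R c) \<bullet> b))"
    by simp
  show "integrable lborel (\<lambda>x. \<Prod>b\<in>Basis. f b (x \<bullet> b))"
    by (subst lborel_eq, subst integrable_distr_eq) (use 1 in auto)
  have "(\<integral>y. (\<Prod>b\<in>Basis. f b (y b)) \<partial>(\<Pi>\<^sub>M b\<in>Basis. lborel)) = (\<Prod>b\<in>Basis. \<integral>r. f b r \<partial>lborel)"
    by (rule product_integral_prod) (use assms in auto)
  then show "(\<integral>x. (\<Prod>b\<in>Basis. f b (x \<bullet> b)) \<partial>lborel) = (\<Prod>b\<in>Basis. \<integral>r. f b r \<partial>lborel)"
    by (subst lborel_eq, subst integral_distr) auto
qed

definition gauss_density :: "real \<Rightarrow> 'a::euclidean_space \<Rightarrow> real" where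
  "gauss_density h y = (\<Prod>b\<in>Basis. normal_density 0 (sqrt h) (y \<bullet> b))"

definition gauss :: "real \<Rightarrow> 'a::euclidean_space measure" where
  "gauss h = density lborel (\<lambda>y. ennreal (gauss_density h y))"

lemma gauss_density_nonneg [simp]: "0 \<le> gauss_density h y"
  by (simp add: gauss_density_def prod_nonneg)

lemma gauss_density_minus: "gauss_density h (- y) = gauss_density h y"
  by (simp add: gauss_density_def normal_density_def)

lemma measurable_gauss_density [measurable]:
  "(\<lambda>(h, y). gauss_density h y) \<in> borel_measurable (borel \<Otimes>\<^sub>M borel)"
  unfolding gauss_density_def normal_density_def by measurable

lemma borel_measurable_gauss_density [measurable]: "gauss_density h \<in> borel_measurable borel"
  unfolding gauss_density_def[abs_def] by measurable

lemma gauss_density_le: 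
  fixes y :: "'a::euclidean_space"
  assumes "0 < h" shows "gauss_density h y \<le> (1 / sqrt (2 * pi * h)) ^ DIM('a)"
proof -
  have "normal_density 0 (sqrt h) r \<le> 1 / sqrt (2 * pi * h)" for r
    using assms by (auto simp: normal_density_def intro!: divide_right_mono)
  then have "gauss_density h y \<le> (\<Prod>b\<in>(Basis::'a set). 1 / sqrt (2 * pi * h))"
    unfolding gauss_density_def by (intro prod_mono) auto
  then show ?thesis by simp
qed

lemma sets_gauss [simp, measurable_cong]: "sets (gauss h) = sets borel"
  and space_gauss [simp]: "space (gauss h) = UNIV"
  by (simp_all add: gauss_def)

lemma gauss_moments:
  fixes k :: "'a::euclidean_space \<Rightarrow> nat"
  assumes "0 < h"
  shows "integrable (gauss h) (\<lambda>v. \<Prod>b\<in>Basis. (v \<bullet> b) ^ k b)"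
    and "(\<integral>v. (\<Prod>b\<in>Basis. (v \<bullet> b) ^ k b) \<partial>gauss h)
      = (\<Prod>b\<in>Basis. \<integral>r. normal_density 0 (sqrt h) r * r ^ k b \<partial>lborel)"
proof -
  let ?f = "\<lambda>b r. normal_density 0 (sqrt h) r * r ^ k b"
  have int: "integrable lborel (?f b)" for b
    using integrable_normal_moment[of "sqrt h" 0 "k b"] assms by simp
  have eq: "(\<lambda>x::'a. gauss_density h x * (\<Prod>b\<in>Basis. (x \<bullet> b) ^ k b)) = (\<lambda>x. \<Prod>b\<in>Basis. ?f b (x \<bullet> b))"
    by (simp add: gauss_density_def prod.distrib)
  show "integrable (gauss h) (\<lambda>v. \<Prod>b\<in>Basis. (v \<bullet> b) ^ k b)"
    unfolding gauss_def
    by (subst integrable_density) (use lborel_prod_coordinates(1)[of ?f, OF int] eq in auto)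
  show "(\<integral>v. (\<Prod>b\<in>Basis. (v \<bullet> b) ^ k b) \<partial>gauss h) = (\<Prod>b\<in>Basis. \<integral>r. ?f b r \<partial>lborel)"
    unfolding gauss_def
    by (subst integral_density) (use lborel_prod_coordinates(2)[of ?f, OF int] eq in auto)
qed

lemma normal_moments_0_to_4:
  assumes "0 < h"
  shows "(\<integral>r. normal_density 0 (sqrt h) r \<partial>lborel) = 1"
    "(\<integral>r. normal_density 0 (sqrt h) r * r \<partial>lborel) = 0"
    "(\<integral>r. normal_density 0 (sqrt h) r * r^2 \<partial>lborel) = h"
    "(\<integral>r. normal_density 0 (sqrt h) r * r^4 \<partial>lborel) = 3 * h^2"
proof -
  have h: "0 < sqrt h" using assms by simp
  show "(\<integral>r. normal_density 0 (sqrt h) r \<partial>lborel) = 1"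
    using integral_normal_density[OF h, of 0] by simp
  show "(\<integral>r. normal_density 0 (sqrt h) r * r \<partial>lborel) = 0"
    using integral_normal_moment_nz_1[OF h, of 0] by simp
  show "(\<integral>r. normal_density 0 (sqrt h) r * r^2 \<partial>lborel) = h"
    using integral_normal_moment_even[OF h, of 0 1] assms by (simp add: fact_numeral)
  show "(\<integral>r. normal_density 0 (sqrt h) r * r^4 \<partial>lborel) = 3 * h^2"
    using integral_normal_moment_even[OF h, of 0 2] assms
    by (simp add: fact_numeral power2_eq_square field_simps)
qed

lemma prob_space_gauss:
  assumes "0 < h" shows "prob_space (gauss h :: 'a::euclidean_space measure)"
proof
  have "(\<integral>v. (1::real) \<partial>(gauss h :: 'a measure)) = 1"
    using gauss_moments(2)[of h "\<lambda>_::'a. 0"] normal_moments_0_to_4(1)[OF assms] assms by simp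
  moreover have "integrable (gauss h :: 'a measure) (\<lambda>_. 1::real)"
    using gauss_moments(1)[of h "\<lambda>_::'a. 0"] assms by simp
  ultimately have "measure (gauss h :: 'a measure) UNIV = 1" by simp
  then show "emeasure (gauss h :: 'a measure) (space (gauss h)) = 1"
    by (cases "emeasure (gauss h :: 'a measure) UNIV") (auto simp: measure_def ennreal_1[symmetric] simp del: ennreal_1)
qed

lemma gauss_coordinate_moments:
  fixes b c :: "'a::euclidean_space"
  assumes h: "0 < h" and bc: "b \<in> Basis" "c \<in> Basis"
  shows "integrable (gauss h) (\<lambda>v. v \<bullet> b)" "(\<integral>v. v \<bullet> b \<partial>gauss h) = 0"
    "integrable (gauss h) (\<lambda>v. (v \<bullet> b) * (v \<bullet> c))"
    "(\<integral>v. (v \<bullet> b) * (v \<bullet> c) \<partial>gauss h) = (if b = c then h else 0)"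
    "integrable (gauss h) (\<lambda>v. (v \<bullet> b)^4)" "(\<integral>v. (v \<bullet> b)^4 \<partial>gauss h) = 3 * h^2"
proof -
  note m = normal_moments_0_to_4[OF h]
  have p: "(\<Prod>d\<in>Basis. g d ^ (if d = b then k else 0)) = g b ^ k" for g :: "'a \<Rightarrow> real" and k
    using bc by (subst prod.remove[of _ b]) auto
  have q: "(\<Prod>d\<in>Basis. if d = b then z else 1) = z" for z :: real
    using bc by simp
  show "integrable (gauss h) (\<lambda>v. v \<bullet> b)" 
    using gauss_moments(1)[OF h, of "\<lambda>d. if d = b then 1 else 0"] unfolding p by simp
  have f: "(\<integral>v. (v \<bullet> b)^k \<partial>gauss h) = (\<integral>r. normal_density 0 (sqrt h) r * r^k \<partial>lborel)" for k
  proof -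
    have "(\<integral>v. (v \<bullet> b)^k \<partial>gauss h)
      = (\<Prod>d\<in>Basis. if d = b then (\<integral>r. normal_density 0 (sqrt h) r * r^k \<partial>lborel) else 1)"
      using gauss_moments(2)[OF h, of "\<lambda>d. if d = b then k else 0"] unfolding p
      by (elim trans, intro prod.cong refl) (simp add: m)
    then show ?thesis unfolding q .
  qed
  show "(\<integral>v. v \<bullet> b \<partial>gauss h) = 0" using f[of 1] m by simp
  show "(\<integral>v. (v \<bullet> b)^4 \<partial>gauss h) = 3 * h^2" using f[of 4] m by simp
  show "integrable (gauss h) (\<lambda>v. (v \<bullet> b)^4)"
    using gauss_moments(1)[OF h, of "\<lambda>d. if d = b then 4 else 0"] unfolding p by simp
  have sq: "integrable (gauss h) (\<lambda>v. (v \<bullet> b)^2)"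
    using gauss_moments(1)[OF h, of "\<lambda>d. if d = b then 2 else 0"] unfolding p by simp
  have pp: "(\<Prod>d\<in>Basis. g d ^ (if d = b \<or> d = c then 1 else 0)) = g b * g c" if "b \<noteq> c" for g :: "'a \<Rightarrow> real"
  proof -
    have "(\<Prod>d\<in>Basis. g d ^ (if d = b \<or> d = c then 1 else 0)) = (\<Prod>d\<in>{b, c}. g d)"
      using bc by (intro prod.mono_neutral_cong_right) auto
    then show ?thesis using that by simp
  qed
  show "integrable (gauss h) (\<lambda>v. (v \<bullet> b) * (v \<bullet> c))"
  proof (cases "b = c")
    case True then show ?thesis using sq by (simp add: power2_eq_square)
  next
    case False then show ?thesis
      using gauss_moments(1)[OF h, of "\<lambda>d. if d = b \<or> d = c then 1 else 0"] unfolding pp[OF False] by blast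
  qed
  show "(\<integral>v. (v \<bullet> b) * (v \<bullet> c) \<partial>gauss h) = (if b = c then h else 0)"
  proof (cases "b = c")
    case True then show ?thesis using f[of 2] m by (simp add: power2_eq_square)
  next
    case False
    have "(\<integral>v. (v \<bullet> b) * (v \<bullet> c) \<partial>gauss h) = 
      (\<Prod>d\<in>Basis. \<integral>r. normal_density 0 (sqrt h) r * r ^ (if d = b \<or> d = c then 1 else 0) \<partial>lborel)"
      using gauss_moments(2)[OF h, of "\<lambda>d. if d = b \<or> d = c then 1 else 0"] unfolding pp[OF False] .
    also have "\<dots> = 0"
      using bc by (intro prod_zero) (auto simp: m intro!: bexI[of _ b])
    finally show ?thesis using False by simp
  qed
qed

lemma gauss_moment_inner:
  fixes l n :: "'a::euclidean_space"
  assumes h: "0 < h"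
  shows "integrable (gauss h) (\<lambda>v. l \<bullet> v)" "(\<integral>v. l \<bullet> v \<partial>gauss h) = 0"
    "integrable (gauss h) (\<lambda>v. (n \<bullet> v)^2)" "(\<integral>v. (n \<bullet> v)^2 \<partial>gauss h) = h * (norm n)^2"
proof -
  have l: "m \<bullet> v = (\<Sum>b\<in>Basis. (m \<bullet> b) * (v \<bullet> b))" for m v :: 'a
    by (rule euclidean_inner)
  have li: "(\<lambda>v. l \<bullet> v) = (\<lambda>v. \<Sum>b\<in>Basis. (l \<bullet> b) * (v \<bullet> b))"
    by (rule ext) (rule l)
  have sq: "(n \<bullet> v)^2 = (\<Sum>b\<in>Basis. \<Sum>c\<in>Basis. ((n \<bullet> b) * (n \<bullet> c)) * ((v \<bullet> b) * (v \<bullet> c)))" for v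
    unfolding l[of n v] power2_eq_square sum_product by (simp add: mult_ac)
  note g = gauss_coordinate_moments[OF h]
  show "integrable (gauss h) (\<lambda>v. l \<bullet> v)" "(\<integral>v. l \<bullet> v \<partial>gauss h) = 0"
    by (subst li, simp add: g)+
  show "integrable (gauss h) (\<lambda>v. (n \<bullet> v)^2)"
    unfolding sq by (intro Bochner_Integration.integrable_sum integrable_mult_right g)
  have "(\<integral>v. (n \<bullet> v)^2 \<partial>gauss h) = (\<Sum>b\<in>Basis. \<Sum>c\<in>Basis. ((n \<bullet> b) * (n \<bullet> c)) * (if b = c then h else 0))"
  proof -
    let ?t = "\<lambda>b c v. ((n \<bullet> b) * (n \<bullet> c)) * ((v \<bullet> b) * (v \<bullet> c))"
    have it: "integrable (gauss h) (?t b c)" if "b \<in> Basis" "c \<in> Basis" for b c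
      using that by (intro integrable_mult_right g)
    have "(\<integral>v. (\<Sum>b\<in>Basis. \<Sum>c\<in>Basis. ?t b c v) \<partial>gauss h)
      = (\<Sum>b\<in>Basis. \<integral>v. (\<Sum>c\<in>Basis. ?t b c v) \<partial>gauss h)"
      by (intro Bochner_Integration.integral_sum Bochner_Integration.integrable_sum it)
    also have "\<dots> = (\<Sum>b\<in>Basis. \<Sum>c\<in>Basis. \<integral>v. ?t b c v \<partial>gauss h)"
      by (intro sum.cong refl Bochner_Integration.integral_sum it)
    also have "\<dots> = (\<Sum>b\<in>Basis. \<Sum>c\<in>Basis. ((n \<bullet> b) * (n \<bullet> c)) * (if b = c then h else 0))"
      by (intro sum.cong refl) (simp only: integral_mult_right_zero g(4))
    finally show ?thesis unfolding sq .
  qed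
  also have "\<dots> = (\<Sum>b\<in>Basis. (n \<bullet> b) * (n \<bullet> b) * h)"
    by (simp add: if_distrib sum.delta' cong: if_cong)
  also have "\<dots> = h * (norm n)^2"
    by (simp add: power2_norm_eq_inner euclidean_inner[of n n] sum_distrib_left mult_ac)
  finally show "(\<integral>v. (n \<bullet> v)^2 \<partial>gauss h) = h * (norm n)^2" .
qed

text \<open>The third moment is controlled by second and fourth moments through \<open>2 s\<^sup>3 \<le> \<surd>h s\<^sup>2 + s\<^sup>4 / \<surd>h\<close>, whose
  terms all scale like \<open>h\<^bsup>3/2\<^esub>\<close>.\<close>

lemma gauss_norm_moments:
  assumes h: "0 < h"
  defines "d \<equiv> real DIM('a::euclidean_space)"
  shows "integrable (gauss h :: 'a measure) (\<lambda>v. (norm v)^2)"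
    "(\<integral>v. (norm v)^2 \<partial>(gauss h :: 'a measure)) = h * d"
    "integrable (gauss h :: 'a measure) (\<lambda>v. (norm v)^3)"
    "(\<integral>v. (norm v)^3 \<partial>(gauss h :: 'a measure)) \<le> 2 * d^2 * (h * sqrt h)"
proof -
  note g = gauss_coordinate_moments[OF h]
  have sq: "(norm v)^2 = (\<Sum>b\<in>Basis. (v \<bullet> b) * (v \<bullet> b))" for v :: 'a
    by (simp add: power2_norm_eq_inner euclidean_inner[of v v])
  show i2: "integrable (gauss h :: 'a measure) (\<lambda>v. (norm v)^2)"
    and m2: "(\<integral>v. (norm v)^2 \<partial>(gauss h :: 'a measure)) = h * d"
    unfolding sq by (simp_all add: g d_def)
  have "(norm v)^4 = (\<Sum>b\<in>Basis. 1 * ((v \<bullet> b) * (v \<bullet> b)))^2" for v :: 'a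
    using sq[of v] by (metis (no_types, lifting) mult_1 numeral_Bit0 numeral_plus_numeral power_add power2_eq_square sum.cong)
  moreover have "(\<Sum>b\<in>Basis. 1 * ((v \<bullet> b) * (v \<bullet> b)))^2
      \<le> (\<Sum>b\<in>(Basis::'a set). 1^2) * (\<Sum>b\<in>Basis. ((v \<bullet> b) * (v \<bullet> b))^2)" for v :: 'a
    by (rule Cauchy_Schwarz_ineq_sum)
  moreover have "((v \<bullet> b) * (v \<bullet> b))^2 = (v \<bullet> b)^4" for v b :: 'a
    by (simp add: power4_eq_xxxx power2_eq_square)
  ultimately have n4: "(norm v)^4 \<le> d * (\<Sum>b\<in>Basis. (v \<bullet> b)^4)" for v :: 'a
    by (simp add: d_def)
  \<comment> \<open>expanding \<open>0 \<le> s\<^sup>2 (\<surd>h - s)\<^sup>2 / \<surd>h\<close>\<close>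
  have n3: "(norm v)^3 \<le> (sqrt h * (norm v)^2 + d / sqrt h * (\<Sum>b\<in>Basis. (v \<bullet> b)^4)) / 2" for v :: 'a
  proof -
    have "0 \<le> (norm v)^2 * (sqrt h - norm v)^2 / sqrt h" using h by simp
    also have "\<dots> = sqrt h * (norm v)^2 - 2 * (norm v)^3 + (norm v)^4 / sqrt h"
    proof -
      have "x^2 * (s - x)^2 / s = s * x^2 - 2 * x^3 + x^4 / s" if "s \<noteq> 0" for s x :: real
        using that by (simp add: field_simps) (simp add: power2_eq_square power3_eq_cube power4_eq_xxxx algebra_simps)
      then show ?thesis using h by auto
    qed
    also have "\<dots> \<le> sqrt h * (norm v)^2 - 2 * (norm v)^3 + d * (\<Sum>b\<in>Basis. (v \<bullet> b)^4) / sqrt h"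
      using n4[of v] h by (simp add: divide_right_mono)
    finally show ?thesis by simp
  qed
  have i: "integrable (gauss h :: 'a measure) (\<lambda>v. (sqrt h * (norm v)^2 + d / sqrt h * (\<Sum>b\<in>Basis. (v \<bullet> b)^4)) / 2)"
    by (intro integrable_divide Bochner_Integration.integrable_add integrable_mult_right i2 Bochner_Integration.integrable_sum g) auto
  show i3: "integrable (gauss h :: 'a measure) (\<lambda>v. (norm v)^3)"
  proof (rule Bochner_Integration.integrable_bound[OF i])
    show "AE v in (gauss h :: 'a measure). norm ((norm v)^3)
       \<le> norm ((sqrt h * (norm v)^2 + d / sqrt h * (\<Sum>b\<in>Basis. (v \<bullet> b)^4)) / 2)"
    proof (rule AE_I2)
      fix v :: 'a
      have "norm ((norm v)^3) = (norm v)^3" by simp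
      also note n3[of v]
      finally show "norm ((norm v)^3) \<le> norm ((sqrt h * (norm v)^2 + d / sqrt h * (\<Sum>b\<in>Basis. (v \<bullet> b)^4)) / 2)"
        unfolding real_norm_def using abs_ge_self order_trans by blast
    qed
  qed simp
  have "(\<integral>v. (norm v)^3 \<partial>(gauss h :: 'a measure))
     \<le> (\<integral>v. (sqrt h * (norm v)^2 + d / sqrt h * (\<Sum>b\<in>Basis. (v \<bullet> b)^4)) / 2 \<partial>(gauss h :: 'a measure))"
    by (intro integral_mono i3 i n3)
  also have "\<dots> = (sqrt h * (h * d) + d / sqrt h * (d * (3 * h^2))) / 2"
  proof -
    have s: "integrable (gauss h :: 'a measure) (\<lambda>v. \<Sum>b\<in>Basis. (v \<bullet> b)^4)"
      "(\<integral>v. (\<Sum>b\<in>Basis. (v \<bullet> b)^4) \<partial>(gauss h :: 'a measure)) = d * (3 * h^2)"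
      using g(5,6)[of b b for b :: 'a] by (simp_all add: d_def)
    have "(\<integral>v. (sqrt h * (norm v)^2 + d / sqrt h * (\<Sum>b\<in>Basis. (v \<bullet> b)^4)) \<partial>(gauss h :: 'a measure))
      = sqrt h * (h * d) + d / sqrt h * (d * (3 * h^2))"
      by (subst Bochner_Integration.integral_add, intro integrable_mult_right i2, intro integrable_mult_right s)
        (simp only: integral_mult_right_zero m2 s)
    then show ?thesis by simp
  qed
  also have "\<dots> = (d + 3 * d^2) / 2 * (h * sqrt h)"
  proof -
    have "h^2 / sqrt h = h * (h / sqrt h)" by (simp add: power2_eq_square)
    also have "h / sqrt h = sqrt h" by (rule real_div_sqrt) (use h in simp)
    finally have hh: "h^2 / sqrt h = h * sqrt h" .
    have "d / sqrt h * (d * (3 * h^2)) = 3 * d^2 * (h^2 / sqrt h)"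
      by (simp add: power2_eq_square)
    then have "d / sqrt h * (d * (3 * h^2)) = 3 * d^2 * (h * sqrt h)"
      unfolding hh .
    then show ?thesis by (simp add: algebra_simps)
  qed
  also have "\<dots> \<le> 2 * d^2 * (h * sqrt h)"
  proof (rule mult_right_mono)
    have "1 \<le> d" using DIM_positive[where 'a='a] by (simp add: d_def Suc_leI)
    then show "(d + 3 * d^2) / 2 \<le> 2 * d^2" by (simp add: power2_eq_square)
  qed (use h in simp)
  finally show "(\<integral>v. (norm v)^3 \<partial>(gauss h :: 'a measure)) \<le> 2 * d^2 * (h * sqrt h)" .
qed

text \<open>Second-order Taylor expansion in the mean: the linear term averages out, and
  \<open>(n \<bullet> v)\<^sup>2\<close> has mean \<open>h\<close>. Only an expansion at the single point \<open>y\<close> is assumed, so that functions of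
  the boundary distance are covered.\<close>

lemma gauss_one_step:
  fixes f :: "'a::euclidean_space \<Rightarrow> real"
  assumes h: "0 < h" and f [measurable]: "f \<in> borel_measurable borel" and n: "norm n = 1"
    and C: "0 \<le> C" 
    and expand: "\<And>v. \<bar>f (y + v) - f y - l \<bullet> v - a * (n \<bullet> v)^2\<bar> \<le> c * (norm v)^2 + C * (norm v)^3"
  shows "integrable (gauss h) (\<lambda>v. f (y + v))"
    "\<bar>(\<integral>v. f (y + v) \<partial>gauss h) - f y - a * h\<bar> \<le> c * real DIM('a) * h + C * (2 * (real DIM('a))^2) * (h * sqrt h)"
proof -
  interpret prob_space "gauss h :: 'a measure" by (rule prob_space_gauss[OF h])
  note g = gauss_moment_inner[OF h] gauss_norm_moments[OF h, where 'a='a]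
  let ?r = "\<lambda>v. f (y + v) - f y - l \<bullet> v - a * (n \<bullet> v)^2"
  have ib: "integrable (gauss h) (\<lambda>v::'a. c * (norm v)^2 + C * (norm v)^3)"
    by (intro Bochner_Integration.integrable_add integrable_mult_right g(5) g(7))
  have ir: "integrable (gauss h) ?r"
  proof (rule Bochner_Integration.integrable_bound[OF ib])
    show "AE v in gauss h. norm (?r v) \<le> norm (c * (norm v)^2 + C * (norm v)^3)"
    proof (rule AE_I2)
      fix v
      show "norm (?r v) \<le> norm (c * (norm v)^2 + C * (norm v)^3)"
        unfolding real_norm_def by (rule order_trans[OF expand[of v] abs_ge_self])
    qed
  qed measurable
  have il: "integrable (gauss h) (\<lambda>v. l \<bullet> v)" by (rule g(1))
  have iq: "integrable (gauss h) (\<lambda>v. a * (n \<bullet> v)^2)" by (rule integrable_mult_right[OF g(3)])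
  have ic: "integrable (gauss h :: 'a measure) (\<lambda>v. f y)" by simp
  note ilq = Bochner_Integration.integrable_add[OF il iq]
  have "integrable (gauss h) (\<lambda>v. ?r v + (f y + (l \<bullet> v + a * (n \<bullet> v)^2)))"
    by (intro Bochner_Integration.integrable_add ir ic il iq)
  then show "integrable (gauss h) (\<lambda>v. f (y + v))" by simp
  have "(\<integral>v. f (y + v) \<partial>gauss h) = (\<integral>v. ?r v + (f y + (l \<bullet> v + a * (n \<bullet> v)^2)) \<partial>gauss h)"
    by simp
  also have "\<dots> = (\<integral>v. ?r v \<partial>gauss h) + (\<integral>v. f y + (l \<bullet> v + a * (n \<bullet> v)^2) \<partial>gauss h)"
    by (rule Bochner_Integration.integral_add[OF ir Bochner_Integration.integrable_add[OF ic ilq]])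
  also have "(\<integral>v. f y + (l \<bullet> v + a * (n \<bullet> v)^2) \<partial>gauss h) = f y + (\<integral>v. l \<bullet> v + a * (n \<bullet> v)^2 \<partial>gauss h)"
    using prob_space Bochner_Integration.integral_add[OF ic ilq] by simp
  also have "(\<integral>v. l \<bullet> v + a * (n \<bullet> v)^2 \<partial>gauss h) = a * h"
    using Bochner_Integration.integral_add[OF il iq] g(2)[of l] g(4)[of n] n
    by (simp only: integral_mult_right_zero power_one mult_1_right add_0)
  finally have "(\<integral>v. ?r v \<partial>gauss h) = (\<integral>v. f (y + v) \<partial>gauss h) - f y - a * h"
    by linarith
  moreover have "\<bar>(\<integral>v. ?r v \<partial>gauss h)\<bar> \<le> (\<integral>v. c * (norm v)^2 + C * (norm v)^3 \<partial>(gauss h :: 'a measure))"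
    using Bochner_Integration.integral_norm_bound_integral[OF ir ib] expand by (simp only: real_norm_def)
  moreover have "(\<integral>v. c * (norm v)^2 + C * (norm v)^3 \<partial>(gauss h :: 'a measure)) 
     \<le> c * real DIM('a) * h + C * (2 * (real DIM('a))^2) * (h * sqrt h)"
  proof -
    have "(\<integral>v. c * (norm v)^2 + C * (norm v)^3 \<partial>(gauss h :: 'a measure))
      = c * (h * real DIM('a)) + C * (\<integral>v. (norm v)^3 \<partial>(gauss h :: 'a measure))"
      using Bochner_Integration.integral_add[OF integrable_mult_right[OF g(5), of c] integrable_mult_right[OF g(7), of C]]
      by (simp only: g(6) integral_mult_right_zero)
    then show ?thesis using mult_left_mono[OF g(8) C] by (simp only: mult_ac)
  qed
  ultimately show "\<bar>(\<integral>v. f (y + v) \<partial>gauss h) - f y - a * h\<bar> \<le> c * real DIM('a) * h + C * (2 * (real DIM('a))^2) * (h * sqrt h)"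
    by linarith
qed

section \<open>Tangent balls and the boundary distance\<close>

text \<open>Balls are convex, and the Hessian is bounded on them by compactness, so Taylor's formula holds uniformly.\<close>

lemma C2_function_expansion:
  fixes f :: "'a::euclidean_space \<Rightarrow> real"
  assumes "C2_function f"
  obtains g M where "0 \<le> M"
    "\<And>a b. norm a \<le> K \<Longrightarrow> norm b \<le> K \<Longrightarrow> \<bar>f b - f a - g a \<bullet> (b - a)\<bar> \<le> M * (norm (b - a))^2"
proof -
  obtain g :: "'a \<Rightarrow> 'a" and H where f: "\<And>x. (f has_derivative (\<lambda>h. g x \<bullet> h)) (at x)"
    and g: "\<And>x. (g has_derivative blinfun_apply (H x)) (at x)" and H: "continuous_on UNIV H"
    using assms unfolding C2_function_def by blast
  have "compact (H ` cball 0 K)"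
    by (rule compact_continuous_image) (use H continuous_on_subset in auto)
  then obtain M where M: "0 < M" "\<And>x. norm x \<le> K \<Longrightarrow> norm (H x) \<le> M"
    unfolding bounded_pos by (auto dest!: compact_imp_bounded simp: bounded_pos)
  have lip: "norm (g b - g a) \<le> M * norm (b - a)" if "norm a \<le> K" "norm b \<le> K" for a b
  proof (rule differentiable_bound[of "cball 0 K"])
    show "(g has_derivative blinfun_apply (H x)) (at x within cball 0 K)" for x
      using g has_derivative_at_withinI by blast
    show "onorm (blinfun_apply (H x)) \<le> M" if "x \<in> cball 0 K" for x
      using M(2)[of x] that by (simp add: norm_blinfun.rep_eq)
  qed (use that in auto)
  have "\<bar>f b - f a - g a \<bullet> (b - a)\<bar> \<le> M * (norm (b - a))^2" if "norm a \<le> K" "norm b \<le> K" for a b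
  proof -
    have "norm ((f b - g a \<bullet> b) - (f a - g a \<bullet> a)) \<le> (M * norm (b - a)) * norm (b - a)"
    proof (rule differentiable_bound[of "closed_segment a b" "\<lambda>x. f x - g a \<bullet> x" "\<lambda>x h. (g x - g a) \<bullet> h"])
      fix x assume x: "x \<in> closed_segment a b"
      show "((\<lambda>x. f x - g a \<bullet> x) has_derivative (\<lambda>h. (g x - g a) \<bullet> h)) (at x within closed_segment a b)"
        using has_derivative_diff[OF has_derivative_at_withinI[OF f[of x]]
            bounded_linear_imp_has_derivative[OF bounded_linear_inner_right[of "g a"]]]
        by (simp add: inner_diff_left)
      have "closed_segment a b \<subseteq> cball 0 K"
        using that by (intro closed_segment_subset) auto
      then have "norm (g x - g a) \<le> M * norm (x - a)"
        using lip[of a x] x that by auto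
      also have "M * norm (x - a) \<le> M * norm (b - a)"
        using M segment_bound1[OF x] by (intro mult_left_mono) (auto simp: norm_minus_commute)
      finally have gx: "norm (g x - g a) \<le> M * norm (b - a)" .
      show "onorm (\<lambda>h. (g x - g a) \<bullet> h) \<le> M * norm (b - a)"
      proof (rule onorm_bound)
        show "0 \<le> M * norm (b - a)" using M(1) by simp
        fix h
        have "norm ((g x - g a) \<bullet> h) \<le> norm (g x - g a) * norm h"
          unfolding real_norm_def by (rule Cauchy_Schwarz_ineq2)
        also have "\<dots> \<le> M * norm (b - a) * norm h" by (intro mult_right_mono gx) simp
        finally show "norm ((g x - g a) \<bullet> h) \<le> M * norm (b - a) * norm h" .
      qed
    qed auto
    then show ?thesis by (simp add: inner_diff_right power2_eq_square algebra_simps)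
  qed
  with M(1) show ?thesis by (intro that[of M g]) auto
qed

text \<open>The vector \<open>n\<close> is the inner unit normal at \<open>z\<close>.\<close>

definition tangent_balls :: "'a::euclidean_space set \<Rightarrow> real \<Rightarrow> 'a \<Rightarrow> bool" where
  "tangent_balls D R z \<longleftrightarrow>
     (\<exists>n. norm n = 1 \<and> ball (z + R *\<^sub>R n) R \<subseteq> D \<and> ball (z - R *\<^sub>R n) R \<subseteq> - D)"

lemma ball_tangent_subset:
  fixes n :: "'a::euclidean_space"
  assumes "norm n = 1" "0 < R" "R \<le> s"
  shows "ball (z + R *\<^sub>R n) R \<subseteq> ball (z + s *\<^sub>R n) s"
proof
  fix x assume "x \<in> ball (z + R *\<^sub>R n) R"
  moreover have "dist (z + s *\<^sub>R n) x \<le> dist (z + s *\<^sub>R n) (z + R *\<^sub>R n) + dist (z + R *\<^sub>R n) x"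
    by (rule dist_triangle)
  moreover have "dist (z + s *\<^sub>R n) (z + R *\<^sub>R n) = s - R"
    using assms by (simp add: dist_norm flip: scaleR_diff_left)
  ultimately show "x \<in> ball (z + s *\<^sub>R n) s" by simp
qed

lemma tangent_balls_mono:
  assumes "tangent_balls D s z" "0 < R" "R \<le> s" shows "tangent_balls D R z"
proof -
  obtain n where n: "norm n = 1" "ball (z + s *\<^sub>R n) s \<subseteq> D" "ball (z - s *\<^sub>R n) s \<subseteq> - D"
    using assms(1) unfolding tangent_balls_def by blast
  then have "ball (z + R *\<^sub>R n) R \<subseteq> D" "ball (z - R *\<^sub>R n) R \<subseteq> - D"
    using ball_tangent_subset[OF n(1) assms(2,3), of z]
      ball_tangent_subset[of "- n", OF _ assms(2,3), of z] by auto
  with n(1) show ?thesis unfolding tangent_balls_def by blast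
qed

text \<open>If \<open>D\<close> lies above the graph of \<open>f\<close> near \<open>z\<close>, and \<open>f\<close> differs from its tangent hyperplane
  by at most \<open>M \<bar>u\<bar>\<^sup>2\<close>, then \<open>z + u\<close> lies in \<open>D\<close> as soon as \<open>u \<bullet> \<nu> > M \<bar>u\<bar>\<^sup>2\<close>, where \<open>\<nu>\<close> is the
  upward normal whose component along \<open>e\<close> is \<open>1\<close>. Every \<open>u\<close> for which \<open>z + u\<close> is in a ball of
  radius \<open>s \<le> 1 / (2 M)\<close> resting on the tangent hyperplane satisfies this.\<close>

lemma C2_domain_tangent_balls_nearby:
  fixes D :: "'a::euclidean_space set"
  assumes D: "C2_domain D" and z0: "z0 \<in> frontier D"
  obtains s where "0 < s" "\<And>z. z \<in> frontier D \<Longrightarrow> z \<in> ball z0 s \<Longrightarrow> tangent_balls D s z"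
proof -
  have "open D" using D by (simp add: C2_domain_def)
  obtain r e f where r: "0 < r" and e: "norm e = 1" and f: "C2_function f"
    and graph: "D \<inter> ball z0 r = {y \<in> ball z0 r. f (y - (y \<bullet> e) *\<^sub>R e) < y \<bullet> e}"
    using D z0 unfolding C2_domain_def by blast
  define P where "P y = y - (y \<bullet> e) *\<^sub>R e" for y
  have graph_iff: "y \<in> D \<longleftrightarrow> f (P y) < y \<bullet> e" if "y \<in> ball z0 r" for y
  proof -
    have "y \<in> D \<inter> ball z0 r \<longleftrightarrow> y \<in> {y \<in> ball z0 r. f (y - (y \<bullet> e) *\<^sub>R e) < y \<bullet> e}"
      by (simp only: graph)
    then show ?thesis using that unfolding P_def by blast
  qed
  have ee: "e \<bullet> e = 1" using e by (simp add: norm_eq_1)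
  have P_le: "norm (P y) \<le> norm y" for y
  proof -
    have "(norm (P y))^2 = (norm y)^2 - (y \<bullet> e)^2"
      unfolding power2_norm_eq_inner P_def using ee
      by (simp add: inner_diff_left inner_diff_right inner_commute power2_eq_square)
    then have "(norm (P y))^2 \<le> (norm y)^2" by simp
    then show ?thesis by (rule power2_le_imp_le) simp
  qed
  have P_add: "P (y + u) = P y + P u" for y u
    by (simp add: P_def inner_add_left scaleR_add_left)
  define K where "K = norm z0 + r"
  obtain g M where M: "0 \<le> M" and expand:
    "\<And>a b. norm a \<le> K \<Longrightarrow> norm b \<le> K \<Longrightarrow> \<bar>f b - f a - g a \<bullet> (b - a)\<bar> \<le> M * (norm (b - a))^2"
    using C2_function_expansion[OF f, of K] by metis
  have K: "norm (P y) \<le> K" if "y \<in> ball z0 r" for y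
  proof -
    have "norm y \<le> norm z0 + norm (y - z0)" using norm_triangle_sub[of y z0] by simp
    then show ?thesis using that P_le[of y] by (simp add: K_def dist_norm norm_minus_commute)
  qed
  have contf: "continuous_on UNIV (\<lambda>y. f (P y))"
  proof -
    have "continuous_on UNIV f"
      using f unfolding C2_function_def
      by (metis continuous_at_imp_continuous_on has_derivative_continuous)
    moreover have "continuous_on UNIV P" unfolding P_def[abs_def] by (intro continuous_intros)
    ultimately show ?thesis
      using continuous_on_compose2[of UNIV f UNIV P] by auto
  qed
  have on_graph: "f (P z) = z \<bullet> e" if z: "z \<in> frontier D" "z \<in> ball z0 r" for z
  proof (rule antisym)
    have "z \<notin> D" using z \<open>open D\<close> by (simp add: frontier_def interior_open)
    then show "z \<bullet> e \<le> f (P z)" using graph_iff[OF z(2)] by (simp add: not_less)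
    have "closed {y. f (P y) \<le> y \<bullet> e}"
      by (intro closed_Collect_le contf continuous_intros)
    moreover have "D \<inter> ball z0 r \<subseteq> {y. f (P y) \<le> y \<bullet> e}"
      using graph_iff by (auto intro: less_imp_le)
    ultimately have "closure (D \<inter> ball z0 r) \<subseteq> {y. f (P y) \<le> y \<bullet> e}"
      by (rule closure_minimal[rotated])
    moreover have "z \<in> closure (D \<inter> ball z0 r)"
      using z open_Int_closure_subset[of "ball z0 r" D] by (auto simp: frontier_def Int_commute)
    ultimately show "f (P z) \<le> z \<bullet> e" by auto
  qed
  \<comment> \<open>the tangent balls have to stay inside \<open>ball z0 r\<close>, where \<open>D\<close> is a graph domain\<close>
  define s where "s = min (r / 4) (1 / (2 * (M + 1)))"
  have s: "0 < s" "s \<le> r / 4" "2 * M * s \<le> 1"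
  proof -
    show "0 < s" "s \<le> r / 4" using r M by (auto simp: s_def)
    have "2 * M * s \<le> 2 * M * (1 / (2 * (M + 1)))"
      using M by (intro mult_left_mono) (auto simp: s_def)
    also have "\<dots> \<le> 1" using M by (simp add: field_simps)
    finally show "2 * M * s \<le> 1" .
  qed
  have "tangent_balls D s z" if z: "z \<in> frontier D" "z \<in> ball z0 s" for z
  proof -
    have zr: "z \<in> ball z0 r" using z s r by auto
    \<comment> \<open>the gradient of \<open>y \<bullet> e - f (P y)\<close> at \<open>z\<close>\<close>
    define \<nu> where "\<nu> = e - P (g (P z))"
    have \<nu>u: "\<nu> \<bullet> u = u \<bullet> e - g (P z) \<bullet> P u" for u
      by (simp add: \<nu>_def P_def inner_diff_left inner_diff_right inner_commute mult.commute)
    have "\<nu> \<bullet> e = 1" using ee by (simp add: \<nu>u P_def inner_commute)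
    then have \<nu>1: "1 \<le> norm \<nu>" using Cauchy_Schwarz_ineq2[of \<nu> e] e by simp
    define n where "n = \<nu> /\<^sub>R norm \<nu>"
    have \<nu>0: "\<nu> \<noteq> 0" using \<nu>1 by auto
    then have n1: "norm n = 1" by (simp add: n_def)
    \<comment> \<open>the sign \<open>\<sigma>\<close> treats the interior and the exterior ball at once\<close>
    have near: "M * (norm u)^2 < \<bar>\<nu> \<bullet> u\<bar>" "0 < \<sigma> * (\<nu> \<bullet> u)" "z + u \<in> ball z0 r"
      if u: "z + u \<in> ball (z + (\<sigma> * s) *\<^sub>R n) s" and \<sigma>: "\<sigma> \<in> {1, -1}" for u and \<sigma> :: real
    proof -
      have "norm ((\<sigma> * s) *\<^sub>R n - u) < s" using u by (simp add: dist_norm)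
      then have "(norm ((\<sigma> * s) *\<^sub>R n - u))^2 < s^2" by (intro power_strict_mono) auto
      moreover have "(norm ((\<sigma> * s) *\<^sub>R n - u))^2 = s^2 - 2 * s * (\<sigma> * (n \<bullet> u)) + (norm u)^2"
        using n1 \<sigma> unfolding power2_norm_eq_inner
        by (auto simp: inner_diff_left inner_diff_right inner_commute norm_eq_1 power2_eq_square algebra_simps)
      ultimately have *: "(norm u)^2 < 2 * s * (\<sigma> * (n \<bullet> u))" by simp
      moreover have "0 \<le> (norm u)^2" by simp
      ultimately have pos: "0 < \<sigma> * (n \<bullet> u)" using s(1)
        by (metis less_le_trans mult_pos_pos not_le order_le_less_trans zero_less_mult_pos zero_less_numeral)
      have nu: "\<sigma> * (\<nu> \<bullet> u) = norm \<nu> * (\<sigma> * (n \<bullet> u))" using \<nu>0 by (simp add: n_def)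
      with pos \<nu>1 show "0 < \<sigma> * (\<nu> \<bullet> u)" by (metis less_le_trans mult_pos_pos zero_less_one)
      then have ab: "\<bar>\<nu> \<bullet> u\<bar> = \<sigma> * (\<nu> \<bullet> u)" using \<sigma> by auto
      have "\<sigma> * (n \<bullet> u) \<le> \<bar>\<nu> \<bullet> u\<bar>" unfolding ab nu using mult_right_mono[OF \<nu>1, of "\<sigma> * (n \<bullet> u)"] pos by simp
      then have le: "(norm u)^2 < 2 * s * \<bar>\<nu> \<bullet> u\<bar>" 
        using * s(1) by (smt (verit) mult_left_mono)
      show "M * (norm u)^2 < \<bar>\<nu> \<bullet> u\<bar>"
      proof (cases "M = 0")
        case True then show ?thesis using \<open>0 < \<sigma> * (\<nu> \<bullet> u)\<close> ab by simp
      next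
        case False
        then have "M * (norm u)^2 < M * (2 * s * \<bar>\<nu> \<bullet> u\<bar>)" using le M by simp
        also have "\<dots> = (2 * M * s) * \<bar>\<nu> \<bullet> u\<bar>" by simp
        also have "\<dots> \<le> 1 * \<bar>\<nu> \<bullet> u\<bar>" using s(3) by (intro mult_right_mono) auto
        finally show ?thesis by simp
      qed
      have "dist z0 (z + u) \<le> dist z0 z + dist z (z + (\<sigma> * s) *\<^sub>R n) + dist (z + (\<sigma> * s) *\<^sub>R n) (z + u)"
        using dist_triangle_le order_trans by (metis (no_types, lifting) add_right_mono dist_triangle)
      also have "\<dots> < s + s + s"
        using z(2) u n1 s(1) \<sigma> by (auto simp: dist_norm intro!: add_less_le_mono add_strict_mono)
      finally show "z + u \<in> ball z0 r" using s(1,2) by simp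
    qed
    have graph_u: "\<bar>f (P (z + u)) - (z + u) \<bullet> e + \<nu> \<bullet> u\<bar> \<le> M * (norm u)^2" if "z + u \<in> ball z0 r" for u
    proof -
      have "\<bar>f (P (z + u)) - f (P z) - g (P z) \<bullet> (P (z + u) - P z)\<bar> \<le> M * (norm (P (z + u) - P z))^2"
        by (intro expand K that zr)
      also have "\<dots> \<le> M * (norm u)^2"
        using M P_le[of u] by (intro mult_left_mono power_mono) (auto simp: P_add)
      finally show ?thesis 
        by (simp add: on_graph[OF z(1) zr] P_add \<nu>u inner_add_left algebra_simps)
    qed
    have "ball (z + s *\<^sub>R n) s \<subseteq> D"
    proof
      fix x assume "x \<in> ball (z + s *\<^sub>R n) s"
      then have *: "z + (x - z) \<in> ball (z + (1 * s) *\<^sub>R n) s" by simp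
      note nr = near[OF *, simplified]
      have "f (P x) < x \<bullet> e" using graph_u[of "x - z"] nr by (simp add: abs_if split: if_splits)
      then show "x \<in> D" using nr(3) graph_iff[of x] by simp
    qed
    moreover have "ball (z - s *\<^sub>R n) s \<subseteq> - D"
    proof
      fix x assume "x \<in> ball (z - s *\<^sub>R n) s"
      then have *: "z + (x - z) \<in> ball (z + (- 1 * s) *\<^sub>R n) s" by simp
      note nr = near[OF *, simplified]
      have "\<not> f (P x) < x \<bullet> e" using graph_u[of "x - z"] nr by (simp add: abs_if split: if_splits)
      then show "x \<in> - D" using nr(3) graph_iff[of x] by simp
    qed
    ultimately show ?thesis using n1 unfolding tangent_balls_def by blast
  qed
  with s(1) show ?thesis using that by blast
qed

text \<open>The radius is a minimum over a finite cover, as the boundary is compact.\<close>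

lemma C2_domain_tangent_balls:
  fixes D :: "'a::euclidean_space set"
  assumes D: "C2_domain D" "bounded D"
  obtains R where "0 < R" "\<And>z. z \<in> frontier D \<Longrightarrow> tangent_balls D R z"
proof -
  have "\<forall>z0\<in>frontier D. \<exists>s>0. \<forall>z\<in>frontier D \<inter> ball z0 s. tangent_balls D s z"
    using C2_domain_tangent_balls_nearby[OF D(1)] by (metis IntE)
  then obtain s where s: "\<And>z0. z0 \<in> frontier D \<Longrightarrow> 0 < s z0"
    "\<And>z0 z. z0 \<in> frontier D \<Longrightarrow> z \<in> frontier D \<Longrightarrow> z \<in> ball z0 (s z0) \<Longrightarrow> tangent_balls D (s z0) z"
    unfolding Bex_def by (metis Int_iff)
  have "compact (frontier D)" using D(2) by (rule compact_frontier_bounded)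
  then obtain F where F: "F \<subseteq> frontier D" "finite F" "frontier D \<subseteq> (\<Union>z0\<in>F. ball z0 (s z0))"
    by (rule compactE_image[of _ "frontier D" "\<lambda>z0. ball z0 (s z0)"]) (use s(1) in auto)
  define R where "R = Min (insert 1 (s ` F))"
  have R: "0 < R" "\<And>z0. z0 \<in> F \<Longrightarrow> R \<le> s z0"
    using F s(1) by (auto simp: R_def)
  have "tangent_balls D R z" if zf: "z \<in> frontier D" for z
  proof -
    obtain z0 where "z0 \<in> F" "z \<in> ball z0 (s z0)" using F(3) zf by blast
    then show ?thesis using tangent_balls_mono[OF s(2)[of z0 z]] R F(1) zf by auto
  qed
  with R(1) show ?thesis using that by blast
qed

text \<open>By \<open>\<surd>(a\<^sup>2 + 2 a x) \<le> a + x\<close>. It bounds distances from the centres of tangent balls to second order.\<close>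

lemma norm_scaled_unit_add_le:
  fixes n v :: "'a::euclidean_space"
  assumes "norm n = 1" "0 < a"
  shows "norm (a *\<^sub>R n + v) \<le> a + n \<bullet> v + (norm v)^2 / (2 * a)"
proof (rule power2_le_imp_le)
  define x where "x = n \<bullet> v + (norm v)^2 / (2 * a)"
  have eq: "(norm (a *\<^sub>R n + v))^2 = a^2 + 2 * a * x"
    using assms unfolding x_def power2_norm_eq_inner
    by (simp add: inner_add_left inner_add_right inner_commute norm_eq_1 power2_eq_square field_simps)
  then have "0 \<le> a * (a + 2 * x)" by (metis distrib_left mult.left_commute mult.assoc power2_eq_square zero_le_power2)
  then have "0 \<le> a + 2 * x" using assms(2) by (simp add: zero_le_mult_iff)
  then show "0 \<le> a + n \<bullet> v + (norm v)^2 / (2 * a)" using assms(2) by (simp add: x_def)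
  have "(norm (a *\<^sub>R n + v))^2 \<le> (a + x)^2" unfolding eq by (simp add: power2_eq_square algebra_simps)
  then show "(norm (a *\<^sub>R n + v))^2 \<le> (a + n \<bullet> v + (norm v)^2 / (2 * a))^2"
    by (simp add: x_def add.assoc)
qed

text \<open>The distance to the complement is squeezed between the distances to the two spheres that touch
  the boundary at the nearest boundary point; both are smooth near \<open>y\<close> and agree with it at \<open>y\<close>
  to first order. This replaces the \<open>C\<^sup>2\<close> regularity of the distance function.\<close>

lemma boundary_distance_expansion:
  fixes D :: "'a::euclidean_space set"
  assumes "open D" "D \<noteq> UNIV" and R: "0 < R" "\<And>z. z \<in> frontier D \<Longrightarrow> tangent_balls D R z"
    and y: "y \<in> D" "infdist y (- D) \<le> R / 2"
  obtains n where "norm n = 1"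
    "\<And>v. y + v \<in> D \<Longrightarrow> \<bar>infdist (y + v) (- D) - infdist y (- D) - n \<bullet> v\<bar> \<le> (norm v)^2 / R"
proof -
  define \<rho> where "\<rho> = infdist y (- D)"
  have cl: "closed (- D)" "- D \<noteq> {}" using assms(1,2) by auto
  obtain z where z: "z \<in> - D" "\<rho> = dist y z"
    using infdist_attains_inf[OF cl] unfolding \<rho>_def by metis
  have \<rho>0: "0 < \<rho>" using z y(1) by auto
  have bD: "ball y \<rho> \<subseteq> D"
  proof
    fix x assume "x \<in> ball y \<rho>"
    then show "x \<in> D" using infdist_le[of x "- D" y] unfolding \<rho>_def by (cases "x \<in> D") auto
  qed
  have "z \<in> closure D"
    using closure_mono[OF bD] \<rho>0 z(2) by auto
  then have "z \<in> frontier D" using z(1) \<open>open D\<close> by (simp add: frontier_def interior_open)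
  then obtain n where n: "norm n = 1" and int: "ball (z + R *\<^sub>R n) R \<subseteq> D" and ext: "ball (z - R *\<^sub>R n) R \<subseteq> - D"
    using R(2) unfolding tangent_balls_def by blast
  have nn: "n \<bullet> n = 1" using n by (simp add: norm_eq_1)
  \<comment> \<open>\<open>ball y \<rho>\<close> lies in \<open>D\<close> and the exterior ball in the complement, so the two balls are disjoint\<close>
  have far: "\<rho> + R \<le> norm (y - (z - R *\<^sub>R n))"
  proof (rule ccontr)
    define c where "c = z - R *\<^sub>R n"
    assume "\<not> \<rho> + R \<le> norm (y - (z - R *\<^sub>R n))"
    then have d: "norm (y - c) < \<rho> + R" by (simp add: c_def)
    define q where "q = y + (\<rho> / (\<rho> + R)) *\<^sub>R (c - y)"
    have "norm (q - y) = \<rho> / (\<rho> + R) * norm (y - c)"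
      using \<rho>0 R(1) by (simp add: q_def norm_minus_commute)
    also have "\<dots> < \<rho> / (\<rho> + R) * (\<rho> + R)"
      using d \<rho>0 R(1) by (intro mult_strict_left_mono) auto
    finally have "q \<in> D" using bD \<rho>0 R(1) by (auto simp: dist_norm norm_minus_commute)
    moreover have "q - c = (R / (\<rho> + R)) *\<^sub>R (y - c)"
    proof -
      have "q - c = (1 - \<rho> / (\<rho> + R)) *\<^sub>R (y - c)" by (simp add: q_def algebra_simps)
      also have "1 - \<rho> / (\<rho> + R) = R / (\<rho> + R)" using \<rho>0 R(1) by (simp add: field_simps)
      finally show ?thesis .
    qed
    then have "norm (q - c) < R / (\<rho> + R) * (\<rho> + R)"
      using d \<rho>0 R(1) by (simp add: divide_strict_right_mono pos_divide_less_eq)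
    then have "q \<notin> D" using ext \<rho>0 R(1) by (auto simp: c_def dist_norm norm_minus_commute)
    ultimately show False by simp
  qed
  have yz: "y = z + \<rho> *\<^sub>R n"
  proof -
    have nyz: "(norm (y - z))^2 = \<rho>^2" using z(2) by (simp add: dist_norm)
    have "(\<rho> + R)^2 \<le> (norm (y - z + R *\<^sub>R n))^2"
      using far \<rho>0 R(1) by (intro power_mono) (auto simp: algebra_simps)
    also have "\<dots> = \<rho>^2 + 2 * R * ((y - z) \<bullet> n) + R^2"
      using nyz nn unfolding power2_norm_eq_inner
      by (simp add: inner_add_left inner_add_right inner_commute power2_eq_square)
    finally have "2 * R * \<rho> \<le> 2 * R * ((y - z) \<bullet> n)" by (simp add: power2_eq_square algebra_simps)
    then have "\<rho> \<le> (y - z) \<bullet> n" using R(1) by simp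
    then have "\<rho> * \<rho> \<le> \<rho> * ((y - z) \<bullet> n)" using \<rho>0 by simp
    moreover have "(norm (y - z - \<rho> *\<^sub>R n))^2 = \<rho>^2 - 2 * (\<rho> * ((y - z) \<bullet> n)) + \<rho>^2"
      using nyz nn unfolding power2_norm_eq_inner
      by (simp add: inner_diff_left inner_diff_right inner_commute power2_eq_square algebra_simps)
    ultimately have "(norm (y - z - \<rho> *\<^sub>R n))^2 \<le> 0" by (simp add: power2_eq_square)
    then show ?thesis by (simp add: algebra_simps)
  qed
  have \<rho>R: "\<rho> \<le> R / 2" using y(2) by (simp add: \<rho>_def)
  have "\<bar>infdist (y + v) (- D) - \<rho> - n \<bullet> v\<bar> \<le> (norm v)^2 / R" if v: "y + v \<in> D" for v
  proof -
    have "infdist (y + v) (- D) \<le> \<rho> + n \<bullet> v + (norm v)^2 / R"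
    proof -
      define c where "c = z - R *\<^sub>R n"
      define w where "w = y + v - c"
      have w: "w = (\<rho> + R) *\<^sub>R n + v" by (simp add: w_def c_def yz algebra_simps)
      have "R \<le> norm w" using v ext by (auto simp: w_def c_def subset_eq dist_norm norm_minus_commute not_less[symmetric])
      define p where "p = c + (R / norm w) *\<^sub>R w"
      have "cball c R \<subseteq> - D"
        using closure_minimal[OF ext cl(1)] R(1) by (simp add: c_def)
      moreover have "p \<in> cball c R" using R(1) \<open>R \<le> norm w\<close> by (simp add: p_def dist_norm)
      ultimately have "infdist (y + v) (- D) \<le> dist (y + v) p" by (intro infdist_le) auto
      also have "dist (y + v) p = norm ((1 - R / norm w) *\<^sub>R w)"
        by (simp add: dist_norm p_def w_def algebra_simps)
      also have "\<dots> = norm w - R"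
      proof -
        have w0: "0 < norm w" using \<open>R \<le> norm w\<close> R(1) by linarith
        then have "(1 - R / norm w) * norm w = norm w - R" by (simp add: left_diff_distrib)
        moreover have "R / norm w \<le> 1" using \<open>R \<le> norm w\<close> w0 by simp
        ultimately show ?thesis by simp
      qed
      also have "norm w \<le> (\<rho> + R) + n \<bullet> v + (norm v)^2 / (2 * (\<rho> + R))"
        unfolding w using n \<rho>0 R(1) by (intro norm_scaled_unit_add_le) auto
      also have "(norm v)^2 / (2 * (\<rho> + R)) \<le> (norm v)^2 / R"
        using \<rho>0 R(1) by (intro divide_left_mono) auto
      finally show ?thesis by simp
    qed
    moreover have "\<rho> + n \<bullet> v - (norm v)^2 / R \<le> infdist (y + v) (- D)"
    proof -
      define c where "c = z + R *\<^sub>R n"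
      have "norm (y + v - c) = norm ((R - \<rho>) *\<^sub>R (- n) + v)"
        by (simp add: c_def yz algebra_simps)
      also have "\<dots> \<le> (R - \<rho>) + (- n) \<bullet> v + (norm v)^2 / (2 * (R - \<rho>))"
        using n \<rho>R R(1) by (intro norm_scaled_unit_add_le) auto
      also have "(norm v)^2 / (2 * (R - \<rho>)) \<le> (norm v)^2 / R"
        using \<rho>R R(1) by (intro divide_left_mono) auto
      finally have *: "norm (y + v - c) \<le> R - \<rho> - n \<bullet> v + (norm v)^2 / R" by simp
      have "\<rho> + n \<bullet> v - (norm v)^2 / R \<le> dist (y + v) p" if "p \<in> - D" for p
      proof -
        have "R \<le> dist c p" using int that by (auto simp: c_def subset_eq not_less[symmetric])
        also have "\<dots> \<le> dist (y + v) c + dist (y + v) p" by (metis dist_commute dist_triangle)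
        finally show ?thesis using * by (simp add: dist_norm)
      qed
      then show ?thesis unfolding infdist_def using cl(2) by (auto intro!: cINF_greatest)
    qed
    ultimately show ?thesis by simp
  qed
  with n show ?thesis using that unfolding \<rho>_def by blast
qed

section \<open>Test functions at the boundary\<close>

text \<open>A derivative-free form of bounds on a function and its first two derivatives: first-order Taylor
  approximation on \<open>S\<close> with a uniform quadratic error.\<close>

definition quadratically_approximable :: "('a::euclidean_space \<Rightarrow> real) \<Rightarrow> 'a set \<Rightarrow> real \<Rightarrow> bool" where
  "quadratically_approximable p S M \<longleftrightarrow> 0 \<le> M \<and> (\<forall>y\<in>S. \<bar>p y\<bar> \<le> M \<and> (\<exists>g. norm g \<le> M \<and>
     (\<forall>z\<in>S. \<bar>p z - p y - g \<bullet> (z - y)\<bar> \<le> M * (norm (z - y))^2)))"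

text \<open>Polynomials are a uniformly dense class of such functions.\<close>

lemma polynomial_quadratically_approximable:
  fixes p :: "'a::euclidean_space \<Rightarrow> real"
  assumes "real_polynomial_function p" and S: "bounded S"
  shows "\<exists>M. quadratically_approximable p S M"
proof -
  obtain K where K: "0 < K" "\<And>y. y \<in> S \<Longrightarrow> norm y \<le> K"
    using S unfolding bounded_pos by blast
  show ?thesis using assms(1)
  proof (induction rule: real_polynomial_function.induct)
    case (linear f)
    define g where "g = (\<Sum>b\<in>Basis. f b *\<^sub>R b)"
    have f: "f y = g \<bullet> y" for y
    proof -
      have "f y = f (\<Sum>b\<in>Basis. (y \<bullet> b) *\<^sub>R b)" by (simp add: euclidean_representation)
      also have "\<dots> = g \<bullet> y" using linear
        by (simp add: bounded_linear.linear linear_sum linear_scale g_def inner_sum_right inner_commute[of _ y] mult.commute)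
      finally show ?thesis .
    qed
    have "\<bar>f y\<bar> \<le> norm g * K" if "y \<in> S" for y
      using Cauchy_Schwarz_ineq2[of g y] K(2)[OF that] unfolding f
      by (meson mult_left_mono norm_ge_zero order_trans)
    then have "quadratically_approximable f S (max (norm g) (norm g * K))"
      unfolding quadratically_approximable_def
      by (auto simp: f inner_diff_right le_max_iff_disj intro!: exI[of _ g])
    then show ?case ..
  next
    case (const c)
    have "quadratically_approximable (\<lambda>x. c) S \<bar>c\<bar>"
      unfolding quadratically_approximable_def by (auto intro!: exI[of _ 0])
    then show ?case ..
  next
    case (add p q)
    then obtain M N where M: "quadratically_approximable p S M" and N: "quadratically_approximable q S N" by blast
    have "quadratically_approximable (\<lambda>x. p x + q x) S (M + N)"
      unfolding quadratically_approximable_def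
    proof (intro conjI ballI)
      show "0 \<le> M + N" using M N by (simp add: quadratically_approximable_def)
      fix y assume y: "y \<in> S"
      then obtain g h where g: "norm g \<le> M" "\<And>z. z \<in> S \<Longrightarrow> \<bar>p z - p y - g \<bullet> (z - y)\<bar> \<le> M * (norm (z - y))^2"
        and h: "norm h \<le> N" "\<And>z. z \<in> S \<Longrightarrow> \<bar>q z - q y - h \<bullet> (z - y)\<bar> \<le> N * (norm (z - y))^2"
        using M N unfolding quadratically_approximable_def by metis
      show "\<bar>p y + q y\<bar> \<le> M + N" using M N y unfolding quadratically_approximable_def
        by (smt (verit, best))
      show "\<exists>g. norm g \<le> M + N \<and> (\<forall>z\<in>S. \<bar>p z + q z - (p y + q y) - g \<bullet> (z - y)\<bar> \<le> (M + N) * (norm (z - y))^2)"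
      proof (intro exI[of _ "g + h"] conjI ballI)
        show "norm (g + h) \<le> M + N" using g(1) h(1) norm_triangle_ineq[of g h] by linarith
        fix z assume "z \<in> S"
        then show "\<bar>p z + q z - (p y + q y) - (g + h) \<bullet> (z - y)\<bar> \<le> (M + N) * (norm (z - y))^2"
          using g(2)[of z] h(2)[of z] unfolding inner_add_left distrib_right by linarith
      qed
    qed
    then show ?case ..
  next
    case (mult p q)
    then obtain M N where M: "quadratically_approximable p S M" and N: "quadratically_approximable q S N" by blast
    have M0: "0 \<le> M" and N0: "0 \<le> N" using M N by (simp_all add: quadratically_approximable_def)
    define L where "L = 2 * M * N + (M + M * (2 * K)) * (N + N * (2 * K))"
    have L: "2 * M * N \<le> L" using M0 N0 K(1) by (simp add: L_def)
    have "quadratically_approximable (\<lambda>x. p x * q x) S L"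
      unfolding quadratically_approximable_def
    proof (intro conjI ballI)
      have MN: "0 \<le> M * N" using M0 N0 by simp
      then show "0 \<le> L" using L by linarith
      fix y assume y: "y \<in> S"
      then obtain g h where g: "norm g \<le> M" "\<And>z. z \<in> S \<Longrightarrow> \<bar>p z - p y - g \<bullet> (z - y)\<bar> \<le> M * (norm (z - y))^2"
        and h: "norm h \<le> N" "\<And>z. z \<in> S \<Longrightarrow> \<bar>q z - q y - h \<bullet> (z - y)\<bar> \<le> N * (norm (z - y))^2"
        using M N unfolding quadratically_approximable_def by metis
      have py: "\<bar>p y\<bar> \<le> M" and qy: "\<bar>q y\<bar> \<le> N" using M N y by (auto simp: quadratically_approximable_def)
      have "\<bar>p y * q y\<bar> \<le> M * N" unfolding abs_mult using py qy M0 by (intro mult_mono) auto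
      then show "\<bar>p y * q y\<bar> \<le> L" using L MN by linarith
      show "\<exists>k. norm k \<le> L \<and> (\<forall>z\<in>S. \<bar>p z * q z - (p y * q y) - k \<bullet> (z - y)\<bar> \<le> L * (norm (z - y))^2)"
      proof (intro exI[of _ "q y *\<^sub>R g + p y *\<^sub>R h"] conjI ballI)
        have "norm (q y *\<^sub>R g + p y *\<^sub>R h) \<le> \<bar>q y\<bar> * norm g + \<bar>p y\<bar> * norm h"
          by (metis norm_scaleR norm_triangle_ineq)
        also have "\<dots> \<le> N * M + M * N"
          using g(1) h(1) py qy M0 N0 by (intro add_mono mult_mono) auto
        also have "\<dots> = 2 * M * N" by simp
        finally show "norm (q y *\<^sub>R g + p y *\<^sub>R h) \<le> L" using L by linarith
        fix z assume z: "z \<in> S"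
        define d where "d = norm (z - y)"
        have d: "0 \<le> d" "d \<le> 2 * K"
          using norm_triangle_ineq4[of z y] K(2)[OF z] K(2)[OF y] by (auto simp: d_def)
        define E F where "E = p z - p y - g \<bullet> (z - y)" and "F = q z - q y - h \<bullet> (z - y)"
        have E: "\<bar>E\<bar> \<le> M * d^2" and F: "\<bar>F\<bar> \<le> N * d^2"
          using g(2)[OF z] h(2)[OF z] by (auto simp: E_def F_def d_def)
        have lip: "\<bar>r z - r y\<bar> \<le> (L' + L' * (2 * K)) * d"
          if "norm k \<le> L'" "\<bar>r z - r y - k \<bullet> (z - y)\<bar> \<le> L' * d^2" "0 \<le> L'" for r :: "'a \<Rightarrow> real" and k L'
        proof -
          have "\<bar>k \<bullet> (z - y)\<bar> \<le> norm k * d" unfolding d_def by (rule Cauchy_Schwarz_ineq2)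
          also have "\<dots> \<le> L' * d" using that(1) d(1) by (intro mult_right_mono)
          finally have "\<bar>r z - r y\<bar> \<le> L' * d + L' * d^2" using that(2) by linarith
          also have "L' * d^2 \<le> L' * (2 * K * d)"
            unfolding power2_eq_square using d that(3) by (intro mult_left_mono mult_right_mono) auto
          finally show ?thesis by (simp add: algebra_simps)
        qed
        have "\<bar>(p z - p y) * (q z - q y)\<bar> \<le> ((M + M * (2 * K)) * d) * ((N + N * (2 * K)) * d)"
          unfolding abs_mult using M0 N0 K(1) d
          by (intro mult_mono lip[OF g(1) _ M0] lip[OF h(1) _ N0] g(2)[OF z, folded d_def] h(2)[OF z, folded d_def]) auto
        moreover have "\<bar>q y * E\<bar> \<le> N * (M * d^2)"
          unfolding abs_mult using qy E N0 by (intro mult_mono) auto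
        moreover have "\<bar>p y * F\<bar> \<le> M * (N * d^2)"
          unfolding abs_mult using py F M0 by (intro mult_mono) auto
        moreover have "p z * q z - (p y * q y) - (q y *\<^sub>R g + p y *\<^sub>R h) \<bullet> (z - y)
           = q y * E + p y * F + (p z - p y) * (q z - q y)"
          by (simp add: E_def F_def inner_add_left algebra_simps)
        moreover have "N * (M * d^2) + M * (N * d^2) + ((M + M * (2 * K)) * d) * ((N + N * (2 * K)) * d) = L * d^2"
          by (simp add: L_def power2_eq_square algebra_simps)
        ultimately show "\<bar>p z * q z - (p y * q y) - (q y *\<^sub>R g + p y *\<^sub>R h) \<bullet> (z - y)\<bar> \<le> L * (norm (z - y))^2"
          unfolding d_def[symmetric] by linarith
      qed
    qed
    then show ?case ..
  qed
qed

definition ramp :: "real \<Rightarrow> real \<Rightarrow> real" where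
  "ramp e r = max 0 (e - r)"

lemma ramp_nonneg [simp]: "0 \<le> ramp e r" by (simp add: ramp_def)

lemma ramp_le: "0 \<le> e \<Longrightarrow> 0 \<le> r \<Longrightarrow> ramp e r \<le> e" by (simp add: ramp_def)

text \<open>The cubic \<open>ramp e r ^ 3 / 3\<close> has first derivative \<open>- (ramp e r)\<^sup>2\<close> and second derivative
  \<open>2 * ramp e r\<close>, which is Lipschitz across the kink at \<open>r = e\<close>.\<close>

lemma ramp_cubed_expansion:
  "\<bar>ramp e (r + s) ^ 3 / 3 - ramp e r ^ 3 / 3 + (ramp e r)^2 * s - ramp e r * s^2\<bar> \<le> \<bar>s\<bar>^3 / 3"
proof -
  define k where "k = e - r"
  have cube: "(k - s)^3 / 3 - k^3 / 3 + k^2 * s - k * s^2 = - (s^3 / 3)"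
    by (simp add: power3_eq_cube power2_eq_square algebra_simps) (simp add: field_simps)
  have abs3: "\<bar>s^3 / 3\<bar> = \<bar>s\<bar>^3 / 3" by (simp add: power_abs)
  have eq: "ramp e (r + s) = max 0 (k - s)" "ramp e r = max 0 k"
    by (auto simp: ramp_def k_def algebra_simps)
  consider "0 \<le> k" "0 \<le> k - s" | "0 \<le> k" "k - s < 0" | "k < 0" "0 \<le> k - s" | "k < 0" "k - s < 0" by linarith
  then show ?thesis
  proof cases
    case 1
    then show ?thesis unfolding eq using cube abs3 by (simp add: max_def)
  next
    case 2
    have "(s - k)^3 \<le> s^3" "0 \<le> (s - k)^3" using 2 by (intro power_mono zero_le_power; simp)+
    moreover have "(k - s)^3 = - ((s - k)^3)" by (simp add: power3_eq_cube algebra_simps)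
    moreover have m: "max 0 (k - s) = 0" "max 0 k = k" "(0::real)^3 = 0" "\<bar>s\<bar> = s" using 2 by auto
    ultimately show ?thesis unfolding eq m using cube by linarith
  next
    case 3
    have "(k - s)^3 \<le> (- s)^3" "0 \<le> (k - s)^3" using 3 by (intro power_mono zero_le_power; simp)+
    then show ?thesis unfolding eq using 3 by (simp add: max_def)
  next
    case 4
    then show ?thesis unfolding eq by (simp add: max_def)
  qed
qed

text \<open>The product of \<open>\<phi>\<close> with a \<open>C\<^sup>2\<close> function of the distance \<open>\<rho>\<close>: zero outside the strip of width \<open>e\<close>, with the value
  \<open>\<phi> e\<^sup>3 / 3\<close> at the boundary and \<open>\<phi> (e - \<rho>)\<^sub>+\<close> as leading part of half its Laplacian.\<close>

definition boundary_bump :: "'a::euclidean_space set \<Rightarrow> ('a \<Rightarrow> real) \<Rightarrow> real \<Rightarrow> 'a \<Rightarrow> real" where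
  "boundary_bump D \<phi> e y = \<phi> y * (ramp e (infdist y (- D)) ^ 3 / 3)"

lemma infdist_add_le: "\<bar>infdist (y + v) A - infdist y A\<bar> \<le> norm (v :: 'a::euclidean_space)"
  using infdist_triangle_abs[of "y + v" A y] by (simp add: dist_norm)

text \<open>The normal second derivative contributes \<open>2 \<phi> ramp e\<close>. Every other second-order term carries
  a further factor of order \<open>e\<close>: it involves the curvature of the boundary or a derivative of \<open>\<phi>\<close>.\<close>

lemma boundary_bump_expansion:
  fixes D :: "'a::euclidean_space set"
  assumes D: "open D" "D \<noteq> UNIV" and R: "0 < R" "\<And>z. z \<in> frontier D \<Longrightarrow> tangent_balls D R z"
    and \<phi>: "quadratically_approximable \<phi> D M"
    and e: "0 < e" "e \<le> R / 2" "e \<le> 1" and y: "y \<in> D"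
  defines "\<kappa> \<equiv> ramp e (infdist y (- D))"
  obtains n l where "norm n = 1" "norm l \<le> 2 * M"
    "\<And>v. y + v \<in> D \<Longrightarrow> norm v \<le> 1 \<Longrightarrow>
       \<bar>boundary_bump D \<phi> e (y + v) - boundary_bump D \<phi> e y - l \<bullet> v - (\<phi> y * \<kappa>) * (n \<bullet> v)^2\<bar>
         \<le> (M / R + 2 * M) * e * \<kappa> * (norm v)^2 + (2 * M / R + 5 * M) * (norm v)^3"
proof -
  define \<rho> where "\<rho> x = infdist x (- D)" for x
  define F where "F r = ramp e r ^ 3 / 3" for r
  have M0: "0 \<le> M" and \<phi>y: "\<bar>\<phi> y\<bar> \<le> M" using \<phi> y by (auto simp: quadratically_approximable_def)
  obtain g where g: "norm g \<le> M" "\<And>z. z \<in> D \<Longrightarrow> \<bar>\<phi> z - \<phi> y - g \<bullet> (z - y)\<bar> \<le> M * (norm (z - y))^2"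
    using \<phi> y unfolding quadratically_approximable_def by metis
  have \<kappa>: "0 \<le> \<kappa>" "\<kappa> \<le> e" "\<kappa> \<le> 1"
    using e ramp_le[of e "infdist y (- D)"] by (auto simp: \<kappa>_def infdist_nonneg)
  have \<kappa>2: "\<kappa>^2 \<le> e * \<kappa>" "\<kappa>^3 \<le> e * \<kappa>"
  proof -
    show 1: "\<kappa>^2 \<le> e * \<kappa>" using \<kappa> by (simp add: power2_eq_square mult_right_mono)
    have "\<kappa>^3 \<le> \<kappa>^2" using \<kappa> by (intro power_decreasing) auto
    with 1 show "\<kappa>^3 \<le> e * \<kappa>" by linarith
  qed
  have Fbd: "0 \<le> F r" "F (\<rho> y) = \<kappa>^3 / 3" for r by (simp_all add: F_def \<kappa>_def \<rho>_def)
  \<comment> \<open>away from the strip there is no normal direction to choose, and \<open>\<kappa> = 0\<close>\<close>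
  have "\<exists>n. norm n = 1 \<and> (\<forall>v. y + v \<in> D \<longrightarrow> \<bar>F (\<rho> (y + v)) - F (\<rho> y) + \<kappa>^2 * (n \<bullet> v) - \<kappa> * (n \<bullet> v)^2\<bar>
     \<le> \<kappa>^2 * (norm v)^2 / R + 2 * \<kappa> * (norm v)^3 / R + (norm v)^3 / 3)"
  proof (cases "\<rho> y \<le> R / 2")
    case True
    then obtain n where n: "norm n = 1" "\<And>v. y + v \<in> D \<Longrightarrow> \<bar>\<rho> (y + v) - \<rho> y - n \<bullet> v\<bar> \<le> (norm v)^2 / R"
      using boundary_distance_expansion[OF D R y] unfolding \<rho>_def by metis
    have "\<bar>F (\<rho> (y + v)) - F (\<rho> y) + \<kappa>^2 * (n \<bullet> v) - \<kappa> * (n \<bullet> v)^2\<bar>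
       \<le> \<kappa>^2 * (norm v)^2 / R + 2 * \<kappa> * (norm v)^3 / R + (norm v)^3 / 3" if v: "y + v \<in> D" for v
    proof -
      define s where "s = \<rho> (y + v) - \<rho> y"
      define x where "x = n \<bullet> v"
      have s: "\<bar>s\<bar> \<le> norm v" unfolding s_def \<rho>_def by (rule infdist_add_le)
      have x: "\<bar>x\<bar> \<le> norm v" using Cauchy_Schwarz_ineq2[of n v] n(1) by (simp add: x_def)
      have sx: "\<bar>s - x\<bar> \<le> (norm v)^2 / R" using n(2)[OF v] by (simp add: s_def x_def)
      have 1: "\<bar>F (\<rho> (y + v)) - F (\<rho> y) + \<kappa>^2 * s - \<kappa> * s^2\<bar> \<le> (norm v)^3 / 3"
      proof -
        have "\<bar>F (\<rho> (y + v)) - F (\<rho> y) + \<kappa>^2 * s - \<kappa> * s^2\<bar> \<le> \<bar>s\<bar>^3 / 3"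
          using ramp_cubed_expansion[of e "\<rho> y" s] by (simp add: F_def \<kappa>_def s_def \<rho>_def)
        also have "\<dots> \<le> (norm v)^3 / 3" using s by (intro divide_right_mono power_mono) auto
        finally show ?thesis .
      qed
      have 2: "\<bar>\<kappa>^2 * (s - x)\<bar> \<le> \<kappa>^2 * (norm v)^2 / R"
        using mult_left_mono[OF sx, of "\<kappa>^2"] by (simp add: abs_mult)
      have "\<bar>(s - x) * (s + x)\<bar> \<le> (norm v)^2 / R * (2 * norm v)"
        unfolding abs_mult using sx s x R(1) by (intro mult_mono) auto
      then have 3: "\<bar>\<kappa> * (s^2 - x^2)\<bar> \<le> 2 * \<kappa> * (norm v)^3 / R"
      proof -
        assume *: "\<bar>(s - x) * (s + x)\<bar> \<le> (norm v)^2 / R * (2 * norm v)"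
        have "\<kappa> * (s^2 - x^2) = \<kappa> * ((s - x) * (s + x))"
          by (simp add: power2_eq_square algebra_simps)
        then have "\<bar>\<kappa> * (s^2 - x^2)\<bar> = \<kappa> * \<bar>(s - x) * (s + x)\<bar>"
          using \<kappa>(1) by (simp only: abs_mult[of \<kappa>] abs_of_nonneg)
        also have "\<dots> \<le> \<kappa> * ((norm v)^2 / R * (2 * norm v))"
          using * \<kappa>(1) by (rule mult_left_mono)
        finally show ?thesis by (simp add: power2_eq_square power3_eq_cube algebra_simps)
      qed
      have "F (\<rho> (y + v)) - F (\<rho> y) + \<kappa>^2 * x - \<kappa> * x^2
        = (F (\<rho> (y + v)) - F (\<rho> y) + \<kappa>^2 * s - \<kappa> * s^2) - \<kappa>^2 * (s - x) + \<kappa> * (s^2 - x^2)"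
        by (simp add: algebra_simps)
      with 1 2 3 show ?thesis unfolding x_def[symmetric] by linarith
    qed
    with n(1) show ?thesis by blast
  next
    case False
    then have \<kappa>0: "\<kappa> = 0" using e(2) by (simp add: \<kappa>_def ramp_def \<rho>_def)
    have "\<bar>F (\<rho> (y + v)) - F (\<rho> y)\<bar> \<le> (norm v)^3 / 3" for v
    proof -
      define s where "s = \<rho> (y + v) - \<rho> y"
      have s: "\<bar>s\<bar> \<le> norm v" unfolding s_def \<rho>_def by (rule infdist_add_le)
      have "\<bar>F (\<rho> (y + v)) - F (\<rho> y) + \<kappa>^2 * s - \<kappa> * s^2\<bar> \<le> \<bar>s\<bar>^3 / 3"
        using ramp_cubed_expansion[of e "\<rho> y" s] by (simp add: F_def \<kappa>_def s_def \<rho>_def)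
      also have "\<dots> \<le> (norm v)^3 / 3" using s by (intro divide_right_mono power_mono) auto
      finally show ?thesis by (simp add: \<kappa>0)
    qed
    moreover obtain b :: 'a where "norm b = 1" using vector_choose_size[of 1] by auto
    ultimately show ?thesis by (auto simp: \<kappa>0)
  qed
  then obtain n where n: "norm n = 1" and Fexp: "\<And>v. y + v \<in> D \<Longrightarrow>
     \<bar>F (\<rho> (y + v)) - F (\<rho> y) + \<kappa>^2 * (n \<bullet> v) - \<kappa> * (n \<bullet> v)^2\<bar>
     \<le> \<kappa>^2 * (norm v)^2 / R + 2 * \<kappa> * (norm v)^3 / R + (norm v)^3 / 3" by blast
  \<comment> \<open>the product rule: \<open>F(\<rho>)\<close> times the gradient of \<open>\<phi>\<close> plus \<open>\<phi> F'(\<rho>)\<close> times that of \<open>\<rho>\<close>\<close>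
  define l where "l = F (\<rho> y) *\<^sub>R g - (\<phi> y * \<kappa>^2) *\<^sub>R n"
  have "norm l \<le> F (\<rho> y) * norm g + \<bar>\<phi> y\<bar> * \<kappa>^2"
    unfolding l_def using norm_triangle_ineq4[of "F (\<rho> y) *\<^sub>R g" "(\<phi> y * \<kappa>^2) *\<^sub>R n"] n Fbd(1)[of "\<rho> y"]
    by (simp add: abs_mult)
  also have "\<dots> \<le> 1 * M + M * 1"
    using g(1) \<phi>y M0 \<kappa> Fbd(1)[of "\<rho> y"] power_le_one[of \<kappa> 3] power_le_one[of \<kappa> 2]
    by (intro add_mono mult_mono) (auto simp: Fbd(2))
  finally have l: "norm l \<le> 2 * M" by simp
  have "\<bar>boundary_bump D \<phi> e (y + v) - boundary_bump D \<phi> e y - l \<bullet> v - (\<phi> y * \<kappa>) * (n \<bullet> v)^2\<bar>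
         \<le> (M / R + 2 * M) * e * \<kappa> * (norm v)^2 + (2 * M / R + 5 * M) * (norm v)^3"
    if v: "y + v \<in> D" "norm v \<le> 1" for v
  proof -
    define a where "a = norm v"
    have a: "0 \<le> a" "a \<le> 1" using v by (auto simp: a_def)
    have pw: "a^3 \<le> a^2" "a^4 \<le> a^3" "a^5 \<le> a^3" "0 \<le> a^3" "0 \<le> a^2"
      using a by (auto intro!: power_decreasing)
    define E where "E = F (\<rho> (y + v)) - F (\<rho> y) + \<kappa>^2 * (n \<bullet> v) - \<kappa> * (n \<bullet> v)^2"
    define H where "H = \<phi> (y + v) - \<phi> y - g \<bullet> v"
    define dF where "dF = F (\<rho> (y + v)) - F (\<rho> y)"
    have E: "\<bar>E\<bar> \<le> \<kappa>^2 * a^2 / R + 2 * \<kappa> * a^3 / R + a^3 / 3"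
      using Fexp[OF v(1)] by (simp add: E_def a_def)
    have H: "\<bar>H\<bar> \<le> M * a^2" using g(2)[OF v(1)] by (simp add: H_def a_def)
    have gv: "\<bar>g \<bullet> v\<bar> \<le> M * a"
      using Cauchy_Schwarz_ineq2[of g v] mult_right_mono[OF g(1), of a] a(1) by (simp add: a_def)
    have dF: "\<bar>dF\<bar> \<le> \<kappa>^2 * a + \<kappa> * a^2 + a^3 / 3"
    proof -
      define s where "s = \<rho> (y + v) - \<rho> y"
      have s: "\<bar>s\<bar> \<le> a" unfolding s_def \<rho>_def a_def by (rule infdist_add_le)
      have 1: "\<bar>dF + \<kappa>^2 * s - \<kappa> * s^2\<bar> \<le> \<bar>s\<bar>^3 / 3"
        using ramp_cubed_expansion[of e "\<rho> y" s] by (simp add: dF_def F_def \<kappa>_def s_def \<rho>_def)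
      have 2: "\<bar>s\<bar>^3 / 3 \<le> a^3 / 3" using s by (intro divide_right_mono power_mono) auto
      have 3: "\<bar>\<kappa>^2 * s\<bar> \<le> \<kappa>^2 * a" using s by (simp add: abs_mult mult_left_mono)
      have "s^2 \<le> a^2" using power_mono[OF s, of 2] by simp
      then have 4: "\<bar>\<kappa> * s^2\<bar> \<le> \<kappa> * a^2" using \<kappa>(1) by (simp add: abs_mult mult_left_mono)
      show ?thesis using 1 2 3 4 by linarith
    qed
    have dF1: "\<bar>dF\<bar> \<le> \<kappa> * e * a + 2 * a^2"
    proof -
      have "\<kappa>^2 * a \<le> \<kappa> * e * a" using mult_right_mono[OF \<kappa>2(1) a(1)] by (simp add: mult_ac)
      moreover have "\<kappa> * a^2 \<le> 1 * a^2" using \<kappa>(3) by (intro mult_right_mono) auto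
      ultimately show ?thesis using dF pw by linarith
    qed
    have "\<bar>\<phi> y * E\<bar> \<le> M * (\<kappa>^2 * a^2 / R + 2 * \<kappa> * a^3 / R + a^3 / 3)"
      unfolding abs_mult using \<phi>y E M0 by (intro mult_mono) auto
    also have "\<dots> \<le> M * (e * \<kappa> * a^2 / R + 2 * 1 * a^3 / R + a^3 / 3)"
      using M0 R(1) \<kappa> \<kappa>2 a by (intro mult_left_mono add_mono divide_right_mono mult_right_mono) auto
    finally have t1: "\<bar>\<phi> y * E\<bar> \<le> M / R * (e * \<kappa> * a^2) + 2 * M / R * a^3 + M * a^3 / 3"
      by (simp add: algebra_simps)
    have "\<bar>(g \<bullet> v) * dF\<bar> \<le> (M * a) * (\<kappa> * e * a + 2 * a^2)"
      unfolding abs_mult using gv dF1 M0 a by (intro mult_mono) auto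
    then have t2: "\<bar>(g \<bullet> v) * dF\<bar> \<le> M * (e * \<kappa> * a^2) + 2 * M * a^3"
      by (simp add: power2_eq_square power3_eq_cube algebra_simps)
    have "\<bar>F (\<rho> (y + v))\<bar> \<le> \<kappa>^3 / 3 + \<bar>dF\<bar>" using Fbd by (simp add: dF_def)
    also have "\<dots> \<le> e * \<kappa> / 3 + (\<kappa>^2 * a + \<kappa> * a^2 + a^3 / 3)" using \<kappa>2 dF by linarith
    also have "\<dots> \<le> e * \<kappa> + 7 / 3 * a"
    proof -
      have "\<kappa>^2 * a \<le> 1 * a" using \<kappa> a power_le_one[of \<kappa> 2] by (intro mult_right_mono) auto
      moreover have "\<kappa> * a^2 \<le> 1 * a^2" using \<kappa> by (intro mult_right_mono) auto
      moreover have "a^2 \<le> a" "a^3 \<le> a" using a power_decreasing[of 1 2 a] power_decreasing[of 1 3 a] by auto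
      moreover have "0 \<le> e * \<kappa>" using e \<kappa> by simp
      ultimately show ?thesis by linarith
    qed
    finally have Fv: "\<bar>F (\<rho> (y + v))\<bar> \<le> e * \<kappa> + 7 / 3 * a" .
    have "\<bar>H * F (\<rho> (y + v))\<bar> \<le> (M * a^2) * (e * \<kappa> + 7 / 3 * a)"
      unfolding abs_mult using H Fv M0 by (intro mult_mono) auto
    then have t3: "\<bar>H * F (\<rho> (y + v))\<bar> \<le> M * (e * \<kappa> * a^2) + 7 / 3 * M * a^3"
      by (simp add: power2_eq_square power3_eq_cube algebra_simps)
    have "boundary_bump D \<phi> e (y + v) - boundary_bump D \<phi> e y - l \<bullet> v - (\<phi> y * \<kappa>) * (n \<bullet> v)^2
      = \<phi> y * E + (g \<bullet> v) * dF + H * F (\<rho> (y + v))"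
      by (simp add: boundary_bump_def F_def[symmetric] \<rho>_def[symmetric] l_def E_def dF_def H_def
          inner_diff_left algebra_simps)
    moreover have "(M / R + 2 * M) * e * \<kappa> * a^2 + (2 * M / R + 5 * M) * a^3
       = M / R * (e * \<kappa> * a^2) + 2 * (M * (e * \<kappa> * a^2)) + 2 * M / R * a^3 + 5 * (M * a^3)"
      by (simp add: algebra_simps)
    moreover have "0 \<le> M * a^3" using M0 pw by simp
    ultimately show ?thesis using t1 t2 t3 unfolding a_def[symmetric] by linarith
  qed
  with n l show ?thesis using that by blast
qed

section \<open>Brownian motion killed at the boundary\<close>

definition grid :: "nat \<Rightarrow> real \<Rightarrow> real" where
  "grid n u = real (nat \<lfloor>u * real (Suc n)\<rfloor>) / real (Suc n)"

lemma grid_bounds: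
  assumes "0 \<le> u" shows "0 \<le> grid n u" "grid n u \<le> u" "u - grid n u \<le> 1 / real (Suc n)"
proof -
  have *: "real (nat \<lfloor>u * real (Suc n)\<rfloor>) = real_of_int \<lfloor>u * real (Suc n)\<rfloor>"
    using assms by simp
  have "real_of_int \<lfloor>u * real (Suc n)\<rfloor> \<le> u * real (Suc n)" "u * real (Suc n) \<le> real_of_int \<lfloor>u * real (Suc n)\<rfloor> + 1"
    by linarith+
  then show "0 \<le> grid n u" "grid n u \<le> u" "u - grid n u \<le> 1 / real (Suc n)"
    unfolding grid_def * using assms
      by (simp_all add: pos_divide_le_eq add.commute[of 1] pos_le_divide_eq diff_le_eq add_divide_distrib[symmetric] del: of_nat_Suc)
qed

lemma grid_tendsto:
  assumes "0 \<le> u" shows "(\<lambda>n. grid n u) \<longlonglongrightarrow> u"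
proof (rule real_tendsto_sandwich)
  show "eventually (\<lambda>n. u - 1 / real (Suc n) \<le> grid n u) sequentially"
    using grid_bounds(3)[OF assms] by (auto simp: algebra_simps)
  show "eventually (\<lambda>n. grid n u \<le> u) sequentially"
    using grid_bounds(2)[OF assms] by auto
  show "(\<lambda>n. u - 1 / real (Suc n)) \<longlonglongrightarrow> u"
    using tendsto_diff[OF tendsto_const LIMSEQ_Suc[OF lim_1_over_n]] by simp
qed simp

context brownian_motion
begin

lemma path_tendsto:
  assumes "x \<in> D" "\<omega> \<in> space (W x)" "S \<longlonglongrightarrow> s" "\<And>n. 0 \<le> S n" "0 \<le> s"
  shows "(\<lambda>n. B (S n) \<omega>) \<longlonglongrightarrow> B s \<omega>"
  by (rule continuous_on_tendsto_compose[OF continuous_paths[OF assms(1,2)] assms(3)])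
    (use assms(4,5) in auto)

lemma distr_increment:
  assumes "x \<in> D" "0 \<le> s" "s < t"
  shows "distr (W x) borel (\<lambda>\<omega>. B t \<omega> - B s \<omega>) = gauss (t - s)"
proof -
  have "distr (W x) lborel (\<lambda>\<omega>. B t \<omega> - B s \<omega>) = gauss (t - s)"
    using distributed_distr_eq_density[OF gaussian_increments[OF assms]]
    by (simp add: gauss_def gauss_density_def[abs_def])
  moreover have "distr (W x) lborel (\<lambda>\<omega>. B t \<omega> - B s \<omega>) = distr (W x) borel (\<lambda>\<omega>. B t \<omega> - B s \<omega>)"
    by (rule distr_cong) auto
  ultimately show ?thesis by simp
qed

text \<open>By path continuity, the process is the pointwise limit of its values at grid times.\<close>

lemma measurable_B_joint:
  assumes x: "x \<in> D"
  shows "(\<lambda>p. B (max 0 (snd p)) (fst p)) \<in> borel_measurable (W x \<Otimes>\<^sub>M borel)"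
proof (rule borel_measurable_LIMSEQ_metric)
  fix n
  show "(\<lambda>p. B (grid n (max 0 (snd p))) (fst p)) \<in> borel_measurable (W x \<Otimes>\<^sub>M borel)"
    unfolding grid_def
  proof (rule measurable_compose_countable[where g = "\<lambda>p. nat \<lfloor>max 0 (snd p) * real (Suc n)\<rfloor>"])
    fix i :: nat
    show "(\<lambda>p. B (real i / real (Suc n)) (fst p)) \<in> borel_measurable (W x \<Otimes>\<^sub>M borel)"
      using measurable_compose[OF measurable_fst measurable_B[OF x, of "real i / real (Suc n)"]] by simp
  qed measurable
next
  fix p assume "p \<in> space (W x \<Otimes>\<^sub>M (borel :: real measure))"
  then have "fst p \<in> space (W x)" by (auto simp: space_pair_measure)
  then show "(\<lambda>n. B (grid n (max 0 (snd p))) (fst p)) \<longlonglongrightarrow> B (max 0 (snd p)) (fst p)"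
    by (intro path_tendsto[OF x] grid_tendsto grid_bounds) auto
qed

lemma AE_position_eq_increments:
  assumes x: "x \<in> D"
  shows "AE \<omega> in W x. \<forall>l. B (h * real l) \<omega> = x + (\<Sum>k<l. B (h * real (Suc k)) \<omega> - B (h * real k) \<omega>)"
  using start[OF x]
proof eventually_elim
  case (elim \<omega>)
  show ?case
  proof
    fix l
    show "B (h * real l) \<omega> = x + (\<Sum>k<l. B (h * real (Suc k)) \<omega> - B (h * real k) \<omega>)"
      using sum_lessThan_telescope[of "\<lambda>k. B (h * real k) \<omega>" l] elim by simp
  qed
qed

text \<open>The discrete Markov property on the grid of mesh \<open>h\<close>: the increment after time \<open>i h\<close> is
  independent of the positions up to that time, so it can be integrated out first.\<close>

lemma grid_markov:
  fixes f :: "'a \<Rightarrow> real"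
  assumes x: "x \<in> D" and h: "0 < h" and K [measurable]: "K \<in> sets borel"
    and f [measurable]: "f \<in> borel_measurable borel" and bd: "\<And>y. \<bar>f y\<bar> \<le> C"
  shows "(\<integral>\<omega>. indicator {\<omega>. \<forall>l\<le>i. B (h * real l) \<omega> \<in> K} \<omega> * f (B (h * real (Suc i)) \<omega>) \<partial>W x)
    = (\<integral>\<omega>. indicator {\<omega>. \<forall>l\<le>i. B (h * real l) \<omega> \<in> K} \<omega> * (\<integral>v. f (B (h * real i) \<omega> + v) \<partial>gauss h) \<partial>W x)"
proof -
  interpret prob_space "W x" by (rule prob_space_W[OF x])
  interpret G: prob_space "gauss h :: 'a measure" by (rule prob_space_gauss[OF h])
  define \<Delta> where "\<Delta> k \<omega> = B (h * real (Suc k)) \<omega> - B (h * real k) \<omega>" for k \<omega>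
  have Bm [measurable]: "B (h * real l) \<in> borel_measurable (W x)" for l
    using measurable_B[OF x] h by simp
  have ind: "indep_vars (\<lambda>_. borel) \<Delta> UNIV"
    unfolding \<Delta>_def
    using independent_increments[OF x, of "\<lambda>k. h * real k"] h
    by (auto simp: incseq_def mult_left_mono)
  let ?P = "\<Pi>\<^sub>M k\<in>{..<i}. (borel :: 'a measure)"
  let ?Q = "\<Pi>\<^sub>M k\<in>{i}. (borel :: 'a measure)"
  define now where "now \<omega> = restrict (\<lambda>k. \<Delta> k \<omega>) {i}" for \<omega>
  define past where "past \<omega> = restrict (\<lambda>k. \<Delta> k \<omega>) {..<i}" for \<omega>
  have "indep_var (PiM {..<i} (\<lambda>_. borel)) (\<lambda>\<omega>. restrict (\<lambda>i. \<Delta> i \<omega>) {..<i})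
       (PiM {i} (\<lambda>_. borel)) (\<lambda>\<omega>. restrict (\<lambda>i. \<Delta> i \<omega>) {i})"
    by (rule indep_var_restrict[OF ind]) auto
  then have iv: "indep_var ?P past ?Q now"
    by (simp add: past_def[abs_def] now_def[abs_def])
  have pm [measurable]: "past \<in> measurable (W x) ?P" by (rule indep_var_rv1[OF iv])
  have nm [measurable]: "now \<in> measurable (W x) ?Q" by (rule indep_var_rv2[OF iv])
  have dm [measurable]: "\<Delta> i \<in> borel_measurable (W x)" unfolding \<Delta>_def[abs_def] by measurable
  have pair: "distr (W x) (?P \<Otimes>\<^sub>M ?Q) (\<lambda>\<omega>. (past \<omega>, now \<omega>)) = distr (W x) ?P past \<Otimes>\<^sub>M distr (W x) ?Q now"
    using iv unfolding indep_var_distribution_eq by simp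
  have dist_\<Delta>: "distr (W x) borel (\<Delta> i) = gauss h"
    using distr_increment[OF x, of "h * real i" "h * real (Suc i)"] h
    by (simp add: \<Delta>_def[abs_def] algebra_simps)
  \<comment> \<open>the position after \<open>l\<close> steps as a function of the increments\<close>
  define pos where "pos l g = x + (\<Sum>k<l. g k)" for l and g :: "nat \<Rightarrow> 'a"
  define G where "G g v = indicator {g. \<forall>l\<le>i. pos l g \<in> K} g * f (pos i g + v)" for g v
  have pos_m [measurable]: "pos l \<in> measurable ?P borel" if "l \<le> i" for l
    unfolding pos_def using that
    by (intro borel_measurable_add borel_measurable_const borel_measurable_sum measurable_component_singleton) auto
  have ind_m [measurable]: "(\<lambda>g. indicator {g. \<forall>l\<le>i. pos l g \<in> K} g :: real) \<in> borel_measurable ?P"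
  proof -
    have "(\<lambda>g. indicator {g. \<forall>l\<le>i. pos l g \<in> K} g :: real) = (\<lambda>g. \<Prod>l\<le>i. indicator K (pos l g))"
      by (auto simp: fun_eq_iff indicator_def split: if_splits intro!: prod.neutral)
    then show ?thesis by simp
  qed
  have pos_i [measurable]: "pos i \<in> measurable ?P borel" by (rule pos_m) simp
  have Gm [measurable]: "(\<lambda>(g, v). G g v) \<in> borel_measurable (?P \<Otimes>\<^sub>M borel)"
    unfolding G_def by measurable
  have Gbd: "\<bar>G g v\<bar> \<le> C" for g v
    using bd[of "pos i g + v"] bd[of 0] by (auto simp: G_def indicator_def)
  have AE_pos: "AE \<omega> in W x. \<forall>l\<le>i. B (h * real l) \<omega> = pos l (past \<omega>)"
    using AE_position_eq_increments[OF x, of h]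
  proof eventually_elim
    case (elim \<omega>)
    show ?case
    proof (intro allI impI)
      fix l assume "l \<le> i"
      then have "pos l (past \<omega>) = x + (\<Sum>k<l. \<Delta> k \<omega>)"
        unfolding pos_def past_def by (intro arg_cong2[of _ _ _ _ "(+)"] refl sum.cong) auto
      then show "B (h * real l) \<omega> = pos l (past \<omega>)"
        using spec[OF elim, of l] by (simp only: \<Delta>_def)
    qed
  qed
  have AE_G: "AE \<omega> in W x. indicator {\<omega>. \<forall>l\<le>i. B (h * real l) \<omega> \<in> K} \<omega> * f (B (h * real i) \<omega> + v \<omega>)
      = G (past \<omega>) (v \<omega>)" for v
    using AE_pos by eventually_elim (auto simp: G_def indicator_def)
  have "(\<integral>\<omega>. indicator {\<omega>. \<forall>l\<le>i. B (h * real l) \<omega> \<in> K} \<omega> * f (B (h * real (Suc i)) \<omega>) \<partial>W x)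
      = (\<integral>\<omega>. G (past \<omega>) (\<Delta> i \<omega>) \<partial>W x)"
  proof (rule integral_cong_AE)
    show "AE \<omega> in W x. indicator {\<omega>. \<forall>l\<le>i. B (h * real l) \<omega> \<in> K} \<omega> * f (B (h * real (Suc i)) \<omega>) = G (past \<omega>) (\<Delta> i \<omega>)"
      using AE_G[of "\<Delta> i"] by (simp add: \<Delta>_def)
  qed measurable
  also have "\<dots> = (\<integral>p. G (fst p) (snd p i) \<partial>distr (W x) (?P \<Otimes>\<^sub>M ?Q) (\<lambda>\<omega>. (past \<omega>, now \<omega>)))"
  proof -
    have "(\<integral>p. G (fst p) (snd p i) \<partial>distr (W x) (?P \<Otimes>\<^sub>M ?Q) (\<lambda>\<omega>. (past \<omega>, now \<omega>)))
      = (\<integral>\<omega>. G (fst (past \<omega>, now \<omega>)) (snd (past \<omega>, now \<omega>) i) \<partial>W x)"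
      by (rule integral_distr) measurable
    then show ?thesis by (simp add: now_def)
  qed
  also have "\<dots> = (\<integral>p. G (fst p) (snd p i) \<partial>(distr (W x) ?P past \<Otimes>\<^sub>M distr (W x) ?Q now))"
    by (simp only: pair)
  also have "\<dots> = (\<integral>g. (\<integral>v. G g v \<partial>gauss h) \<partial>distr (W x) ?P past)"
  proof -
    interpret D: prob_space "distr (W x) ?P past" by (rule prob_space_distr) simp
    interpret E: prob_space "distr (W x) ?Q now" by (rule prob_space_distr) simp
    interpret DE: pair_prob_space "distr (W x) ?P past" "distr (W x) ?Q now" ..
    have "integrable (distr (W x) ?P past \<Otimes>\<^sub>M distr (W x) ?Q now) (\<lambda>p. G (fst p) (snd p i))"
      by (rule DE.P.integrable_const_bound[where B=C]) (use Gbd in auto)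
    from DE.integral_fst'[OF this]
    have "(\<integral>p. G (fst p) (snd p i) \<partial>(distr (W x) ?P past \<Otimes>\<^sub>M distr (W x) ?Q now))
       = (\<integral>g. (\<integral>s. G g (s i) \<partial>distr (W x) ?Q now) \<partial>distr (W x) ?P past)" by simp
    also have "\<dots> = (\<integral>g. (\<integral>v. G g v \<partial>gauss h) \<partial>distr (W x) ?P past)"
    proof (rule Bochner_Integration.integral_cong[OF refl])
      fix g assume "g \<in> space (distr (W x) ?P past)"
      then have g: "g \<in> space ?P" by simp
      have Gg [measurable]: "G g \<in> borel_measurable borel"
        using measurable_compose[OF measurable_Pair1'[OF g] Gm] by simp
      have "(\<integral>s. G g (s i) \<partial>distr (W x) ?Q now) = (\<integral>\<omega>. G g (now \<omega> i) \<partial>W x)"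
        by (rule integral_distr) measurable
      also have "\<dots> = (\<integral>\<omega>. G g (\<Delta> i \<omega>) \<partial>W x)" by (simp add: now_def)
      also have "\<dots> = (\<integral>v. G g v \<partial>distr (W x) borel (\<Delta> i))"
        by (rule integral_distr[symmetric]) measurable
      finally show "(\<integral>s. G g (s i) \<partial>distr (W x) ?Q now) = (\<integral>v. G g v \<partial>gauss h)" by (simp add: dist_\<Delta>)
    qed
    finally show ?thesis .
  qed
  also have "\<dots> = (\<integral>\<omega>. (\<integral>v. G (past \<omega>) v \<partial>gauss h) \<partial>W x)"
    by (subst integral_distr) auto
  also have "\<dots> = (\<integral>\<omega>. indicator {\<omega>. \<forall>l\<le>i. B (h * real l) \<omega> \<in> K} \<omega> * (\<integral>v. f (B (h * real i) \<omega> + v) \<partial>gauss h) \<partial>W x)"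
  proof (rule integral_cong_AE)
    show "AE \<omega> in W x. (\<integral>v. G (past \<omega>) v \<partial>gauss h)
       = indicator {\<omega>. \<forall>l\<le>i. B (h * real l) \<omega> \<in> K} \<omega> * (\<integral>v. f (B (h * real i) \<omega> + v) \<partial>gauss h)"
      using AE_pos by eventually_elim (auto simp: G_def indicator_def)
  qed measurable
  finally show ?thesis .
qed

end

locale killed_brownian_motion = brownian_motion D W B
  for D :: "'a::euclidean_space set" and W :: "'a \<Rightarrow> 'v measure" and B :: "real \<Rightarrow> 'v \<Rightarrow> 'a" +
  assumes open_D: "open D" and bounded_D: "bounded D"
begin

lemma D_neq_UNIV: "D \<noteq> UNIV" and compl_D_ne: "- D \<noteq> {}"
proof -
  show "D \<noteq> UNIV" using bounded_D not_bounded_UNIV by auto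
  then show "- D \<noteq> {}" by auto
qed

lemma borel_D [measurable]: "D \<in> sets borel"
  using open_D by simp

text \<open>An exhaustion of \<open>D\<close> by closed sets. On closed sets, survival is a limit of survival on grids.\<close>

definition core :: "nat \<Rightarrow> 'a set" where
  "core m = {y. 1 / real (Suc m) \<le> infdist y (- D)}"

lemma closed_core: "closed (core m)"
  unfolding core_def by (intro closed_Collect_le continuous_intros)

lemma core_subset: "core m \<subseteq> D"
proof
  fix y assume "y \<in> core m"
  moreover have "0 < 1 / real (Suc m)" by simp
  ultimately have "0 < infdist y (- D)" unfolding core_def by (metis mem_Collect_eq less_le_trans)
  then show "y \<in> D" by (cases "y \<in> D") (auto simp: infdist_zero)
qed

lemma borel_core [measurable]: "core m \<in> sets borel"
  using closed_core by simp

lemma core_mono: "m \<le> n \<Longrightarrow> core m \<subseteq> core n"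
  unfolding core_def using order_trans[OF frac_le[of 1 1 "real (Suc m)" "real (Suc n)"]] by auto

lemma compact_in_core:
  assumes "compact S" "S \<subseteq> D"
  obtains m where "S \<subseteq> core m"
proof (cases "S = {}")
  case True then show ?thesis using that by blast
next
  case False
  then obtain s where s: "s \<in> S" "\<And>y. y \<in> S \<Longrightarrow> infdist s (- D) \<le> infdist y (- D)"
    using continuous_attains_inf[OF assms(1) False continuous_on_infdist[OF continuous_on_id], of "- D"] by blast
  have "infdist s (- D) \<noteq> 0"
    using in_closed_iff_infdist_zero[of "- D" s] open_D compl_D_ne s(1) assms(2) by auto
  then have "0 < infdist s (- D)" using infdist_nonneg[of s "- D"] by linarith
  then obtain m where "1 / real (Suc m) < infdist s (- D)" using nat_approx_posE by blast
  then have "1 / real (Suc m) \<le> infdist y (- D)" if "y \<in> S" for y using s(2)[OF that] by linarith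
  then have "S \<subseteq> core m" unfolding core_def by blast
  then show ?thesis using that by blast
qed

definition alive :: "'a set \<Rightarrow> real \<Rightarrow> 'v \<Rightarrow> bool" where
  "alive K t \<omega> \<longleftrightarrow> (\<forall>s. 0 \<le> s \<and> s \<le> t \<longrightarrow> B s \<omega> \<in> K)"

lemma aliveD: "alive K t \<omega> \<Longrightarrow> 0 \<le> s \<Longrightarrow> s \<le> t \<Longrightarrow> B s \<omega> \<in> K"
  by (auto simp: alive_def)

lemma alive_mono: "alive K t \<omega> \<Longrightarrow> K \<subseteq> K' \<Longrightarrow> alive K' t \<omega>"
  unfolding alive_def by blast

abbreviation (input) "\<zeta> \<equiv> exit_time D B"

lemma exit_time_cases:
  assumes "x \<in> D" "\<omega> \<in> space (W x)"
  obtains (never) "\<zeta> \<omega> = \<infinity>" "\<And>s. 0 \<le> s \<Longrightarrow> B s \<omega> \<in> D"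
  | (exits) z where "0 \<le> z" "\<zeta> \<omega> = ereal z" "B z \<omega> \<notin> D" "\<And>s. 0 \<le> s \<Longrightarrow> s < z \<Longrightarrow> B s \<omega> \<in> D"
proof -
  let ?E = "{t. 0 \<le> t \<and> B t \<omega> \<notin> D}"
  have "closed ({0..} \<inter> (\<lambda>t. B t \<omega>) -` (- D))"
    by (rule continuous_closed_preimage[OF continuous_paths[OF assms]]) (use open_D in auto)
  moreover have "{0..} \<inter> (\<lambda>t. B t \<omega>) -` (- D) = ?E" by auto
  ultimately have cl: "closed ?E" by simp
  show ?thesis
  proof (cases "?E = {}")
    case True
    then have "\<zeta> \<omega> = \<infinity>" unfolding exit_time_def by (simp only: image_empty Inf_empty top_ereal_def)
    with True never show ?thesis by blast
  next
    case False
    define z where "z = Inf ?E"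
    have bdd: "bdd_below ?E" by (rule bdd_belowI[of _ 0]) auto
    have z: "z \<in> ?E" unfolding z_def by (rule closed_contains_Inf[OF False bdd cl])
    have le: "z \<le> s" if "s \<in> ?E" for s unfolding z_def by (rule cInf_lower[OF that bdd])
    have "\<zeta> \<omega> = ereal z" unfolding exit_time_def
      by (rule antisym) (use z le in \<open>auto intro!: INF_greatest INF_lower2\<close>)
    then show ?thesis using z le by (intro exits[of z]) force+
  qed
qed

lemma less_exit_time_iff:
  assumes "x \<in> D" "\<omega> \<in> space (W x)" "0 \<le> t"
  shows "ereal t < \<zeta> \<omega> \<longleftrightarrow> alive D t \<omega>"
  using assms(1,2)
proof (cases rule: exit_time_cases)
  case never
  then show ?thesis by (simp add: alive_def)
next
  case (exits z)
  show ?thesis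
  proof
    assume "ereal t < \<zeta> \<omega>" then show "alive D t \<omega>" using exits by (auto simp: alive_def)
  next
    assume *: "alive D t \<omega>"
    have "\<not> z \<le> t" using * exits(1,3) by (auto simp: alive_def)
    then show "ereal t < \<zeta> \<omega>" using exits(2) by simp
  qed
qed

text \<open>The path up to time \<open>t\<close> is compact, so if it stays in the open set \<open>D\<close> it keeps a positive
  distance from the complement.\<close>

lemma alive_core_iff:
  assumes "x \<in> D" "\<omega> \<in> space (W x)" 
  shows "alive D t \<omega> \<longleftrightarrow> (\<exists>m. alive (core m) t \<omega>)"
proof
  assume *: "alive D t \<omega>"
  have "compact ((\<lambda>s. B s \<omega>) ` {0..t})"
    by (intro compact_continuous_image continuous_on_subset[OF continuous_paths[OF assms]]) auto
  moreover have "(\<lambda>s. B s \<omega>) ` {0..t} \<subseteq> D" using * by (auto simp: alive_def)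
  ultimately obtain m where m: "(\<lambda>s. B s \<omega>) ` {0..t} \<subseteq> core m" by (rule compact_in_core)
  have "alive (core m) t \<omega>" unfolding alive_def
  proof (intro allI impI)
    fix s assume "0 \<le> s \<and> s \<le> t"
    then have "B s \<omega> \<in> (\<lambda>s. B s \<omega>) ` {0..t}" by auto
    then show "B s \<omega> \<in> core m" using m by blast
  qed
  then show "\<exists>m. alive (core m) t \<omega>" ..
next
  assume "\<exists>m. alive (core m) t \<omega>"
  then obtain m where m: "alive (core m) t \<omega>" ..
  show "alive D t \<omega>" unfolding alive_def
  proof (intro allI impI)
    fix s assume "0 \<le> s \<and> s \<le> t"
    then have "B s \<omega> \<in> core m" using aliveD[OF m] by simp
    then show "B s \<omega> \<in> D" by (rule subsetD[OF core_subset])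
  qed
qed

lemma alive_core_tendsto:
  assumes "x \<in> D" "\<omega> \<in> space (W x)" 
  shows "(\<lambda>m. indicator {\<omega>. alive (core m) t \<omega>} \<omega> :: real) \<longlonglongrightarrow> indicator {\<omega>. alive D t \<omega>} \<omega>"
proof (rule tendsto_eventually)
  show "\<forall>\<^sub>F m in sequentially. (indicator {\<omega>. alive (core m) t \<omega>} \<omega> :: real) = indicator {\<omega>. alive D t \<omega>} \<omega>"
  proof (cases "alive D t \<omega>")
    case True
    then obtain m where "alive (core m) t \<omega>" using alive_core_iff[OF assms] by blast
    then have "alive (core n) t \<omega>" if "m \<le> n" for n
      using alive_mono core_mono[OF that] by blast
    then show ?thesis using True by (intro eventually_sequentiallyI[of m]) (simp add: indicator_def)
  next
    case False
    then have "\<not> alive (core m) t \<omega>" for m using alive_core_iff[OF assms] by blast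
    with False show ?thesis by (simp add: indicator_def)
  qed
qed

text \<open>The grid divides \<open>[0, t]\<close> into \<open>n + 1\<close> steps, of which only the first \<open>i\<close> are tested, so that grids of the
  same mesh can be followed through all intermediate times.\<close>

definition grid_alive :: "'a set \<Rightarrow> real \<Rightarrow> nat \<Rightarrow> nat \<Rightarrow> 'v \<Rightarrow> bool" where
  "grid_alive K t n i \<omega> \<longleftrightarrow> (\<forall>l\<le>i. B (t / real (Suc n) * real l) \<omega> \<in> K)"

lemma alive_imp_grid_alive:
  assumes "alive K s \<omega>" "t / real (Suc n) * real i \<le> s" "0 \<le> t"
  shows "grid_alive K t n i \<omega>"
  unfolding grid_alive_def
proof (intro allI impI)
  fix l assume "l \<le> i"
  then have "t / real (Suc n) * real l \<le> t / real (Suc n) * real i"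
    using assms(3) by (intro mult_left_mono) auto
  then show "B (t / real (Suc n) * real l) \<omega> \<in> K"
    using assms by (intro aliveD[OF assms(1)]) auto
qed

lemma grid_time: "t / real (Suc n) * real (nat \<lfloor>s / t * real (Suc n)\<rfloor>) = t * grid n (s / t)"
  by (simp add: grid_def)

lemma grid_time_tendsto:
  assumes "0 < t" "0 \<le> s"
  shows "(\<lambda>n. t * grid n (s / t)) \<longlonglongrightarrow> s"
  using tendsto_mult[OF tendsto_const grid_tendsto[of "s / t"], of t] assms by simp

text \<open>For closed \<open>K\<close>, a path that leaves \<open>K\<close> stays outside for some time, and a fine grid
  notices it.\<close>

lemma grid_alive_tendsto:
  assumes "x \<in> D" "\<omega> \<in> space (W x)" "closed K" and t: "0 < t" and s: "0 \<le> s"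
  shows "(\<lambda>n. indicator {\<omega>. grid_alive K t n (nat \<lfloor>s / t * real (Suc n)\<rfloor>) \<omega>} \<omega> :: real)
     \<longlonglongrightarrow> indicator {\<omega>. alive K s \<omega>} \<omega>"
proof (rule tendsto_eventually)
  have le_s: "t * grid n (s / t) \<le> s" for n
    using mult_left_mono[OF grid_bounds(2)[of "s / t" n], of t] s t by simp
  show "\<forall>\<^sub>F n in sequentially. (indicator {\<omega>. grid_alive K t n (nat \<lfloor>s / t * real (Suc n)\<rfloor>) \<omega>} \<omega> :: real)
     = indicator {\<omega>. alive K s \<omega>} \<omega>"
  proof (cases "alive K s \<omega>")
    case True
    then have "grid_alive K t n (nat \<lfloor>s / t * real (Suc n)\<rfloor>) \<omega>" for n
      using le_s t by (intro alive_imp_grid_alive[OF True]) (auto simp only: grid_time less_imp_le)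
    with True show ?thesis by simp
  next
    case False
    then obtain r where r: "0 \<le> r" "r \<le> s" "B r \<omega> \<in> - K" by (auto simp: alive_def)
    have "(\<lambda>n. B (t * grid n (r / t)) \<omega>) \<longlonglongrightarrow> B r \<omega>"
      using assms r t by (intro path_tendsto[OF assms(1,2)] grid_time_tendsto mult_nonneg_nonneg grid_bounds) auto
    then have "\<forall>\<^sub>F n in sequentially. B (t * grid n (r / t)) \<omega> \<in> - K"
      by (rule topological_tendstoD) (use r(3) assms(3) in auto)
    then have "\<forall>\<^sub>F n in sequentially. \<not> grid_alive K t n (nat \<lfloor>s / t * real (Suc n)\<rfloor>) \<omega>"
    proof eventually_elim
      case (elim n)
      have "nat \<lfloor>r / t * real (Suc n)\<rfloor> \<le> nat \<lfloor>s / t * real (Suc n)\<rfloor>"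
        using r t by (intro nat_mono floor_mono mult_right_mono divide_right_mono) auto
      then show ?case using elim unfolding grid_alive_def grid_time[symmetric] by blast
    qed
    with False show ?thesis by (auto elim: eventually_mono)
  qed
qed

lemma pred_grid_alive:
  assumes x: "x \<in> D" and [measurable]: "K \<in> sets borel" and t: "0 \<le> t"
  shows "Measurable.pred (W x) (grid_alive K t n i)"
proof -
  have [measurable]: "B (t / real (Suc n) * real l) \<in> borel_measurable (W x)" for l
    using measurable_B[OF x] t by simp
  show ?thesis unfolding grid_alive_def[abs_def] by measurable
qed

lemma alive_grid_iff:
  assumes "x \<in> D" "\<omega> \<in> space (W x)" "closed K" "0 < t"
  shows "alive K t \<omega> \<longleftrightarrow> (\<forall>n. grid_alive K t n (Suc n) \<omega>)"
proof
  assume "alive K t \<omega>"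
  then show "\<forall>n. grid_alive K t n (Suc n) \<omega>"
    using assms(4) by (auto intro!: alive_imp_grid_alive simp del: of_nat_Suc)
next
  assume *: "\<forall>n. grid_alive K t n (Suc n) \<omega>"
  have "nat \<lfloor>t / t * real (Suc n)\<rfloor> = Suc n" for n
    using assms(4) by (simp del: of_nat_Suc)
  then have "(\<lambda>n. 1 :: real) \<longlonglongrightarrow> indicator {\<omega>. alive K t \<omega>} \<omega>"
    using grid_alive_tendsto[OF assms(1-4), of t] assms(4) * by (simp del: of_nat_Suc)
  then have "indicator {\<omega>. alive K t \<omega>} \<omega> = (1::real)"
    using LIMSEQ_unique tendsto_const by blast
  then show "alive K t \<omega>" by (simp add: indicator_def split: if_splits)
qed

lemma pred_alive_closed:
  assumes x: "x \<in> D" and K: "closed K"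
  shows "Measurable.pred (W x) (alive K t)"
proof -
  consider "0 < t" | "t = 0" | "t < 0" by linarith
  then show ?thesis
  proof cases
    case 1
    have [measurable]: "Measurable.pred (W x) (grid_alive K t n i)" for n i
      using pred_grid_alive[OF x, of K t n i] K 1 by simp
    have "Measurable.pred (W x) (\<lambda>\<omega>. \<forall>n. grid_alive K t n (Suc n) \<omega>)" by measurable
    moreover have "Measurable.pred (W x) (alive K t) \<longleftrightarrow> Measurable.pred (W x) (\<lambda>\<omega>. \<forall>n. grid_alive K t n (Suc n) \<omega>)"
      by (rule measurable_cong) (rule alive_grid_iff[OF x _ K 1])
    ultimately show ?thesis by blast
  next
    case 2
    have [measurable]: "B 0 \<in> borel_measurable (W x)" using measurable_B[OF x] by simp
    have [measurable]: "K \<in> sets borel" using K by simp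
    have eq: "alive K t = (\<lambda>\<omega>. B 0 \<omega> \<in> K)" unfolding alive_def[abs_def] 2 by (auto simp: fun_eq_iff)
    show ?thesis unfolding eq by measurable
  next
    case 3
    then have "alive K t = (\<lambda>\<omega>. True)" unfolding alive_def[abs_def] by auto
    then show ?thesis by simp
  qed
qed

lemma pred_alive:
  assumes x: "x \<in> D"
  shows "Measurable.pred (W x) (alive D t)"
proof -
  have [measurable]: "Measurable.pred (W x) (alive (core m) t)" for m
    by (rule pred_alive_closed[OF x closed_core])
  have "Measurable.pred (W x) (\<lambda>\<omega>. \<exists>m. alive (core m) t \<omega>)" by measurable
  moreover have "Measurable.pred (W x) (alive D t) \<longleftrightarrow> Measurable.pred (W x) (\<lambda>\<omega>. \<exists>m. alive (core m) t \<omega>)"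
    by (rule measurable_cong) (rule alive_core_iff[OF x])
  ultimately show ?thesis by blast
qed

lemma measurable_exit_time:
  assumes x: "x \<in> D"
  shows "\<zeta> \<in> borel_measurable (W x)"
proof (rule borel_measurableI_greater)
  fix y :: ereal
  have nonneg: "0 \<le> \<zeta> \<omega>" for \<omega>
    unfolding exit_time_def by (auto intro!: INF_greatest)
  consider "y < 0" | "y = \<infinity>" | t where "y = ereal t" "0 \<le> t"
  proof (cases y)
    case (real r)
    then show ?thesis using that(1) that(3)[of r] by (cases "r < 0") (simp_all add: zero_ereal_def)
  next
    case PInf then show ?thesis using that(2) by blast
  next
    case MInf then show ?thesis using that(1) by simp
  qed
  then show "{\<omega> \<in> space (W x). y < \<zeta> \<omega>} \<in> sets (W x)"
  proof cases
    case 1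
    then have "{\<omega> \<in> space (W x). y < \<zeta> \<omega>} = space (W x)" using nonneg by (auto intro: less_le_trans)
    then show ?thesis by simp
  next
    case 2
    then show ?thesis by simp
  next
    case 3
    have "{\<omega> \<in> space (W x). y < \<zeta> \<omega>} = {\<omega> \<in> space (W x). alive D t \<omega>}"
      using less_exit_time_iff[OF x _ 3(2)] 3(1) by auto
    then show ?thesis using pred_alive[OF x, of t] by (simp add: pred_def)
  qed
qed

end

section \<open>Green measure and exit distribution\<close>

context killed_brownian_motion
begin

lemma exit_time_nonneg: "0 \<le> exit_time D B \<omega>"
  unfolding exit_time_def by (auto intro!: INF_greatest)

definition lifetime_set :: "('v \<times> real) set" where
  "lifetime_set = {p. 0 \<le> snd p \<and> ereal (snd p) < exit_time D B (fst p)}"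

text \<open>Occupation measure of the killed path, \<open>green x A\<close> being the expected time spent in \<open>A\<close>
  before the exit from \<open>D\<close>. The processes have no meaning at negative times, which \<open>lifetime_set\<close> excludes; \<open>max 0\<close>
  only serves measurability.\<close>

definition green :: "'a \<Rightarrow> 'a measure" where
  "green x = distr (density (W x \<Otimes>\<^sub>M lborel) (indicator lifetime_set)) borel (\<lambda>p. B (max 0 (snd p)) (fst p))"

text \<open>On the null event that the path never leaves \<open>D\<close>, the default value is its position at time \<open>0\<close>.\<close>

definition exit_law :: "'a \<Rightarrow> 'a measure" where
  "exit_law x = distr (W x) borel (\<lambda>\<omega>. B (real_of_ereal (exit_time D B \<omega>)) \<omega>)"

lemma sets_green [simp, measurable_cong]: "sets (green x) = sets borel"
  and space_green [simp]: "space (green x) = UNIV"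
  by (simp_all add: green_def)

lemma sets_exit_law [simp, measurable_cong]: "sets (exit_law x) = sets borel"
  and space_exit_law [simp]: "space (exit_law x) = UNIV"
  by (simp_all add: exit_law_def)

lemma measurable_B_lborel:
  assumes x: "x \<in> D"
  shows "(\<lambda>p. B (max 0 (snd p)) (fst p)) \<in> borel_measurable (W x \<Otimes>\<^sub>M lborel)"
  using measurable_B_joint[OF x]
  by (subst measurable_cong_sets[OF sets_pair_measure_cong[OF refl sets_lborel] refl])

lemma sets_lifetime_set:
  assumes x: "x \<in> D"
  shows "lifetime_set \<inter> space (W x \<Otimes>\<^sub>M lborel) \<in> sets (W x \<Otimes>\<^sub>M lborel)"
proof -
  have [measurable]: "exit_time D B \<in> borel_measurable (W x)" by (rule measurable_exit_time[OF x])
  have "{p \<in> space (W x \<Otimes>\<^sub>M (borel :: real measure)). 0 \<le> snd p \<and> ereal (snd p) < exit_time D B (fst p)}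
      \<in> sets (W x \<Otimes>\<^sub>M borel)" by measurable
  moreover have "lifetime_set \<inter> space (W x \<Otimes>\<^sub>M lborel)
      = {p \<in> space (W x \<Otimes>\<^sub>M (borel :: real measure)). 0 \<le> snd p \<and> ereal (snd p) < exit_time D B (fst p)}"
    by (auto simp: lifetime_set_def space_pair_measure)
  moreover have "sets (W x \<Otimes>\<^sub>M (lborel :: real measure)) = sets (W x \<Otimes>\<^sub>M borel)"
    by (rule sets_pair_measure_cong) auto
  ultimately show ?thesis by simp
qed

lemma measurable_lifetime_indicator:
  assumes x: "x \<in> D"
  shows "(indicator lifetime_set :: _ \<Rightarrow> ennreal) \<in> borel_measurable (W x \<Otimes>\<^sub>M lborel)"
    and "(indicator lifetime_set :: _ \<Rightarrow> real) \<in> borel_measurable (W x \<Otimes>\<^sub>M lborel)"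
  using sets_lifetime_set[OF x] by (simp_all only: borel_measurable_indicator_iff)

lemma nn_integral_green:
  assumes x: "x \<in> D" and f [measurable]: "f \<in> borel_measurable borel"
  shows "(\<integral>\<^sup>+ y. f y \<partial>green x) = (\<integral>\<^sup>+ \<omega>. (\<integral>\<^sup>+ t. f (B t \<omega>)
     * indicator {t. 0 \<le> t \<and> ereal t < exit_time D B \<omega>} t \<partial>lborel) \<partial>W x)"
proof -
  note [measurable] = measurable_B_lborel[OF x] measurable_lifetime_indicator[OF x]
  have "(\<integral>\<^sup>+ y. f y \<partial>green x)
     = (\<integral>\<^sup>+ p. indicator lifetime_set p * f (B (max 0 (snd p)) (fst p)) \<partial>(W x \<Otimes>\<^sub>M lborel))"
    unfolding green_def by (subst nn_integral_distr) (auto intro!: nn_integral_density)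
  also have "\<dots> = (\<integral>\<^sup>+ \<omega>. (\<integral>\<^sup>+ t. indicator lifetime_set (\<omega>, t) * f (B (max 0 t) \<omega>) \<partial>lborel) \<partial>W x)"
    by (subst lborel.nn_integral_fst[symmetric]) auto
  also have "\<dots> = (\<integral>\<^sup>+ \<omega>. (\<integral>\<^sup>+ t. f (B t \<omega>)
     * indicator {t. 0 \<le> t \<and> ereal t < exit_time D B \<omega>} t \<partial>lborel) \<partial>W x)"
    by (intro nn_integral_cong) (auto simp: indicator_def lifetime_set_def)
  finally show ?thesis .
qed

lemma nn_integral_green_time:
  assumes x: "x \<in> D" and f [measurable]: "f \<in> borel_measurable borel"
  shows "(\<integral>\<^sup>+ y. f y \<partial>green x) = (\<integral>\<^sup>+ t. (\<integral>\<^sup>+ \<omega>. f (B t \<omega>) * indicator {\<omega>. alive D t \<omega>} \<omega> \<partial>W x)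
     * indicator {0..} t \<partial>lborel)"
proof -
  interpret W: prob_space "W x" by (rule prob_space_W[OF x])
  interpret WL: pair_sigma_finite "W x" "lborel :: real measure" ..
  note [measurable] = measurable_B_lborel[OF x] measurable_lifetime_indicator[OF x]
  have "(\<integral>\<^sup>+ y. f y \<partial>green x)
     = (\<integral>\<^sup>+ p. indicator lifetime_set p * f (B (max 0 (snd p)) (fst p)) \<partial>(W x \<Otimes>\<^sub>M lborel))"
    unfolding green_def by (subst nn_integral_distr) (auto intro!: nn_integral_density)
  also have "\<dots> = (\<integral>\<^sup>+ t. (\<integral>\<^sup>+ \<omega>. indicator lifetime_set (\<omega>, t) * f (B (max 0 t) \<omega>) \<partial>W x) \<partial>lborel)"
    by (subst WL.nn_integral_snd[symmetric]) auto
  also have "\<dots> = (\<integral>\<^sup>+ t. (\<integral>\<^sup>+ \<omega>. f (B t \<omega>) * indicator {\<omega>. alive D t \<omega>} \<omega> \<partial>W x)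
     * indicator {0..} t \<partial>lborel)"
  proof (rule nn_integral_cong)
    fix t :: real
    show "(\<integral>\<^sup>+ \<omega>. indicator lifetime_set (\<omega>, t) * f (B (max 0 t) \<omega>) \<partial>W x)
      = (\<integral>\<^sup>+ \<omega>. f (B t \<omega>) * indicator {\<omega>. alive D t \<omega>} \<omega> \<partial>W x) * indicator {0..} t"
    proof (cases "0 \<le> t")
      case True
      then show ?thesis using less_exit_time_iff[OF x]
        by (auto intro!: nn_integral_cong simp: lifetime_set_def indicator_def)
    qed (simp add: lifetime_set_def)
  qed
  finally show ?thesis .
qed

lemma AE_green_in_D:
  assumes x: "x \<in> D" shows "AE y in green x. y \<in> D"
proof -
  have "(\<integral>\<^sup>+ y. indicator (- D) y \<partial>green x) = (\<integral>\<^sup>+ \<omega>. 0 \<partial>W x)"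
    unfolding nn_integral_green[OF x borel_measurable_indicator[OF borel_comp[OF borel_D]]]
  proof (rule nn_integral_cong)
    fix \<omega> assume \<omega>: "\<omega> \<in> space (W x)"
    have "(\<integral>\<^sup>+ t. indicator (- D) (B t \<omega>) * indicator {t. 0 \<le> t \<and> ereal t < exit_time D B \<omega>} t \<partial>lborel)
      = (\<integral>\<^sup>+ t. 0 \<partial>(lborel :: real measure))"
      using less_exit_time_iff[OF x \<omega>] aliveD[of D _ \<omega>]
      by (intro nn_integral_cong) (auto simp: indicator_def)
    then show "(\<integral>\<^sup>+ t. indicator (- D) (B t \<omega>) * indicator {t. 0 \<le> t \<and> ereal t < exit_time D B \<omega>} t \<partial>lborel) = 0"
      by simp
  qed
  then have "emeasure (green x) (- D) = 0" by simp
  then show ?thesis by (intro AE_I[of _ _ "- D"]) auto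
qed

lemma distr_position:
  assumes x: "x \<in> D" and t: "0 < t" and f [measurable]: "f \<in> borel_measurable borel"
  shows "(\<integral>\<^sup>+ \<omega>. f (B t \<omega>) \<partial>W x) = (\<integral>\<^sup>+ y. ennreal (gauss_density t (y - x)) * f y \<partial>lborel)"
proof -
  have [measurable]: "B t \<in> borel_measurable (W x)" "B 0 \<in> borel_measurable (W x)"
    using measurable_B[OF x] t by auto
  have "(\<integral>\<^sup>+ \<omega>. f (B t \<omega>) \<partial>W x) = (\<integral>\<^sup>+ \<omega>. f (x + (B t \<omega> - B 0 \<omega>)) \<partial>W x)"
    by (rule nn_integral_cong_AE) (use start[OF x] in eventually_elim, simp)
  also have "\<dots> = (\<integral>\<^sup>+ v. f (x + v) \<partial>distr (W x) borel (\<lambda>\<omega>. B t \<omega> - B 0 \<omega>))"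
    by (subst nn_integral_distr) auto
  also have "\<dots> = (\<integral>\<^sup>+ v. f (x + v) \<partial>gauss t)"
    using distr_increment[OF x, of 0 t] t by simp
  also have "\<dots> = (\<integral>\<^sup>+ v. ennreal (gauss_density t v) * f (x + v) \<partial>lborel)"
    unfolding gauss_def by (subst nn_integral_density) auto
  also have "\<dots> = (\<integral>\<^sup>+ v. ennreal (gauss_density t ((x + v) - x)) * f (x + v) \<partial>lborel)"
    by simp
  also have "\<dots> = (\<integral>\<^sup>+ y. ennreal (gauss_density t (y - x)) * f y \<partial>distr lborel borel ((+) x))"
    by (subst nn_integral_distr) auto
  also have "distr lborel borel ((+) x) = lborel" by (rule lborel_distr_plus)
  finally show ?thesis .
qed

text \<open>Dropping the condition of survival, the position is Gaussian, and its density is at most that at the centre.\<close>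

lemma nn_integral_killed_le:
  assumes x: "x \<in> D" and t: "0 < t" and f [measurable]: "f \<in> borel_measurable borel"
  shows "(\<integral>\<^sup>+ \<omega>. f (B t \<omega>) * indicator {\<omega>. alive D t \<omega>} \<omega> \<partial>W x)
    \<le> ennreal ((1 / sqrt (2 * pi * t)) ^ DIM('a)) * (\<integral>\<^sup>+ y. f y * indicator D y \<partial>lborel)"
proof -
  have "(\<integral>\<^sup>+ \<omega>. f (B t \<omega>) * indicator {\<omega>. alive D t \<omega>} \<omega> \<partial>W x) \<le> (\<integral>\<^sup>+ \<omega>. f (B t \<omega>) * indicator D (B t \<omega>) \<partial>W x)"
    using t by (intro nn_integral_mono) (auto simp: indicator_def alive_def)
  also have "\<dots> = (\<integral>\<^sup>+ y. ennreal (gauss_density t (y - x)) * (f y * indicator D y) \<partial>lborel)"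
    by (rule distr_position[OF x t]) measurable
  also have "\<dots> \<le> (\<integral>\<^sup>+ y. ennreal ((1 / sqrt (2 * pi * t)) ^ DIM('a)) * (f y * indicator D y) \<partial>lborel)"
    by (intro nn_integral_mono mult_right_mono ennreal_leI gauss_density_le t) simp
  also have "\<dots> = ennreal ((1 / sqrt (2 * pi * t)) ^ DIM('a)) * (\<integral>\<^sup>+ y. f y * indicator D y \<partial>lborel)"
    by (rule nn_integral_cmult) measurable
  finally show ?thesis .
qed

text \<open>While the path stays in \<open>D\<close>, all its increments are bounded by the diameter of \<open>D\<close>. For a
  large time step each increment does so with probability at most \<open>1/2\<close>, independently.\<close>

lemma exit_time_geometric:
  obtains s where "0 < s" "\<And>x k. x \<in> D \<Longrightarrow> measure (W x) {\<omega> \<in> space (W x). alive D (s * real k) \<omega>} \<le> (1 / 2) ^ k"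
proof -
  obtain b where b: "0 < b" "\<And>y. y \<in> D \<Longrightarrow> norm y \<le> b" using bounded_D unfolding bounded_pos by blast
  define V where "V = measure lborel (cball (0::'a) (2 * b))"
  have V: "0 \<le> V" by (simp add: V_def)
  \<comment> \<open>for a time step \<open>s\<close> the density of an increment is at most \<open>1 / (2 V + 1)\<close>\<close>
  define s where "s = (2 * V + 1)^2"
  have s: "0 < s" using V by (simp add: s_def)
  have half: "measure (gauss s) (cball (0::'a) (2 * b)) \<le> 1 / 2"
  proof -
    interpret G: prob_space "gauss s :: 'a measure" by (rule prob_space_gauss[OF s])
    define p where "p = 1 / sqrt (2 * pi * s)"
    have sq: "2 * V + 1 \<le> sqrt (2 * pi * s)"
    proof -
      have "sqrt s \<le> sqrt (2 * pi * s)" using s pi_ge_two by (intro real_sqrt_le_mono) (simp add: mult_le_cancel_right1)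
      then show ?thesis using V by (simp add: s_def)
    qed
    have p: "0 \<le> p" "p \<le> 1 / (2 * V + 1)" "p \<le> 1"
    proof -
      show "0 \<le> p" using s by (simp add: p_def)
      show "p \<le> 1 / (2 * V + 1)" unfolding p_def using sq V by (intro frac_le) auto
      also have "1 / (2 * V + 1) \<le> 1" using V by simp
      finally show "p \<le> 1" .
    qed
    have pd: "p ^ DIM('a) \<le> 1 / (2 * V + 1)"
    proof -
      have "p ^ DIM('a) \<le> p ^ 1" using p by (intro power_decreasing) (auto simp: Suc_leI)
      then show ?thesis using p by simp
    qed
    have "emeasure (gauss s) (cball (0::'a) (2 * b)) = (\<integral>\<^sup>+ y. ennreal (gauss_density s y) * indicator (cball (0::'a) (2 * b)) y \<partial>lborel)"
      unfolding gauss_def by (rule emeasure_density) auto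
    also have "\<dots> \<le> (\<integral>\<^sup>+ y. ennreal (p ^ DIM('a)) * indicator (cball (0::'a) (2 * b)) y \<partial>lborel)"
      unfolding p_def by (intro nn_integral_mono mult_right_mono ennreal_leI gauss_density_le s) simp
    also have "\<dots> = ennreal (p ^ DIM('a)) * emeasure lborel (cball (0::'a) (2 * b))"
      by (rule nn_integral_cmult_indicator) simp
    also have "\<dots> = ennreal (p ^ DIM('a) * V)"
      unfolding V_def using p(1) by (subst emeasure_eq_ennreal_measure) (use emeasure_bounded_finite[of "cball (0::'a) (2 * b)"] in \<open>auto simp: ennreal_mult\<close>)
    finally have "measure (gauss s) (cball (0::'a) (2 * b)) \<le> p ^ DIM('a) * V"
      using p V by (simp add: G.emeasure_eq_measure)
    also have "\<dots> \<le> 1 / (2 * V + 1) * V" using pd V by (rule mult_right_mono)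
    also have "\<dots> \<le> 1 / 2" using V by (simp add: field_simps)
    finally show ?thesis .
  qed
  have "measure (W x) {\<omega> \<in> space (W x). alive D (s * real k) \<omega>} \<le> (1 / 2) ^ k" if x: "x \<in> D" for x k
  proof -
    interpret prob_space "W x" by (rule prob_space_W[OF x])
    define \<Delta> where "\<Delta> i \<omega> = B (s * real (Suc i)) \<omega> - B (s * real i) \<omega>" for i \<omega>
    have ind: "indep_vars (\<lambda>_. borel) \<Delta> UNIV"
      unfolding \<Delta>_def using independent_increments[OF x, of "\<lambda>i. s * real i"] s
      by (auto simp: incseq_def mult_left_mono)
    have Bm [measurable]: "B (s * real l) \<in> borel_measurable (W x)" for l
      using measurable_B[OF x] s by simp
    have dist_\<Delta>: "distr (W x) borel (\<Delta> i) = gauss s" for i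
      using distr_increment[OF x, of "s * real i" "s * real (Suc i)"] s
      by (simp add: \<Delta>_def[abs_def] algebra_simps)
    have \<Delta>m [measurable]: "\<Delta> i \<in> borel_measurable (W x)" for i
      unfolding \<Delta>_def[abs_def] by measurable
    have one: "prob (\<Delta> i -` cball 0 (2 * b) \<inter> space (W x)) \<le> 1 / 2" for i
    proof -
      have "measure (distr (W x) borel (\<Delta> i)) (cball 0 (2 * b)) = prob (\<Delta> i -` cball 0 (2 * b) \<inter> space (W x))"
        by (rule measure_distr) auto
      then show ?thesis using half by (simp add: dist_\<Delta>)
    qed
    show ?thesis
    proof (cases "k = 0")
      case True then show ?thesis by simp
    next
      case False
      have "{\<omega> \<in> space (W x). alive D (s * real k) \<omega>} \<subseteq> (\<Inter>i\<in>{..<k}. \<Delta> i -` cball 0 (2 * b) \<inter> space (W x))"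
      proof
        fix \<omega> assume \<omega>: "\<omega> \<in> {\<omega> \<in> space (W x). alive D (s * real k) \<omega>}"
        have "norm (\<Delta> i \<omega>) \<le> 2 * b" if "i < k" for i
        proof -
          have "B (s * real (Suc i)) \<omega> \<in> D" "B (s * real i) \<omega> \<in> D"
            using \<omega> that s by (auto intro!: aliveD mult_left_mono)
          then show ?thesis using b(2) norm_triangle_ineq4[of "B (s * real (Suc i)) \<omega>" "B (s * real i) \<omega>"]
            unfolding \<Delta>_def by (smt (verit))
        qed
        then show "\<omega> \<in> (\<Inter>i\<in>{..<k}. \<Delta> i -` cball 0 (2 * b) \<inter> space (W x))" using \<omega> by auto
      qed
      then have "prob {\<omega> \<in> space (W x). alive D (s * real k) \<omega>} \<le> prob (\<Inter>i\<in>{..<k}. \<Delta> i -` cball 0 (2 * b) \<inter> space (W x))"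
        by (rule finite_measure_mono) (use False in \<open>intro sets.finite_INT measurable_sets[OF \<Delta>m], auto\<close>)
      also have "\<dots> = (\<Prod>i\<in>{..<k}. prob (\<Delta> i -` cball 0 (2 * b) \<inter> space (W x)))"
        by (rule indep_varsD[OF ind]) (use False in auto)
      also have "\<dots> \<le> (\<Prod>i\<in>{..<k}. 1 / 2)" by (intro prod_mono) (use one in auto)
      finally show ?thesis by simp
    qed
  qed
  with s show ?thesis using that by blast
qed

text \<open>The geometric decay along multiples of a fixed time gives exponential decay, uniformly in the
  starting point.\<close>

lemma survival_bound:
  obtains \<beta> where "integrable lborel \<beta>" "\<And>t. 0 \<le> \<beta> t"
    "\<And>x t. x \<in> D \<Longrightarrow> 0 \<le> t \<Longrightarrow> measure (W x) {\<omega> \<in> space (W x). alive D t \<omega>} \<le> \<beta> t"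
proof -
  obtain s where s: "0 < s" and geo: "\<And>x k. x \<in> D \<Longrightarrow> measure (W x) {\<omega> \<in> space (W x). alive D (s * real k) \<omega>} \<le> (1 / 2) ^ k"
    using exit_time_geometric by blast
  define l where "l = ln 2 / s"
  have l: "0 < l" using s by (simp add: l_def)
  define \<beta> where "\<beta> t = 2 / l * exponential_density l t" for t
  have "integrable lborel (exponential_density l)"
  proof (rule integrableI_nonneg)
    interpret prob_space "density lborel (exponential_density l)" by (rule prob_space_exponential_density[OF l])
    have "(\<integral>\<^sup>+ t. ennreal (exponential_density l t) \<partial>lborel) = 1"
      using emeasure_space_1 by (simp add: emeasure_density)
    then show "(\<integral>\<^sup>+ t. ennreal (exponential_density l t) \<partial>lborel) < \<infinity>" by simp
  qed (use l in \<open>auto simp: exponential_density_def\<close>)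
  then have 1: "integrable lborel \<beta>" unfolding \<beta>_def by (rule integrable_mult_right)
  have 2: "0 \<le> \<beta> t" for t using l by (simp add: \<beta>_def exponential_density_def)
  have 3: "measure (W x) {\<omega> \<in> space (W x). alive D t \<omega>} \<le> \<beta> t" if x: "x \<in> D" and t: "0 \<le> t" for x t
  proof -
    interpret prob_space "W x" by (rule prob_space_W[OF x])
    define k where "k = nat \<lfloor>t / s\<rfloor>"
    have k: "real k \<le> t / s" "t / s \<le> real k + 1" using s t by (auto simp: k_def)
    have "prob {\<omega> \<in> space (W x). alive D t \<omega>} \<le> prob {\<omega> \<in> space (W x). alive D (s * real k) \<omega>}"
    proof (rule finite_measure_mono)
      have "s * real k \<le> t" using k(1) s by (simp add: pos_le_divide_eq mult.commute)
      then show "{\<omega> \<in> space (W x). alive D t \<omega>} \<subseteq> {\<omega> \<in> space (W x). alive D (s * real k) \<omega>}"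
        by (auto simp: alive_def)
      show "{\<omega> \<in> space (W x). alive D (s * real k) \<omega>} \<in> events"
        using pred_alive[OF x, of "s * real k"] by (simp add: pred_def)
    qed
    also have "\<dots> \<le> (1 / 2) ^ k" by (rule geo[OF x])
    also have "\<dots> = 2 * exp (- ln 2 * (real k + 1))"
    proof -
      have "exp (- ln 2 * (real k + 1)) = exp (real (Suc k) * - ln 2)" by (simp add: algebra_simps)
      also have "\<dots> = exp (- ln (2::real)) ^ Suc k" by (rule exp_of_nat_mult)
      also have "exp (- ln (2::real)) = 1 / 2" by (simp add: exp_minus)
      finally show ?thesis by simp
    qed
    also have "\<dots> \<le> 2 * exp (- ln 2 * (t / s))"
      using mult_left_mono[OF k(2), of "ln 2"] by simp
    also have "\<dots> = \<beta> t"
      using t l s by (simp add: \<beta>_def exponential_density_def) (simp add: l_def mult.commute)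
    finally show ?thesis .
  qed
  show ?thesis using that[OF 1 2 3] .
qed

lemma green_finite_mass:
  obtains C where "0 \<le> C" "\<And>x. x \<in> D \<Longrightarrow> emeasure (green x) UNIV \<le> ennreal C"
proof -
  obtain \<beta> where \<beta>: "integrable lborel \<beta>" "\<And>t. 0 \<le> \<beta> t"
    "\<And>x t. x \<in> D \<Longrightarrow> 0 \<le> t \<Longrightarrow> measure (W x) {\<omega> \<in> space (W x). alive D t \<omega>} \<le> \<beta> t"
    using survival_bound by blast
  have "emeasure (green x) UNIV \<le> ennreal (\<integral>t. \<beta> t \<partial>lborel)" if x: "x \<in> D" for x
  proof -
    interpret prob_space "W x" by (rule prob_space_W[OF x])
    have "emeasure (green x) UNIV = (\<integral>\<^sup>+ y. 1 \<partial>green x)" by simp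
    also have "\<dots> = (\<integral>\<^sup>+ t. (\<integral>\<^sup>+ \<omega>. 1 * indicator {\<omega>. alive D t \<omega>} \<omega> \<partial>W x) * indicator {0..} t \<partial>lborel)"
      by (rule nn_integral_green_time[OF x]) simp
    also have "\<dots> \<le> (\<integral>\<^sup>+ t. ennreal (\<beta> t) \<partial>lborel)"
    proof (rule nn_integral_mono)
      fix t :: real
      show "(\<integral>\<^sup>+ \<omega>. 1 * indicator {\<omega>. alive D t \<omega>} \<omega> \<partial>W x) * indicator {0..} t \<le> ennreal (\<beta> t)"
      proof (cases "0 \<le> t")
        case True
        have ev: "{\<omega> \<in> space (W x). alive D t \<omega>} \<in> events" using pred_alive[OF x, of t] by (simp add: pred_def)
        have "(\<integral>\<^sup>+ \<omega>. 1 * indicator {\<omega>. alive D t \<omega>} \<omega> \<partial>W x) = (\<integral>\<^sup>+ \<omega>. indicator {\<omega> \<in> space (W x). alive D t \<omega>} \<omega> \<partial>W x)"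
          by (intro nn_integral_cong) (auto simp: indicator_def)
        also have "\<dots> = ennreal (prob {\<omega> \<in> space (W x). alive D t \<omega>})" using ev by (simp add: emeasure_eq_measure)
        also have "\<dots> \<le> ennreal (\<beta> t)" by (intro ennreal_leI \<beta>(3) x True)
        finally show ?thesis using True by simp
      qed simp
    qed
    also have "\<dots> = ennreal (\<integral>t. \<beta> t \<partial>lborel)"
      using \<beta> by (intro nn_integral_eq_integral) auto
    finally show ?thesis .
  qed
  moreover have "0 \<le> (\<integral>t. \<beta> t \<partial>lborel)" using \<beta>(2) by simp
  ultimately show ?thesis using that by blast
qed

lemma finite_measure_green:
  assumes x: "x \<in> D" shows "finite_measure (green x)"
proof -
  obtain C where "emeasure (green x) UNIV \<le> ennreal C" using green_finite_mass x by metis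
  then have "emeasure (green x) (space (green x)) \<noteq> \<infinity>" by (auto simp: top_unique)
  then show ?thesis by (rule finite_measureI)
qed

lemma AE_exit_time_finite:
  assumes x: "x \<in> D" shows "AE \<omega> in W x. exit_time D B \<omega> < \<infinity>"
proof -
  interpret finite_measure "green x" by (rule finite_measure_green[OF x])
  note [measurable] = measurable_lifetime_indicator[OF x]
  have meas: "(\<lambda>\<omega>. \<integral>\<^sup>+ t. indicator lifetime_set (\<omega>, t) \<partial>lborel) \<in> borel_measurable (W x)"
    by (rule lborel.borel_measurable_nn_integral) simp
  have eq: "(\<integral>\<^sup>+ t. 1 * indicator {t. 0 \<le> t \<and> ereal t < exit_time D B \<omega>} t \<partial>lborel) = (\<integral>\<^sup>+ t. indicator lifetime_set (\<omega>, t) \<partial>lborel)" for \<omega>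
    by (intro nn_integral_cong) (auto simp: indicator_def lifetime_set_def)
  have "emeasure (green x) UNIV < \<top>" using emeasure_finite[of UNIV] top.not_eq_extremum by blast
  then have "(\<integral>\<^sup>+ y. 1 \<partial>green x) < \<infinity>" by simp
  then have "(\<integral>\<^sup>+ \<omega>. (\<integral>\<^sup>+ t. indicator lifetime_set (\<omega>, t) \<partial>lborel) \<partial>W x) \<noteq> \<infinity>"
    using nn_integral_green[OF x, of "\<lambda>_. 1"] unfolding eq by (simp add: less_top)
  from nn_integral_PInf_AE[OF meas this] show ?thesis
  proof eventually_elim
    case (elim \<omega>)
    show ?case
    proof (rule ccontr)
      assume "\<not> exit_time D B \<omega> < \<infinity>"
      then have "exit_time D B \<omega> = \<infinity>" by simp
      then have "(\<integral>\<^sup>+ t. indicator lifetime_set (\<omega>, t) \<partial>lborel) = (\<integral>\<^sup>+ t. indicator {0..} t \<partial>(lborel :: real measure))"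
        by (intro nn_integral_cong) (auto simp: indicator_def lifetime_set_def)
      also have "\<dots> = emeasure lborel {0::real..}" by simp
      finally have "emeasure lborel {0::real..} < \<infinity>" using elim by (simp add: less_top)
      then obtain n where n: "emeasure lborel {0::real..} < of_nat n"
        using ennreal_Ex_less_of_nat by auto
      have "of_nat n = emeasure lborel {0..real n}" by (simp add: ennreal_of_nat_eq_real_of_nat)
      also have "\<dots> \<le> emeasure lborel {0::real..}" by (rule emeasure_mono) auto
      finally show False using n by simp
    qed
  qed
qed

lemma measurable_exit_position:
  assumes x: "x \<in> D"
  shows "(\<lambda>\<omega>. B (real_of_ereal (exit_time D B \<omega>)) \<omega>) \<in> borel_measurable (W x)"
proof -
  have [measurable]: "exit_time D B \<in> borel_measurable (W x)" by (rule measurable_exit_time[OF x])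
  have "(\<lambda>\<omega>. (\<omega>, real_of_ereal (exit_time D B \<omega>))) \<in> measurable (W x) (W x \<Otimes>\<^sub>M borel)"
    by measurable
  from measurable_compose[OF this measurable_B_joint[OF x]]
  show ?thesis using exit_time_nonneg by (simp add: real_of_ereal_pos max_absorb2)
qed

lemma prob_space_exit_law:
  assumes x: "x \<in> D" shows "prob_space (exit_law x)"
  unfolding exit_law_def using measurable_exit_position[OF x]
  by (intro prob_space.prob_space_distr prob_space_W[OF x])

lemma exit_position_frontier:
  assumes x: "x \<in> D" and \<omega>: "\<omega> \<in> space (W x)" and "B 0 \<omega> \<in> D" and "exit_time D B \<omega> < \<infinity>"
  shows "B (real_of_ereal (exit_time D B \<omega>)) \<omega> \<in> frontier D"
  using x \<omega>
proof (cases rule: exit_time_cases)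
  case never then show ?thesis using assms(4) by simp
next
  case (exits z)
  have z: "0 < z" using exits assms(3) by (cases "z = 0") auto
  have "(\<lambda>n. B (z * grid n (1 - 1 / real (Suc n))) \<omega>) \<longlonglongrightarrow> B z \<omega>"
  proof (rule path_tendsto[OF x \<omega>])
    have g: "grid n (1 - 1 / real (Suc n)) = 1 - 1 / real (Suc n)" for n
    proof -
      have "(1 - 1 / real (Suc n)) * real (Suc n) = real n" by (simp add: left_diff_distrib)
      then show ?thesis by (simp only: grid_def) (simp add: field_simps)
    qed
    show "(\<lambda>n. z * grid n (1 - 1 / real (Suc n))) \<longlonglongrightarrow> z"
      unfolding g using tendsto_mult[OF tendsto_const[of z] tendsto_diff[OF tendsto_const[of 1] LIMSEQ_Suc[OF lim_1_over_n]]] by simp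
    show "0 \<le> z * grid n (1 - 1 / real (Suc n))" for n
      using z by (intro mult_nonneg_nonneg grid_bounds) auto
  qed (use z in auto)
  moreover have "B (z * grid n (1 - 1 / real (Suc n))) \<omega> \<in> D" for n
  proof (rule exits(4))
    have u: "0 \<le> 1 - 1 / real (Suc n)" "1 - 1 / real (Suc n) < 1" by auto
    show "0 \<le> z * grid n (1 - 1 / real (Suc n))" using z u by (intro mult_nonneg_nonneg grid_bounds) auto
    show "z * grid n (1 - 1 / real (Suc n)) < z" using order.strict_trans1[OF grid_bounds(2)[OF u(1), of n] u(2)] z by simp
  qed
  ultimately have "B z \<omega> \<in> closure D" unfolding closure_sequential
    by (intro exI[of _ "\<lambda>n. B (z * grid n (1 - 1 / real (Suc n))) \<omega>"]) simp
  then show ?thesis using exits open_D by (simp add: frontier_def interior_open)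
qed

lemma AE_exit_law_frontier:
  assumes x: "x \<in> D" shows "AE y in exit_law x. y \<in> frontier D"
proof -
  have "AE \<omega> in W x. B (real_of_ereal (exit_time D B \<omega>)) \<omega> \<in> frontier D"
    using AE_exit_time_finite[OF x] start[OF x] AE_space
    by eventually_elim (use x in \<open>auto intro!: exit_position_frontier\<close>)
  then show ?thesis unfolding exit_law_def
    by (subst AE_distr_iff) (use measurable_exit_position[OF x] in auto)
qed

end

section \<open>A Dynkin estimate\<close>

context killed_brownian_motion
begin

definition stop_index :: "'a set \<Rightarrow> real \<Rightarrow> nat \<Rightarrow> 'v \<Rightarrow> nat" where
  "stop_index K t n \<omega> = (LEAST i. i = Suc n \<or> B (t / real (Suc n) * real i) \<omega> \<notin> K)"

lemma stop_index_cases: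
  "stop_index K t n \<omega> = Suc n \<or> B (t / real (Suc n) * real (stop_index K t n \<omega>)) \<omega> \<notin> K"
  unfolding stop_index_def by (rule LeastI[of _ "Suc n"]) simp

lemma stop_index_le: "stop_index K t n \<omega> \<le> Suc n"
  unfolding stop_index_def by (rule Least_le) simp

lemma stop_index_le_exit: "B (t / real (Suc n) * real i) \<omega> \<notin> K \<Longrightarrow> stop_index K t n \<omega> \<le> i"
  unfolding stop_index_def by (rule Least_le) simp

lemma grid_alive_iff_less_stop_index:
  assumes "i < Suc n" shows "grid_alive K t n i \<omega> \<longleftrightarrow> i < stop_index K t n \<omega>"
proof
  assume *: "grid_alive K t n i \<omega>"
  show "i < stop_index K t n \<omega>"
  proof (rule ccontr)
    assume "\<not> i < stop_index K t n \<omega>"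
    then have "stop_index K t n \<omega> \<le> i" by simp
    then show False using * assms stop_index_cases[of K t n \<omega>] unfolding grid_alive_def by auto
  qed
next
  assume *: "i < stop_index K t n \<omega>"
  show "grid_alive K t n i \<omega>" unfolding grid_alive_def
  proof (intro allI impI)
    fix l assume "l \<le> i"
    then have "l < stop_index K t n \<omega>" using * by simp
    then show "B (t / real (Suc n) * real l) \<omega> \<in> K"
      using not_less_Least unfolding stop_index_def by blast
  qed
qed

text \<open>Increments are summed exactly as long as the grid path is alive, so the sum ends at the first
  exit from \<open>K\<close> seen by the grid.\<close>

lemma stopped_telescope:
  fixes f :: "'a \<Rightarrow> real"
  shows "(\<Sum>i<Suc n. indicator {\<omega>. grid_alive K t n i \<omega>} \<omega>
      * (f (B (t / real (Suc n) * real (Suc i)) \<omega>) - f (B (t / real (Suc n) * real i) \<omega>)))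
    = f (B (t / real (Suc n) * real (stop_index K t n \<omega>)) \<omega>) - f (B 0 \<omega>)"
proof -
  let ?g = "\<lambda>i. f (B (t / real (Suc n) * real i) \<omega>)"
  have "(\<Sum>i<Suc n. indicator {\<omega>. grid_alive K t n i \<omega>} \<omega> * (?g (Suc i) - ?g i))
    = (\<Sum>i<stop_index K t n \<omega>. ?g (Suc i) - ?g i)"
  proof (rule sum.mono_neutral_cong_right)
    show le: "{..<stop_index K t n \<omega>} \<subseteq> {..<Suc n}" using stop_index_le[of K t n \<omega>] by auto
    have ind: "(indicator {\<omega>. grid_alive K t n i \<omega>} \<omega> :: real) = (if i < stop_index K t n \<omega> then 1 else 0)"
      if "i < Suc n" for i
      using grid_alive_iff_less_stop_index[OF that] by (simp add: indicator_def)
    show "\<forall>i\<in>{..<Suc n} - {..<stop_index K t n \<omega>}. indicator {\<omega>. grid_alive K t n i \<omega>} \<omega> * (?g (Suc i) - ?g i) = 0"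
      using ind by simp
    show "indicator {\<omega>. grid_alive K t n i \<omega>} \<omega> * (?g (Suc i) - ?g i) = ?g (Suc i) - ?g i"
      if "i \<in> {..<stop_index K t n \<omega>}" for i
      using ind[of i] that subsetD[OF le that] by simp
  qed simp
  also have "\<dots> = ?g (stop_index K t n \<omega>) - ?g 0" by (rule sum_lessThan_telescope)
  finally show ?thesis by simp
qed

lemma measurable_stopped:
  fixes f :: "'a \<Rightarrow> real"
  assumes x: "x \<in> D" and t: "0 \<le> t" and K: "K \<in> sets borel" and f [measurable]: "f \<in> borel_measurable borel"
  shows "(\<lambda>\<omega>. f (B (t / real (Suc n) * real (stop_index K t n \<omega>)) \<omega>)) \<in> borel_measurable (W x)"
proof -
  have [measurable]: "Measurable.pred (W x) (grid_alive K t n i)" for i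
    by (rule pred_grid_alive[OF x K t])
  have [measurable]: "B (t / real (Suc n) * real i) \<in> borel_measurable (W x)" for i
    using measurable_B[OF x] t by simp
  have [measurable]: "B 0 \<in> borel_measurable (W x)" using measurable_B[OF x] by simp
  have eq: "f (B (t / real (Suc n) * real (stop_index K t n \<omega>)) \<omega>) = f (B 0 \<omega>)
      + (\<Sum>i<Suc n. indicator {\<omega>. grid_alive K t n i \<omega>} \<omega>
      * (f (B (t / real (Suc n) * real (Suc i)) \<omega>) - f (B (t / real (Suc n) * real i) \<omega>)))" for \<omega>
    unfolding stopped_telescope by simp
  show ?thesis unfolding eq by measurable
qed

definition grid_occupation :: "'a \<Rightarrow> 'a set \<Rightarrow> real \<Rightarrow> nat \<Rightarrow> ('a \<Rightarrow> real) \<Rightarrow> real" where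
  "grid_occupation x K t n g = (\<Sum>i<Suc n. t / real (Suc n)
     * (\<integral>\<omega>. indicator {\<omega>. grid_alive K t n i \<omega>} \<omega> * g (B (t / real (Suc n) * real i) \<omega>) \<partial>W x))"

lemma integrable_grid_alive:
  assumes x: "x \<in> D" and K: "K \<in> sets borel" and t: "0 \<le> t" and i: "0 \<le> u"
    and g: "g \<in> borel_measurable borel" and bd: "\<And>y. \<bar>g y\<bar> \<le> (C::real)"
  shows "integrable (W x) (\<lambda>\<omega>. indicator {\<omega>. grid_alive K t n i \<omega>} \<omega> * g (B u \<omega>))"
proof -
  interpret prob_space "W x" by (rule prob_space_W[OF x])
  note [measurable] = pred_grid_alive[OF x K t] measurable_B[OF x i] g
  have C: "0 \<le> C" using bd[of 0] by linarith
  have "(\<lambda>\<omega>. indicator {\<omega>. grid_alive K t n i \<omega>} \<omega> * g (B u \<omega>)) \<in> borel_measurable (W x)"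
    by measurable
  then show ?thesis
    by (intro integrable_const_bound[where B=C]) (use bd C in \<open>auto simp: indicator_def\<close>)
qed

text \<open>Dynkin's formula on the grid: by the discrete Markov property the mean of each alive increment is
  the mean over a Gaussian step, to which the one-step estimate \<open>step\<close> applies.\<close>

lemma grid_stopped_estimate:
  fixes f a c :: "'a \<Rightarrow> real"
  assumes x: "x \<in> D" and t: "0 < t" and K [measurable]: "K \<in> sets borel"
    and [measurable]: "f \<in> borel_measurable borel" "a \<in> borel_measurable borel" "c \<in> borel_measurable borel"
    and bd: "\<And>y. \<bar>f y\<bar> \<le> C" "\<And>y. \<bar>a y\<bar> \<le> C" "\<And>y. \<bar>c y\<bar> \<le> C"
    and step: "\<And>y. y \<in> K \<Longrightarrow> \<bar>(\<integral>v. f (y + v) \<partial>gauss (t / real (Suc n))) - f y - t / real (Suc n) * a y\<bar>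
       \<le> t / real (Suc n) * c y + \<eta>" and \<eta>: "0 \<le> \<eta>"
  shows "\<bar>(\<integral>\<omega>. f (B (t / real (Suc n) * real (stop_index K t n \<omega>)) \<omega>) \<partial>W x) - f x - grid_occupation x K t n a\<bar>
    \<le> grid_occupation x K t n c + real (Suc n) * \<eta>"
proof -
  interpret prob_space "W x" by (rule prob_space_W[OF x])
  define h where "h = t / real (Suc n)"
  have h: "0 < h" using t by (simp add: h_def)
  have C: "0 \<le> C" using bd(1)[of 0] by linarith
  define A where "A i \<omega> = (indicator {\<omega>. grid_alive K t n i \<omega>} \<omega> :: real)" for i \<omega>
  have A01: "0 \<le> A i \<omega>" "A i \<omega> \<le> 1" for i \<omega> by (auto simp: A_def indicator_def)
  have [measurable]: "Measurable.pred (W x) (grid_alive K t n i)" for i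
    using t by (intro pred_grid_alive[OF x K]) simp
  have Am [measurable]: "A i \<in> borel_measurable (W x)" for i
    unfolding A_def[abs_def] by measurable
  have Bm [measurable]: "B (h * real i) \<in> borel_measurable (W x)" "B (h * real (Suc i)) \<in> borel_measurable (W x)" for i
    using measurable_B[OF x] h by (auto simp del: of_nat_Suc)
  define Pf where "Pf y = (\<integral>v. f (y + v) \<partial>gauss h)" for y
  interpret G: prob_space "gauss h :: 'a measure" by (rule prob_space_gauss[OF h])
  have Pfm [measurable]: "Pf \<in> borel_measurable borel" unfolding Pf_def[abs_def] by measurable
  have Pf_bd: "\<bar>Pf y\<bar> \<le> C" for y
  proof -
    have "\<bar>Pf y\<bar> \<le> (\<integral>v. C \<partial>(gauss h :: 'a measure))" unfolding Pf_def
      by (rule order_trans[OF integral_abs_bound[of "gauss h" "\<lambda>v. f (y + v)"]])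
        (intro integral_mono' G.integrable_const_bound[where B=C], use bd C in auto)
    then show ?thesis using G.prob_space by simp
  qed
  have int: "integrable (W x) (\<lambda>\<omega>. A i \<omega> * g (B (h * real l) \<omega>))"
    if "g \<in> borel_measurable borel" "\<And>y. \<bar>g y\<bar> \<le> C'" for g :: "'a \<Rightarrow> real" and C' i l
    unfolding A_def using t h by (intro integrable_grid_alive[OF x K _ _ that]) auto
  note intf = int[OF \<open>f \<in> _\<close> bd(1)] and inta = int[OF \<open>a \<in> _\<close> bd(2)] and intc = int[OF \<open>c \<in> _\<close> bd(3)]
    and intP = int[OF Pfm Pf_bd]
  have B0: "B (h * real 0) \<omega> = B 0 \<omega>" for \<omega> by simp
  have tele: "f (B (h * real (stop_index K t n \<omega>)) \<omega>) = f (B (h * real 0) \<omega>)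
      + (\<Sum>i<Suc n. A i \<omega> * (f (B (h * real (Suc i)) \<omega>) - f (B (h * real i) \<omega>)))" for \<omega>
    using stopped_telescope[where f=f and K=K and t=t and n=n and \<omega>=\<omega>] unfolding A_def h_def B0 by simp

  have step_i: "(\<integral>\<omega>. A i \<omega> * (f (B (h * real (Suc i)) \<omega>) - f (B (h * real i) \<omega>)) \<partial>W x)
     = (\<integral>\<omega>. A i \<omega> * Pf (B (h * real i) \<omega>) \<partial>W x) - (\<integral>\<omega>. A i \<omega> * f (B (h * real i) \<omega>) \<partial>W x)" for i
  proof -
    have "(\<integral>\<omega>. A i \<omega> * (f (B (h * real (Suc i)) \<omega>) - f (B (h * real i) \<omega>)) \<partial>W x)
      = (\<integral>\<omega>. A i \<omega> * f (B (h * real (Suc i)) \<omega>) \<partial>W x) - (\<integral>\<omega>. A i \<omega> * f (B (h * real i) \<omega>) \<partial>W x)"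
      unfolding right_diff_distrib by (rule Bochner_Integration.integral_diff[OF intf intf])
    also have "(\<integral>\<omega>. A i \<omega> * f (B (h * real (Suc i)) \<omega>) \<partial>W x) = (\<integral>\<omega>. A i \<omega> * Pf (B (h * real i) \<omega>) \<partial>W x)"
      using grid_markov[OF x h K \<open>f \<in> _\<close> bd(1), of i]
      unfolding A_def grid_alive_def h_def[symmetric] Pf_def .
    finally show ?thesis .
  qed
  have bound_i: "\<bar>(\<integral>\<omega>. A i \<omega> * (f (B (h * real (Suc i)) \<omega>) - f (B (h * real i) \<omega>)) \<partial>W x)
      - h * (\<integral>\<omega>. A i \<omega> * a (B (h * real i) \<omega>) \<partial>W x)\<bar> \<le> h * (\<integral>\<omega>. A i \<omega> * c (B (h * real i) \<omega>) \<partial>W x) + \<eta>" for i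
  proof -
    have ii: "integrable (W x) (\<lambda>\<omega>. A i \<omega> * Pf (B (h * real i) \<omega>) - A i \<omega> * f (B (h * real i) \<omega>) - h * (A i \<omega> * a (B (h * real i) \<omega>)))"
      by (intro Bochner_Integration.integrable_diff integrable_mult_right intP intf inta)
    have ic: "integrable (W x) (\<lambda>\<omega>. h * (A i \<omega> * c (B (h * real i) \<omega>)) + \<eta>)"
      by (intro Bochner_Integration.integrable_add integrable_mult_right intc) simp
    have "(\<integral>\<omega>. A i \<omega> * (f (B (h * real (Suc i)) \<omega>) - f (B (h * real i) \<omega>)) \<partial>W x) - h * (\<integral>\<omega>. A i \<omega> * a (B (h * real i) \<omega>) \<partial>W x)
      = (\<integral>\<omega>. A i \<omega> * Pf (B (h * real i) \<omega>) - A i \<omega> * f (B (h * real i) \<omega>) - h * (A i \<omega> * a (B (h * real i) \<omega>)) \<partial>W x)"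
      unfolding step_i
      using Bochner_Integration.integral_diff[OF Bochner_Integration.integrable_diff[OF intP[of i i] intf[of i i]] integrable_mult_right[OF inta[of i i], of h]]
        Bochner_Integration.integral_diff[OF intP[of i i] intf[of i i]]
      by simp
    also have "\<bar>\<dots>\<bar> \<le> (\<integral>\<omega>. h * (A i \<omega> * c (B (h * real i) \<omega>)) + \<eta> \<partial>W x)"
    proof (rule order_trans[OF integral_abs_bound], rule integral_mono[OF integrable_abs[OF ii] ic])
      fix \<omega>
      show "\<bar>A i \<omega> * Pf (B (h * real i) \<omega>) - A i \<omega> * f (B (h * real i) \<omega>) - h * (A i \<omega> * a (B (h * real i) \<omega>))\<bar>
        \<le> h * (A i \<omega> * c (B (h * real i) \<omega>)) + \<eta>"
      proof (cases "grid_alive K t n i \<omega>")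
        case True
        then have "B (h * real i) \<omega> \<in> K" unfolding grid_alive_def h_def by blast
        from step[OF this, folded h_def] show ?thesis using True by (simp add: A_def Pf_def)
      next
        case False then show ?thesis using \<eta> by (simp add: A_def)
      qed
    qed
    also have "\<dots> = h * (\<integral>\<omega>. A i \<omega> * c (B (h * real i) \<omega>) \<partial>W x) + \<eta>"
      using Bochner_Integration.integral_add[OF integrable_mult_right[OF intc[of i i], of h] integrable_const[of \<eta>]] prob_space
      by simp
    finally show ?thesis .
  qed
  have f0: "(\<integral>\<omega>. f (B (h * real 0) \<omega>) \<partial>W x) = f x" 
  proof -
    have "(\<integral>\<omega>. f (B (h * real 0) \<omega>) \<partial>W x) = (\<integral>\<omega>. f x \<partial>W x)"
    proof (rule integral_cong_AE)
      show "AE \<omega> in W x. f (B (h * real 0) \<omega>) = f x"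
        using start[OF x] by eventually_elim simp
    qed measurable
    then show ?thesis using prob_space by simp
  qed
  have if0: "integrable (W x) (\<lambda>\<omega>. f (B (h * real 0) \<omega>))"
    using bd(1) measurable_compose[OF Bm(1)[of 0] \<open>f \<in> _\<close>]
    by (intro integrable_const_bound[where B=C]) auto
  have "(\<integral>\<omega>. f (B (h * real (stop_index K t n \<omega>)) \<omega>) \<partial>W x)
     = f x + (\<Sum>i<Suc n. \<integral>\<omega>. A i \<omega> * (f (B (h * real (Suc i)) \<omega>) - f (B (h * real i) \<omega>)) \<partial>W x)"
    unfolding tele
  proof -
    have id: "integrable (W x) (\<lambda>\<omega>. A i \<omega> * (f (B (h * real (Suc i)) \<omega>) - f (B (h * real i) \<omega>)))" for i
      unfolding right_diff_distrib by (rule Bochner_Integration.integrable_diff[OF intf intf])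
    show "(\<integral>\<omega>. f (B (h * real 0) \<omega>) + (\<Sum>i<Suc n. A i \<omega> * (f (B (h * real (Suc i)) \<omega>) - f (B (h * real i) \<omega>))) \<partial>W x)
      = f x + (\<Sum>i<Suc n. \<integral>\<omega>. A i \<omega> * (f (B (h * real (Suc i)) \<omega>) - f (B (h * real i) \<omega>)) \<partial>W x)"
      using Bochner_Integration.integral_add[OF if0 Bochner_Integration.integrable_sum[OF id, of "\<lambda>i. i" "{..<Suc n}"]]
        Bochner_Integration.integral_sum[OF id, of "\<lambda>i. i" "{..<Suc n}"] f0
      by simp
  qed
  then have eq: "(\<integral>\<omega>. f (B (h * real (stop_index K t n \<omega>)) \<omega>) \<partial>W x) - f x - grid_occupation x K t n a
     = (\<Sum>i<Suc n. (\<integral>\<omega>. A i \<omega> * (f (B (h * real (Suc i)) \<omega>) - f (B (h * real i) \<omega>)) \<partial>W x)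
      - h * (\<integral>\<omega>. A i \<omega> * a (B (h * real i) \<omega>) \<partial>W x))"
    unfolding grid_occupation_def h_def[symmetric] A_def[symmetric] sum_subtractf by simp
  have "\<bar>(\<Sum>i<Suc n. (\<integral>\<omega>. A i \<omega> * (f (B (h * real (Suc i)) \<omega>) - f (B (h * real i) \<omega>)) \<partial>W x)
      - h * (\<integral>\<omega>. A i \<omega> * a (B (h * real i) \<omega>) \<partial>W x))\<bar>
    \<le> (\<Sum>i<Suc n. h * (\<integral>\<omega>. A i \<omega> * c (B (h * real i) \<omega>) \<partial>W x) + \<eta>)"
    by (rule order_trans[OF sum_abs]) (rule sum_mono, rule bound_i)
  also have "\<dots> = grid_occupation x K t n c + real (Suc n) * \<eta>"
    unfolding grid_occupation_def h_def[symmetric] A_def[symmetric] sum.distrib by simp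
  finally show "\<bar>(\<integral>\<omega>. f (B (t / real (Suc n) * real (stop_index K t n \<omega>)) \<omega>) \<partial>W x) - f x - grid_occupation x K t n a\<bar>
    \<le> grid_occupation x K t n c + real (Suc n) * \<eta>"
    using eq unfolding h_def by simp
qed

end

context killed_brownian_motion
begin

definition occupation_integrand :: "'a set \<Rightarrow> real \<Rightarrow> ('a \<Rightarrow> real) \<Rightarrow> 'v \<times> real \<Rightarrow> real" where
  "occupation_integrand K t g p = indicator {0..<t} (snd p) *
     (indicator {\<omega>. alive K (snd p) \<omega>} (fst p) * g (B (max 0 (snd p)) (fst p)))"

lemma measurable_snd_indicator:
  "(\<lambda>p. indicator {a..<b::real} (snd p) :: real) \<in> borel_measurable (M \<Otimes>\<^sub>M lborel)"
  by (rule measurable_compose[OF measurable_snd]) simp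

lemma integrable_time_indicator:
  fixes t C :: real
  assumes x: "x \<in> D" and t: "0 \<le> t"
  shows "integrable (W x \<Otimes>\<^sub>M lborel) (\<lambda>p. C * indicator {0..<t} (snd p) :: real)"
proof (rule integrableI_bounded_set[where A = "space (W x) \<times> {0..<t}" and B = "\<bar>C\<bar>"])
  interpret prob_space "W x" by (rule prob_space_W[OF x])
  show "space (W x) \<times> {0..<t} \<in> sets (W x \<Otimes>\<^sub>M lborel)"
    by (rule pair_measureI) (simp_all only: sets.top sets_lborel atLeastLessThan_borel)
  have "emeasure (W x \<Otimes>\<^sub>M lborel) (space (W x) \<times> {0..<t}) = emeasure (W x) (space (W x)) * emeasure lborel {0..<t}"
    by (rule lborel.emeasure_pair_measure_Times) auto
  then show "emeasure (W x \<Otimes>\<^sub>M lborel) (space (W x) \<times> {0..<t}) < \<infinity>"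
    using t by (simp add: emeasure_space_1)
  show "(\<lambda>p. C * indicator {0..<t} (snd p)) \<in> borel_measurable (W x \<Otimes>\<^sub>M lborel)"
    by (rule borel_measurable_times[OF borel_measurable_const measurable_snd_indicator])
qed (auto simp: indicator_def space_pair_measure)

text \<open>The grid occupation is the integral over \<open>s < t\<close> of a step function that converges pointwise to the
  integrand of the time spent in \<open>K\<close> before the first exit.\<close>

lemma grid_occupation_tendsto:
  fixes g :: "'a \<Rightarrow> real"
  assumes x: "x \<in> D" and K: "closed K" and t: "0 < t" and g: "continuous_on UNIV g" and bd: "\<And>y. \<bar>g y\<bar> \<le> C"
  shows "(\<lambda>n. grid_occupation x K t n g) \<longlonglongrightarrow> (\<integral>p. occupation_integrand K t g p \<partial>(W x \<Otimes>\<^sub>M lborel))"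
    and "occupation_integrand K t g \<in> borel_measurable (W x \<Otimes>\<^sub>M lborel)"
proof -
  interpret prob_space "W x" by (rule prob_space_W[OF x])
  interpret WL: pair_sigma_finite "W x" "lborel :: real measure" ..
  have C: "0 \<le> C" using bd[of 0] by linarith
  have gm [measurable]: "g \<in> borel_measurable borel" by (rule borel_measurable_continuous_onI[OF g])
  have Kb: "K \<in> sets borel" using K by simp
  define h where "h n = t / real (Suc n)" for n
  have h: "0 < h n" for n using t by (simp add: h_def)
  define F where "F n i \<omega> = indicator {\<omega>. grid_alive K t n i \<omega>} \<omega> * g (B (h n * real i) \<omega>)" for n i \<omega>
  have Fi: "integrable (W x) (F n i)" for n i
    unfolding F_def h_def using t by (intro integrable_grid_alive[OF x Kb _ _ gm bd]) auto
  have Fm [measurable]: "F n i \<in> borel_measurable (W x)" for n i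
    using Fi by (rule borel_measurable_integrable)
  define \<Phi> where "\<Phi> n p = (\<Sum>i<Suc n. indicator {h n * real i..<h n * real (Suc i)} (snd p) * F n i (fst p))" for n p
  have \<Phi>m: "\<Phi> n \<in> borel_measurable (W x \<Otimes>\<^sub>M lborel)" for n
    unfolding \<Phi>_def[abs_def]
    by (intro borel_measurable_sum borel_measurable_times measurable_snd_indicator measurable_compose[OF measurable_fst Fm])
  \<comment> \<open>at time \<open>s\<close> only the summand whose interval contains \<open>s\<close> survives\<close>
  have \<Phi>_eq: "\<Phi> n (\<omega>, s) = indicator {0..<t} s * F n (nat \<lfloor>s / t * real (Suc n)\<rfloor>) \<omega>" for n \<omega> s
  proof (cases "s \<in> {0..<t}")
    case True
    define i0 where "i0 = nat \<lfloor>s / t * real (Suc n)\<rfloor>"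
    have iff: "s \<in> {h n * real i..<h n * real (Suc i)} \<longleftrightarrow> i = i0" for i
    proof -
      have "s \<in> {h n * real i..<h n * real (Suc i)} \<longleftrightarrow> real i \<le> s / h n \<and> s / h n < real (Suc i)"
        using h[of n] by (simp add: pos_le_divide_eq pos_divide_less_eq mult.commute del: of_nat_Suc)
      also have "s / h n = s / t * real (Suc n)" by (simp add: h_def)
      also have "real i \<le> s / t * real (Suc n) \<and> s / t * real (Suc n) < real (Suc i) \<longleftrightarrow> \<lfloor>s / t * real (Suc n)\<rfloor> = int i"
        by (simp add: floor_eq_iff add.commute[of 1])
      also have "\<dots> \<longleftrightarrow> i = i0" using True unfolding i0_def by (auto simp: nat_eq_iff2)
      finally show ?thesis .
    qed
    have i0: "i0 < Suc n"
    proof -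
      have "s / t * real (Suc n) < real (Suc n)" using True t by (simp add: pos_divide_less_eq)
      then have "\<lfloor>s / t * real (Suc n)\<rfloor> < int (Suc n)" by (simp add: floor_less_iff del: of_nat_Suc)
      then show ?thesis unfolding i0_def using True t by (subst nat_less_iff) auto
    qed
    have "\<Phi> n (\<omega>, s) = (\<Sum>i<Suc n. if i = i0 then F n i \<omega> else 0)"
      unfolding \<Phi>_def fst_conv snd_conv
      by (intro sum.cong refl) (simp only: indicator_def iff of_bool_def if_True if_False mult_1 mult_zero_left split: if_splits, simp)
    also have "\<dots> = F n i0 \<omega>" using i0 by simp
    finally show ?thesis using True by (simp add: i0_def)
  next
    case False
    have "s \<notin> {h n * real i..<h n * real (Suc i)}" if "i < Suc n" for i
    proof
      assume s: "s \<in> {h n * real i..<h n * real (Suc i)}"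
      have "0 \<le> h n * real i" using h[of n] by simp
      then have "0 \<le> s" using s by auto
      moreover have "h n * real (Suc i) \<le> h n * real (Suc n)" using h[of n] that by (intro mult_left_mono) auto
      then have "s < t" using s by (simp add: h_def)
      ultimately show False using False by simp
    qed
    then show ?thesis using False unfolding \<Phi>_def by simp
  qed
  have Fbd: "\<bar>F n i \<omega>\<bar> \<le> C" for n i \<omega> using bd C by (auto simp: F_def indicator_def)
  have \<Phi>bd: "norm (\<Phi> n p) \<le> C * indicator {0..<t} (snd p)" for n p
    using Fbd by (cases p) (auto simp: \<Phi>_eq indicator_def)
  have wi: "integrable (W x \<Otimes>\<^sub>M lborel) (\<lambda>p. C * indicator {0..<t} (snd p))"
    using t by (intro integrable_time_indicator[OF x]) simp
  have \<Phi>i: "integrable (W x \<Otimes>\<^sub>M lborel) (\<Phi> n)" for n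
    by (rule Bochner_Integration.integrable_bound[OF wi \<Phi>m]) (use \<Phi>bd C in \<open>auto intro!: AE_I2 simp: abs_mult\<close>)
  have lim: "(\<lambda>n. \<Phi> n p) \<longlonglongrightarrow> occupation_integrand K t g p" if p: "p \<in> space (W x \<Otimes>\<^sub>M lborel)" for p
  proof -
    obtain \<omega> s where ps: "p = (\<omega>, s)" by (cases p)
    have \<omega>: "\<omega> \<in> space (W x)" using p by (simp add: ps space_pair_measure)
    show ?thesis
    proof (cases "s \<in> {0..<t}")
      case True
      then have s: "0 \<le> s" "max 0 s = s" by auto
      have "(\<lambda>n. B (t * grid n (s / t)) \<omega>) \<longlonglongrightarrow> B s \<omega>"
        using s t by (intro path_tendsto[OF x \<omega>] grid_time_tendsto mult_nonneg_nonneg grid_bounds) auto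
      then have "(\<lambda>n. g (B (t * grid n (s / t)) \<omega>)) \<longlonglongrightarrow> g (B s \<omega>)"
        by (rule continuous_on_tendsto_compose[OF g]) auto
      from tendsto_mult[OF grid_alive_tendsto[OF x \<omega> K t s(1)] this]
      show ?thesis using True s unfolding ps \<Phi>_eq F_def h_def grid_time
        by (simp add: occupation_integrand_def)
    next
      case False
      then show ?thesis unfolding ps \<Phi>_eq by (simp add: occupation_integrand_def)
    qed
  qed
  show om: "occupation_integrand K t g \<in> borel_measurable (W x \<Otimes>\<^sub>M lborel)"
    by (rule borel_measurable_LIMSEQ_metric[OF \<Phi>m lim])
  have "(\<lambda>n. \<integral>p. \<Phi> n p \<partial>(W x \<Otimes>\<^sub>M lborel)) \<longlonglongrightarrow> (\<integral>p. occupation_integrand K t g p \<partial>(W x \<Otimes>\<^sub>M lborel))"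
    by (rule integral_dominated_convergence[OF om \<Phi>m wi]) (use lim \<Phi>bd in auto)
  moreover have "(\<integral>p. \<Phi> n p \<partial>(W x \<Otimes>\<^sub>M lborel)) = grid_occupation x K t n g" for n
  proof -
    have "(\<integral>p. \<Phi> n p \<partial>(W x \<Otimes>\<^sub>M lborel)) = (\<integral>\<omega>. (\<integral>s. \<Phi> n (\<omega>, s) \<partial>lborel) \<partial>W x)"
      by (rule WL.integral_fst'[symmetric, OF \<Phi>i])
    also have "\<dots> = (\<integral>\<omega>. (\<Sum>i<Suc n. h n * F n i \<omega>) \<partial>W x)"
    proof (rule Bochner_Integration.integral_cong[OF refl])
      fix \<omega>
      have ii: "integrable lborel (\<lambda>s. indicator {h n * real i..<h n * real (Suc i)} s * F n i \<omega>)" for i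
      proof -
        have "h n * real i \<le> h n * real (Suc i)" using h[of n] by (intro mult_left_mono) auto
        then have "emeasure lborel {h n * real i..<h n * real (Suc i)} < \<infinity>" by (simp del: of_nat_Suc)
        then show ?thesis by (intro integrable_mult_left integrable_real_indicator) (simp_all only: sets_lborel atLeastLessThan_borel)
      qed
      have m: "measure lborel {h n * real i..<h n * real (Suc i)} = h n" for i
      proof -
        have "h n * real i \<le> h n * real (Suc i)" using h[of n] by (intro mult_left_mono) auto
        then have "measure lborel {h n * real i..<h n * real (Suc i)} = h n * real (Suc i) - h n * real i"
          by (simp del: of_nat_Suc)
        then show ?thesis by (simp add: algebra_simps)
      qed
      have "(\<integral>s. \<Phi> n (\<omega>, s) \<partial>lborel) = (\<Sum>i<Suc n. \<integral>s. indicator {h n * real i..<h n * real (Suc i)} s * F n i \<omega> \<partial>lborel)"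
        unfolding \<Phi>_def fst_conv snd_conv by (rule Bochner_Integration.integral_sum) (rule ii)
      also have "\<dots> = (\<Sum>i<Suc n. h n * F n i \<omega>)"
        by (intro sum.cong refl) (simp only: integral_mult_left_zero Bochner_Integration.integral_indicator, simp only: m space_lborel space_borel Int_UNIV_right)
      finally show "(\<integral>s. \<Phi> n (\<omega>, s) \<partial>lborel) = (\<Sum>i<Suc n. h n * F n i \<omega>)" .
    qed
    also have "\<dots> = (\<Sum>i<Suc n. \<integral>\<omega>. h n * F n i \<omega> \<partial>W x)"
      by (rule Bochner_Integration.integral_sum) (intro integrable_mult_right Fi)
    also have "\<dots> = grid_occupation x K t n g"
      unfolding grid_occupation_def F_def h_def by simp
    finally show ?thesis .
  qed
  ultimately show "(\<lambda>n. grid_occupation x K t n g) \<longlonglongrightarrow> (\<integral>p. occupation_integrand K t g p \<partial>(W x \<Otimes>\<^sub>M lborel))"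
    by simp
qed

definition exit_before :: "'a set \<Rightarrow> real \<Rightarrow> 'v \<Rightarrow> real" where
  "exit_before K t \<omega> = Inf (insert t {s. 0 \<le> s \<and> B s \<omega> \<notin> K})"

lemma exit_before_bounds:
  assumes "0 \<le> t" shows "0 \<le> exit_before K t \<omega>" "exit_before K t \<omega> \<le> t"
    "\<And>s. 0 \<le> s \<Longrightarrow> B s \<omega> \<notin> K \<Longrightarrow> exit_before K t \<omega> \<le> s"
proof -
  have bdd: "bdd_below (insert t {s. 0 \<le> s \<and> B s \<omega> \<notin> K})" by (rule bdd_belowI[of _ 0]) (use assms in auto)
  show "0 \<le> exit_before K t \<omega>" unfolding exit_before_def by (rule cInf_greatest) (use assms in auto)
  show "exit_before K t \<omega> \<le> t" unfolding exit_before_def by (rule cInf_lower[OF _ bdd]) simp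
  show "exit_before K t \<omega> \<le> s" if "0 \<le> s" "B s \<omega> \<notin> K" for s
    unfolding exit_before_def by (rule cInf_lower[OF _ bdd]) (use that in simp)
qed

text \<open>Closedness of \<open>K\<close> matters: the grid cannot miss the exit, since the path spends open
  time intervals outside \<open>K\<close> arbitrarily soon after it.\<close>

lemma stop_time_tendsto:
  assumes x: "x \<in> D" and \<omega>: "\<omega> \<in> space (W x)" and K: "closed K" and t: "0 < t"
  shows "(\<lambda>n. t / real (Suc n) * real (stop_index K t n \<omega>)) \<longlonglongrightarrow> exit_before K t \<omega>"
proof (rule order_tendstoI)
  let ?s = "\<lambda>n. t / real (Suc n) * real (stop_index K t n \<omega>)"
  note eb = exit_before_bounds[OF less_imp_le[OF t], where K=K and \<omega>=\<omega>]
  have lower: "exit_before K t \<omega> \<le> ?s n" for n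
    using stop_index_cases[of K t n \<omega>]
  proof
    assume "stop_index K t n \<omega> = Suc n"
    then have "?s n = t" by simp
    with eb(2) show ?thesis by simp
  next
    assume "B (?s n) \<omega> \<notin> K" then show ?thesis by (intro eb(3)) (use t in auto)
  qed
  have upper: "?s n \<le> t" for n
  proof -
    have "?s n \<le> t / real (Suc n) * real (Suc n)"
      using stop_index_le[of K t n \<omega>] t by (intro mult_left_mono) (auto simp del: of_nat_Suc)
    then show ?thesis by simp
  qed
  fix a
  show "\<forall>\<^sub>F n in sequentially. a < ?s n" if "a < exit_before K t \<omega>"
    using less_le_trans[OF that lower] by simp
  show "\<forall>\<^sub>F n in sequentially. ?s n < a" if a: "exit_before K t \<omega> < a"
  proof (cases "t < a")
    case True then show ?thesis using le_less_trans[OF upper] by simp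
  next
    case False
    obtain r where r: "r \<in> insert t {s. 0 \<le> s \<and> B s \<omega> \<notin> K}" "r < a"
      using cInf_lessD[OF _ a[unfolded exit_before_def]] by blast
    then have r': "0 \<le> r" "B r \<omega> \<in> - K" using False by auto
    have "(\<lambda>n. B (t * grid n (r / t)) \<omega>) \<longlonglongrightarrow> B r \<omega>"
      using r' t by (intro path_tendsto[OF x \<omega>] grid_time_tendsto mult_nonneg_nonneg grid_bounds) auto
    then have "\<forall>\<^sub>F n in sequentially. B (t * grid n (r / t)) \<omega> \<in> - K"
      by (rule topological_tendstoD) (use r' K in auto)
    then show ?thesis
    proof eventually_elim
      case (elim n)
      then have "stop_index K t n \<omega> \<le> nat \<lfloor>r / t * real (Suc n)\<rfloor>"
        by (intro stop_index_le_exit) (simp only: grid_time Compl_iff not_False_eq_True)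
      then have "?s n \<le> t / real (Suc n) * real (nat \<lfloor>r / t * real (Suc n)\<rfloor>)"
        using t by (intro mult_left_mono) auto
      also have "\<dots> = t * grid n (r / t)" by (rule grid_time)
      also have "\<dots> \<le> t * (r / t)" using t r' by (intro mult_left_mono grid_bounds) auto
      also have "\<dots> < a" using t r by simp
      finally show ?case .
    qed
  qed
qed

text \<open>The exit times from the exhausting closed sets increase to a time at which the path, by
  continuity, is at the boundary.\<close>

lemma exit_before_tendsto:
  assumes x: "x \<in> D" and \<omega>: "\<omega> \<in> space (W x)" and fin: "exit_time D B \<omega> < \<infinity>"
  shows "(\<lambda>m. exit_before (core m) (real (Suc m)) \<omega>) \<longlonglongrightarrow> real_of_ereal (exit_time D B \<omega>)"
  using x \<omega>
proof (cases rule: exit_time_cases)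
  case never then show ?thesis using fin by simp
next
  case (exits z)
  have "(\<lambda>m. exit_before (core m) (real (Suc m)) \<omega>) \<longlonglongrightarrow> z"
  proof (rule order_tendstoI)
    fix a assume a: "a < z"
    show "\<forall>\<^sub>F m in sequentially. a < exit_before (core m) (real (Suc m)) \<omega>"
    proof (cases "a < 0")
      case True
      then show ?thesis using less_le_trans[OF True exit_before_bounds(1)] by simp
    next
      case False
      define r where "r = (a + z) / 2"
      have r: "0 \<le> r" "a < r" "r < z" using a False by (auto simp: r_def)
      have "alive D r \<omega>" using exits(4) r by (auto simp: alive_def)
      then obtain m0 where m0: "alive (core m0) r \<omega>" using alive_core_iff[OF x \<omega>] by blast
      have "\<forall>\<^sub>F m in sequentially. m0 \<le> m \<and> r < real (Suc m)"
        using eventually_ge_at_top[of m0] eventually_gt_at_top[of "nat \<lceil>r\<rceil>"]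
      proof eventually_elim
        case (elim m)
        then have "r < real m + 1" by linarith
        with elim show ?case by simp
      qed
      then show ?thesis
      proof eventually_elim
        case (elim m)
        then have al: "alive (core m) r \<omega>" using alive_mono[OF m0 core_mono] by blast
        have "r \<le> exit_before (core m) (real (Suc m)) \<omega>"
          unfolding exit_before_def
        proof (rule cInf_greatest)
          fix s assume "s \<in> insert (real (Suc m)) {s. 0 \<le> s \<and> B s \<omega> \<notin> core m}"
          then show "r \<le> s" using elim aliveD[OF al, of s] by (cases "s \<le> r") auto
        qed simp
        then show ?case using r by simp
      qed
    qed
  next
    fix a assume a: "z < a"
    have "B z \<omega> \<notin> core m" for m using exits(3) core_subset by blast
    then have "exit_before (core m) (real (Suc m)) \<omega> \<le> z" for m
      by (intro exit_before_bounds(3) exits(1)) auto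
    then show "\<forall>\<^sub>F m in sequentially. exit_before (core m) (real (Suc m)) \<omega> < a"
      using a le_less_trans by (intro always_eventually allI) blast
  qed
  then show ?thesis using exits(2) by simp
qed

lemma integrable_lifetime:
  assumes x: "x \<in> D" shows "integrable (W x \<Otimes>\<^sub>M lborel) (indicator lifetime_set :: _ \<Rightarrow> real)"
proof (rule integrableI_nonneg)
  note [measurable] = measurable_B_lborel[OF x] measurable_lifetime_indicator[OF x]
  show "(indicator lifetime_set :: _ \<Rightarrow> real) \<in> borel_measurable (W x \<Otimes>\<^sub>M lborel)" by measurable
  interpret finite_measure "green x" by (rule finite_measure_green[OF x])
  have "(\<integral>\<^sup>+ p. ennreal (indicator lifetime_set p) \<partial>(W x \<Otimes>\<^sub>M lborel)) = (\<integral>\<^sup>+ p. indicator lifetime_set p * 1 \<partial>(W x \<Otimes>\<^sub>M lborel))"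
    by (simp add: ennreal_indicator)
  also have "\<dots> = (\<integral>\<^sup>+ p. 1 \<partial>density (W x \<Otimes>\<^sub>M lborel) (indicator lifetime_set))"
    by (rule nn_integral_density[symmetric]) measurable
  also have "\<dots> = (\<integral>\<^sup>+ y. 1 \<partial>green x)"
    unfolding green_def by (rule nn_integral_distr[symmetric]) measurable
  also have "\<dots> = emeasure (green x) UNIV" by simp
  also have "\<dots> < \<infinity>" using emeasure_finite[of UNIV] top.not_eq_extremum by (simp only: infinity_ennreal_def) blast
  finally show "(\<integral>\<^sup>+ p. ennreal (indicator lifetime_set p) \<partial>(W x \<Otimes>\<^sub>M lborel)) < \<infinity>" .
qed auto

lemma integral_green:
  fixes g :: "'a \<Rightarrow> real"
  assumes x: "x \<in> D" and [measurable]: "g \<in> borel_measurable borel"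
  shows "(\<integral>y. g y \<partial>green x) = (\<integral>p. indicator lifetime_set p * g (B (max 0 (snd p)) (fst p)) \<partial>(W x \<Otimes>\<^sub>M lborel))"
proof -
  note [measurable] = measurable_B_lborel[OF x] measurable_lifetime_indicator[OF x]
  have "(\<integral>y. g y \<partial>green x) = (\<integral>p. g (B (max 0 (snd p)) (fst p)) \<partial>density (W x \<Otimes>\<^sub>M lborel) (\<lambda>p. ennreal (indicator lifetime_set p)))"
    unfolding green_def ennreal_indicator by (rule integral_distr) measurable
  also have "\<dots> = (\<integral>p. indicator lifetime_set p *\<^sub>R g (B (max 0 (snd p)) (fst p)) \<partial>(W x \<Otimes>\<^sub>M lborel))"
    by (rule integral_density) auto
  finally show ?thesis by simp
qed

text \<open>Dominated convergence along the exhaustion by \<open>core m\<close>; the lifetime is integrable.\<close>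

lemma occupation_tendsto_green:
  fixes g :: "'a \<Rightarrow> real"
  assumes x: "x \<in> D" and g: "continuous_on UNIV g" and bd: "\<And>y. \<bar>g y\<bar> \<le> C"
  shows "(\<lambda>m. \<integral>p. occupation_integrand (core m) (real (Suc m)) g p \<partial>(W x \<Otimes>\<^sub>M lborel)) \<longlonglongrightarrow> (\<integral>y. g y \<partial>green x)"
proof -
  note [measurable] = measurable_B_lborel[OF x] measurable_lifetime_indicator[OF x]
  have gm [measurable]: "g \<in> borel_measurable borel" by (rule borel_measurable_continuous_onI[OF g])
  have C: "0 \<le> C" using bd[of 0] by linarith
  show ?thesis unfolding integral_green[OF x gm]
  proof (rule integral_dominated_convergence[where w = "\<lambda>p. C * indicator lifetime_set p"])
    show "(\<lambda>p. indicator lifetime_set p * g (B (max 0 (snd p)) (fst p))) \<in> borel_measurable (W x \<Otimes>\<^sub>M lborel)"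
      by measurable
    show "occupation_integrand (core m) (real (Suc m)) g \<in> borel_measurable (W x \<Otimes>\<^sub>M lborel)" for m
      by (rule grid_occupation_tendsto(2)[OF x closed_core _ g bd]) simp
    show "integrable (W x \<Otimes>\<^sub>M lborel) (\<lambda>p. C * indicator lifetime_set p)"
      by (rule integrable_mult_right[OF integrable_lifetime[OF x]])
    show "AE p in W x \<Otimes>\<^sub>M lborel. (\<lambda>m. occupation_integrand (core m) (real (Suc m)) g p)
        \<longlonglongrightarrow> indicator lifetime_set p * g (B (max 0 (snd p)) (fst p))"
    proof (rule AE_I2)
      fix p assume "p \<in> space (W x \<Otimes>\<^sub>M (lborel :: real measure))"
      then obtain \<omega> s where p: "p = (\<omega>, s)" "\<omega> \<in> space (W x)" by (cases p) (auto simp: space_pair_measure)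
      show "(\<lambda>m. occupation_integrand (core m) (real (Suc m)) g p) \<longlonglongrightarrow> indicator lifetime_set p * g (B (max 0 (snd p)) (fst p))"
      proof (cases "0 \<le> s")
        case True
        have "\<forall>\<^sub>F m in sequentially. s < real (Suc m)"
          using eventually_gt_at_top[of "nat \<lceil>s\<rceil>"] by eventually_elim linarith
        then have "\<forall>\<^sub>F m in sequentially. indicator {0..<real (Suc m)} s = (1::real)"
          by eventually_elim (use True in simp)
        then have "(\<lambda>m. indicator {0..<real (Suc m)} s :: real) \<longlonglongrightarrow> 1" by (rule tendsto_eventually)
        from tendsto_mult[OF this tendsto_mult[OF alive_core_tendsto[OF x p(2), of s] tendsto_const]]
        have "(\<lambda>m. occupation_integrand (core m) (real (Suc m)) g p) \<longlonglongrightarrow> 1 * (indicator {\<omega>. alive D s \<omega>} \<omega> * g (B (max 0 s) \<omega>))"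
          unfolding occupation_integrand_def p fst_conv snd_conv .
        moreover have "(indicator lifetime_set p :: real) = indicator {\<omega>. alive D s \<omega>} \<omega>"
          using less_exit_time_iff[OF x p(2) True] True by (simp add: p lifetime_set_def indicator_def)
        ultimately show ?thesis by (simp add: p)
      next
        case False
        then show ?thesis by (simp add: occupation_integrand_def p lifetime_set_def)
      qed
    qed
    show "AE p in W x \<Otimes>\<^sub>M lborel. norm (occupation_integrand (core m) (real (Suc m)) g p) \<le> C * indicator lifetime_set p" for m
    proof (rule AE_I2)
      fix p assume "p \<in> space (W x \<Otimes>\<^sub>M (lborel :: real measure))"
      then obtain \<omega> s where p: "p = (\<omega>, s)" "\<omega> \<in> space (W x)" by (cases p) (auto simp: space_pair_measure)
      show "norm (occupation_integrand (core m) (real (Suc m)) g p) \<le> C * indicator lifetime_set p"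
      proof (cases "0 \<le> s \<and> alive (core m) s \<omega>")
        case True
        then have "ereal s < exit_time D B \<omega>"
          using less_exit_time_iff[OF x p(2)] alive_core_iff[OF x p(2)] by blast
        then have "p \<in> lifetime_set" using True by (simp add: p lifetime_set_def)
        then show ?thesis using bd C by (auto simp: occupation_integrand_def indicator_def)
      next
        case False
        then have "occupation_integrand (core m) (real (Suc m)) g p = 0"
          by (auto simp: occupation_integrand_def p indicator_def)
        then show ?thesis using C by simp
      qed
    qed
  qed
qed

text \<open>Dynkin's formula as an inequality. In place of a generator applied to \<open>f\<close>, the assumption is
  that the mean of \<open>f\<close> over a small Gaussian step is \<open>f + h a\<close> with an error of at most \<open>h c\<close>
  up to higher order, uniformly away from the boundary. The estimate is first obtained for the exit from \<open>core m\<close>, capped at time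
  \<open>m + 1\<close>, from the grids of mesh tending to \<open>0\<close>; then \<open>m\<close> tends to infinity.\<close>

lemma dynkin_estimate:
  fixes f a c :: "'a \<Rightarrow> real"
  assumes x: "x \<in> D" and cont: "continuous_on UNIV f" "continuous_on UNIV a" "continuous_on UNIV c"
    and bd: "\<And>y. \<bar>f y\<bar> \<le> C" "\<And>y. \<bar>a y\<bar> \<le> C" "\<And>y. \<bar>c y\<bar> \<le> C"
    and step: "\<And>m. \<exists>C'\<ge>0. \<forall>h y. 0 < h \<longrightarrow> h \<le> 1 \<longrightarrow> y \<in> core m \<longrightarrow>
       \<bar>(\<integral>v. f (y + v) \<partial>gauss h) - f y - h * a y\<bar> \<le> h * c y + C' * (h * sqrt h)"
  shows "\<bar>(\<integral>y. f y \<partial>exit_law x) - f x - (\<integral>y. a y \<partial>green x)\<bar> \<le> (\<integral>y. c y \<partial>green x)"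
proof -
  interpret prob_space "W x" by (rule prob_space_W[OF x])
  have [measurable]: "f \<in> borel_measurable borel" "a \<in> borel_measurable borel" "c \<in> borel_measurable borel"
    using cont by (auto intro: borel_measurable_continuous_onI)
  have C: "0 \<le> C" using bd(1)[of 0] by linarith
  have fB: "(\<lambda>m. f (B (S m) \<omega>)) \<longlonglongrightarrow> f (B s \<omega>)" if "\<omega> \<in> space (W x)" "S \<longlonglongrightarrow> s" "\<And>m. 0 \<le> S m" "0 \<le> s" for S s \<omega>
    by (rule continuous_on_tendsto_compose[OF cont(1) path_tendsto[OF x that]]) auto
  let ?O = "\<lambda>g m. \<integral>p. occupation_integrand (core m) (real (Suc m)) g p \<partial>(W x \<Otimes>\<^sub>M lborel)"
  have stop_m: "(\<lambda>\<omega>. f (B (real (Suc m) / real (Suc n) * real (stop_index (core m) (real (Suc m)) n \<omega>)) \<omega>)) \<in> borel_measurable (W x)" for m n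
    by (rule measurable_stopped[OF x]) auto
  have stop_lim: "(\<lambda>n. f (B (real (Suc m) / real (Suc n) * real (stop_index (core m) (real (Suc m)) n \<omega>)) \<omega>))
      \<longlonglongrightarrow> f (B (exit_before (core m) (real (Suc m)) \<omega>) \<omega>)" if "\<omega> \<in> space (W x)" for m \<omega>
    by (rule fB[OF that stop_time_tendsto[OF x that closed_core]]) (auto intro: exit_before_bounds)
  have eb_m: "(\<lambda>\<omega>. f (B (exit_before (core m) (real (Suc m)) \<omega>) \<omega>)) \<in> borel_measurable (W x)" for m
    by (rule borel_measurable_LIMSEQ_metric[OF stop_m stop_lim])
  have m_level: "\<bar>(\<integral>\<omega>. f (B (exit_before (core m) (real (Suc m)) \<omega>) \<omega>) \<partial>W x) - f x - ?O a m\<bar> \<le> ?O c m" for m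
  proof -
    define t where "t = real (Suc m)"
    have t: "0 < t" by (simp add: t_def)
    obtain C' where C': "0 \<le> C'" "\<And>h y. 0 < h \<Longrightarrow> h \<le> 1 \<Longrightarrow> y \<in> core m \<Longrightarrow>
       \<bar>(\<integral>v. f (y + v) \<partial>gauss h) - f y - h * a y\<bar> \<le> h * c y + C' * (h * sqrt h)"
      using step[of m] by blast
    let ?h = "\<lambda>n. t / real (Suc n)"
    have h0: "?h \<longlonglongrightarrow> 0"
      using tendsto_mult[OF tendsto_const[of t] LIMSEQ_Suc[OF lim_1_over_n]] by simp
    have "\<forall>\<^sub>F n in sequentially. ?h n < 1" by (rule order_tendstoD(2)[OF h0]) simp
    then have ev: "\<forall>\<^sub>F n in sequentially.
        \<bar>(\<integral>\<omega>. f (B (t / real (Suc n) * real (stop_index (core m) t n \<omega>)) \<omega>) \<partial>W x) - f x - grid_occupation x (core m) t n a\<bar>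
        \<le> grid_occupation x (core m) t n c + C' * t * sqrt (?h n)"
    proof eventually_elim
      case (elim n)
      have "real (Suc n) * (C' * (?h n * sqrt (?h n))) = C' * t * sqrt (?h n)" by simp
      moreover have "\<bar>(\<integral>\<omega>. f (B (t / real (Suc n) * real (stop_index (core m) t n \<omega>)) \<omega>) \<partial>W x) - f x - grid_occupation x (core m) t n a\<bar>
        \<le> grid_occupation x (core m) t n c + real (Suc n) * (C' * (?h n * sqrt (?h n)))"
        using t elim C'(1) by (intro grid_stopped_estimate[OF x t borel_core _ _ _ bd] C'(2)) auto
      ultimately show ?case by simp
    qed
    have lim_f: "(\<lambda>n. \<integral>\<omega>. f (B (t / real (Suc n) * real (stop_index (core m) t n \<omega>)) \<omega>) \<partial>W x)
       \<longlonglongrightarrow> (\<integral>\<omega>. f (B (exit_before (core m) t \<omega>) \<omega>) \<partial>W x)"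
      unfolding t_def
      by (rule integral_dominated_convergence[OF eb_m stop_m, where w = "\<lambda>_. C"]) (use stop_lim bd in auto)
    have lim_a: "(\<lambda>n. grid_occupation x (core m) t n a) \<longlonglongrightarrow> ?O a m"
      unfolding t_def[symmetric] by (rule grid_occupation_tendsto(1)[OF x closed_core t cont(2) bd(2)])
    have lim_c: "(\<lambda>n. grid_occupation x (core m) t n c) \<longlonglongrightarrow> ?O c m"
      unfolding t_def[symmetric] by (rule grid_occupation_tendsto(1)[OF x closed_core t cont(3) bd(3)])
    have "(\<lambda>n. C' * t * sqrt (?h n)) \<longlonglongrightarrow> C' * t * sqrt 0"
      by (intro tendsto_mult tendsto_const tendsto_real_sqrt h0)
    then have lim_e: "(\<lambda>n. C' * t * sqrt (?h n)) \<longlonglongrightarrow> 0" by simp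
    have "\<bar>(\<integral>\<omega>. f (B (exit_before (core m) t \<omega>) \<omega>) \<partial>W x) - f x - ?O a m\<bar> \<le> ?O c m + 0"
      by (rule tendsto_le[OF sequentially_bot tendsto_add[OF lim_c lim_e]
          tendsto_rabs[OF tendsto_diff[OF tendsto_diff[OF lim_f tendsto_const] lim_a]] ev])
    then show ?thesis by (simp add: t_def)
  qed
  have "(\<lambda>m. \<integral>\<omega>. f (B (exit_before (core m) (real (Suc m)) \<omega>) \<omega>) \<partial>W x) \<longlonglongrightarrow> (\<integral>\<omega>. f (B (real_of_ereal (exit_time D B \<omega>)) \<omega>) \<partial>W x)"
  proof (rule integral_dominated_convergence[where w = "\<lambda>_. C"])
    show "(\<lambda>\<omega>. f (B (real_of_ereal (exit_time D B \<omega>)) \<omega>)) \<in> borel_measurable (W x)"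
      using measurable_compose[OF measurable_exit_position[OF x] \<open>f \<in> _\<close>] by simp
    show "(\<lambda>\<omega>. f (B (exit_before (core m) (real (Suc m)) \<omega>) \<omega>)) \<in> borel_measurable (W x)" for m
      by (rule eb_m)
    show "AE \<omega> in W x. (\<lambda>m. f (B (exit_before (core m) (real (Suc m)) \<omega>) \<omega>)) \<longlonglongrightarrow> f (B (real_of_ereal (exit_time D B \<omega>)) \<omega>)"
      using AE_exit_time_finite[OF x] AE_space
    proof eventually_elim
      case (elim \<omega>)
      then show ?case
        by (intro fB exit_before_tendsto[OF x] exit_before_bounds) (auto simp: real_of_ereal_pos exit_time_nonneg)
    qed
  qed (use bd in auto)
  also have "(\<integral>\<omega>. f (B (real_of_ereal (exit_time D B \<omega>)) \<omega>) \<partial>W x) = (\<integral>y. f y \<partial>exit_law x)"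
    unfolding exit_law_def by (rule integral_distr[symmetric]) (use measurable_exit_position[OF x] in auto)
  finally have lim_f: "(\<lambda>m. \<integral>\<omega>. f (B (exit_before (core m) (real (Suc m)) \<omega>) \<omega>) \<partial>W x) \<longlonglongrightarrow> (\<integral>y. f y \<partial>exit_law x)" .
  note lim_a = occupation_tendsto_green[OF x cont(2) bd(2)]
  note lim_c = occupation_tendsto_green[OF x cont(3) bd(3)]
  show ?thesis
    by (rule tendsto_le[OF sequentially_bot lim_c tendsto_rabs[OF tendsto_diff[OF tendsto_diff[OF lim_f tendsto_const] lim_a]]])
      (use m_level in auto)
qed

end

section \<open>The Green operator is symmetric and positive\<close>

text \<open>The one-step operator of Gaussian steps of variance \<open>h\<close> that are killed outside \<open>K\<close>.\<close>

definition gauss_step :: "real \<Rightarrow> 'a::euclidean_space set \<Rightarrow> ('a \<Rightarrow> real) \<Rightarrow> 'a \<Rightarrow> real" where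
  "gauss_step h K g y = (\<integral>z. gauss_density h (z - y) * (indicator K z * g z) \<partial>lborel)"

lemma gauss_step_eq:
  fixes g :: "'a::euclidean_space \<Rightarrow> real"
  assumes [measurable]: "g \<in> borel_measurable borel" "K \<in> sets borel"
  shows "(\<integral>v. indicator K (y + v) * g (y + v) \<partial>gauss h) = gauss_step h K g y"
proof -
  have "(\<integral>v. indicator K (y + v) * g (y + v) \<partial>gauss h)
      = (\<integral>v. gauss_density h v *\<^sub>R (indicator K (y + v) * g (y + v)) \<partial>lborel)"
    unfolding gauss_def by (rule integral_density) auto
  also have "\<dots> = (\<integral>v. gauss_density h ((y + v) - y) * (indicator K (y + v) * g (y + v)) \<partial>lborel)"
    by simp
  also have "\<dots> = (\<integral>z. gauss_density h (z - y) * (indicator K z * g z) \<partial>distr lborel borel ((+) y))"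
    by (rule integral_distr[symmetric]) auto
  finally show ?thesis unfolding lborel_distr_plus gauss_step_def .
qed

lemma measurable_gauss_step_joint:
  fixes G :: "'b \<Rightarrow> 'a::euclidean_space \<Rightarrow> real"
  assumes [measurable]: "(\<lambda>p. G (fst p) (snd p)) \<in> borel_measurable (N \<Otimes>\<^sub>M borel)" "K \<in> sets borel" "\<eta> \<in> borel_measurable N"
  shows "(\<lambda>p. gauss_step (\<eta> (fst p)) K (G (fst p)) (snd p)) \<in> borel_measurable (N \<Otimes>\<^sub>M borel)"
  unfolding gauss_step_def
proof (rule lborel.borel_measurable_lebesgue_integral)
  have [measurable]: "(\<lambda>q. G (fst (fst q)) (snd q)) \<in> borel_measurable ((N \<Otimes>\<^sub>M borel) \<Otimes>\<^sub>M lborel)"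
  proof -
    have "(\<lambda>q. (fst (fst q), snd q)) \<in> measurable ((N \<Otimes>\<^sub>M borel) \<Otimes>\<^sub>M lborel) (N \<Otimes>\<^sub>M borel)" by measurable
    from measurable_compose[OF this assms(1)] show ?thesis by simp
  qed
  have [measurable]: "(\<lambda>q. gauss_density (\<eta> (fst (fst q))) (snd q - snd (fst q))) \<in> borel_measurable ((N \<Otimes>\<^sub>M borel) \<Otimes>\<^sub>M lborel)"
  proof -
    have "(\<lambda>q. (\<eta> (fst (fst q)), snd q - snd (fst q))) \<in> measurable ((N \<Otimes>\<^sub>M borel) \<Otimes>\<^sub>M lborel) (borel \<Otimes>\<^sub>M borel)" by measurable
    from measurable_compose[OF this measurable_gauss_density] show ?thesis by simp
  qed
  show "(\<lambda>(p, z). gauss_density (\<eta> (fst p)) (z - snd p) * (indicator K z * G (fst p) z))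
     \<in> borel_measurable ((N \<Otimes>\<^sub>M borel) \<Otimes>\<^sub>M lborel)"
    unfolding case_prod_beta by measurable
qed

lemma measurable_gauss_step [measurable]:
  assumes "g \<in> borel_measurable borel" "K \<in> sets borel"
  shows "gauss_step h K g \<in> borel_measurable borel"
proof -
  have "(\<lambda>p. gauss_step h K g (snd p)) \<in> borel_measurable (count_space {()} \<Otimes>\<^sub>M borel)"
    using measurable_gauss_step_joint[of "\<lambda>_. g" "count_space {()}" K "\<lambda>_. h"] assms by simp
  from measurable_compose[OF measurable_Pair1'[of "()" "count_space {()}" borel] this] show ?thesis by simp
qed

lemma gauss_step_bounded:
  fixes g :: "'a::euclidean_space \<Rightarrow> real"
  assumes h: "0 < h" and [measurable]: "g \<in> borel_measurable borel" "K \<in> sets borel" and bd: "\<And>y. \<bar>g y\<bar> \<le> C"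
  shows "\<bar>gauss_step h K g y\<bar> \<le> C"
proof -
  interpret prob_space "gauss h :: 'a measure" by (rule prob_space_gauss[OF h])
  have C: "0 \<le> C" using bd[of 0] by linarith
  have b: "\<bar>indicator K z * g z\<bar> \<le> C" for z using bd[of z] C by (auto simp: indicator_def)
  have i: "integrable (gauss h) (\<lambda>v. indicator K (y + v) * g (y + v))"
    by (rule integrable_const_bound[where B=C]) (use b in auto)
  have "\<bar>gauss_step h K g y\<bar> \<le> (\<integral>v. \<bar>indicator K (y + v) * g (y + v)\<bar> \<partial>gauss h)"
    unfolding gauss_step_eq[symmetric, OF assms(2,3)] by (rule integral_abs_bound)
  also have "\<dots> \<le> (\<integral>v. C \<partial>(gauss h :: 'a measure))"
    by (rule integral_mono[OF integrable_abs[OF i]]) (use b in auto)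
  also have "\<dots> = C" using prob_space by simp
  finally show ?thesis .
qed

lemma gauss_step_funpow:
  fixes g :: "'a::euclidean_space \<Rightarrow> real"
  assumes h: "0 < h" and g: "g \<in> borel_measurable borel" and K: "K \<in> sets borel" and bd: "\<And>y. \<bar>g y\<bar> \<le> C"
  shows "(gauss_step h K ^^ i) g \<in> borel_measurable borel" "\<bar>(gauss_step h K ^^ i) g y\<bar> \<le> C"
proof -
  have "(gauss_step h K ^^ i) g \<in> borel_measurable borel \<and> (\<forall>y. \<bar>(gauss_step h K ^^ i) g y\<bar> \<le> C)"
  proof (induction i)
    case 0 then show ?case using g bd by simp
  next
    case (Suc i)
    then show ?case using measurable_gauss_step[OF _ K] gauss_step_bounded[OF h _ K] by simp
  qed
  then show "(gauss_step h K ^^ i) g \<in> borel_measurable borel" "\<bar>(gauss_step h K ^^ i) g y\<bar> \<le> C" by auto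
qed

text \<open>Fubini and the evenness of the Gaussian density.\<close>

lemma gauss_step_symmetric:
  fixes a b :: "'a::euclidean_space \<Rightarrow> real"
  assumes h: "0 < h" and K [measurable]: "K \<in> sets borel" and fin: "emeasure lborel K < \<infinity>"
    and [measurable]: "a \<in> borel_measurable borel" "b \<in> borel_measurable borel"
    and bd: "\<And>y. \<bar>a y\<bar> \<le> C" "\<And>y. \<bar>b y\<bar> \<le> C"
  shows "(\<integral>y. indicator K y * (a y * gauss_step h K b y) \<partial>lborel) = (\<integral>y. indicator K y * (gauss_step h K a y * b y) \<partial>lborel)"
proof -
  have C: "0 \<le> C" using bd(1)[of 0] by linarith
  define F where "F y z = (indicator K y * a y) * (gauss_density h (z - y) * (indicator K z * b z))" for y z
  define p where "p = (1 / sqrt (2 * pi * h)) ^ DIM('a)"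
  have p: "0 \<le> p" "\<And>v::'a. gauss_density h v \<le> p"
    using gauss_density_le[OF h] h by (auto simp: p_def)
  have [measurable]: "(\<lambda>q. gauss_density h (snd q - fst q)) \<in> borel_measurable (lborel \<Otimes>\<^sub>M (lborel :: 'a measure))"
    by (rule measurable_compose[OF _ borel_measurable_gauss_density]) measurable
  have Fm: "(\<lambda>(y, z). F y z) \<in> borel_measurable (lborel \<Otimes>\<^sub>M lborel)"
    unfolding F_def case_prod_beta by measurable
  have int: "integrable (lborel \<Otimes>\<^sub>M lborel) (\<lambda>(y, z). F y z)"
  proof (rule integrableI_bounded_set[where A = "K \<times> K" and B = "C * (p * C)"])
    show "K \<times> K \<in> sets (lborel \<Otimes>\<^sub>M lborel)" by (rule pair_measureI) simp_all
    have "emeasure (lborel \<Otimes>\<^sub>M lborel) (K \<times> K) = emeasure lborel K * emeasure lborel K"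
      by (rule lborel.emeasure_pair_measure_Times) simp_all
    then show "emeasure (lborel \<Otimes>\<^sub>M lborel) (K \<times> K) < \<infinity>"
      using fin by (simp add: ennreal_mult_less_top)
    have "\<bar>F y z\<bar> \<le> C * (p * C)" for y z
      unfolding F_def abs_mult using bd C p
      by (intro mult_mono) (auto simp: indicator_def)
    then show "AE q in lborel \<Otimes>\<^sub>M lborel. q \<in> K \<times> K \<longrightarrow> norm (case q of (y, z) \<Rightarrow> F y z) \<le> C * (p * C)"
      by (intro AE_I2) (auto simp: case_prod_beta)
    show "AE q in lborel \<Otimes>\<^sub>M lborel. q \<notin> K \<times> K \<longrightarrow> (case q of (y, z) \<Rightarrow> F y z) = 0"
      by (intro AE_I2) (auto simp: F_def indicator_def)
  qed (rule Fm)
  have "(\<integral>y. indicator K y * (a y * gauss_step h K b y) \<partial>lborel) = (\<integral>y. (\<integral>z. F y z \<partial>lborel) \<partial>lborel)"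
    unfolding F_def gauss_step_def by (simp add: mult.assoc)
  also have "\<dots> = (\<integral>z. (\<integral>y. F y z \<partial>lborel) \<partial>lborel)"
    by (rule lborel_pair.Fubini_integral[OF int, symmetric])
  also have "\<dots> = (\<integral>z. indicator K z * (gauss_step h K a z * b z) \<partial>lborel)"
  proof (rule Bochner_Integration.integral_cong[OF refl])
    fix z
    have "F y z = (indicator K z * b z) * (gauss_density h (y - z) * (indicator K y * a y))" for y
      using gauss_density_minus[of h "y - z"] by (simp add: F_def mult_ac)
    then have "(\<integral>y. F y z \<partial>lborel) = (\<integral>y. (indicator K z * b z) * (gauss_density h (y - z) * (indicator K y * a y)) \<partial>lborel)"
      by (simp only:)
    also have "\<dots> = (indicator K z * b z) * gauss_step h K a z"
      by (simp only: integral_mult_right_zero gauss_step_def)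
    finally show "(\<integral>y. F y z \<partial>lborel) = indicator K z * (gauss_step h K a z * b z)"
      by (simp only: mult_ac)
  qed
  finally show ?thesis .
qed

text \<open>An even power of a symmetric operator is a square.\<close>

lemma gauss_step_even_power_nonneg:
  fixes g :: "'a::euclidean_space \<Rightarrow> real"
  assumes h: "0 < h" and K: "K \<in> sets borel" and fin: "emeasure lborel K < \<infinity>"
    and g: "g \<in> borel_measurable borel" and bd: "\<And>y. \<bar>g y\<bar> \<le> C"
  shows "0 \<le> (\<integral>y. indicator K y * (g y * (gauss_step h K ^^ (2 * j)) g y) \<partial>lborel)"
proof -
  let ?T = "gauss_step h K"
  note Tm = gauss_step_funpow[OF h _ K]
  have shift: "(\<integral>y. indicator K y * (a y * (?T ^^ i) b y) \<partial>lborel) = (\<integral>y. indicator K y * ((?T ^^ i) a y * b y) \<partial>lborel)"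
    if "a \<in> borel_measurable borel" "b \<in> borel_measurable borel" "\<And>y. \<bar>a y\<bar> \<le> C" "\<And>y. \<bar>b y\<bar> \<le> C" for a b i
    using that
  proof (induction i arbitrary: b)
    case 0 then show ?case by simp
  next
    case (Suc i)
    have "(\<integral>y. indicator K y * (a y * (?T ^^ Suc i) b y) \<partial>lborel) = (\<integral>y. indicator K y * (a y * (?T ^^ i) (?T b) y) \<partial>lborel)"
      by (simp add: funpow_swap1)
    also have "\<dots> = (\<integral>y. indicator K y * ((?T ^^ i) a y * ?T b y) \<partial>lborel)"
      by (rule Suc.IH[OF Suc.prems(1) _ Suc.prems(3)])
        (use Suc.prems gauss_step_bounded[OF h _ K] measurable_gauss_step[OF _ K] in auto)
    also have "\<dots> = (\<integral>y. indicator K y * (?T ((?T ^^ i) a) y * b y) \<partial>lborel)"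
      by (rule gauss_step_symmetric[OF h K fin]) (use Suc.prems Tm in auto)
    finally show ?case by simp
  qed
  have "(?T ^^ (2 * j)) g = (?T ^^ j) ((?T ^^ j) g)" by (simp add: mult_2 funpow_add)
  then have "(\<integral>y. indicator K y * (g y * (?T ^^ (2 * j)) g y) \<partial>lborel) = (\<integral>y. indicator K y * ((?T ^^ j) g y * (?T ^^ j) g y) \<partial>lborel)"
    using shift[of g "(?T ^^ j) g" j] g bd Tm by auto
  also have "0 \<le> \<dots>" by (intro integral_nonneg_AE AE_I2) simp
  finally show ?thesis .
qed

context killed_brownian_motion
begin

text \<open>Iterating the discrete Markov property turns the expectation over grid paths into a power of
  the one-step operator.\<close>

lemma grid_expectation_eq_gauss_step:
  fixes g :: "'a \<Rightarrow> real"
  assumes x: "x \<in> D" and h: "0 < h" and K [measurable]: "K \<in> sets borel"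
    and g: "g \<in> borel_measurable borel" and bd: "\<And>y. \<bar>g y\<bar> \<le> C"
  shows "(\<integral>\<omega>. indicator {\<omega>. \<forall>l\<le>i. B (h * real l) \<omega> \<in> K} \<omega> * g (B (h * real i) \<omega>) \<partial>W x)
    = indicator K x * (gauss_step h K ^^ i) g x"
  using g bd
proof (induction i arbitrary: g)
  case (0 g)
  interpret prob_space "W x" by (rule prob_space_W[OF x])
  have [measurable]: "B 0 \<in> borel_measurable (W x)" using measurable_B[OF x] by simp
  note [measurable] = 0(1)
  have "(\<integral>\<omega>. indicator {\<omega>. \<forall>l\<le>0. B (h * real l) \<omega> \<in> K} \<omega> * g (B (h * real 0) \<omega>) \<partial>W x)
    = (\<integral>\<omega>. indicator K (B 0 \<omega>) * g (B 0 \<omega>) \<partial>W x)"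
    by (intro Bochner_Integration.integral_cong refl) (simp add: indicator_def)
  also have "\<dots> = (\<integral>\<omega>. indicator K x * g x \<partial>W x)"
  proof (rule integral_cong_AE)
    show "AE \<omega> in W x. indicator K (B 0 \<omega>) * g (B 0 \<omega>) = indicator K x * g x"
      using start[OF x] by eventually_elim simp
  qed measurable
  finally show ?case using prob_space by simp
next
  case (Suc i g)
  note [measurable] = Suc.prems(1)
  have C: "0 \<le> C" using Suc.prems(2)[of 0] by linarith
  define f where "f y = indicator K y * g y" for y
  have fm: "f \<in> borel_measurable borel" unfolding f_def[abs_def] by measurable
  have fb: "\<bar>f y\<bar> \<le> C" for y using Suc.prems(2)[of y] C by (auto simp: f_def indicator_def)
  have "(\<integral>\<omega>. indicator {\<omega>. \<forall>l\<le>Suc i. B (h * real l) \<omega> \<in> K} \<omega> * g (B (h * real (Suc i)) \<omega>) \<partial>W x)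
    = (\<integral>\<omega>. indicator {\<omega>. \<forall>l\<le>i. B (h * real l) \<omega> \<in> K} \<omega> * f (B (h * real (Suc i)) \<omega>) \<partial>W x)"
  proof (intro Bochner_Integration.integral_cong refl)
    fix \<omega>
    have "(\<forall>l\<le>Suc i. B (h * real l) \<omega> \<in> K) \<longleftrightarrow> (\<forall>l\<le>i. B (h * real l) \<omega> \<in> K) \<and> B (h * real (Suc i)) \<omega> \<in> K"
      by (metis le_Suc_eq)
    then show "indicator {\<omega>. \<forall>l\<le>Suc i. B (h * real l) \<omega> \<in> K} \<omega> * g (B (h * real (Suc i)) \<omega>)
      = indicator {\<omega>. \<forall>l\<le>i. B (h * real l) \<omega> \<in> K} \<omega> * f (B (h * real (Suc i)) \<omega>)"
      by (simp add: f_def indicator_def del: of_nat_Suc)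
  qed
  also have "\<dots> = (\<integral>\<omega>. indicator {\<omega>. \<forall>l\<le>i. B (h * real l) \<omega> \<in> K} \<omega> * (\<integral>v. f (B (h * real i) \<omega> + v) \<partial>gauss h) \<partial>W x)"
    by (rule grid_markov[OF x h K fm fb])
  also have "\<dots> = (\<integral>\<omega>. indicator {\<omega>. \<forall>l\<le>i. B (h * real l) \<omega> \<in> K} \<omega> * gauss_step h K g (B (h * real i) \<omega>) \<partial>W x)"
    unfolding f_def gauss_step_eq[OF Suc.prems(1) K] ..
  also have "\<dots> = indicator K x * (gauss_step h K ^^ i) (gauss_step h K g) x"
    by (rule Suc.IH) (use Suc.prems gauss_step_bounded[OF h _ K] measurable_gauss_step[OF _ K] in auto)
  finally show ?case by (simp add: funpow_swap1)
qed

definition killed :: "('a \<Rightarrow> real) \<Rightarrow> real \<Rightarrow> 'a \<Rightarrow> real" where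
  "killed g t x = (\<integral>\<omega>. indicator {\<omega>. alive D t \<omega>} \<omega> * g (B t \<omega>) \<partial>W x)"

text \<open>The number of grid steps is even, so that positivity of even powers applies to every
  approximation.\<close>

definition killed_approx :: "('a \<Rightarrow> real) \<Rightarrow> nat \<Rightarrow> nat \<Rightarrow> real \<Rightarrow> 'a \<Rightarrow> real" where
  "killed_approx g m n t x = indicator (core m) x *
     (gauss_step (t / real (Suc (Suc (2 * n)))) (core m) ^^ (2 * Suc n)) g x"

lemma measurable_killed_approx:
  assumes [measurable]: "g \<in> borel_measurable borel"
  shows "(\<lambda>p. killed_approx g m n (fst p) (snd p)) \<in> borel_measurable (borel \<Otimes>\<^sub>M borel)"
proof -
  have "(\<lambda>p. (gauss_step (fst p / real (Suc (Suc (2 * n)))) (core m) ^^ i) g (snd p)) \<in> borel_measurable (borel \<Otimes>\<^sub>M borel)" for i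
  proof (induction i)
    case 0 then show ?case by simp
  next
    case (Suc i)
    from measurable_gauss_step_joint[OF Suc borel_core[of m], of "\<lambda>t. t / real (Suc (Suc (2 * n)))"]
    show ?case by simp
  qed
  then show ?thesis unfolding killed_approx_def by measurable
qed

context
  fixes g :: "'a \<Rightarrow> real" and C :: real
  assumes g [measurable]: "g \<in> borel_measurable borel" and bd: "\<And>y. \<bar>g y\<bar> \<le> C"
begin

lemma bound_nonneg: "0 \<le> C"
  using bd[of 0] by linarith

lemma killed_approx_bound: "0 < t \<Longrightarrow> \<bar>killed_approx g m n t x\<bar> \<le> C"
  unfolding killed_approx_def using gauss_step_funpow(2)[OF _ g borel_core[of m] bd, of "t / real (Suc (Suc (2 * n)))" "2 * Suc n" x] bound_nonneg
  by (auto simp: indicator_def simp del: funpow.simps of_nat_Suc)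

lemma killed_approx_tendsto:
  assumes x: "x \<in> D" and t: "0 < t"
  shows "(\<lambda>n. killed_approx g m n t x) \<longlonglongrightarrow> (\<integral>\<omega>. indicator {\<omega>. alive (core m) t \<omega>} \<omega> * g (B t \<omega>) \<partial>W x)"
proof -
  interpret prob_space "W x" by (rule prob_space_W[OF x])
  have [measurable]: "B t \<in> borel_measurable (W x)" using measurable_B[OF x] t by simp
  have [measurable]: "Measurable.pred (W x) (alive (core m) t)" by (rule pred_alive_closed[OF x closed_core])
  have [measurable]: "Measurable.pred (W x) (grid_alive (core m) t n i)" for n i
    using t by (intro pred_grid_alive[OF x borel_core]) simp
  have eq: "killed_approx g m n t x = (\<integral>\<omega>. indicator {\<omega>. grid_alive (core m) t (Suc (2 * n)) (2 * Suc n) \<omega>} \<omega> * g (B t \<omega>) \<partial>W x)" for n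
  proof -
    have "t / real (Suc (Suc (2 * n))) * real (2 * Suc n) = t" by simp
    then show ?thesis
      using grid_expectation_eq_gauss_step[OF x _ borel_core g bd, of "t / real (Suc (Suc (2 * n)))" "2 * Suc n" m] t
      unfolding killed_approx_def grid_alive_def by simp
  qed
  show ?thesis unfolding eq
  proof (rule integral_dominated_convergence[where w = "\<lambda>_. C"])
    show "AE \<omega> in W x. (\<lambda>n. indicator {\<omega>. grid_alive (core m) t (Suc (2 * n)) (2 * Suc n) \<omega>} \<omega> * g (B t \<omega>))
      \<longlonglongrightarrow> indicator {\<omega>. alive (core m) t \<omega>} \<omega> * g (B t \<omega>)"
    proof (rule AE_I2)
      fix \<omega> assume \<omega>: "\<omega> \<in> space (W x)"
      have nat: "nat \<lfloor>t / t * real (Suc n)\<rfloor> = Suc n" for n using t by (simp del: of_nat_Suc)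
      have "strict_mono (\<lambda>n::nat. Suc (2 * n))" by (rule strict_monoI) simp
      from LIMSEQ_subseq_LIMSEQ[OF grid_alive_tendsto[OF x \<omega> closed_core t less_imp_le[OF t], unfolded nat] this, of m]
      have "(\<lambda>n. indicator {\<omega>. grid_alive (core m) t (Suc (2 * n)) (2 * Suc n) \<omega>} \<omega> :: real)
        \<longlonglongrightarrow> indicator {\<omega>. alive (core m) t \<omega>} \<omega>" by (simp add: comp_def)
      then show "(\<lambda>n. indicator {\<omega>. grid_alive (core m) t (Suc (2 * n)) (2 * Suc n) \<omega>} \<omega> * g (B t \<omega>))
        \<longlonglongrightarrow> indicator {\<omega>. alive (core m) t \<omega>} \<omega> * g (B t \<omega>)" by (intro tendsto_mult tendsto_const)
    qed
    show "AE \<omega> in W x. norm (indicator {\<omega>. grid_alive (core m) t (Suc (2 * n)) (2 * Suc n) \<omega>} \<omega> * g (B t \<omega>)) \<le> C" for n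
      using bd bound_nonneg by (intro AE_I2) (auto simp: indicator_def)
  qed auto
qed

lemma killed_core_tendsto:
  assumes x: "x \<in> D" and t: "0 < t"
  shows "(\<lambda>m. \<integral>\<omega>. indicator {\<omega>. alive (core m) t \<omega>} \<omega> * g (B t \<omega>) \<partial>W x) \<longlonglongrightarrow> killed g t x"
proof -
  interpret prob_space "W x" by (rule prob_space_W[OF x])
  have [measurable]: "B t \<in> borel_measurable (W x)" using measurable_B[OF x] t by simp
  have [measurable]: "Measurable.pred (W x) (alive (core m) t)" for m by (rule pred_alive_closed[OF x closed_core])
  have [measurable]: "Measurable.pred (W x) (alive D t)" by (rule pred_alive[OF x])
  show ?thesis unfolding killed_def
  proof (rule integral_dominated_convergence[where w = "\<lambda>_. C"])
    show "AE \<omega> in W x. (\<lambda>m. indicator {\<omega>. alive (core m) t \<omega>} \<omega> * g (B t \<omega>)) \<longlonglongrightarrow> indicator {\<omega>. alive D t \<omega>} \<omega> * g (B t \<omega>)"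
      using alive_core_tendsto[OF x] by (intro AE_I2 tendsto_mult tendsto_const) auto
    show "AE \<omega> in W x. norm (indicator {\<omega>. alive (core m) t \<omega>} \<omega> * g (B t \<omega>)) \<le> C" for m
      using bd bound_nonneg by (intro AE_I2) (auto simp: indicator_def)
  qed auto
qed

lemma killed_core_bound:
  assumes x: "x \<in> D" and t: "0 < t"
  shows "\<bar>\<integral>\<omega>. indicator {\<omega>. alive (core m) t \<omega>} \<omega> * g (B t \<omega>) \<partial>W x\<bar> \<le> C"
  by (rule tendsto_upperbound[OF tendsto_rabs[OF killed_approx_tendsto[OF x t]]])
    (use killed_approx_bound[OF t] in auto)

text \<open>A jointly measurable version of \<open>killed g\<close>. The laws \<open>W x\<close> are given separately for each starting point, so measurability
  in \<open>x\<close> has to come from the explicit approximations.\<close>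

definition killed_version :: "real \<Rightarrow> 'a \<Rightarrow> real" where
  "killed_version t x = lim (\<lambda>m. lim (\<lambda>n. killed_approx g m n t x))"

lemma measurable_killed_version:
  "(\<lambda>p. killed_version (fst p) (snd p)) \<in> borel_measurable (borel \<Otimes>\<^sub>M borel)"
  unfolding killed_version_def
  by (intro borel_measurable_lim_metric measurable_killed_approx g)

lemma killed_version_eq:
  assumes x: "x \<in> D" and t: "0 < t" shows "killed_version t x = killed g t x"
  unfolding killed_version_def limI[OF killed_approx_tendsto[OF x t]]
  by (rule limI[OF killed_core_tendsto[OF x t]])

lemma emeasure_D_finite: "emeasure lborel D < \<infinity>"
  by (rule emeasure_bounded_finite[OF bounded_D])

lemma integrable_D: "integrable lborel (\<lambda>x. c * indicator D x :: real)"
  by (intro integrable_mult_right integrable_real_indicator) (use emeasure_D_finite in auto)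

text \<open>Positivity of even powers survives the two limits, in the mesh and in the exhaustion.\<close>

lemma killed_positive:
  assumes t: "0 < t"
  shows "0 \<le> (\<integral>x. indicator D x * (g x * killed_version t x) \<partial>lborel)"
proof -
  define k where "k m x = lim (\<lambda>n. killed_approx g m n t x)" for m x
  have am: "(\<lambda>x. killed_approx g m n t x) \<in> borel_measurable borel" for m n
    using measurable_compose[OF measurable_Pair1'[of t borel borel] measurable_killed_approx[OF g, of m n]] by simp
  have km: "k m \<in> borel_measurable borel" for m
    unfolding k_def[abs_def] by (intro borel_measurable_lim_metric am)
  have vm: "killed_version t \<in> borel_measurable borel"
    unfolding killed_version_def[abs_def] using km[unfolded k_def[abs_def]] by (rule borel_measurable_lim_metric)
  note [measurable] = am km vm
  have lim_n: "(\<lambda>n. killed_approx g m n t x) \<longlonglongrightarrow> k m x" if "x \<in> D" for m x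
    using killed_approx_tendsto[OF that t, of m] limI[OF killed_approx_tendsto[OF that t, of m]] by (simp add: k_def)
  have kb: "\<bar>k m x\<bar> \<le> C" if "x \<in> D" for m x
    using killed_core_bound[OF that t, of m] limI[OF killed_approx_tendsto[OF that t, of m]] by (simp add: k_def)
  have lim_m: "(\<lambda>m. k m x) \<longlonglongrightarrow> killed_version t x" if "x \<in> D" for x
    using killed_core_tendsto[OF that t] limI[OF killed_approx_tendsto[OF that t]] killed_version_eq[OF that t]
    by (simp add: k_def)
  have dom: "norm (indicator D x * (g x * r)) \<le> C * C * indicator D x" if "x \<in> D \<Longrightarrow> \<bar>r\<bar> \<le> C" for x r
    using that bd[of x] bound_nonneg by (auto simp: indicator_def abs_mult intro!: mult_mono)
  have pos_n: "0 \<le> (\<integral>x. indicator D x * (g x * killed_approx g m n t x) \<partial>lborel)" for m n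
  proof -
    have eq: "indicator D x * (g x * killed_approx g m n t x)
       = indicator (core m) x * (g x * (gauss_step (t / real (Suc (Suc (2 * n)))) (core m) ^^ (2 * Suc n)) g x)" for x
      using subsetD[OF core_subset, of x m] by (auto simp: killed_approx_def indicator_def)
    have "emeasure lborel (core m) < \<infinity>"
      using bounded_subset[OF bounded_D core_subset] by (rule emeasure_bounded_finite)
    then show ?thesis unfolding eq
      using t by (intro gauss_step_even_power_nonneg[OF _ borel_core _ g bd]) auto
  qed
  have pos_m: "0 \<le> (\<integral>x. indicator D x * (g x * k m x) \<partial>lborel)" for m
  proof (rule LIMSEQ_le_const)
    show "(\<lambda>n. \<integral>x. indicator D x * (g x * killed_approx g m n t x) \<partial>lborel) \<longlonglongrightarrow> (\<integral>x. indicator D x * (g x * k m x) \<partial>lborel)"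
    proof (rule integral_dominated_convergence[OF _ _ integrable_D[of "C * C"]])
      show "AE x in lborel. (\<lambda>n. indicator D x * (g x * killed_approx g m n t x)) \<longlonglongrightarrow> indicator D x * (g x * k m x)"
        using lim_n by (intro AE_I2) (auto simp: indicator_def intro!: tendsto_mult)
      show "AE x in lborel. norm (indicator D x * (g x * killed_approx g m n t x)) \<le> C * C * indicator D x" for n
        using killed_approx_bound[OF t] by (intro AE_I2 dom) auto
    qed measurable
  qed (use pos_n in auto)
  show ?thesis
  proof (rule LIMSEQ_le_const)
    show "(\<lambda>m. \<integral>x. indicator D x * (g x * k m x) \<partial>lborel) \<longlonglongrightarrow> (\<integral>x. indicator D x * (g x * killed_version t x) \<partial>lborel)"
    proof (rule integral_dominated_convergence[OF _ _ integrable_D[of "C * C"]])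
      show "AE x in lborel. (\<lambda>m. indicator D x * (g x * k m x)) \<longlonglongrightarrow> indicator D x * (g x * killed_version t x)"
        using lim_m by (intro AE_I2) (auto simp: indicator_def intro!: tendsto_mult)
      show "AE x in lborel. norm (indicator D x * (g x * k m x)) \<le> C * C * indicator D x" for m
        using kb by (intro AE_I2 dom) auto
    qed measurable
  qed (use pos_m in auto)
qed

lemma killed_bound:
  assumes x: "x \<in> D" and t: "0 < t"
  shows "\<bar>killed g t x\<bar> \<le> C * measure (W x) {\<omega> \<in> space (W x). alive D t \<omega>}"
proof -
  interpret prob_space "W x" by (rule prob_space_W[OF x])
  have [measurable]: "B t \<in> borel_measurable (W x)" using measurable_B[OF x] t by simp
  have [measurable]: "Measurable.pred (W x) (alive D t)" by (rule pred_alive[OF x])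
  have i: "integrable (W x) (\<lambda>\<omega>. indicator {\<omega>. alive D t \<omega>} \<omega> * g (B t \<omega>))"
    by (rule integrable_const_bound[where B=C]) (use bd bound_nonneg in \<open>auto simp: indicator_def\<close>)
  have ev: "{\<omega> \<in> space (W x). alive D t \<omega>} \<in> events" by measurable
  have "\<bar>killed g t x\<bar> \<le> (\<integral>\<omega>. \<bar>indicator {\<omega>. alive D t \<omega>} \<omega> * g (B t \<omega>)\<bar> \<partial>W x)"
    unfolding killed_def by (rule integral_abs_bound)
  also have "\<dots> \<le> (\<integral>\<omega>. C * indicator {\<omega> \<in> space (W x). alive D t \<omega>} \<omega> \<partial>W x)"
  proof (rule integral_mono[OF integrable_abs[OF i]])
    show "integrable (W x) (\<lambda>\<omega>. C * indicator {\<omega> \<in> space (W x). alive D t \<omega>} \<omega>)"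
      using ev by (intro integrable_mult_right integrable_real_indicator) (auto simp: less_top[symmetric])
  qed (use bd in \<open>auto simp: indicator_def\<close>)
  also have "\<dots> = C * prob {\<omega> \<in> space (W x). alive D t \<omega>}" using ev by simp
  finally show ?thesis .
qed

lemma integrable_green: "x \<in> D \<Longrightarrow> integrable (green x) g"
  by (rule finite_measure.integrable_const_bound[OF finite_measure_green, where B=C]) (use bd in auto)

lemma integral_green_time:
  assumes x: "x \<in> D"
  shows "(\<integral>y. g y \<partial>green x) = (\<integral>t. indicator {0<..} t * killed g t x \<partial>lborel)"
    "(\<lambda>t. indicator {0<..} t * killed g t x) \<in> borel_measurable borel"
proof -
  interpret prob_space "W x" by (rule prob_space_W[OF x])
  interpret WL: pair_sigma_finite "W x" "lborel :: real measure" ..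
  note [measurable] = measurable_B_lborel[OF x] measurable_lifetime_indicator[OF x]
  have i: "integrable (W x \<Otimes>\<^sub>M lborel) (\<lambda>p. indicator lifetime_set p * g (B (max 0 (snd p)) (fst p)))"
  proof (rule Bochner_Integration.integrable_bound[OF integrable_mult_right[OF integrable_lifetime[OF x], of C]])
    show "AE p in W x \<Otimes>\<^sub>M lborel. norm (indicator lifetime_set p * g (B (max 0 (snd p)) (fst p))) \<le> norm (C * indicator lifetime_set p)"
      using bd bound_nonneg by (intro AE_I2) (auto simp: indicator_def)
  qed measurable
  have i': "integrable (W x \<Otimes>\<^sub>M lborel) (\<lambda>(\<omega>, t). indicator lifetime_set (\<omega>, t) * g (B (max 0 t) \<omega>))"
    using i unfolding case_prod_beta prod.collapse .
  have km: "(\<lambda>t. indicator {0<..} t * killed g t x) \<in> borel_measurable borel"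
  proof -
    have "(\<lambda>t. killed_version t x) \<in> borel_measurable borel"
      using measurable_compose[OF measurable_Pair2'[of x borel borel] measurable_killed_version] by simp
    then have "(\<lambda>t. indicator {0<..} t * killed_version t x) \<in> borel_measurable borel" by measurable
    moreover have "(\<lambda>t. indicator {0<..} t * killed_version t x) = (\<lambda>t. indicator {0<..} t * killed g t x)"
      using killed_version_eq[OF x] by (auto simp: fun_eq_iff indicator_def)
    ultimately show ?thesis by simp
  qed
  then show "(\<lambda>t. indicator {0<..} t * killed g t x) \<in> borel_measurable borel" .
  have "(\<integral>y. g y \<partial>green x) = (\<integral>p. (case p of (\<omega>, t) \<Rightarrow> indicator lifetime_set (\<omega>, t) * g (B (max 0 t) \<omega>)) \<partial>(W x \<Otimes>\<^sub>M lborel))"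
    unfolding integral_green[OF x g] by (simp add: case_prod_beta)
  also have "\<dots> = (\<integral>t. (\<integral>\<omega>. indicator lifetime_set (\<omega>, t) * g (B (max 0 t) \<omega>) \<partial>W x) \<partial>lborel)"
    by (rule WL.integral_snd[symmetric, OF i'])
  also have "\<dots> = (\<integral>t. indicator {0<..} t * killed g t x \<partial>lborel)"
  proof (rule integral_cong_AE)
    show "(\<lambda>t. \<integral>\<omega>. indicator lifetime_set (\<omega>, t) * g (B (max 0 t) \<omega>) \<partial>W x) \<in> borel_measurable lborel"
      by (rule borel_measurable_integrable[OF WL.integrable_snd[OF i']])
    show "(\<lambda>t. indicator {0<..} t * killed g t x) \<in> borel_measurable lborel" using km by simp
    show "AE t in lborel. (\<integral>\<omega>. indicator lifetime_set (\<omega>, t) * g (B (max 0 t) \<omega>) \<partial>W x) = indicator {0<..} t * killed g t x"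
      using AE_lborel_singleton[of "0::real"]
    proof eventually_elim
      case (elim t)
      show ?case
      proof (cases "0 < t")
        case True
        have "(\<integral>\<omega>. indicator lifetime_set (\<omega>, t) * g (B (max 0 t) \<omega>) \<partial>W x) = killed g t x"
          unfolding killed_def
          by (rule Bochner_Integration.integral_cong[OF refl])
            (use True less_exit_time_iff[OF x, of _ t] in \<open>auto simp: lifetime_set_def indicator_def\<close>)
        then show ?thesis using True by simp
      next
        case False
        then show ?thesis using elim by (simp add: lifetime_set_def)
      qed
    qed
  qed
  finally show "(\<integral>y. g y \<partial>green x) = (\<integral>t. indicator {0<..} t * killed g t x \<partial>lborel)" .
qed

text \<open>The Green operator is the time integral of the killed semigroup, so its positivity is inherited
  from each time. The survival bound dominates the integrand and justifies Fubini.\<close>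

lemma green_positive:
  shows "0 \<le> (\<integral>x. indicator D x * (g x * (\<integral>y. g y \<partial>green x)) \<partial>lborel)"
    and "(\<lambda>x. indicator D x * (\<integral>y. g y \<partial>green x)) \<in> borel_measurable borel"
proof -
  obtain \<beta> where \<beta>: "integrable lborel \<beta>" "\<And>t. 0 \<le> \<beta> t"
    "\<And>x t. x \<in> D \<Longrightarrow> 0 \<le> t \<Longrightarrow> measure (W x) {\<omega> \<in> space (W x). alive D t \<omega>} \<le> \<beta> t"
    using survival_bound by blast
  have [measurable]: "\<beta> \<in> borel_measurable borel" using borel_measurable_integrable[OF \<beta>(1)] by simp
  define V where "V t x = indicator {0<..} t * killed_version t x" for t x
  have [measurable]: "(\<lambda>q. killed_version (snd q) (fst q)) \<in> borel_measurable (lborel \<Otimes>\<^sub>M lborel)"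
  proof -
    have "(\<lambda>q. (snd q, fst q)) \<in> measurable (lborel \<Otimes>\<^sub>M lborel) (borel \<Otimes>\<^sub>M borel)" by measurable
    from measurable_compose[OF this measurable_killed_version] show ?thesis by simp
  qed
  have Vm [measurable]: "(\<lambda>q. V (snd q) (fst q)) \<in> borel_measurable (lborel \<Otimes>\<^sub>M lborel)"
    unfolding V_def by measurable
  have green_eq: "(\<integral>y. g y \<partial>green x) = (\<integral>t. V t x \<partial>lborel)" if "x \<in> D" for x
  proof -
    have "(\<lambda>t. V t x) = (\<lambda>t. indicator {0<..} t * killed g t x)"
      using killed_version_eq[OF that] by (auto simp: V_def indicator_def fun_eq_iff)
    then show ?thesis using integral_green_time(1)[OF that] by simp
  qed
  have "(\<lambda>x. \<integral>t. V t x \<partial>lborel) \<in> borel_measurable borel"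
    using lborel.borel_measurable_lebesgue_integral[of "\<lambda>x t. V t x" lborel] Vm by (simp add: case_prod_beta)
  then have "(\<lambda>x. indicator D x * (\<integral>t. V t x \<partial>lborel)) \<in> borel_measurable borel" by measurable
  moreover have "(\<lambda>x. indicator D x * (\<integral>t. V t x \<partial>lborel)) = (\<lambda>x. indicator D x * (\<integral>y. g y \<partial>green x))"
    using green_eq by (auto simp: fun_eq_iff indicator_def)
  ultimately show "(\<lambda>x. indicator D x * (\<integral>y. g y \<partial>green x)) \<in> borel_measurable borel" by simp
  have Vb: "\<bar>V t x\<bar> \<le> C * \<beta> t" if "x \<in> D" for t x
  proof (cases "0 < t")
    case True
    then have "\<bar>V t x\<bar> \<le> C * measure (W x) {\<omega> \<in> space (W x). alive D t \<omega>}"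
      using killed_bound[OF that True] killed_version_eq[OF that True] by (simp add: V_def)
    also have "\<dots> \<le> C * \<beta> t" using \<beta>(3)[OF that, of t] True bound_nonneg by (intro mult_left_mono) auto
    finally show ?thesis .
  next
    case False then show ?thesis using \<beta>(2) bound_nonneg by (simp add: V_def)
  qed
  define F where "F x t = indicator D x * (g x * V t x)" for x t
  have Fm [measurable]: "(\<lambda>(x, t). F x t) \<in> borel_measurable (lborel \<Otimes>\<^sub>M lborel)"
    unfolding F_def case_prod_beta by measurable
  have dom: "integrable (lborel \<Otimes>\<^sub>M lborel) (\<lambda>(x, t). (C * C * indicator D x) * \<beta> t)"
  proof -
    have m: "(\<lambda>(x, t). (C * C * indicator D x) * \<beta> t) \<in> borel_measurable (lborel \<Otimes>\<^sub>M lborel)"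
      unfolding case_prod_beta by measurable
    have "(\<integral>t. norm ((C * C * indicator D x) * \<beta> t) \<partial>lborel) = ((\<integral>t. \<beta> t \<partial>lborel) * C * C) * indicator D x" for x
    proof -
      have "(\<integral>t. norm ((C * C * indicator D x) * \<beta> t) \<partial>lborel) = (\<integral>t. (C * C * indicator D x) * \<beta> t \<partial>lborel)"
        using \<beta>(2) bound_nonneg by (intro Bochner_Integration.integral_cong refl) (simp add: abs_mult)
      then show ?thesis by simp
    qed
    then have i1: "integrable lborel (\<lambda>x. \<integral>t. norm ((C * C * indicator D x) * \<beta> t) \<partial>lborel)"
      using integrable_D[of "(\<integral>t. \<beta> t \<partial>lborel) * C * C"] by (simp only:)
    have i2: "AE x in lborel. integrable lborel (\<lambda>t. (C * C * indicator D x) * \<beta> t)"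
      by (intro AE_I2 integrable_mult_right \<beta>(1))
    show ?thesis by (rule lborel_pair.Fubini_integrable[OF m]) (simp_all only: prod.case i1 i2)
  qed
  have Fi: "integrable (lborel \<Otimes>\<^sub>M lborel) (\<lambda>(x, t). F x t)"
  proof (rule Bochner_Integration.integrable_bound[OF dom Fm])
    have "\<bar>F x t\<bar> \<le> (C * C * indicator D x) * \<beta> t" for x t
    proof (cases "x \<in> D")
      case True
      have "\<bar>g x\<bar> * \<bar>V t x\<bar> \<le> C * (C * \<beta> t)"
        using bd[of x] Vb[OF True, of t] bound_nonneg by (intro mult_mono) auto
      then show ?thesis using True by (simp add: F_def abs_mult mult.assoc)
    qed (simp add: F_def)
    then show "AE q in lborel \<Otimes>\<^sub>M lborel. norm (case q of (x, t) \<Rightarrow> F x t) \<le> norm (case q of (x, t) \<Rightarrow> (C * C * indicator D x) * \<beta> t)"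
      by (intro AE_I2) (auto simp: case_prod_beta intro: order_trans[OF _ abs_ge_self])
  qed
  have "(\<integral>x. indicator D x * (g x * (\<integral>y. g y \<partial>green x)) \<partial>lborel) = (\<integral>x. (\<integral>t. F x t \<partial>lborel) \<partial>lborel)"
    using green_eq by (intro Bochner_Integration.integral_cong refl) (auto simp: F_def indicator_def)
  also have "\<dots> = (\<integral>t. (\<integral>x. F x t \<partial>lborel) \<partial>lborel)"
    by (rule lborel_pair.Fubini_integral[OF Fi, symmetric])
  also have "0 \<le> \<dots>"
  proof (rule integral_nonneg_AE, rule AE_I2)
    fix t
    show "0 \<le> (\<integral>x. F x t \<partial>lborel)"
      using killed_positive[of t] by (cases "0 < t") (auto simp: F_def V_def)
  qed
  finally show "0 \<le> (\<integral>x. indicator D x * (g x * (\<integral>y. g y \<partial>green x)) \<partial>lborel)" .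
qed

end

text \<open>The law of the killed path at a fixed positive time has a bounded density, so the Green measure
  carries convergence in \<open>L\<^sup>1(D)\<close> over to pointwise convergence.\<close>

lemma green_L1_continuity:
  fixes k :: "nat \<Rightarrow> 'a \<Rightarrow> real"
  assumes x: "x \<in> D" and k [measurable]: "\<And>n. k n \<in> borel_measurable borel"
    and bd: "\<And>n y. 0 \<le> k n y" "\<And>n y. k n y \<le> C"
    and L1: "(\<lambda>n. \<integral>y. indicator D y * k n y \<partial>lborel) \<longlonglongrightarrow> 0"
  shows "(\<lambda>n. \<integral>y. k n y \<partial>green x) \<longlonglongrightarrow> 0"
proof -
  interpret prob_space "W x" by (rule prob_space_W[OF x])
  obtain \<beta> where \<beta>: "integrable lborel \<beta>" "\<And>t. 0 \<le> \<beta> t"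
    "\<And>x t. x \<in> D \<Longrightarrow> 0 \<le> t \<Longrightarrow> measure (W x) {\<omega> \<in> space (W x). alive D t \<omega>} \<le> \<beta> t"
    using survival_bound by blast
  have C: "0 \<le> C" using bd[of 0 0] by linarith
  have ab: "\<bar>k n y\<bar> \<le> C" for n y using bd[of n y] by simp
  have "(\<lambda>n. \<integral>t. indicator {0<..} t * killed (k n) t x \<partial>lborel) \<longlonglongrightarrow> (\<integral>t. 0 \<partial>(lborel :: real measure))"
  proof (rule integral_dominated_convergence[OF _ _ integrable_mult_right[OF \<beta>(1), of C]])
    show "(\<lambda>t. indicator {0<..} t * killed (k n) t x) \<in> borel_measurable lborel" for n
      using integral_green_time(2)[OF k ab x] by simp
    show "AE t in lborel. norm (indicator {0<..} t * killed (k n) t x) \<le> C * \<beta> t" for n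
    proof (rule AE_I2)
      fix t :: real
      show "norm (indicator {0<..} t * killed (k n) t x) \<le> C * \<beta> t"
      proof (cases "0 < t")
        case True
        have "\<bar>killed (k n) t x\<bar> \<le> C * measure (W x) {\<omega> \<in> space (W x). alive D t \<omega>}"
          by (rule killed_bound[OF k ab x True])
        also have "\<dots> \<le> C * \<beta> t" using \<beta>(3)[OF x, of t] True C by (intro mult_left_mono) auto
        finally show ?thesis using True by simp
      qed (use \<beta>(2) C in simp)
    qed
    show "AE t in lborel. (\<lambda>n. indicator {0<..} t * killed (k n) t x) \<longlonglongrightarrow> 0"
    proof (rule AE_I2)
      fix t :: real
      show "(\<lambda>n. indicator {0<..} t * killed (k n) t x) \<longlonglongrightarrow> 0"
      proof (cases "0 < t")
        case True
        have [measurable]: "B t \<in> borel_measurable (W x)" using measurable_B[OF x] True by simp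
        have [measurable]: "Measurable.pred (W x) (alive D t)" by (rule pred_alive[OF x])
        define p where "p = (1 / sqrt (2 * pi * t)) ^ DIM('a)"
        have p: "0 \<le> p" using True by (simp add: p_def)
        have kn: "0 \<le> killed (k n) t x" "killed (k n) t x \<le> p * (\<integral>y. indicator D y * k n y \<partial>lborel)" for n
        proof -
          have i: "integrable (W x) (\<lambda>\<omega>. indicator {\<omega>. alive D t \<omega>} \<omega> * k n (B t \<omega>))"
            by (rule integrable_const_bound[where B=C]) (use ab C in \<open>auto simp: indicator_def\<close>)
          have iD: "integrable lborel (\<lambda>y. indicator D y * k n y)"
            by (rule Bochner_Integration.integrable_bound[OF integrable_D[OF k[of n] ab, of C]])
              (use ab C in \<open>auto simp: indicator_def\<close>)
          show 0: "0 \<le> killed (k n) t x" unfolding killed_def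
            using bd by (intro integral_nonneg_AE AE_I2) auto
          have "ennreal (killed (k n) t x) = (\<integral>\<^sup>+ \<omega>. ennreal (indicator {\<omega>. alive D t \<omega>} \<omega> * k n (B t \<omega>)) \<partial>W x)"
            unfolding killed_def using bd by (intro nn_integral_eq_integral[symmetric] i AE_I2) auto
          also have "\<dots> = (\<integral>\<^sup>+ \<omega>. ennreal (k n (B t \<omega>)) * indicator {\<omega>. alive D t \<omega>} \<omega> \<partial>W x)"
            by (intro nn_integral_cong) (simp add: indicator_def)
          also have "\<dots> \<le> ennreal p * (\<integral>\<^sup>+ y. ennreal (k n y) * indicator D y \<partial>lborel)"
            unfolding p_def by (rule nn_integral_killed_le[OF x True]) measurable
          also have "(\<integral>\<^sup>+ y. ennreal (k n y) * indicator D y \<partial>lborel) = (\<integral>\<^sup>+ y. ennreal (indicator D y * k n y) \<partial>lborel)"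
            by (intro nn_integral_cong) (simp add: indicator_def)
          also have "\<dots> = ennreal (\<integral>y. indicator D y * k n y \<partial>lborel)"
            using bd by (intro nn_integral_eq_integral iD AE_I2) auto
          also have "ennreal p * \<dots> = ennreal (p * (\<integral>y. indicator D y * k n y \<partial>lborel))"
            using p bd by (intro ennreal_mult[symmetric]) (auto intro!: integral_nonneg_AE AE_I2)
          finally show "killed (k n) t x \<le> p * (\<integral>y. indicator D y * k n y \<partial>lborel)"
            using p bd by (subst (asm) ennreal_le_iff) (auto intro!: mult_nonneg_nonneg integral_nonneg_AE AE_I2)
        qed
        have "(\<lambda>n. killed (k n) t x) \<longlonglongrightarrow> 0"
        proof (rule tendsto_sandwich[OF _ _ tendsto_const])
          show "(\<lambda>n. p * (\<integral>y. indicator D y * k n y \<partial>lborel)) \<longlonglongrightarrow> 0"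
            using tendsto_mult[OF tendsto_const[of p] L1] by simp
        qed (use kn in auto)
        then show ?thesis using True by simp
      qed simp
    qed
  qed simp
  then show ?thesis unfolding integral_green_time(1)[OF k ab x] by simp
qed

end

section \<open>Occupation of thin boundary strips\<close>

context killed_brownian_motion
begin

lemma in_D_of_core:
  assumes "y \<in> core m" "norm v < 1 / real (Suc m)" shows "y + v \<in> D"
proof (rule ccontr)
  assume "y + v \<notin> D"
  then have "infdist y (- D) \<le> dist y (y + v)" by (intro infdist_le) simp
  also have "\<dots> = norm v" by (simp add: dist_norm)
  finally show False using assms by (simp add: core_def)
qed

lemma boundary_bump_bounded:
  assumes "\<And>y. \<bar>\<phi> y\<bar> \<le> M" "0 < e" "e \<le> 1" shows "\<bar>boundary_bump D \<phi> e y\<bar> \<le> M"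
proof -
  have M: "0 \<le> M" using assms(1)[of 0] by linarith
  have r: "0 \<le> ramp e (infdist y (- D))" "ramp e (infdist y (- D)) \<le> 1"
    using assms(2,3) infdist_nonneg[of y "- D"] by (auto simp: ramp_def)
  then have "ramp e (infdist y (- D)) ^ 3 \<le> 1" by (rule power_le_one)
  then have "ramp e (infdist y (- D)) ^ 3 / 3 \<le> 1" by simp
  then have "\<bar>\<phi> y\<bar> * (ramp e (infdist y (- D)) ^ 3 / 3) \<le> M * 1"
    using assms(1) M r by (intro mult_mono) auto
  then show ?thesis using r by (simp add: boundary_bump_def abs_mult)
qed

lemma continuous_ramp_infdist: "continuous_on UNIV (\<lambda>y. ramp e (infdist y (- D)))"
  unfolding ramp_def by (intro continuous_intros)

text \<open>The expansion of the bump holds only for steps that stay in \<open>D\<close>. Steps from \<open>core m\<close> that leave \<open>D\<close> are longer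
  than a fixed radius, so boundedness of the bump yields a cubic bound for them.\<close>

lemma boundary_bump_step:
  fixes \<phi> :: "'a \<Rightarrow> real"
  assumes R: "0 < R" "\<And>z. z \<in> frontier D \<Longrightarrow> tangent_balls D R z"
    and \<phi>: "quadratically_approximable \<phi> D M" "\<And>y. \<bar>\<phi> y\<bar> \<le> M" "continuous_on UNIV \<phi>"
    and e: "0 < e" "e \<le> R / 2" "e \<le> 1"
  shows "\<exists>C'\<ge>0. \<forall>h y. 0 < h \<longrightarrow> h \<le> 1 \<longrightarrow> y \<in> core m \<longrightarrow>
     \<bar>(\<integral>v. boundary_bump D \<phi> e (y + v) \<partial>gauss h) - boundary_bump D \<phi> e y - h * (\<phi> y * ramp e (infdist y (- D)))\<bar>
     \<le> h * ((M / R + 2 * M) * real DIM('a) * e * ramp e (infdist y (- D))) + C' * (h * sqrt h)"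
proof -
  define f where "f = boundary_bump D \<phi> e"
  define r where "r = 1 / real (Suc m)"
  have r: "0 < r" "r \<le> 1" by (auto simp: r_def)
  have M: "0 \<le> M" using \<phi>(1) by (simp add: quadratically_approximable_def)
  have fb: "\<bar>f y\<bar> \<le> M" for y unfolding f_def by (rule boundary_bump_bounded[OF \<phi>(2) e(1,3)])
  have fm: "f \<in> borel_measurable borel"
    unfolding f_def boundary_bump_def[abs_def]
    by (intro borel_measurable_continuous_onI continuous_intros \<phi>(3) continuous_ramp_infdist) simp
  define C where "C = (2 * M / R + 5 * M) + M * (2 / r^3 + 2 / r^2 + 1 / r)"
  have C1: "2 * M / R + 5 * M \<le> C" using M r by (simp add: C_def)
  have C2: "M * (2 / r^3 + 2 / r^2 + 1 / r) \<le> C" using M R(1) by (simp add: C_def)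
  have C: "0 \<le> C" using C1 M R(1) by (intro order_trans[OF _ C1]) auto
  have "\<bar>(\<integral>v. f (y + v) \<partial>gauss h) - f y - h * (\<phi> y * ramp e (infdist y (- D)))\<bar>
     \<le> h * ((M / R + 2 * M) * real DIM('a) * e * ramp e (infdist y (- D))) + C * (2 * (real DIM('a))^2) * (h * sqrt h)"
    if h: "0 < h" and y: "y \<in> core m" for h y
  proof -
    define \<kappa> where "\<kappa> = ramp e (infdist y (- D))"
    have yD: "y \<in> D" using core_subset y by blast
    have \<kappa>: "0 \<le> \<kappa>" "\<kappa> \<le> 1" using e infdist_nonneg[of y "- D"] by (auto simp: \<kappa>_def ramp_def)
    obtain n l where n: "norm n = 1" and l: "norm l \<le> 2 * M" and ex: "\<And>v. y + v \<in> D \<Longrightarrow> norm v \<le> 1 \<Longrightarrow>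
       \<bar>f (y + v) - f y - l \<bullet> v - (\<phi> y * \<kappa>) * (n \<bullet> v)^2\<bar>
         \<le> (M / R + 2 * M) * e * \<kappa> * (norm v)^2 + (2 * M / R + 5 * M) * (norm v)^3"
      using boundary_bump_expansion[OF open_D D_neq_UNIV R \<phi>(1) e yD] unfolding f_def \<kappa>_def by metis
    have c0: "0 \<le> (M / R + 2 * M) * e * \<kappa>" using M R(1) e \<kappa> by simp
    have "\<bar>f (y + v) - f y - l \<bullet> v - (\<phi> y * \<kappa>) * (n \<bullet> v)^2\<bar>
         \<le> (M / R + 2 * M) * e * \<kappa> * (norm v)^2 + C * (norm v)^3" for v
    proof (cases "norm v < r")
      case True
      have "(2 * M / R + 5 * M) * (norm v)^3 \<le> C * (norm v)^3" using C1 by (intro mult_right_mono) auto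
      moreover have "y + v \<in> D" using in_D_of_core[OF y] True by (simp add: r_def)
      ultimately show ?thesis using ex[of v] True r by linarith
    next
      case False
      \<comment> \<open>for large \<open>v\<close> the cubic term alone dominates, as \<open>f\<close> is bounded\<close>
      define a where "a = norm v"
      have a: "r \<le> a" using False by (simp add: a_def)
      have a1: "1 \<le> a / r" using a r by simp
      have p1: "1 \<le> a^3 / r^3" using one_le_power[OF a1, of 3] by (simp add: power_divide)
      have p2: "a \<le> a^3 / r^2"
      proof -
        have "a * 1 \<le> a * (a / r)^2" using one_le_power[OF a1, of 2] a r by (intro mult_left_mono) auto
        then show ?thesis by (simp add: power_divide power2_eq_square power3_eq_cube mult.assoc)
      qed
      have p3: "a^2 \<le> a^3 / r"
      proof -
        have "a^2 * 1 \<le> a^2 * (a / r)" using a1 by (intro mult_left_mono) auto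
        then show ?thesis by (simp add: power2_eq_square power3_eq_cube)
      qed
      have q1: "\<bar>l \<bullet> v\<bar> \<le> 2 * M * a"
        using Cauchy_Schwarz_ineq2[of l v] mult_right_mono[OF l, of a] by (simp add: a_def)
      have q2: "\<bar>(\<phi> y * \<kappa>) * (n \<bullet> v)^2\<bar> \<le> M * a^2"
      proof -
        have "\<bar>n \<bullet> v\<bar> \<le> a" using Cauchy_Schwarz_ineq2[of n v] n by (simp add: a_def)
        then have "(n \<bullet> v)^2 \<le> a^2" using power_mono[of "\<bar>n \<bullet> v\<bar>" a 2] by simp
        moreover have "\<bar>\<phi> y\<bar> * \<kappa> \<le> M * 1" using \<phi>(2)[of y] \<kappa> M by (intro mult_mono) auto
        ultimately have "(\<bar>\<phi> y\<bar> * \<kappa>) * (n \<bullet> v)^2 \<le> M * a^2" using M \<kappa> by (intro mult_mono) auto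
        then show ?thesis using \<kappa> by (simp add: abs_mult)
      qed
      have "\<bar>f (y + v) - f y - l \<bullet> v - (\<phi> y * \<kappa>) * (n \<bullet> v)^2\<bar> \<le> M * 2 + M * (2 * a) + M * a^2"
        using fb[of "y + v"] fb[of y] q1 q2 by linarith
      also have "\<dots> \<le> M * (2 * (a^3 / r^3)) + M * (2 * (a^3 / r^2)) + M * (a^3 / r)"
        using p1 p2 p3 M by (intro add_mono mult_left_mono) auto
      also have "\<dots> = M * (2 / r^3 + 2 / r^2 + 1 / r) * a^3" by (simp add: algebra_simps)
      also have "\<dots> \<le> C * a^3" using C2 a r by (intro mult_right_mono) auto
      finally show ?thesis using mult_nonneg_nonneg[OF c0, of "(norm v)^2"] by (simp add: a_def)
    qed
    from gauss_one_step(2)[OF h fm n C this] show ?thesis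
      by (simp add: \<kappa>_def[symmetric] mult_ac)
  qed
  then show ?thesis unfolding f_def[symmetric] using C
    by (intro exI[of _ "C * (2 * (real DIM('a))^2)"]) simp
qed

text \<open>Dynkin's formula for the boundary bump. Since the error is itself controlled by the occupation
  of the strip, the case \<open>\<phi> = 1\<close> bounds that occupation without any prior estimate.\<close>

lemma bump_occupation_estimate:
  fixes \<phi> :: "'a \<Rightarrow> real"
  assumes x: "x \<in> D" and R: "0 < R" "\<And>z. z \<in> frontier D \<Longrightarrow> tangent_balls D R z"
    and \<phi>: "quadratically_approximable \<phi> D M" "\<And>y. \<bar>\<phi> y\<bar> \<le> M" "continuous_on UNIV \<phi>"
    and e: "0 < e" "e \<le> R / 2" "e \<le> 1"
  shows "\<bar>e^3 / 3 * (\<integral>y. \<phi> y \<partial>exit_law x) - \<phi> x * (ramp e (infdist x (- D)) ^ 3 / 3)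
      - (\<integral>y. \<phi> y * ramp e (infdist y (- D)) \<partial>green x)\<bar>
    \<le> (M / R + 2 * M) * real DIM('a) * e * (\<integral>y. ramp e (infdist y (- D)) \<partial>green x)"
proof -
  have M: "0 \<le> M" using \<phi>(1) by (simp add: quadratically_approximable_def)
  define q where "q = (M / R + 2 * M) * real DIM('a) * e"
  have q: "0 \<le> q" using M R e by (simp add: q_def)
  have \<kappa>: "\<bar>ramp e (infdist y (- D))\<bar> \<le> 1" for y using e infdist_nonneg[of y "- D"] by (auto simp: ramp_def)
  have b1: "\<bar>boundary_bump D \<phi> e y\<bar> \<le> max M q" for y
    using boundary_bump_bounded[of \<phi> M e y, OF \<phi>(2) e(1,3)] by simp
  have b2: "\<bar>\<phi> y * ramp e (infdist y (- D))\<bar> \<le> max M q" for y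
    using mult_mono[OF \<phi>(2)[of y] \<kappa>[of y] M] by (simp add: abs_mult le_max_iff_disj)
  have b3: "\<bar>q * ramp e (infdist y (- D))\<bar> \<le> max M q" for y
    using mult_left_mono[OF \<kappa>[of y] q] q by (simp add: abs_mult le_max_iff_disj)
  have "\<bar>(\<integral>y. boundary_bump D \<phi> e y \<partial>exit_law x) - boundary_bump D \<phi> e x
      - (\<integral>y. \<phi> y * ramp e (infdist y (- D)) \<partial>green x)\<bar> \<le> (\<integral>y. q * ramp e (infdist y (- D)) \<partial>green x)"
  proof (rule dynkin_estimate[OF x _ _ _ b1 b2 b3])
    show "continuous_on UNIV (boundary_bump D \<phi> e)"
      unfolding boundary_bump_def[abs_def] by (intro continuous_intros \<phi>(3) continuous_ramp_infdist) simp
    show "continuous_on UNIV (\<lambda>y. \<phi> y * ramp e (infdist y (- D)))"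
      by (intro continuous_intros \<phi>(3) continuous_ramp_infdist)
    show "continuous_on UNIV (\<lambda>y. q * ramp e (infdist y (- D)))"
      by (intro continuous_intros continuous_ramp_infdist)
  qed (unfold q_def, rule boundary_bump_step[OF R \<phi> e])
  moreover have "(\<integral>y. boundary_bump D \<phi> e y \<partial>exit_law x) = (\<integral>y. e^3 / 3 * \<phi> y \<partial>exit_law x)"
  proof (rule integral_cong_AE)
    show "AE y in exit_law x. boundary_bump D \<phi> e y = e^3 / 3 * \<phi> y"
      using AE_exit_law_frontier[OF x]
    proof eventually_elim
      case (elim y)
      then have "infdist y (- D) = 0" using open_D by (intro infdist_zero) (simp add: frontier_def interior_open)
      then show ?case using e(1) by (simp add: boundary_bump_def ramp_def)
    qed
    show "boundary_bump D \<phi> e \<in> borel_measurable (exit_law x)"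
    proof -
      have "continuous_on UNIV (boundary_bump D \<phi> e)"
        unfolding boundary_bump_def[abs_def] by (intro continuous_intros \<phi>(3) continuous_ramp_infdist) simp
      then have "boundary_bump D \<phi> e \<in> borel_measurable borel" by (rule borel_measurable_continuous_onI)
      then show ?thesis by simp
    qed
    show "(\<lambda>y. e^3 / 3 * \<phi> y) \<in> borel_measurable (exit_law x)"
      using borel_measurable_continuous_onI[OF \<phi>(3)] by simp
  qed
  ultimately show ?thesis unfolding q_def by (simp add: boundary_bump_def)
qed

text \<open>The error term in Dynkin's formula is at most half the occupation itself for small \<open>e\<close>, and can be
  absorbed.\<close>

lemma ramp_occupation_bound:
  assumes R: "0 < R" "\<And>z. z \<in> frontier D \<Longrightarrow> tangent_balls D R z"
  obtains e0 where "0 < e0" "e0 \<le> R / 2" "e0 \<le> 1"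
    "\<And>x e. x \<in> D \<Longrightarrow> 0 < e \<Longrightarrow> e \<le> e0 \<Longrightarrow> (\<integral>y. ramp e (infdist y (- D)) \<partial>green x) \<le> e^3"
proof -
  define c where "c = (1 / R + 2) * real DIM('a)"
  have c: "0 < c" using R(1) by (simp add: c_def add_pos_pos)
  define e0 where "e0 = min (min (R / 2) 1) (1 / (2 * c))"
  have e0: "0 < e0" "e0 \<le> R / 2" "e0 \<le> 1" "e0 \<le> 1 / (2 * c)" using R(1) c by (auto simp: e0_def)
  have qa: "quadratically_approximable (\<lambda>_. 1) D 1"
    unfolding quadratically_approximable_def by (auto intro!: exI[of _ 0])
  have "(\<integral>y. ramp e (infdist y (- D)) \<partial>green x) \<le> e^3" if x: "x \<in> D" and e: "0 < e" "e \<le> e0" for x e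
  proof -
    interpret E: prob_space "exit_law x" by (rule prob_space_exit_law[OF x])
    define A where "A = (\<integral>y. ramp e (infdist y (- D)) \<partial>green x)"
    have A0: "0 \<le> A" unfolding A_def by (intro integral_nonneg_AE AE_I2) simp
    have "\<bar>e^3 / 3 * (\<integral>y. 1 \<partial>exit_law x) - 1 * (ramp e (infdist x (- D)) ^ 3 / 3) - (\<integral>y. 1 * ramp e (infdist y (- D)) \<partial>green x)\<bar>
      \<le> (1 / R + 2 * 1) * real DIM('a) * e * A"
      unfolding A_def using e e0 by (intro bump_occupation_estimate[OF x R qa]) auto
    then have "\<bar>e^3 / 3 - ramp e (infdist x (- D)) ^ 3 / 3 - A\<bar> \<le> c * e * A"
      using E.prob_space by (simp add: A_def c_def)
    moreover have "0 \<le> ramp e (infdist x (- D)) ^ 3 / 3" by simp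
    ultimately have 1: "A \<le> e^3 / 3 + c * e * A" by linarith
    have "c * e \<le> c * (1 / (2 * c))" using e e0 c by (intro mult_left_mono) auto
    then have "c * e \<le> 1 / 2" using c by simp
    then have "c * e * A \<le> 1 / 2 * A" using A0 by (rule mult_right_mono)
    then have "A \<le> e^3 / 3 + 1 / 2 * A" using 1 by linarith
    moreover have "0 \<le> e^3" using e by simp
    ultimately show ?thesis unfolding A_def[symmetric] by linarith
  qed
  with e0 show ?thesis using that by blast
qed

lemma inner_strip_borel [measurable]: "inner_strip D \<epsilon> \<in> sets borel"
proof -
  have "closed {y. infdist y (- D) \<le> \<epsilon>}" by (intro closed_Collect_le continuous_intros)
  then have "D \<inter> {y. infdist y (- D) \<le> \<epsilon>} \<in> sets borel" by (intro sets.Int) auto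
  moreover have "inner_strip D \<epsilon> = D \<inter> {y. infdist y (- D) \<le> \<epsilon>}" by (auto simp: inner_strip_def)
  ultimately show ?thesis by simp
qed

lemma ramp_borel [measurable]: "(\<lambda>y. ramp e (infdist y (- D))) \<in> borel_measurable borel"
  by (rule borel_measurable_continuous_onI[OF continuous_ramp_infdist])

lemma ramp_diff_bounds:
  assumes "a < b"
  shows "r \<le> a \<Longrightarrow> ramp b r - ramp a r = b - a" "0 \<le> ramp b r - ramp a r" "ramp b r - ramp a r \<le> b - a"
    "b < r \<Longrightarrow> ramp b r - ramp a r = 0"
  using assms by (auto simp: ramp_def max_def)

text \<open>\<open>\<epsilon>\<close> times the indicator of the strip lies below the ramp of width \<open>2 \<epsilon>\<close>.\<close>

lemma strip_green_bound:
  assumes R: "0 < R" "\<And>z. z \<in> frontier D \<Longrightarrow> tangent_balls D R z"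
  obtains \<epsilon>0 where "0 < \<epsilon>0" "\<And>x \<epsilon>. x \<in> D \<Longrightarrow> 0 < \<epsilon> \<Longrightarrow> \<epsilon> \<le> \<epsilon>0 \<Longrightarrow> (\<integral>y. indicator (inner_strip D \<epsilon>) y \<partial>green x) \<le> 8 * \<epsilon>^2"
proof -
  obtain e0 where e0: "0 < e0" "e0 \<le> R / 2" "e0 \<le> 1"
    "\<And>x e. x \<in> D \<Longrightarrow> 0 < e \<Longrightarrow> e \<le> e0 \<Longrightarrow> (\<integral>y. ramp e (infdist y (- D)) \<partial>green x) \<le> e^3"
    using ramp_occupation_bound[OF R] by metis
  have "(\<integral>y. indicator (inner_strip D \<epsilon>) y \<partial>green x) \<le> 8 * \<epsilon>^2" if x: "x \<in> D" and \<epsilon>: "0 < \<epsilon>" "\<epsilon> \<le> e0 / 2" for x \<epsilon>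
  proof -
    interpret finite_measure "green x" by (rule finite_measure_green[OF x])
    have "\<epsilon> * (\<integral>y. indicator (inner_strip D \<epsilon>) y \<partial>green x) = (\<integral>y. \<epsilon> * indicator (inner_strip D \<epsilon>) y \<partial>green x)" by simp
    also have "\<dots> \<le> (\<integral>y. ramp (2 * \<epsilon>) (infdist y (- D)) \<partial>green x)"
    proof (rule integral_mono)
      show "integrable (green x) (\<lambda>y. \<epsilon> * indicator (inner_strip D \<epsilon>) y)"
        by (intro integrable_mult_right integrable_real_indicator) (auto simp: less_top[symmetric])
      show "integrable (green x) (\<lambda>y. ramp (2 * \<epsilon>) (infdist y (- D)))"
        using \<epsilon> by (intro integrable_const_bound[where B="2 * \<epsilon>"]) (auto intro!: ramp_le simp: infdist_nonneg)
      show "\<epsilon> * indicator (inner_strip D \<epsilon>) y \<le> ramp (2 * \<epsilon>) (infdist y (- D))" for y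
        using \<epsilon> by (auto simp: indicator_def inner_strip_def ramp_def)
    qed
    also have "\<dots> \<le> (2 * \<epsilon>)^3" using \<epsilon> by (intro e0(4)[OF x]) auto
    also have "\<dots> = \<epsilon> * (8 * \<epsilon>^2)" by (simp add: power2_eq_square power3_eq_cube)
    finally show ?thesis using \<epsilon> by simp
  qed
  then show ?thesis using that[of "e0 / 2"] e0(1) by simp
qed

text \<open>With \<open>N\<close> the occupation of the strip of width \<open>\<epsilon>\<close>, weighted by \<open>\<phi> \<ge> 0\<close>, the occupation integral
  of \<open>ramp e\<close> is \<open>\<integral>\<^sub>0\<^sup>e N\<close>. It equals \<open>e\<^sup>3/3\<close> times the exit mean up to \<open>O(e\<^sup>4)\<close>; as \<open>N\<close> is monotone,
  difference quotients at relative distance \<open>\<surd>\<epsilon>\<close> on both sides of \<open>\<epsilon>\<close> determine \<open>N\<close> itself.\<close>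

lemma strip_green_rate:
  fixes \<phi> :: "'a \<Rightarrow> real"
  assumes x: "x \<in> D" and R: "0 < R" "\<And>z. z \<in> frontier D \<Longrightarrow> tangent_balls D R z"
    and \<phi>: "quadratically_approximable \<phi> D M" "\<And>y. \<bar>\<phi> y\<bar> \<le> M" "continuous_on UNIV \<phi>" and nn: "\<And>y. 0 \<le> \<phi> y"
  obtains C \<epsilon>1 where "0 < \<epsilon>1" "\<And>\<epsilon>. 0 < \<epsilon> \<Longrightarrow> \<epsilon> \<le> \<epsilon>1 \<Longrightarrow>
     \<bar>(\<integral>y. indicator (inner_strip D \<epsilon>) y * \<phi> y \<partial>green x) / \<epsilon>^2 - (\<integral>y. \<phi> y \<partial>exit_law x)\<bar> \<le> C * sqrt \<epsilon>"
proof -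
  interpret finite_measure "green x" by (rule finite_measure_green[OF x])
  interpret E: prob_space "exit_law x" by (rule prob_space_exit_law[OF x])
  have M: "0 \<le> M" using \<phi>(1) by (simp add: quadratically_approximable_def)
  have [measurable]: "\<phi> \<in> borel_measurable borel" by (rule borel_measurable_continuous_onI[OF \<phi>(3)])
  obtain e0 where e0: "0 < e0" "e0 \<le> R / 2" "e0 \<le> 1"
    "\<And>x e. x \<in> D \<Longrightarrow> 0 < e \<Longrightarrow> e \<le> e0 \<Longrightarrow> (\<integral>y. ramp e (infdist y (- D)) \<partial>green x) \<le> e^3"
    using ramp_occupation_bound[OF R] by metis
  define \<rho> where "\<rho> y = infdist y (- D)" for y
  have \<rho>x: "0 < \<rho> x"
  proof -
    have "closed (- D)" using open_D by (simp add: closed_def)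
    then show ?thesis using in_closed_iff_infdist_zero[of "- D" x] compl_D_ne x infdist_nonneg[of x "- D"]
      unfolding \<rho>_def by (metis ComplD less_eq_real_def)
  qed
  define H where "H = (\<integral>y. \<phi> y \<partial>exit_law x)"
  have iH: "integrable (exit_law x) \<phi>" by (rule E.integrable_const_bound[where B=M]) (use \<phi>(2) in auto)
  have H: "0 \<le> H" "H \<le> M"
  proof -
    show "0 \<le> H" unfolding H_def using nn by (intro integral_nonneg_AE AE_I2)
    have "H \<le> (\<integral>y. M \<partial>exit_law x)" unfolding H_def using \<phi>(2) by (intro integral_mono iH) (auto simp: abs_le_iff)
    then show "H \<le> M" using E.prob_space by simp
  qed
  define A where "A e = (\<integral>y. \<phi> y * ramp e (\<rho> y) \<partial>green x)" for e
  define N where "N e = (\<integral>y. indicator (inner_strip D e) y * \<phi> y \<partial>green x)" for e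
  define c where "c = (M / R + 2 * M) * real DIM('a)"
  have c: "0 \<le> c" using M R by (simp add: c_def)
  have iA: "integrable (green x) (\<lambda>y. \<phi> y * ramp e (\<rho> y))" if "0 \<le> e" for e
  proof (rule integrable_const_bound[where B = "M * e"])
    have "\<bar>\<phi> y\<bar> * \<bar>ramp e (\<rho> y)\<bar> \<le> M * e" for y
      using \<phi>(2)[of y] M that infdist_nonneg[of y "- D"] by (intro mult_mono) (auto simp: ramp_def \<rho>_def)
    then show "AE y in green x. norm (\<phi> y * ramp e (\<rho> y)) \<le> M * e" by (simp add: abs_mult)
  qed (simp add: \<rho>_def)
  have iN: "integrable (green x) (\<lambda>y. indicator (inner_strip D e) y * \<phi> y)" for e
    by (rule integrable_const_bound[where B = M]) (use \<phi>(2) M in \<open>auto simp: indicator_def\<close>)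
  \<comment> \<open>the bump vanishes at \<open>x\<close> once \<open>e\<close> is at most the distance of \<open>x\<close> to the boundary\<close>
  have A_est: "\<bar>A e - e^3 / 3 * H\<bar> \<le> c * e^4" if e: "0 < e" "e \<le> e0" "e \<le> \<rho> x" for e
  proof -
    have "\<bar>e^3 / 3 * H - \<phi> x * (ramp e (\<rho> x) ^ 3 / 3) - A e\<bar> \<le> c * e * (\<integral>y. ramp e (\<rho> y) \<partial>green x)"
      unfolding H_def A_def c_def \<rho>_def using e e0 by (intro bump_occupation_estimate[OF x R \<phi>]) auto
    moreover have "ramp e (\<rho> x) = 0" using e by (simp add: ramp_def)
    moreover have "c * e * (\<integral>y. ramp e (\<rho> y) \<partial>green x) \<le> c * e * e^3"
      using e0(4)[OF x e(1,2)] c e unfolding \<rho>_def by (intro mult_left_mono) auto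
    moreover have "c * e * e^3 = c * e^4" by (simp add: power3_eq_cube power4_eq_xxxx)
    ultimately show ?thesis by simp
  qed
  \<comment> \<open>\<open>A\<close> is a primitive of the monotone function \<open>N\<close>\<close>
  have upper: "(b - a) * N a \<le> A b - A a" and lower: "A b - A a \<le> (b - a) * N b" if ab: "0 \<le> a" "a < b" for a b
  proof -
    have ia: "A b - A a = (\<integral>y. \<phi> y * (ramp b (\<rho> y) - ramp a (\<rho> y)) \<partial>green x)"
      unfolding A_def right_diff_distrib using ab by (intro Bochner_Integration.integral_diff[symmetric] iA) auto
    have ii: "integrable (green x) (\<lambda>y. \<phi> y * (ramp b (\<rho> y) - ramp a (\<rho> y)))"
      unfolding right_diff_distrib using ab by (intro Bochner_Integration.integrable_diff iA) auto
    have "(b - a) * N a = (\<integral>y. (b - a) * (indicator (inner_strip D a) y * \<phi> y) \<partial>green x)"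
      unfolding N_def by simp
    also have "\<dots> \<le> (\<integral>y. \<phi> y * (ramp b (\<rho> y) - ramp a (\<rho> y)) \<partial>green x)"
    proof (rule integral_mono[OF integrable_mult_right[OF iN] ii])
      fix y
      show "(b - a) * (indicator (inner_strip D a) y * \<phi> y) \<le> \<phi> y * (ramp b (\<rho> y) - ramp a (\<rho> y))"
        using ramp_diff_bounds[OF ab(2), of "\<rho> y"] nn[of y]
        by (auto simp: indicator_def inner_strip_def \<rho>_def mult.commute)
    qed
    finally show "(b - a) * N a \<le> A b - A a" unfolding ia .
    have "(\<integral>y. \<phi> y * (ramp b (\<rho> y) - ramp a (\<rho> y)) \<partial>green x) \<le> (\<integral>y. (b - a) * (indicator (inner_strip D b) y * \<phi> y) \<partial>green x)"
    proof (rule integral_mono_AE[OF ii integrable_mult_right[OF iN]])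
      show "AE y in green x. \<phi> y * (ramp b (\<rho> y) - ramp a (\<rho> y)) \<le> (b - a) * (indicator (inner_strip D b) y * \<phi> y)"
        using AE_green_in_D[OF x]
      proof eventually_elim
        case (elim y)
        show ?case
        proof (cases "\<rho> y \<le> b")
          case True
          then have "y \<in> inner_strip D b" using elim by (simp add: inner_strip_def \<rho>_def)
          then show ?thesis using mult_left_mono[OF ramp_diff_bounds(3)[OF ab(2), of "\<rho> y"] nn[of y]] by (simp add: mult.commute)
        next
          case False
          then show ?thesis using ramp_diff_bounds(4)[OF ab(2), of "\<rho> y"] ab nn[of y] by simp
        qed
      qed
    qed
    also have "\<dots> = (b - a) * N b" unfolding N_def by simp
    finally show "A b - A a \<le> (b - a) * N b" unfolding ia .
  qed
  define \<epsilon>1 where "\<epsilon>1 = min (min (e0 / 2) (\<rho> x / 2)) (1 / 4)"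
  have "\<bar>N \<epsilon> / \<epsilon>^2 - H\<bar> \<le> (2 * M + 32 * c) * sqrt \<epsilon>" if \<epsilon>: "0 < \<epsilon>" "\<epsilon> \<le> \<epsilon>1" for \<epsilon>
  proof -
    define \<eta> where "\<eta> = sqrt \<epsilon>"
    have \<epsilon>': "\<epsilon> \<le> e0 / 2" "\<epsilon> \<le> \<rho> x / 2" "\<epsilon> \<le> 1 / 4" using \<epsilon> by (auto simp: \<epsilon>1_def)
    have "sqrt \<epsilon> \<le> sqrt ((1/2)^2)" using \<epsilon>' by (intro real_sqrt_le_mono) (simp add: power2_eq_square)
    then have \<eta>: "0 < \<eta>" "\<eta> \<le> 1 / 2" "\<eta>^2 = \<epsilon>" using \<epsilon> by (auto simp: \<eta>_def)
    define b a where "b = (1 + \<eta>) * \<epsilon>" and "a = (1 - \<eta>) * \<epsilon>"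
    have b: "\<epsilon> < b" "b \<le> 2 * \<epsilon>" "b - \<epsilon> = \<eta> * \<epsilon>" using \<epsilon> \<eta> by (auto simp: b_def algebra_simps)
    have a: "0 < a" "a < \<epsilon>" "\<epsilon> - a = \<eta> * \<epsilon>" using \<epsilon> \<eta> by (auto simp: a_def algebra_simps)
    have pos: "0 < \<eta> * \<epsilon>" using \<epsilon> \<eta> by simp
    have Ae: "\<bar>A \<epsilon> - \<epsilon>^3 / 3 * H\<bar> \<le> c * \<epsilon>^4" using \<epsilon> \<epsilon>' e0 by (intro A_est) auto
    have "\<bar>A b - b^3 / 3 * H\<bar> \<le> c * b^4" using \<epsilon> \<epsilon>' b by (intro A_est) auto
    also have "c * b^4 \<le> c * (2 * \<epsilon>)^4" using b \<epsilon> c by (intro mult_left_mono power_mono) auto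
    finally have Ab: "\<bar>A b - b^3 / 3 * H\<bar> \<le> 16 * (c * \<epsilon>^4)" by (simp add: power_mult_distrib)
    have "\<bar>A a - a^3 / 3 * H\<bar> \<le> c * a^4" using \<epsilon> \<epsilon>' a by (intro A_est) auto
    also have "c * a^4 \<le> c * \<epsilon>^4" using a c by (intro mult_left_mono power_mono) auto
    finally have Aa: "\<bar>A a - a^3 / 3 * H\<bar> \<le> c * \<epsilon>^4" .
    \<comment> \<open>dividing by the increment \<open>\<eta> \<epsilon>\<close> turns the error \<open>\<epsilon>\<^sup>4\<close> into \<open>\<epsilon>\<^sup>2 \<eta>\<close>, of the same order as the error from
      the cubic; this fixes the choice \<open>\<eta> = \<surd>\<epsilon>\<close>\<close>
    have e4: "\<epsilon>^4 = (\<eta> * \<epsilon>) * (\<epsilon>^2 * \<eta>)"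
    proof -
      have "\<epsilon>^4 = \<epsilon> * \<epsilon> * \<epsilon>^2" by (simp add: power2_eq_square power4_eq_xxxx)
      also have "\<dots> = \<eta>^2 * \<epsilon> * \<epsilon>^2" unfolding \<eta>(3) ..
      finally show ?thesis by (simp add: power2_eq_square mult_ac)
    qed
    have b3: "b^3 / 3 * H - \<epsilon>^3 / 3 * H = (\<eta> * \<epsilon>) * (\<epsilon>^2 * ((1 + \<eta> + \<eta>^2 / 3) * H))"
      by (simp add: b_def power_mult_distrib) (simp add: power2_eq_square power3_eq_cube field_simps)
    have a3: "\<epsilon>^3 / 3 * H - a^3 / 3 * H = (\<eta> * \<epsilon>) * (\<epsilon>^2 * ((1 - \<eta> + \<eta>^2 / 3) * H))"
      by (simp add: a_def power_mult_distrib) (simp add: power2_eq_square power3_eq_cube field_simps)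
    have "(\<eta> * \<epsilon>) * N \<epsilon> \<le> A b - A \<epsilon>" using upper[of \<epsilon> b] b \<epsilon> by simp
    also have "\<dots> \<le> (b^3 / 3 * H - \<epsilon>^3 / 3 * H) + 17 * (c * \<epsilon>^4)" using Ab Ae by linarith
    also have "\<dots> = (\<eta> * \<epsilon>) * (\<epsilon>^2 * ((1 + \<eta> + \<eta>^2 / 3) * H + 17 * c * \<eta>))"
      unfolding b3 e4 by (simp add: algebra_simps)
    finally have "N \<epsilon> \<le> \<epsilon>^2 * ((1 + \<eta> + \<eta>^2 / 3) * H + 17 * c * \<eta>)"
      using pos by (rule mult_left_le_imp_le)
    then have up: "N \<epsilon> / \<epsilon>^2 \<le> (1 + \<eta> + \<eta>^2 / 3) * H + 17 * c * \<eta>"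
      using \<epsilon> by (simp add: pos_divide_le_eq mult.commute)
    have "(\<eta> * \<epsilon>) * (\<epsilon>^2 * ((1 - \<eta> + \<eta>^2 / 3) * H - 2 * c * \<eta>)) = (\<epsilon>^3 / 3 * H - a^3 / 3 * H) - 2 * (c * \<epsilon>^4)"
      unfolding a3 e4 by (simp add: algebra_simps)
    also have "\<dots> \<le> A \<epsilon> - A a" using Aa Ae by linarith
    also have "\<dots> \<le> (\<eta> * \<epsilon>) * N \<epsilon>" using lower[of a \<epsilon>] a by simp
    finally have "\<epsilon>^2 * ((1 - \<eta> + \<eta>^2 / 3) * H - 2 * c * \<eta>) \<le> N \<epsilon>"
      using pos by (rule mult_left_le_imp_le)
    then have lo: "(1 - \<eta> + \<eta>^2 / 3) * H - 2 * c * \<eta> \<le> N \<epsilon> / \<epsilon>^2"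
      using \<epsilon> by (simp add: pos_le_divide_eq mult.commute)
    have "\<eta>^2 \<le> \<eta>" using power_decreasing[of 1 2 \<eta>] \<eta>(1,2) by simp
    then have h1: "\<eta>^2 / 3 * H \<le> \<eta> * H" using H \<eta> by (intro mult_right_mono) auto
    have h2: "\<eta> * H \<le> \<eta> * M" using H \<eta> by (intro mult_left_mono) auto
    have h3: "0 \<le> \<eta>^2 / 3 * H" "0 \<le> c * \<eta>" "0 \<le> \<eta> * M" using H \<eta> c M by auto
    have "N \<epsilon> / \<epsilon>^2 - H \<le> \<eta> * H + \<eta>^2 / 3 * H + 17 * (c * \<eta>)" using up by (simp add: algebra_simps)
    moreover have "- (\<eta> * H) + \<eta>^2 / 3 * H - 2 * (c * \<eta>) \<le> N \<epsilon> / \<epsilon>^2 - H" using lo by (simp add: algebra_simps)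
    ultimately have "\<bar>N \<epsilon> / \<epsilon>^2 - H\<bar> \<le> 2 * (\<eta> * M) + 32 * (c * \<eta>)" using h1 h2 h3 by linarith
    also have "\<dots> = (2 * M + 32 * c) * \<eta>" by (simp add: algebra_simps)
    finally show ?thesis by (simp add: \<eta>_def)
  qed
  moreover have "0 < \<epsilon>1" using e0 \<rho>x by (simp add: \<epsilon>1_def)
  ultimately show ?thesis using that[of \<epsilon>1 "2 * M + 32 * c"] unfolding N_def H_def by blast
qed

lemma measurable_indicator_times_continuous:
  fixes \<phi> :: "'a \<Rightarrow> real"
  assumes "continuous_on (closure D) \<phi>" "S \<in> sets borel" "S \<subseteq> closure D"
  shows "(\<lambda>y. indicator S y * \<phi> y) \<in> borel_measurable borel"
  using borel_measurable_continuous_on_indicator[OF assms(2) continuous_on_subset[OF assms(1,3)]] by simp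

text \<open>Approximating \<open>\<phi> + \<delta>\<close> instead of \<open>\<phi>\<close> makes the polynomial nonnegative on the closure.\<close>

lemma nonneg_polynomial_approximation:
  fixes \<phi> :: "'a \<Rightarrow> real"
  assumes \<phi>: "continuous_on (closure D) \<phi>" "\<And>y. y \<in> closure D \<Longrightarrow> 0 \<le> \<phi> y" and \<delta>: "0 < \<delta>"
  obtains p M where "quadratically_approximable p D M" "\<And>y. \<bar>p y\<bar> \<le> M" "continuous_on UNIV p" "\<And>y. 0 \<le> p y"
    "\<And>y. y \<in> closure D \<Longrightarrow> \<bar>p y - \<phi> y\<bar> \<le> 2 * \<delta>"
proof -
  have cpt: "compact (closure D)" using bounded_D by (simp add: compact_closure)
  obtain q where q: "real_polynomial_function q" "\<And>y. y \<in> closure D \<Longrightarrow> \<bar>(\<phi> y + \<delta>) - q y\<bar> < \<delta>"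
  proof (rule Stone_Weierstrass_real_polynomial_function[OF cpt _ \<delta>])
    show "continuous_on (closure D) (\<lambda>y. \<phi> y + \<delta>)" by (intro continuous_intros \<phi>(1))
  qed blast
  obtain M where M: "quadratically_approximable q (closure D) M"
    using polynomial_quadratically_approximable[OF q(1) bounded_closure[OF bounded_D]] by blast
  have M0: "0 \<le> M" using M by (simp add: quadratically_approximable_def)
  have qM: "0 \<le> q y" "q y \<le> M" if "y \<in> closure D" for y
    using q(2)[OF that] \<phi>(2)[OF that] M that unfolding quadratically_approximable_def by (auto simp: abs_le_iff)
  \<comment> \<open>truncation makes the polynomial bounded without changing it on the closure of \<open>D\<close>\<close>
  define p where "p y = max 0 (min M (q y))" for y
  have pq: "p y = q y" if "y \<in> closure D" for y using qM[OF that] by (simp add: p_def)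
  show ?thesis
  proof (rule that[of p M])
    show "quadratically_approximable p D M"
      unfolding quadratically_approximable_def
    proof (intro conjI ballI M0)
      fix y assume y: "y \<in> D"
      have cl: "z \<in> closure D" if "z \<in> D" for z using closure_subset that by blast
      have py: "p y = q y" by (rule pq[OF cl[OF y]])
      obtain g where g: "norm g \<le> M" "\<And>z. z \<in> closure D \<Longrightarrow> \<bar>q z - q y - g \<bullet> (z - y)\<bar> \<le> M * (norm (z - y))^2"
        using M cl[OF y] unfolding quadratically_approximable_def by blast
      show "\<bar>p y\<bar> \<le> M" using M cl[OF y] unfolding quadratically_approximable_def py by blast
      show "\<exists>g. norm g \<le> M \<and> (\<forall>z\<in>D. \<bar>p z - p y - g \<bullet> (z - y)\<bar> \<le> M * (norm (z - y))^2)"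
        using g py pq cl by (intro exI[of _ g]) simp
    qed
    show "\<bar>p y\<bar> \<le> M" "0 \<le> p y" for y using M0 by (auto simp: p_def)
    have "continuous_on UNIV q" using continuous_real_polymonial_function[OF q(1)] by (simp add: continuous_at_imp_continuous_on)
    then show "continuous_on UNIV p" unfolding p_def by (intro continuous_intros)
    show "\<bar>p y - \<phi> y\<bar> \<le> 2 * \<delta>" if "y \<in> closure D" for y using q(2)[OF that] pq[OF that] by linarith
  qed
qed

text \<open>The rate for polynomials extends to continuous functions by density, since strip occupations
  divided by \<open>\<epsilon>\<^sup>2\<close> are uniformly bounded.\<close>

lemma strip_green_tendsto:
  fixes \<phi> :: "'a \<Rightarrow> real"
  assumes x: "x \<in> D" and R: "0 < R" "\<And>z. z \<in> frontier D \<Longrightarrow> tangent_balls D R z"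
    and \<phi>: "continuous_on (closure D) \<phi>" "\<And>y. y \<in> closure D \<Longrightarrow> 0 \<le> \<phi> y"
  shows "((\<lambda>\<epsilon>. (\<integral>y. indicator (inner_strip D \<epsilon>) y * \<phi> y \<partial>green x) / \<epsilon>^2)
     \<longlongrightarrow> (\<integral>y. indicator (frontier D) y * \<phi> y \<partial>exit_law x)) (at_right 0)"
proof (rule tendstoI)
  interpret finite_measure "green x" by (rule finite_measure_green[OF x])
  interpret E: prob_space "exit_law x" by (rule prob_space_exit_law[OF x])
  fix r :: real assume r: "0 < r"
  \<comment> \<open>approximation costs \<open>16 \<delta>\<close> in the strip, by the factor \<open>8\<close> of its bound, and \<open>2 \<delta>\<close> at the exit point\<close>
  define \<delta> where "\<delta> = r / 40"
  have \<delta>: "0 < \<delta>" using r by (simp add: \<delta>_def)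
  obtain p M where p: "quadratically_approximable p D M" "\<And>y. \<bar>p y\<bar> \<le> M" "continuous_on UNIV p" "\<And>y. 0 \<le> p y"
    and close: "\<And>y. y \<in> closure D \<Longrightarrow> \<bar>p y - \<phi> y\<bar> \<le> 2 * \<delta>"
    using nonneg_polynomial_approximation[OF \<phi> \<delta>] by metis
  obtain C \<epsilon>1 where C: "0 < \<epsilon>1" "\<And>\<epsilon>. 0 < \<epsilon> \<Longrightarrow> \<epsilon> \<le> \<epsilon>1 \<Longrightarrow>
     \<bar>(\<integral>y. indicator (inner_strip D \<epsilon>) y * p y \<partial>green x) / \<epsilon>^2 - (\<integral>y. p y \<partial>exit_law x)\<bar> \<le> C * sqrt \<epsilon>"
    using strip_green_rate[OF x R p] by metis
  obtain \<epsilon>0 where \<epsilon>0: "0 < \<epsilon>0" "\<And>x \<epsilon>. x \<in> D \<Longrightarrow> 0 < \<epsilon> \<Longrightarrow> \<epsilon> \<le> \<epsilon>0 \<Longrightarrow> (\<integral>y. indicator (inner_strip D \<epsilon>) y \<partial>green x) \<le> 8 * \<epsilon>^2"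
    using strip_green_bound[OF R] by metis
  have pm [measurable]: "p \<in> borel_measurable borel" by (rule borel_measurable_continuous_onI[OF p(3)])
  have strip_cl: "inner_strip D \<epsilon> \<subseteq> closure D" for \<epsilon> using closure_subset by (auto simp: inner_strip_def)
  have fr_cl: "frontier D \<subseteq> closure D" by (simp add: frontier_def)
  have fr_b [measurable]: "frontier D \<in> sets borel" by simp
  have bnd: "\<bar>\<phi> y\<bar> \<le> M + 2 * \<delta>" if "y \<in> closure D" for y using close[OF that] p(2)[of y] by linarith
  have M: "0 \<le> M" using p(2)[of 0] by linarith
  have i\<phi>: "integrable (green x) (\<lambda>y. indicator (inner_strip D \<epsilon>) y * \<phi> y)" for \<epsilon>
  proof (rule integrable_const_bound[where B = "M + 2 * \<delta>"])
    show "AE y in green x. norm (indicator (inner_strip D \<epsilon>) y * \<phi> y) \<le> M + 2 * \<delta>"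
      using bnd subsetD[OF strip_cl] M \<delta> by (intro AE_I2) (auto simp: indicator_def)
  qed (use measurable_indicator_times_continuous[OF \<phi>(1) inner_strip_borel strip_cl] in simp)
  have ip: "integrable (green x) (\<lambda>y. indicator (inner_strip D \<epsilon>) y * p y)" for \<epsilon>
    by (rule integrable_const_bound[where B = M]) (use p(2) M in \<open>auto simp: indicator_def\<close>)
  have ex: "\<bar>(\<integral>y. p y \<partial>exit_law x) - (\<integral>y. indicator (frontier D) y * \<phi> y \<partial>exit_law x)\<bar> \<le> 2 * \<delta>"
  proof -
    have i1: "integrable (exit_law x) p" by (rule E.integrable_const_bound[where B=M]) (use p(2) in auto)
    have i2: "integrable (exit_law x) (\<lambda>y. indicator (frontier D) y * \<phi> y)"
    proof (rule E.integrable_const_bound[where B = "M + 2 * \<delta>"])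
      show "AE y in exit_law x. norm (indicator (frontier D) y * \<phi> y) \<le> M + 2 * \<delta>"
        using bnd subsetD[OF fr_cl] M \<delta> by (intro AE_I2) (auto simp: indicator_def)
    qed (use measurable_indicator_times_continuous[OF \<phi>(1) fr_b fr_cl] in simp)
    have "(\<integral>y. p y \<partial>exit_law x) - (\<integral>y. indicator (frontier D) y * \<phi> y \<partial>exit_law x)
      = (\<integral>y. p y - indicator (frontier D) y * \<phi> y \<partial>exit_law x)"
      by (rule Bochner_Integration.integral_diff[symmetric, OF i1 i2])
    also have "\<bar>\<dots>\<bar> \<le> (\<integral>y. \<bar>p y - indicator (frontier D) y * \<phi> y\<bar> \<partial>exit_law x)" by (rule integral_abs_bound)
    also have "\<dots> \<le> (\<integral>y. 2 * \<delta> \<partial>exit_law x)"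
    proof (rule integral_mono_AE)
      show "integrable (exit_law x) (\<lambda>y. \<bar>p y - indicator (frontier D) y * \<phi> y\<bar>)"
        by (rule integrable_abs[OF Bochner_Integration.integrable_diff[OF i1 i2]])
      show "AE y in exit_law x. \<bar>p y - indicator (frontier D) y * \<phi> y\<bar> \<le> 2 * \<delta>"
        using AE_exit_law_frontier[OF x] by eventually_elim (use close fr_cl in auto)
    qed simp
    finally show ?thesis using E.prob_space by simp
  qed
  define \<epsilon>2 where "\<epsilon>2 = min \<epsilon>0 \<epsilon>1"
  have "((\<lambda>\<epsilon>. C * sqrt \<epsilon>) \<longlongrightarrow> C * sqrt 0) (at_right 0)"
    by (intro tendsto_mult tendsto_const tendsto_real_sqrt tendsto_ident_at)
  then have "\<forall>\<^sub>F \<epsilon> in at_right 0. C * sqrt \<epsilon> < \<delta>" using \<delta> by (intro order_tendstoD(2)) auto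
  moreover have "\<forall>\<^sub>F \<epsilon> in at_right 0. \<epsilon> \<in> {0<..<\<epsilon>2}"
    using C(1) \<epsilon>0(1) by (intro eventually_at_right_real) (simp add: \<epsilon>2_def)
  ultimately show "\<forall>\<^sub>F \<epsilon> in at_right 0. dist ((\<integral>y. indicator (inner_strip D \<epsilon>) y * \<phi> y \<partial>green x) / \<epsilon>^2)
      (\<integral>y. indicator (frontier D) y * \<phi> y \<partial>exit_law x) < r"
  proof eventually_elim
    case (elim \<epsilon>)
    then have \<epsilon>: "0 < \<epsilon>" "\<epsilon> \<le> \<epsilon>0" "\<epsilon> \<le> \<epsilon>1" by (auto simp: \<epsilon>2_def)
    have "\<bar>(\<integral>y. indicator (inner_strip D \<epsilon>) y * \<phi> y \<partial>green x) - (\<integral>y. indicator (inner_strip D \<epsilon>) y * p y \<partial>green x)\<bar>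
      = \<bar>\<integral>y. indicator (inner_strip D \<epsilon>) y * \<phi> y - indicator (inner_strip D \<epsilon>) y * p y \<partial>green x\<bar>"
      using Bochner_Integration.integral_diff[OF i\<phi> ip] by simp
    also have "\<dots> \<le> (\<integral>y. \<bar>indicator (inner_strip D \<epsilon>) y * \<phi> y - indicator (inner_strip D \<epsilon>) y * p y\<bar> \<partial>green x)"
      by (rule integral_abs_bound)
    also have "\<dots> \<le> (\<integral>y. 2 * \<delta> * indicator (inner_strip D \<epsilon>) y \<partial>green x)"
    proof (rule integral_mono)
      show "integrable (green x) (\<lambda>y. \<bar>indicator (inner_strip D \<epsilon>) y * \<phi> y - indicator (inner_strip D \<epsilon>) y * p y\<bar>)"
        by (rule integrable_abs[OF Bochner_Integration.integrable_diff[OF i\<phi> ip]])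
      show "integrable (green x) (\<lambda>y. 2 * \<delta> * indicator (inner_strip D \<epsilon>) y)"
        by (intro integrable_mult_right integrable_real_indicator) (auto simp: less_top[symmetric])
      show "\<bar>indicator (inner_strip D \<epsilon>) y * \<phi> y - indicator (inner_strip D \<epsilon>) y * p y\<bar> \<le> 2 * \<delta> * indicator (inner_strip D \<epsilon>) y" for y
        using close[of y] subsetD[OF strip_cl, of y \<epsilon>] by (auto simp: indicator_def)
    qed
    also have "\<dots> \<le> 2 * \<delta> * (8 * \<epsilon>^2)"
      using \<epsilon>0(2)[OF x \<epsilon>(1,2)] \<delta> by simp
    finally have d: "\<bar>(\<integral>y. indicator (inner_strip D \<epsilon>) y * \<phi> y \<partial>green x) - (\<integral>y. indicator (inner_strip D \<epsilon>) y * p y \<partial>green x)\<bar> / \<epsilon>^2 \<le> 16 * \<delta>"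
      using \<epsilon>(1) by (simp add: pos_divide_le_eq)
    then have "\<bar>(\<integral>y. indicator (inner_strip D \<epsilon>) y * \<phi> y \<partial>green x) / \<epsilon>^2 - (\<integral>y. indicator (inner_strip D \<epsilon>) y * p y \<partial>green x) / \<epsilon>^2\<bar> \<le> 16 * \<delta>"
      unfolding diff_divide_distrib[symmetric] abs_divide by simp
    moreover have "\<bar>(\<integral>y. indicator (inner_strip D \<epsilon>) y * p y \<partial>green x) / \<epsilon>^2 - (\<integral>y. p y \<partial>exit_law x)\<bar> < \<delta>"
      using C(2)[OF \<epsilon>(1,3)] elim by linarith
    ultimately show ?case using ex r unfolding dist_real_def \<delta>_def by linarith
  qed
qed

end

section \<open>Stability of the nonlinear equation\<close>

text \<open>The derivative \<open>r (1 - e\<^bsup>-ur\<^esub>)\<close> of the integrand lies between \<open>0\<close> and \<open>min r (u r\<^sup>2)\<close>.\<close>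

lemma branching_integrand_increment:
  fixes u v r :: real
  assumes "0 \<le> u" "u \<le> v" "v \<le> C" "0 < r"
  shows "0 \<le> (exp (- v * r) - 1 + v * r) - (exp (- u * r) - 1 + u * r)"
    "(exp (- v * r) - 1 + v * r) - (exp (- u * r) - 1 + u * r) \<le> (v - u) * max 1 C * min r (r^2)"
proof -
  define s where "s = (v - u) * r"
  have s: "0 \<le> s" using assms by (simp add: s_def)
  have vr: "v * r = u * r + s" by (simp add: s_def algebra_simps)
  have eq: "(exp (- v * r) - 1 + v * r) - (exp (- u * r) - 1 + u * r) = s - exp (- u * r) * (1 - exp (- s))"
    unfolding s_def by (simp add: algebra_simps flip: exp_add)
  have e1: "1 - exp (- s) \<le> s" using exp_ge_add_one_self[of "- s"] by simp
  have e2: "0 \<le> 1 - exp (- s)" using s by simp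
  have e3: "s * exp (- s) \<le> 1 - exp (- s)"
  proof -
    have "(1 + s) * exp (- s) \<le> exp s * exp (- s)" using exp_ge_add_one_self[of s] by (intro mult_right_mono) auto
    then show ?thesis by (simp add: algebra_simps flip: exp_add)
  qed
  have u1: "exp (- u * r) \<le> 1" using assms by simp
  have "exp (- u * r) * (1 - exp (- s)) \<le> 1 * (1 - exp (- s))" using u1 e2 by (rule mult_right_mono)
  also have "\<dots> \<le> s" using e1 by simp
  finally show "0 \<le> (exp (- v * r) - 1 + v * r) - (exp (- u * r) - 1 + u * r)"
    unfolding eq by (simp only: diff_ge_0_iff_ge)
  have b1: "(exp (- v * r) - 1 + v * r) - (exp (- u * r) - 1 + u * r) \<le> s"
    unfolding eq using mult_nonneg_nonneg[of "exp (- u * r)", OF _ e2] by simp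
  have b2: "(exp (- v * r) - 1 + v * r) - (exp (- u * r) - 1 + u * r) \<le> s * (v * r)"
  proof -
    have "s * (1 - v * r) \<le> s * exp (- (v * r))"
      using exp_ge_add_one_self[of "- (v * r)"] s by (intro mult_left_mono) auto
    also have "\<dots> = exp (- u * r) * (s * exp (- s))" unfolding vr by (simp add: mult_ac flip: exp_add)
    also have "\<dots> \<le> exp (- u * r) * (1 - exp (- s))" using e3 by (intro mult_left_mono) auto
    finally show ?thesis unfolding eq by (simp add: algebra_simps)
  qed
  have vu: "0 \<le> v - u" using assms by simp
  have c1: "s \<le> (v - u) * max 1 C * r"
    using mult_right_mono[of 1 "max 1 C" "(v - u) * r"] s unfolding s_def by (simp add: mult_ac)
  have c2: "s * (v * r) \<le> (v - u) * max 1 C * r^2"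
  proof -
    have "s * (v * r) = ((v - u) * r^2) * v" by (simp add: s_def power2_eq_square)
    also have "\<dots> \<le> ((v - u) * r^2) * max 1 C" using assms vu by (intro mult_left_mono) auto
    finally show ?thesis by (simp add: mult_ac)
  qed
  show "(exp (- v * r) - 1 + v * r) - (exp (- u * r) - 1 + u * r) \<le> (v - u) * max 1 C * min r (r^2)"
    using b1 b2 c1 c2 by (cases "r \<le> r^2") (auto simp: min_def)
qed

lemma branching_mechanism_increment:
  assumes n: "sets n = sets (restrict_space borel {0<..})" and fin: "(\<integral>\<^sup>+ r. ennreal (min r (r\<^sup>2)) \<partial>n) < \<infinity>"
  obtains l where "0 \<le> l" "\<And>u v C. 0 \<le> u \<Longrightarrow> u \<le> v \<Longrightarrow> v \<le> C \<Longrightarrow>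
     branching_mechanism n u \<le> branching_mechanism n v \<and>
     branching_mechanism n v - branching_mechanism n u \<le> max 1 C * l * (v - u)"
proof -
  have sp: "space n = {0<..}" using sets_eq_imp_space_eq[OF n] by (simp add: space_restrict_space)
  have meas: "f \<in> borel_measurable n" if "f \<in> borel_measurable borel" for f :: "real \<Rightarrow> real"
    using measurable_restrict_space1[OF that] by (subst measurable_cong_sets[OF n refl])
  have im: "integrable n (\<lambda>r. min r (r\<^sup>2))"
  proof (rule integrableI_nonneg)
    show "(\<lambda>r. min r (r\<^sup>2)) \<in> borel_measurable n" by (rule meas) measurable
    show "AE r in n. 0 \<le> min r (r\<^sup>2)" by (rule AE_I2) (simp add: sp)
  qed (rule fin)
  define l where "l = (\<integral>r. min r (r\<^sup>2) \<partial>n)"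
  have l: "0 \<le> l" unfolding l_def using sp by (intro integral_nonneg_AE AE_I2) auto
  define e where "e u r = exp (- u * r) - 1 + u * r" for u r :: real
  have em: "e u \<in> borel_measurable n" for u unfolding e_def by (rule meas) measurable
  have inc: "0 \<le> e v r - e u r" "e v r - e u r \<le> (v - u) * max 1 C * min r (r^2)"
    if "0 \<le> u" "u \<le> v" "v \<le> C" "r \<in> space n" for u v C r
    using branching_integrand_increment[of u v C r] that sp unfolding e_def by auto
  have ie: "integrable n (e v)" if v: "0 \<le> v" for v
  proof (rule Bochner_Integration.integrable_bound[OF integrable_mult_right[OF im, of "v * max 1 v"] em])
    have "norm (e v r) \<le> norm (v * max 1 v * min r (r\<^sup>2))" if "r \<in> space n" for r
      using inc[of 0 v v r] v that by (simp add: e_def)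
    then show "AE r in n. norm (e v r) \<le> norm (v * max 1 v * min r (r\<^sup>2))" by (intro AE_I2)
  qed
  have "branching_mechanism n u \<le> branching_mechanism n v \<and>
     branching_mechanism n v - branching_mechanism n u \<le> max 1 C * l * (v - u)"
    if uv: "0 \<le> u" "u \<le> v" "v \<le> C" for u v C
  proof -
    have v: "0 \<le> v" using uv by simp
    have bm: "branching_mechanism n w = (\<integral>r. e w r \<partial>n)" for w by (simp add: branching_mechanism_def e_def)
    have d: "branching_mechanism n v - branching_mechanism n u = (\<integral>r. e v r - e u r \<partial>n)"
      unfolding bm by (rule Bochner_Integration.integral_diff[symmetric, OF ie[OF v] ie[OF uv(1)]])
    have "0 \<le> (\<integral>r. e v r - e u r \<partial>n)" using inc[OF uv] by (intro integral_nonneg_AE AE_I2) auto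
    moreover have "(\<integral>r. e v r - e u r \<partial>n) \<le> (\<integral>r. (v - u) * max 1 C * min r (r\<^sup>2) \<partial>n)"
      by (rule integral_mono[OF Bochner_Integration.integrable_diff[OF ie[OF v] ie[OF uv(1)]] integrable_mult_right[OF im]])
        (rule inc(2)[OF uv])
    ultimately show ?thesis using d by (simp add: l_def mult_ac)
  qed
  with l show ?thesis using that by blast
qed

lemma branching_mechanism_0: "branching_mechanism n 0 = 0"
  by (simp add: branching_mechanism_def)

context killed_brownian_motion
begin

text \<open>With \<open>v = w\<^sub>n - w\<close> and \<open>k = \<psi>(w\<^sub>n) - \<psi>(w)\<close>, subtracting the equations gives \<open>v + G k = \<delta>\<close>, where
  \<open>\<delta> = h\<^sub>n - h\<close> tends to \<open>0\<close>. Pairing with \<open>k\<close> in \<open>L\<^sup>2(D)\<close> yields \<open>\<integral>v k \<le> \<integral>\<delta> k\<close>, as \<open>G\<close> is positive.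
  Since \<open>\<psi>\<close> is increasing and Lipschitz, \<open>k\<^sup>2 \<le> L v k\<close>, so \<open>k\<close> tends to \<open>0\<close> in \<open>L\<^sup>2(D)\<close> and \<open>G k\<close>
  tends to \<open>0\<close> pointwise. The convergence of \<open>h\<^sub>n\<close> is assumed pointwise only, since in the application it is not uniform
  near the boundary.\<close>

lemma nonlinear_stability:
  fixes \<psi> :: "real \<Rightarrow> real" and w :: "'a \<Rightarrow> real" and wn :: "nat \<Rightarrow> 'a \<Rightarrow> real"
  assumes inc: "\<And>u v. 0 \<le> u \<Longrightarrow> u \<le> v \<Longrightarrow> v \<le> C \<Longrightarrow> \<psi> u \<le> \<psi> v \<and> \<psi> v - \<psi> u \<le> L * (v - u)"
    and L: "0 \<le> L"
    and wm: "(\<lambda>y. indicator D y * w y) \<in> borel_measurable borel"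
      "\<And>n. (\<lambda>y. indicator D y * wn n y) \<in> borel_measurable borel"
    and \<psi>m: "(\<lambda>y. indicator D y * \<psi> (w y)) \<in> borel_measurable borel"
      "\<And>n. (\<lambda>y. indicator D y * \<psi> (wn n y)) \<in> borel_measurable borel"
    and wb: "\<And>y. y \<in> D \<Longrightarrow> 0 \<le> w y \<and> w y \<le> C" "\<And>n y. y \<in> D \<Longrightarrow> 0 \<le> wn n y \<and> wn n y \<le> C"
    and eq: "\<And>y. y \<in> D \<Longrightarrow> w y + (\<integral>z. indicator D z * \<psi> (w z) \<partial>green y) = h y"
      "\<And>n y. y \<in> D \<Longrightarrow> wn n y + (\<integral>z. indicator D z * \<psi> (wn n z) \<partial>green y) = hn n y"
    and hb: "\<And>n y. y \<in> D \<Longrightarrow> \<bar>hn n y - h y\<bar> \<le> H"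
    and lim: "\<And>y. y \<in> D \<Longrightarrow> (\<lambda>n. hn n y) \<longlonglongrightarrow> h y"
    and x: "x \<in> D"
  shows "(\<lambda>n. wn n x) \<longlonglongrightarrow> w x"
proof -
  have C: "0 \<le> C" using wb(1)[OF x] by linarith
  define k where "k n y = indicator D y * \<psi> (wn n y) - indicator D y * \<psi> (w y)" for n y
  define v where "v n y = indicator D y * wn n y - indicator D y * w y" for n y
  have km [measurable]: "k n \<in> borel_measurable borel" and vm [measurable]: "v n \<in> borel_measurable borel" for n
    unfolding k_def[abs_def] v_def[abs_def] using wm \<psi>m by (auto intro!: borel_measurable_diff)
  have lip: "\<bar>\<psi> a - \<psi> b\<bar> \<le> L * \<bar>a - b\<bar>" "0 \<le> (a - b) * (\<psi> a - \<psi> b)"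
    "(\<psi> a - \<psi> b)^2 \<le> L * ((a - b) * (\<psi> a - \<psi> b))" if "0 \<le> a" "a \<le> C" "0 \<le> b" "b \<le> C" for a b
  proof -
    have *: "\<bar>\<psi> a - \<psi> b\<bar> \<le> L * \<bar>a - b\<bar> \<and> (a - b) * (\<psi> a - \<psi> b) = \<bar>a - b\<bar> * \<bar>\<psi> a - \<psi> b\<bar>"
    proof (cases "a \<le> b")
      case True
      then have "a - b \<le> 0" "\<psi> a - \<psi> b \<le> 0" using inc[OF that(1) True that(4)] by auto
      then show ?thesis using inc[OF that(1) True that(4)] by (simp add: abs_of_nonpos algebra_simps)
    next
      case False
      then show ?thesis using inc[OF that(3) _ that(2)] by (simp add: abs_if)
    qed
    then show "\<bar>\<psi> a - \<psi> b\<bar> \<le> L * \<bar>a - b\<bar>" "0 \<le> (a - b) * (\<psi> a - \<psi> b)" by auto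
    have "(\<psi> a - \<psi> b)^2 = \<bar>\<psi> a - \<psi> b\<bar> * \<bar>\<psi> a - \<psi> b\<bar>" by (simp add: power2_eq_square)
    also have "\<dots> \<le> (L * \<bar>a - b\<bar>) * \<bar>\<psi> a - \<psi> b\<bar>" using * by (intro mult_right_mono) auto
    finally show "(\<psi> a - \<psi> b)^2 \<le> L * ((a - b) * (\<psi> a - \<psi> b))" using * by simp
  qed
  have pt_all: "\<bar>k n y\<bar> \<le> L * C \<and> 0 \<le> v n y * k n y \<and> (k n y)^2 \<le> L * (v n y * k n y) \<and> \<bar>v n y\<bar> \<le> C" for n y
  proof (cases "y \<in> D")
    case True
    note b = wb(2)[OF True, of n] wb(1)[OF True]
    have d: "\<bar>wn n y - w y\<bar> \<le> C" using b by (auto simp: abs_le_iff)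
    show ?thesis
      using lip[of "wn n y" "w y"] b d mult_left_mono[OF d L] True by (simp add: k_def v_def)
  qed (use C L in \<open>simp add: k_def v_def\<close>)
  then have pt: "\<bar>k n y\<bar> \<le> L * C" "0 \<le> v n y * k n y" "(k n y)^2 \<le> L * (v n y * k n y)" "\<bar>v n y\<bar> \<le> C" for n y
    by blast+
  have LC: "0 \<le> L * C" using L C by simp
  have \<psi>b: "\<bar>indicator D z * \<psi> (u z)\<bar> \<le> \<bar>\<psi> 0\<bar> + L * C" if "\<And>y. y \<in> D \<Longrightarrow> 0 \<le> u y \<and> u y \<le> C" for u z
  proof (cases "z \<in> D")
    case True
    have "\<bar>\<psi> (u z) - \<psi> 0\<bar> \<le> L * \<bar>u z - 0\<bar>" by (rule lip(1)) (use that[OF True] C in auto)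
    also have "\<dots> \<le> L * C" using that[OF True] L by (intro mult_left_mono) auto
    finally show ?thesis using True by simp
  qed (use LC in simp)
  have diff_eq: "v n y + (\<integral>z. k n z \<partial>green y) = hn n y - h y" if y: "y \<in> D" for n y
  proof -
    have "(\<integral>z. k n z \<partial>green y) = (\<integral>z. indicator D z * \<psi> (wn n z) \<partial>green y) - (\<integral>z. indicator D z * \<psi> (w z) \<partial>green y)"
      unfolding k_def
      by (rule Bochner_Integration.integral_diff[OF
            integrable_green[OF \<psi>m(2) \<psi>b[of "wn n", OF wb(2)] y] integrable_green[OF \<psi>m(1) \<psi>b[of w, OF wb(1)] y]])
    then show ?thesis using eq(1)[OF y] eq(2)[OF y, of n] y by (simp add: v_def)
  qed
  define \<delta> where "\<delta> n y = v n y + indicator D y * (\<integral>z. k n z \<partial>green y)" for n y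
  have gm: "(\<lambda>y. indicator D y * (\<integral>z. k n z \<partial>green y)) \<in> borel_measurable borel" for n
    by (rule green_positive(2)[OF km pt(1)])
  have \<delta>m [measurable]: "\<delta> n \<in> borel_measurable borel" for n
    unfolding \<delta>_def[abs_def] by (intro borel_measurable_add vm gm)
  have \<delta>_eq: "\<delta> n y = indicator D y * (hn n y - h y)" for n y
    using diff_eq[of y n] by (cases "y \<in> D") (simp_all add: \<delta>_def v_def)
  have H: "0 \<le> H" using hb[OF x, of 0] by linarith
  have \<delta>b: "\<bar>\<delta> n y\<bar> \<le> H * indicator D y" for n y using hb[of y n] H by (cases "y \<in> D") (auto simp: \<delta>_eq)
  have iD: "integrable lborel (\<lambda>y. c * indicator D y :: real)" for c
    by (rule integrable_D[OF km[of 0] pt(1)])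
  have iDf: "integrable lborel f" if "f \<in> borel_measurable borel" "\<And>y. \<bar>f y\<bar> \<le> c * indicator D y" for f :: "'a \<Rightarrow> real" and c
  proof (rule Bochner_Integration.integrable_bound[OF iD[of c]])
    show "AE y in lborel. norm (f y) \<le> norm (c * indicator D y)"
      unfolding real_norm_def by (rule AE_I2) (rule order_trans[OF that(2) abs_ge_self])
  qed (use that(1) in simp)
  have kD: "\<bar>k n y\<bar> \<le> L * C * indicator D y" for n y using pt(1)[of n y] by (cases "y \<in> D") (auto simp: k_def)
  have ivk: "integrable lborel (\<lambda>y. v n y * k n y)" for n
  proof (rule iDf)
    show "\<bar>v n y * k n y\<bar> \<le> (C * (L * C)) * indicator D y" for y
      using mult_mono[OF pt(4)[of n y] kD[of n y] C] by (simp add: abs_mult mult_ac)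
  qed measurable
  have i\<delta>k: "integrable lborel (\<lambda>y. \<delta> n y * k n y)" for n
  proof (rule iDf)
    have "\<bar>\<delta> n y\<bar> \<le> H" for y using \<delta>b[of n y] H by (cases "y \<in> D") simp_all
    then show "\<bar>\<delta> n y * k n y\<bar> \<le> (H * (L * C)) * indicator D y" for y
      using mult_mono[OF _ kD[of n y] H] by (simp add: abs_mult mult_ac)
  qed measurable
  have i\<delta>: "integrable lborel (\<lambda>y. \<bar>\<delta> n y\<bar>)" for n
    by (rule iDf[of _ H]) (use \<delta>b in auto)
  have ik2: "integrable lborel (\<lambda>y. (k n y)^2)" for n
  proof (rule iDf)
    show "\<bar>(k n y)^2\<bar> \<le> ((L * C) * (L * C)) * indicator D y" for y
      using mult_mono[OF pt(1)[of n y] kD[of n y] LC] by (simp add: power2_eq_square abs_mult mult_ac)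
  qed measurable
  have key: "(\<integral>y. (k n y)^2 \<partial>lborel) \<le> L * (L * C) * (\<integral>y. \<bar>\<delta> n y\<bar> \<partial>lborel)" for n
  proof -
    have gk: "\<delta> n y * k n y - v n y * k n y = indicator D y * (k n y * (\<integral>z. k n z \<partial>green y))" for y
      by (simp add: \<delta>_def algebra_simps)
    have "0 \<le> (\<integral>y. \<delta> n y * k n y - v n y * k n y \<partial>lborel)"
      unfolding gk by (rule green_positive(1)[OF km pt(1)])
    then have 1: "(\<integral>y. v n y * k n y \<partial>lborel) \<le> (\<integral>y. \<delta> n y * k n y \<partial>lborel)"
      using Bochner_Integration.integral_diff[OF i\<delta>k[of n] ivk[of n]] by simp
    have "(\<integral>y. (k n y)^2 \<partial>lborel) \<le> (\<integral>y. L * (v n y * k n y) \<partial>lborel)"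
      by (rule integral_mono[OF ik2 integrable_mult_right[OF ivk] pt(3)])
    also have "\<dots> = L * (\<integral>y. v n y * k n y \<partial>lborel)" by simp
    also have "\<dots> \<le> L * (\<integral>y. \<delta> n y * k n y \<partial>lborel)" using 1 L by (rule mult_left_mono)
    also have "\<dots> \<le> L * (\<integral>y. (L * C) * \<bar>\<delta> n y\<bar> \<partial>lborel)"
    proof (intro mult_left_mono L integral_mono[OF i\<delta>k integrable_mult_right[OF i\<delta>]])
      fix y
      have "\<delta> n y * k n y \<le> \<bar>\<delta> n y\<bar> * \<bar>k n y\<bar>" by (metis abs_ge_self abs_mult)
      also have "\<dots> \<le> \<bar>\<delta> n y\<bar> * (L * C)" using pt(1) by (intro mult_left_mono) auto
      finally show "\<delta> n y * k n y \<le> (L * C) * \<bar>\<delta> n y\<bar>" by (simp add: mult.commute)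
    qed
    finally show ?thesis by (simp add: mult.assoc)
  qed
  have "(\<lambda>n. \<integral>y. \<bar>\<delta> n y\<bar> \<partial>lborel) \<longlonglongrightarrow> (\<integral>y. 0 \<partial>(lborel :: 'a measure))"
  proof (rule integral_dominated_convergence[OF _ _ iD[of H]])
    show "AE y in lborel. (\<lambda>n. \<bar>\<delta> n y\<bar>) \<longlonglongrightarrow> 0"
    proof (rule AE_I2)
      fix y
      show "(\<lambda>n. \<bar>\<delta> n y\<bar>) \<longlonglongrightarrow> 0"
      proof (cases "y \<in> D")
        case True
        then have "(\<lambda>n. \<delta> n y) \<longlonglongrightarrow> 0" using tendsto_diff[OF lim[OF True] tendsto_const[of "h y"]] by (simp add: \<delta>_eq)
        then show ?thesis by (rule tendsto_rabs_zero)
      qed (simp add: \<delta>_eq)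
    qed
    show "AE y in lborel. norm \<bar>\<delta> n y\<bar> \<le> H * indicator D y" for n using \<delta>b by simp
  qed measurable
  then have "(\<lambda>n. L * (L * C) * (\<integral>y. \<bar>\<delta> n y\<bar> \<partial>lborel)) \<longlonglongrightarrow> 0"
    using tendsto_mult[OF tendsto_const[of "L * (L * C)"]] by fastforce
  then have k2: "(\<lambda>n. \<integral>y. (k n y)^2 \<partial>lborel) \<longlonglongrightarrow> 0"
    by (rule tendsto_sandwich[OF _ _ tendsto_const, rotated 2]) (use key in auto)
  have gk2: "(\<lambda>n. \<integral>y. (k n y)^2 \<partial>green x) \<longlonglongrightarrow> 0"
  proof (rule green_L1_continuity[OF x, where C = "(L * C)^2"])
    have "indicator D y * (k n y)^2 = (k n y)^2" for n y by (cases "y \<in> D") (simp_all add: k_def)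
    then show "(\<lambda>n. \<integral>y. indicator D y * (k n y)^2 \<partial>lborel) \<longlonglongrightarrow> 0" using k2 by (simp only:)
    show "(k n y)^2 \<le> (L * C)^2" for n y using power_mono[OF pt(1), of n y 2] by simp
  qed auto
  have gk: "(\<lambda>n. \<integral>y. \<bar>k n y\<bar> \<partial>green x) \<longlonglongrightarrow> 0"
  proof (rule LIMSEQ_I)
    interpret finite_measure "green x" by (rule finite_measure_green[OF x])
    fix r :: real assume r: "0 < r"
    define m where "m = measure (green x) UNIV"
    have m: "0 \<le> m" by (simp add: m_def)
    define \<eta> where "\<eta> = r / (2 * (m + 1))"
    have \<eta>: "0 < \<eta>" using r m by (simp add: \<eta>_def)
    have \<eta>m: "\<eta> * m \<le> r / 2"
    proof -
      have "\<eta> * m \<le> \<eta> * (m + 1)" using \<eta> by simp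
      also have "\<dots> = r / 2" using m by (simp add: \<eta>_def field_simps)
      finally show ?thesis .
    qed
    have "0 < \<eta> * (r / 2)" using \<eta> r by simp
    then have "\<forall>\<^sub>F n in sequentially. (\<integral>y. (k n y)^2 \<partial>green x) < \<eta> * (r / 2)" by (rule order_tendstoD(2)[OF gk2])
    then obtain N where N: "\<And>n. N \<le> n \<Longrightarrow> (\<integral>y. (k n y)^2 \<partial>green x) < \<eta> * (r / 2)"
      unfolding eventually_sequentially by blast
    have "norm ((\<integral>y. \<bar>k n y\<bar> \<partial>green x) - 0) < r" if n: "N \<le> n" for n
    proof -
      have i1: "integrable (green x) (\<lambda>y. \<bar>k n y\<bar>)" by (rule integrable_green[OF _ _ x, where C = "L * C"]) (use pt(1) in auto)
      have i2: "integrable (green x) (\<lambda>y. (k n y)^2)"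
        by (rule integrable_green[OF _ _ x, where C = "(L * C)^2"]) (use power_mono[OF pt(1), of n _ 2] in auto)
      have "(\<integral>y. \<bar>k n y\<bar> \<partial>green x) \<le> (\<integral>y. \<eta> + (k n y)^2 / \<eta> \<partial>green x)"
      proof (rule integral_mono[OF i1])
        show "integrable (green x) (\<lambda>y. \<eta> + (k n y)^2 / \<eta>)" using i2 by simp
        \<comment> \<open>Chebyshev's inequality in pointwise form\<close>
        show "\<bar>k n y\<bar> \<le> \<eta> + (k n y)^2 / \<eta>" for y
        proof (cases "\<bar>k n y\<bar> \<le> \<eta>")
          case True then show ?thesis using \<eta> by (simp add: add_increasing2)
        next
          case False
          then have "\<eta> * \<bar>k n y\<bar> \<le> \<bar>k n y\<bar> * \<bar>k n y\<bar>" using \<eta> by (intro mult_right_mono) auto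
          then have "\<bar>k n y\<bar> \<le> (k n y)^2 / \<eta>" using \<eta> by (simp add: pos_le_divide_eq power2_eq_square mult.commute)
          then show ?thesis using \<eta> by simp
        qed
      qed
      also have "\<dots> = \<eta> * m + (\<integral>y. (k n y)^2 \<partial>green x) / \<eta>"
        using Bochner_Integration.integral_add[OF integrable_const[of \<eta>] integrable_divide[OF i2, of \<eta>]]
        by (simp add: m_def mult.commute)
      also have "\<dots> < r / 2 + r / 2"
      proof (rule add_le_less_mono[OF \<eta>m])
        show "(\<integral>y. (k n y)^2 \<partial>green x) / \<eta> < r / 2" using N[OF n] \<eta> by (simp add: pos_divide_less_eq mult.commute)
      qed
      finally have "(\<integral>y. \<bar>k n y\<bar> \<partial>green x) < r" by simp
      moreover have "0 \<le> (\<integral>y. \<bar>k n y\<bar> \<partial>green x)" by (intro integral_nonneg_AE AE_I2) simp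
      ultimately show ?thesis unfolding real_norm_def by linarith
    qed
    then show "\<exists>N. \<forall>n\<ge>N. norm ((\<integral>y. \<bar>k n y\<bar> \<partial>green x) - 0) < r" by blast
  qed
  have "\<bar>wn n x - w x\<bar> \<le> \<bar>hn n x - h x\<bar> + (\<integral>y. \<bar>k n y\<bar> \<partial>green x)" for n
  proof -
    have "\<bar>\<integral>y. k n y \<partial>green x\<bar> \<le> (\<integral>y. \<bar>k n y\<bar> \<partial>green x)" by (rule integral_abs_bound)
    moreover have "wn n x - w x + (\<integral>y. k n y \<partial>green x) = hn n x - h x" using diff_eq[OF x, of n] x by (simp add: v_def)
    ultimately show ?thesis by linarith
  qed
  moreover have "(\<lambda>n. \<bar>hn n x - h x\<bar> + (\<integral>y. \<bar>k n y\<bar> \<partial>green x)) \<longlonglongrightarrow> 0"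
    using tendsto_add[OF tendsto_rabs_zero[OF LIM_zero[OF lim[OF x]]] gk] by simp
  ultimately have "(\<lambda>n. wn n x - w x) \<longlonglongrightarrow> 0"
    by (intro Lim_null_comparison[of "\<lambda>n. wn n x - w x"]) auto
  then show ?thesis by (rule LIM_zero_cancel)
qed

end

section \<open>The exit equation for strip densities\<close>

context killed_brownian_motion
begin

lemma nn_integral_green_on_D:
  assumes x: "x \<in> D" and f: "(\<lambda>y. indicator D y * f y) \<in> borel_measurable borel"
  shows "(\<integral>\<^sup>+ \<omega>. (\<integral>\<^sup>+ t. f (B t \<omega>) * indicator {t. 0 \<le> t \<and> ereal t < exit_time D B \<omega>} t \<partial>lborel) \<partial>W x)
    = (\<integral>\<^sup>+ y. indicator D y * f y \<partial>green x)"
    and "(\<lambda>\<omega>. \<integral>\<^sup>+ t. f (B t \<omega>) * indicator {t. 0 \<le> t \<and> ereal t < exit_time D B \<omega>} t \<partial>lborel) \<in> borel_measurable (W x)"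
proof -
  note [measurable] = measurable_B_lborel[OF x] measurable_lifetime_indicator[OF x] f
  have eq: "(\<integral>\<^sup>+ t. f (B t \<omega>) * indicator {t. 0 \<le> t \<and> ereal t < exit_time D B \<omega>} t \<partial>lborel)
    = (\<integral>\<^sup>+ t. (indicator D (B t \<omega>) * f (B t \<omega>)) * indicator {t. 0 \<le> t \<and> ereal t < exit_time D B \<omega>} t \<partial>lborel)"
    if "\<omega> \<in> space (W x)" for \<omega>
    using less_exit_time_iff[OF x that] aliveD[of D _ \<omega>]
    by (intro nn_integral_cong) (auto simp: indicator_def)
  show "(\<integral>\<^sup>+ \<omega>. (\<integral>\<^sup>+ t. f (B t \<omega>) * indicator {t. 0 \<le> t \<and> ereal t < exit_time D B \<omega>} t \<partial>lborel) \<partial>W x)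
    = (\<integral>\<^sup>+ y. indicator D y * f y \<partial>green x)"
    unfolding nn_integral_green[OF x f] by (rule nn_integral_cong) (rule eq)
  have eq2: "(\<integral>\<^sup>+ t. f (B t \<omega>) * indicator {t. 0 \<le> t \<and> ereal t < exit_time D B \<omega>} t \<partial>lborel)
    = (\<integral>\<^sup>+ t. indicator lifetime_set (\<omega>, t) * (indicator D (B (max 0 t) \<omega>) * f (B (max 0 t) \<omega>)) \<partial>lborel)"
    if "\<omega> \<in> space (W x)" for \<omega>
    unfolding eq[OF that] by (intro nn_integral_cong) (auto simp: indicator_def lifetime_set_def)
  have m: "(\<lambda>q. indicator lifetime_set q * (indicator D (B (max 0 (snd q)) (fst q)) * f (B (max 0 (snd q)) (fst q))))
      \<in> borel_measurable (W x \<Otimes>\<^sub>M lborel)"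
    by (intro borel_measurable_times_ennreal measurable_lifetime_indicator(1)[OF x] measurable_compose[OF measurable_B_lborel[OF x] f])
  have "(\<lambda>\<omega>. \<integral>\<^sup>+ t. indicator lifetime_set (\<omega>, t) * (indicator D (B (max 0 t) \<omega>) * f (B (max 0 t) \<omega>)) \<partial>lborel) \<in> borel_measurable (W x)"
    using lborel.borel_measurable_nn_integral_fst[OF m] by simp
  then show "(\<lambda>\<omega>. \<integral>\<^sup>+ t. f (B t \<omega>) * indicator {t. 0 \<le> t \<and> ereal t < exit_time D B \<omega>} t \<partial>lborel) \<in> borel_measurable (W x)"
    by (subst measurable_cong[OF eq2])
qed

lemma bounded_borel_nonnegD:
  fixes f :: "'a \<Rightarrow> real"
  assumes "f \<in> bounded_borel_nonneg E" "E \<in> sets borel"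
  obtains b where "(\<lambda>y. indicator E y * f y) \<in> borel_measurable borel" "\<And>y. 0 \<le> indicator E y * f y" "\<And>y. \<bar>indicator E y * f y\<bar> \<le> b"
proof -
  have m: "f \<in> borel_measurable (restrict_space borel E)" and nn: "\<And>y. y \<in> E \<Longrightarrow> 0 \<le> f y" and b: "bounded (f ` E)"
    using assms(1) by (auto simp: bounded_borel_nonneg_def)
  obtain b where "0 < b" "\<And>y. y \<in> E \<Longrightarrow> \<bar>f y\<bar> \<le> b" using b unfolding bounded_pos by auto
  moreover have "(\<lambda>y. indicator E y * f y) \<in> borel_measurable borel"
    using m borel_measurable_restrict_space_iff[of E borel f] assms(2) by simp
  ultimately show ?thesis using nn by (intro that[of b]) (auto simp: indicator_def)
qed

text \<open>The right-hand side of the exit equation, which is also the solution for \<open>\<psi> = 0\<close>.\<close>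

definition linear_part :: "('a \<Rightarrow> real) \<Rightarrow> ('a \<Rightarrow> real) \<Rightarrow> 'a \<Rightarrow> real" where
  "linear_part \<phi> g x = (\<integral>y. indicator D y * \<phi> y \<partial>green x) + (\<integral>y. indicator (frontier D) y * g y \<partial>exit_law x)"

text \<open>All terms of the equation in \<open>[0,\<infinity>]\<close> are dominated by its bounded right-hand side, so it can be
  read in real numbers.\<close>

lemma exit_equation_real:
  fixes \<psi> :: "real \<Rightarrow> real"
  assumes eq: "exit_equation D \<psi> W B \<phi> g w"
    and \<phi>: "\<phi> \<in> bounded_borel_nonneg D" and g: "g \<in> bounded_borel_nonneg (frontier D)"
    and \<psi>0: "\<psi> 0 = 0" and \<psi>_mono: "mono_on {0..} \<psi>"
  shows "(\<lambda>y. indicator D y * w y) \<in> borel_measurable borel"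
    "(\<lambda>y. indicator D y * \<psi> (w y)) \<in> borel_measurable borel"
    "\<And>x. x \<in> D \<Longrightarrow> 0 \<le> w x \<and> w x \<le> linear_part \<phi> g x"
    "\<And>x. x \<in> D \<Longrightarrow> w x + (\<integral>z. indicator D z * \<psi> (w z) \<partial>green x) = linear_part \<phi> g x"
proof -
  have \<psi>: "\<psi> 0 = 0" "\<And>u v. 0 \<le> u \<Longrightarrow> u \<le> v \<Longrightarrow> \<psi> u \<le> \<psi> v"
    using \<psi>0 mono_onD[OF \<psi>_mono] by auto
  have w0: "0 \<le> w y" if "y \<in> D" for y using eq that by (simp add: exit_equation_def)
  have "w \<in> borel_measurable (restrict_space borel D)" using eq by (simp add: exit_equation_def)
  then show wm: "(\<lambda>y. indicator D y * w y) \<in> borel_measurable borel"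
    using borel_measurable_restrict_space_iff[of D borel w] borel_D by simp
  have "mono (\<lambda>u. \<psi> (max 0 u))" by (intro monoI \<psi>(2)) auto
  then have "(\<lambda>u. \<psi> (max 0 u)) \<in> borel_measurable borel" by (rule borel_measurable_mono)
  from measurable_compose[OF wm this]
  have "(\<lambda>y. indicator D y * \<psi> (max 0 (indicator D y * w y))) \<in> borel_measurable borel" by measurable
  moreover have "indicator D y * \<psi> (max 0 (indicator D y * w y)) = indicator D y * \<psi> (w y)" for y
    using w0[of y] by (cases "y \<in> D") auto
  ultimately show \<psi>m: "(\<lambda>y. indicator D y * \<psi> (w y)) \<in> borel_measurable borel" by simp
  have \<psi>nn: "0 \<le> indicator D y * \<psi> (w y)" for y
    using \<psi>(2)[of 0 "w y"] \<psi>(1) w0[of y] by (cases "y \<in> D") auto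
  obtain bp where p: "(\<lambda>y. indicator D y * \<phi> y) \<in> borel_measurable borel" "\<And>y. 0 \<le> indicator D y * \<phi> y"
    "\<And>y. \<bar>indicator D y * \<phi> y\<bar> \<le> bp"
    using bounded_borel_nonnegD[OF \<phi> borel_D] by metis
  have fr: "frontier D \<in> sets borel" by simp
  obtain bg where gg: "(\<lambda>y. indicator (frontier D) y * g y) \<in> borel_measurable borel" "\<And>y. 0 \<le> indicator (frontier D) y * g y"
    "\<And>y. \<bar>indicator (frontier D) y * g y\<bar> \<le> bg"
    using bounded_borel_nonnegD[OF g fr] by metis
  have main: "w x + (\<integral>z. indicator D z * \<psi> (w z) \<partial>green x) = linear_part \<phi> g x" if x: "x \<in> D" for x
  proof -
    interpret E: prob_space "exit_law x" by (rule prob_space_exit_law[OF x])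
    define I1 where "I1 = (\<integral>\<^sup>+ \<omega>. (\<integral>\<^sup>+ t. ennreal (\<psi> (w (B t \<omega>))) * indicator {t. 0 \<le> t \<and> ereal t < exit_time D B \<omega>} t \<partial>lborel) \<partial>W x)"
    define J where "J \<omega> = (\<integral>\<^sup>+ t. ennreal (\<phi> (B t \<omega>)) * indicator {t. 0 \<le> t \<and> ereal t < exit_time D B \<omega>} t \<partial>lborel)" for \<omega>
    define Q where "Q \<omega> = ennreal (g (B (real_of_ereal (exit_time D B \<omega>)) \<omega>)) * indicator {\<omega>. exit_time D B \<omega> < \<infinity>} \<omega>" for \<omega>
    define Q' where "Q' \<omega> = ennreal (indicator (frontier D) (B (real_of_ereal (exit_time D B \<omega>)) \<omega>) * g (B (real_of_ereal (exit_time D B \<omega>)) \<omega>))" for \<omega>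
    have ind: "indicator D y * ennreal c = ennreal (indicator D y * c)" for c y
      by (simp add: indicator_def)
    have e: "ennreal (w x) + I1 = (\<integral>\<^sup>+ \<omega>. J \<omega> + Q \<omega> \<partial>W x)"
      using eq x unfolding exit_equation_def I1_def J_def Q_def by blast
    have I1: "I1 = (\<integral>\<^sup>+ y. ennreal (indicator D y * \<psi> (w y)) \<partial>green x)"
      unfolding I1_def using nn_integral_green_on_D(1)[OF x, of "\<lambda>y. ennreal (\<psi> (w y))"] \<psi>m by (simp add: ind)
    have J: "(\<integral>\<^sup>+ \<omega>. J \<omega> \<partial>W x) = (\<integral>\<^sup>+ y. ennreal (indicator D y * \<phi> y) \<partial>green x)" and Jm: "J \<in> borel_measurable (W x)"
      unfolding J_def using nn_integral_green_on_D[OF x, of "\<lambda>y. ennreal (\<phi> y)"] p(1) by (simp_all add: ind)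
    have Q'm: "Q' \<in> borel_measurable (W x)"
      unfolding Q'_def using measurable_compose[OF measurable_exit_position[OF x] gg(1)] by simp
    have QQ': "AE \<omega> in W x. Q \<omega> = Q' \<omega>"
      using AE_exit_time_finite[OF x] start[OF x] AE_space
    proof eventually_elim
      case (elim \<omega>)
      then have "B (real_of_ereal (exit_time D B \<omega>)) \<omega> \<in> frontier D"
        using x by (intro exit_position_frontier[OF x]) auto
      then show ?case using elim by (simp add: Q_def Q'_def)
    qed
    have "(\<integral>\<^sup>+ \<omega>. J \<omega> + Q \<omega> \<partial>W x) = (\<integral>\<^sup>+ \<omega>. J \<omega> + Q' \<omega> \<partial>W x)"
      by (rule nn_integral_cong_AE) (use QQ' in eventually_elim, simp)
    also have "\<dots> = (\<integral>\<^sup>+ \<omega>. J \<omega> \<partial>W x) + (\<integral>\<^sup>+ \<omega>. Q' \<omega> \<partial>W x)" by (rule nn_integral_add[OF Jm Q'm])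
    also have "(\<integral>\<^sup>+ \<omega>. Q' \<omega> \<partial>W x) = (\<integral>\<^sup>+ y. ennreal (indicator (frontier D) y * g y) \<partial>exit_law x)"
      unfolding exit_law_def Q'_def using measurable_exit_position[OF x] gg(1) by (subst nn_integral_distr) auto
    also have "\<dots> = ennreal (\<integral>y. indicator (frontier D) y * g y \<partial>exit_law x)"
      using gg by (intro nn_integral_eq_integral E.integrable_const_bound[where B=bg]) auto
    also have "(\<integral>\<^sup>+ \<omega>. J \<omega> \<partial>W x) = ennreal (\<integral>y. indicator D y * \<phi> y \<partial>green x)"
      unfolding J using p by (intro nn_integral_eq_integral integrable_green[OF p(1,3) x]) auto
    also have "ennreal (\<integral>y. indicator D y * \<phi> y \<partial>green x) + ennreal (\<integral>y. indicator (frontier D) y * g y \<partial>exit_law x)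
      = ennreal (linear_part \<phi> g x)"
      unfolding linear_part_def using p(2) gg(2) by (intro ennreal_plus[symmetric] integral_nonneg_AE AE_I2)
    finally have e2: "ennreal (w x) + (\<integral>\<^sup>+ y. ennreal (indicator D y * \<psi> (w y)) \<partial>green x) = ennreal (linear_part \<phi> g x)"
      using e I1 by simp
    have l0: "0 \<le> linear_part \<phi> g x"
      unfolding linear_part_def using p(2) gg(2) by (intro add_nonneg_nonneg integral_nonneg_AE AE_I2)
    have "(\<integral>\<^sup>+ y. ennreal (indicator D y * \<psi> (w y)) \<partial>green x) \<le> ennreal (linear_part \<phi> g x)"
      unfolding e2[symmetric] by simp
    then have "(\<integral>\<^sup>+ y. ennreal (indicator D y * \<psi> (w y)) \<partial>green x) < \<infinity>" by (rule le_less_trans) simp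
    then have "integrable (green x) (\<lambda>y. indicator D y * \<psi> (w y))"
      using \<psi>m \<psi>nn by (intro integrableI_nonneg) auto
    then have "(\<integral>\<^sup>+ y. ennreal (indicator D y * \<psi> (w y)) \<partial>green x) = ennreal (\<integral>y. indicator D y * \<psi> (w y) \<partial>green x)"
      using \<psi>nn by (intro nn_integral_eq_integral) auto
    with e2 have "ennreal (w x + (\<integral>y. indicator D y * \<psi> (w y) \<partial>green x)) = ennreal (linear_part \<phi> g x)"
      using w0[OF x] \<psi>nn by (subst ennreal_plus) (auto intro!: integral_nonneg_AE)
    moreover have "0 \<le> (\<integral>y. indicator D y * \<psi> (w y) \<partial>green x)" using \<psi>nn by (intro integral_nonneg_AE AE_I2)
    ultimately show ?thesis using w0[OF x] l0 by (subst (asm) ennreal_inj) auto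
  qed
  show "w x + (\<integral>z. indicator D z * \<psi> (w z) \<partial>green x) = linear_part \<phi> g x" if "x \<in> D" for x
    by (rule main[OF that])
  show "0 \<le> w x \<and> w x \<le> linear_part \<phi> g x" if x: "x \<in> D" for x
  proof -
    have "0 \<le> (\<integral>y. indicator D y * \<psi> (w y) \<partial>green x)" using \<psi>nn by (intro integral_nonneg_AE AE_I2)
    then show ?thesis using main[OF x] w0[OF x] by linarith
  qed
qed

end

text \<open>The analytic consequences of the hypotheses on \<open>D\<close> and \<open>\<psi>\<close> on which the convergence rests: uniform tangent balls, and
  a monotone branching mechanism, Lipschitz on \<open>[0,C]\<close> with constant \<open>max 1 C * l\<close>.\<close>

locale strip_setting =
  exit_measure D W B \<psi> M P X XD + killed_brownian_motion D W B
  for D :: "'a::euclidean_space set" and W :: "'a \<Rightarrow> 'v measure" and B :: "real \<Rightarrow> 'v \<Rightarrow> 'a"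
    and \<psi> :: "real \<Rightarrow> real" and M :: "'w measure" and P :: "'a measure \<Rightarrow> 'w measure"
    and X :: "real \<Rightarrow> 'w \<Rightarrow> 'a measure" and XD :: "'w \<Rightarrow> 'a measure" +
  fixes R l :: real
  assumes R_pos: "0 < R" and tangent: "\<And>z. z \<in> frontier D \<Longrightarrow> tangent_balls D R z"
    and l_nonneg: "0 \<le> l" and \<psi>_0: "\<psi> 0 = 0"
    and \<psi>_increment: "\<And>u v C. 0 \<le> u \<Longrightarrow> u \<le> v \<Longrightarrow> v \<le> C \<Longrightarrow> \<psi> u \<le> \<psi> v \<and> \<psi> v - \<psi> u \<le> max 1 C * l * (v - u)"
begin

lemma \<psi>_mono: "mono_on {0..} \<psi>"
  using \<psi>_increment by (intro mono_onI) auto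

lemma zero_bounded_borel: "(\<lambda>_. 0) \<in> bounded_borel_nonneg E"
  by (auto simp: bounded_borel_nonneg_def intro: bounded_subset[of "{0}"])

lemma strip_density_bounded_borel:
  fixes \<phi> :: "'a \<Rightarrow> real"
  assumes \<phi>: "continuous_on (closure D) \<phi>" "\<And>y. y \<in> closure D \<Longrightarrow> 0 \<le> \<phi> y" and c: "0 \<le> c"
  shows "(\<lambda>y. c * (indicator (inner_strip D \<epsilon>) y * \<phi> y)) \<in> bounded_borel_nonneg D"
    and "(\<lambda>y. c * \<phi> y) \<in> bounded_borel_nonneg (frontier D)"
proof -
  have strip_cl: "inner_strip D \<epsilon> \<subseteq> closure D" using closure_subset by (auto simp: inner_strip_def)
  have fr_cl: "frontier D \<subseteq> closure D" by (simp add: frontier_def)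
  have "compact (\<phi> ` closure D)" using bounded_D by (intro compact_continuous_image \<phi>(1)) (simp add: compact_closure)
  then have "bounded (\<phi> ` closure D)" by (rule compact_imp_bounded)
  then obtain b where b: "0 < b" "\<And>y. y \<in> closure D \<Longrightarrow> \<bar>\<phi> y\<bar> \<le> b" unfolding bounded_pos by auto
  have b1: "bounded ((\<lambda>y. c * (indicator (inner_strip D \<epsilon>) y * \<phi> y)) ` D)"
    unfolding bounded_iff
  proof (intro exI[of _ "c * b"] ballI)
    fix z assume "z \<in> (\<lambda>y. c * (indicator (inner_strip D \<epsilon>) y * \<phi> y)) ` D"
    then obtain y where "y \<in> D" "z = c * (indicator (inner_strip D \<epsilon>) y * \<phi> y)" by blast
    then show "norm z \<le> c * b"
      using b(1) b(2)[of y] c subsetD[OF closure_subset[of D], of y] by (auto simp: abs_mult indicator_def intro!: mult_left_mono)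
  qed
  have m1: "(\<lambda>y. indicator (inner_strip D \<epsilon>) y * \<phi> y) \<in> borel_measurable borel"
    by (rule measurable_indicator_times_continuous[OF \<phi>(1) inner_strip_borel strip_cl])
  show "(\<lambda>y. c * (indicator (inner_strip D \<epsilon>) y * \<phi> y)) \<in> bounded_borel_nonneg D"
    unfolding bounded_borel_nonneg_def
    using b1 c \<phi>(2) subsetD[OF closure_subset[of D]] m1
    by (auto intro!: measurable_restrict_space1 borel_measurable_times mult_nonneg_nonneg)
  have b2: "bounded ((\<lambda>y. c * \<phi> y) ` frontier D)"
    unfolding bounded_iff
  proof (intro exI[of _ "c * b"] ballI)
    fix z assume "z \<in> (\<lambda>y. c * \<phi> y) ` frontier D"
    then obtain y where "y \<in> frontier D" "z = c * \<phi> y" by blast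
    then show "norm z \<le> c * b" using b(2)[of y] c fr_cl by (auto simp: abs_mult intro!: mult_left_mono)
  qed
  have "continuous_on (frontier D) (\<lambda>y. c * \<phi> y)"
    by (intro continuous_intros continuous_on_subset[OF \<phi>(1) fr_cl])
  then have "(\<lambda>y. c * \<phi> y) \<in> borel_measurable (restrict_space borel (frontier D))"
    by (rule borel_measurable_continuous_on_restrict)
  then show "(\<lambda>y. c * \<phi> y) \<in> bounded_borel_nonneg (frontier D)"
    unfolding bounded_borel_nonneg_def using b2 c \<phi>(2) fr_cl by auto
qed

lemma linear_part_strip:
  fixes \<phi> :: "'a \<Rightarrow> real"
  shows "linear_part (\<lambda>y. c * (indicator (inner_strip D \<epsilon>) y * \<phi> y)) (\<lambda>y. b * \<phi> y) x
    = c * (\<integral>y. indicator (inner_strip D \<epsilon>) y * \<phi> y \<partial>green x) + b * (\<integral>y. indicator (frontier D) y * \<phi> y \<partial>exit_law x)"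
proof -
  have e1: "indicator D y * (c * (indicator (inner_strip D \<epsilon>) y * \<phi> y)) = c * (indicator (inner_strip D \<epsilon>) y * \<phi> y)" for y
    by (auto simp: indicator_def inner_strip_def)
  have e2: "indicator (frontier D) y * (b * \<phi> y) = b * (indicator (frontier D) y * \<phi> y)" for y by simp
  show ?thesis unfolding linear_part_def e1 e2 by (simp only: integral_mult_right_zero)
qed

text \<open>The strip term of the linear part tends to \<open>a\<close> times the mean of \<open>\<phi>\<close> at the exit point and acts in the limit like
  an additional boundary value \<open>a \<phi>\<close>. Stability carries this over to the solutions, which are uniformly bounded.\<close>

lemma solution_tendsto:
  fixes \<phi> :: "'a \<Rightarrow> real"
  assumes \<phi>: "continuous_on (closure D) \<phi>" "\<And>y. y \<in> closure D \<Longrightarrow> 0 \<le> \<phi> y" and ab: "0 \<le> a" "0 \<le> b"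
    and E: "\<And>n. 0 < E n" "E \<longlonglongrightarrow> 0" "\<And>n x. x \<in> D \<Longrightarrow> (\<integral>y. indicator (inner_strip D (E n)) y \<partial>green x) \<le> 8 * (E n)^2"
    and wn: "\<And>n. exit_equation D \<psi> W B (\<lambda>y. a / (E n)^2 * (indicator (inner_strip D (E n)) y * \<phi> y)) (\<lambda>y. b * \<phi> y) (wn n)"
    and w: "exit_equation D \<psi> W B (\<lambda>_. 0) (\<lambda>y. (a + b) * \<phi> y) w"
    and \<mu>: "\<mu> \<in> finite_measures D"
  shows "(\<lambda>n. \<integral>x. wn n x \<partial>\<mu>) \<longlonglongrightarrow> (\<integral>x. w x \<partial>\<mu>)"
proof -
  have strip_cl: "inner_strip D \<epsilon> \<subseteq> closure D" for \<epsilon> using closure_subset by (auto simp: inner_strip_def)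
  have fr_cl: "frontier D \<subseteq> closure D" by (simp add: frontier_def)
  have "compact (\<phi> ` closure D)" using bounded_D by (intro compact_continuous_image \<phi>(1)) (simp add: compact_closure)
  then have "bounded (\<phi> ` closure D)" by (rule compact_imp_bounded)
  then obtain F where F: "0 < F" "\<And>y. y \<in> closure D \<Longrightarrow> \<bar>\<phi> y\<bar> \<le> F" unfolding bounded_pos by auto
  have c: "0 \<le> a / (E n)^2" for n using ab by simp
  have ab': "0 \<le> a + b" using ab by simp
  have sd1: "(\<lambda>y. a / (E n)^2 * (indicator (inner_strip D (E n)) y * \<phi> y)) \<in> bounded_borel_nonneg D" for n
    by (rule strip_density_bounded_borel(1)[OF \<phi> c])
  have sd2: "(\<lambda>y. b * \<phi> y) \<in> bounded_borel_nonneg (frontier D)"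
    by (rule strip_density_bounded_borel(2)[OF \<phi> ab(2)])
  have sd3: "(\<lambda>y. (a + b) * \<phi> y) \<in> bounded_borel_nonneg (frontier D)"
    by (rule strip_density_bounded_borel(2)[OF \<phi> ab'])
  note rn = exit_equation_real[OF wn sd1 sd2 \<psi>_0 \<psi>_mono]
  note r = exit_equation_real[OF w zero_bounded_borel sd3 \<psi>_0 \<psi>_mono]
  define S where "S \<epsilon> x = (\<integral>y. indicator (inner_strip D \<epsilon>) y * \<phi> y \<partial>green x)" for \<epsilon> x
  define H where "H x = (\<integral>y. indicator (frontier D) y * \<phi> y \<partial>exit_law x)" for x
  define hn where "hn n x = a / (E n)^2 * S (E n) x + b * H x" for n x
  define h where "h x = (a + b) * H x" for x
  have lp: "linear_part (\<lambda>y. a / (E n)^2 * (indicator (inner_strip D (E n)) y * \<phi> y)) (\<lambda>y. b * \<phi> y) x = hn n x" for n x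
    unfolding linear_part_strip hn_def S_def H_def ..
  have lp0: "linear_part (\<lambda>_. 0) (\<lambda>y. (a + b) * \<phi> y) x = h x" for x
    using linear_part_strip[of 0 0 \<phi> "a + b" x] unfolding h_def H_def by simp
  have H: "0 \<le> H x" "H x \<le> F" if x: "x \<in> D" for x
  proof -
    interpret E: prob_space "exit_law x" by (rule prob_space_exit_law[OF x])
    have nn: "0 \<le> indicator (frontier D) y * \<phi> y" "indicator (frontier D) y * \<phi> y \<le> F" for y
      using \<phi>(2)[of y] F(1) F(2)[of y] subsetD[OF fr_cl, of y] by (auto simp: indicator_def)
    show "0 \<le> H x" unfolding H_def using nn(1) by (intro integral_nonneg_AE AE_I2)
    have "(\<lambda>y. indicator (frontier D) y * \<phi> y) \<in> borel_measurable borel"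
      by (rule measurable_indicator_times_continuous[OF \<phi>(1) _ fr_cl]) simp
    then have "integrable (exit_law x) (\<lambda>y. indicator (frontier D) y * \<phi> y)"
      using nn by (intro E.integrable_const_bound[where B=F]) (auto simp: abs_le_iff)
    then have "H x \<le> (\<integral>y. F \<partial>exit_law x)" unfolding H_def using nn(2) by (intro integral_mono) auto
    then show "H x \<le> F" using E.prob_space by simp
  qed
  have S: "0 \<le> S (E n) x" "S (E n) x \<le> 8 * F * (E n)^2" if x: "x \<in> D" for n x
  proof -
    have nn: "0 \<le> indicator (inner_strip D (E n)) y * \<phi> y"
      "indicator (inner_strip D (E n)) y * \<phi> y \<le> F * indicator (inner_strip D (E n)) y" for y
      using \<phi>(2)[of y] F(1) F(2)[of y] subsetD[OF strip_cl, of y "E n"] by (auto simp: indicator_def)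
    show "0 \<le> S (E n) x" unfolding S_def using nn(1) by (intro integral_nonneg_AE AE_I2)
    have i2: "integrable (green x) (\<lambda>y. F * indicator (inner_strip D (E n)) y)"
      by (rule integrable_green[OF _ _ x, where C=F]) (use F(1) in \<open>auto simp: indicator_def\<close>)
    have "indicator (inner_strip D (E n)) y * \<phi> y \<le> F" for y using nn(2)[of y] F(1) by (auto simp: indicator_def split: if_splits)
    then have i1: "integrable (green x) (\<lambda>y. indicator (inner_strip D (E n)) y * \<phi> y)"
      using nn(1) measurable_indicator_times_continuous[OF \<phi>(1) inner_strip_borel strip_cl]
      by (intro integrable_green[OF _ _ x, where C=F]) auto
    have "S (E n) x \<le> (\<integral>y. F * indicator (inner_strip D (E n)) y \<partial>green x)"
      unfolding S_def by (rule integral_mono[OF i1 i2 nn(2)])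
    also have "\<dots> \<le> F * (8 * (E n)^2)" using E(3)[OF x, of n] F(1) by simp
    finally show "S (E n) x \<le> 8 * F * (E n)^2" by simp
  qed
  define C where "C = 8 * a * F + (a + b) * F"
  have hnb: "0 \<le> hn n x" "hn n x \<le> C" if x: "x \<in> D" for n x
  proof -
    show "0 \<le> hn n x" unfolding hn_def using S(1)[OF x] H(1)[OF x] ab by (intro add_nonneg_nonneg mult_nonneg_nonneg) auto
    have "a / (E n)^2 * S (E n) x \<le> a / (E n)^2 * (8 * F * (E n)^2)" by (rule mult_left_mono[OF S(2)[OF x] c])
    also have "\<dots> = 8 * a * F" using E(1)[of n] by simp
    finally have 1: "a / (E n)^2 * S (E n) x \<le> 8 * a * F" .
    have 2: "b * H x \<le> b * F" using H(2)[OF x] ab by (intro mult_left_mono)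
    have "0 \<le> a * F" using ab F by simp
    then show "hn n x \<le> C" using 1 2 by (simp add: hn_def C_def algebra_simps)
  qed
  have hb: "0 \<le> h x" "h x \<le> C" if x: "x \<in> D" for x
  proof -
    show "0 \<le> h x" unfolding h_def using H(1)[OF x] ab by simp
    have "(a + b) * H x \<le> (a + b) * F" using H(2)[OF x] ab by (intro mult_left_mono) auto
    moreover have "0 \<le> 8 * a * F" using ab F by simp
    ultimately show "h x \<le> C" unfolding h_def C_def by linarith
  qed
  have lim: "(\<lambda>n. hn n x) \<longlonglongrightarrow> h x" if x: "x \<in> D" for x
  proof -
    have "filterlim E (at_right 0) sequentially"
      using E(1,2) by (intro tendsto_imp_filterlim_at_right) auto
    from filterlim_compose[OF strip_green_tendsto[OF x R_pos tangent \<phi>] this]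
    have "(\<lambda>n. S (E n) x / (E n)^2) \<longlonglongrightarrow> H x" unfolding S_def H_def .
    then have "(\<lambda>n. a * (S (E n) x / (E n)^2) + b * H x) \<longlonglongrightarrow> a * H x + b * H x"
      by (intro tendsto_intros)
    then show ?thesis by (simp add: hn_def h_def algebra_simps)
  qed
  have wb: "0 \<le> w x \<and> w x \<le> C" if "x \<in> D" for x using r(3)[OF that] hb(2)[OF that] unfolding lp0 by linarith
  have wnb: "0 \<le> wn n x \<and> wn n x \<le> C" if "x \<in> D" for n x using rn(3)[OF that, of n] hnb(2)[OF that, of n] unfolding lp by linarith
  have pointwise: "(\<lambda>n. wn n x) \<longlonglongrightarrow> w x" if x: "x \<in> D" for x
  proof (rule nonlinear_stability[where C=C and L = "max 1 C * l" and \<psi>=\<psi> and h=h and hn=hn and H = "C"])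
    show "\<psi> u \<le> \<psi> v \<and> \<psi> v - \<psi> u \<le> max 1 C * l * (v - u)" if "0 \<le> u" "u \<le> v" "v \<le> C" for u v
      by (rule \<psi>_increment[OF that])
    show "0 \<le> max 1 C * l" using l_nonneg by simp
    show "w y + (\<integral>z. indicator D z * \<psi> (w z) \<partial>green y) = h y" if "y \<in> D" for y using r(4)[OF that] unfolding lp0 .
    show "wn n y + (\<integral>z. indicator D z * \<psi> (wn n z) \<partial>green y) = hn n y" if "y \<in> D" for n y using rn(4)[OF that, of n] unfolding lp .
    show "\<bar>hn n y - h y\<bar> \<le> C" if "y \<in> D" for n y using hnb[OF that, of n] hb[OF that] by (auto simp: abs_le_iff)
    show "(\<lambda>n. hn n y) \<longlonglongrightarrow> h y" if "y \<in> D" for y by (rule lim[OF that])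
    show "0 \<le> w y \<and> w y \<le> C" if "y \<in> D" for y by (rule wb[OF that])
    show "0 \<le> wn n y \<and> wn n y \<le> C" if "y \<in> D" for n y by (rule wnb[OF that])
  qed (use r(1,2) rn(1,2) x in auto)
  have s\<mu>: "sets \<mu> = sets (restrict_space borel D)" and fm: "finite_measure \<mu>" using \<mu> by (auto simp: finite_measures_def)
  interpret finite_measure \<mu> by (rule fm)
  have sp: "space \<mu> = D" using sets_eq_imp_space_eq[OF s\<mu>] by (simp add: space_restrict_space)
  have m\<mu>: "f \<in> borel_measurable \<mu>" if "f \<in> borel_measurable (restrict_space borel D)" for f :: "'a \<Rightarrow> real"
    using that by (subst measurable_cong_sets[OF s\<mu> refl])
  show ?thesis
  proof (rule integral_dominated_convergence[where w = "\<lambda>_. C"])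
    show "w \<in> borel_measurable \<mu>" "wn n \<in> borel_measurable \<mu>" for n
      using w wn by (auto intro!: m\<mu> simp: exit_equation_def)
    show "AE x in \<mu>. (\<lambda>n. wn n x) \<longlonglongrightarrow> w x" using pointwise by (intro AE_I2) (simp add: sp)
    show "AE x in \<mu>. norm (wn n x) \<le> C" for n using wnb by (intro AE_I2) (simp add: sp)
  qed simp
qed

end

section \<open>Measurability of the superprocess and its strip occupation\<close>

lemma space_finite_measure_algebra: "space (finite_measure_algebra E) = finite_measures E"
proof -
  have "{} \<in> sets (restrict_space borel E)" by simp
  then show ?thesis by (auto simp: finite_measure_algebra_def space_Sup_eq_UN)
qed

lemma measurable_emeasure_finite_measure_algebra:
  "A \<in> sets (restrict_space borel E) \<Longrightarrow> (\<lambda>\<mu>. emeasure \<mu> A) \<in> borel_measurable (finite_measure_algebra E)"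
  by (auto intro!: measurable_Sup1 measurable_vimage_algebra1 simp: finite_measure_algebra_def)

lemma measurable_eqI:
  "g \<in> measurable M N \<Longrightarrow> (\<And>w. w \<in> space M \<Longrightarrow> f w = g w) \<Longrightarrow> f \<in> measurable M N"
  by (simp cong: measurable_cong)

lemma measurable_kernel_nn_integral:
  assumes sets: "\<And>p. p \<in> space N \<Longrightarrow> sets (K p) = sets Q"
    and em: "\<And>A. A \<in> sets Q \<Longrightarrow> (\<lambda>p. emeasure (K p) A) \<in> borel_measurable N"
    and f: "f \<in> borel_measurable Q"
  shows "(\<lambda>p. \<integral>\<^sup>+ x. f x \<partial>K p) \<in> borel_measurable N"
  using f
proof (induction rule: borel_measurable_induct)
  case (cong f g)
  have "(\<integral>\<^sup>+ x. f x \<partial>K p) = (\<integral>\<^sup>+ x. g x \<partial>K p)" if "p \<in> space N" for p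
    using cong(3) sets_eq_imp_space_eq[OF sets[OF that]] by (intro nn_integral_cong) auto
  then show ?case by (rule measurable_eqI[OF cong(4)])
next
  case (set A)
  have "(\<integral>\<^sup>+ x. indicator A x \<partial>K p) = emeasure (K p) A" if "p \<in> space N" for p
    using set sets[OF that] by simp
  then show ?case by (rule measurable_eqI[OF em[OF set]])
next
  case (mult u c)
  have "(\<integral>\<^sup>+ x. c * u x \<partial>K p) = c * (\<integral>\<^sup>+ x. u x \<partial>K p)" if "p \<in> space N" for p
    using mult(2) by (intro nn_integral_cmult) (simp add: measurable_cong_sets[OF sets[OF that] refl])
  then show ?case by (rule measurable_eqI[OF borel_measurable_times_ennreal[OF borel_measurable_const mult(4)]])
next
  case (add u v)
  have "(\<integral>\<^sup>+ x. v x + u x \<partial>K p) = (\<integral>\<^sup>+ x. v x \<partial>K p) + (\<integral>\<^sup>+ x. u x \<partial>K p)" if "p \<in> space N" for p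
    using \<open>u \<in> borel_measurable Q\<close> \<open>v \<in> borel_measurable Q\<close>
    by (intro nn_integral_add) (simp_all add: measurable_cong_sets[OF sets[OF that] refl])
  moreover have "(\<lambda>p. (\<integral>\<^sup>+ x. v x \<partial>K p) + (\<integral>\<^sup>+ x. u x \<partial>K p)) \<in> borel_measurable N"
    by (intro borel_measurable_add add)
  ultimately show ?case by (rule measurable_eqI[rotated])
next
  case (seq U)
  have "(\<integral>\<^sup>+ x. (\<Squnion>i. U i) x \<partial>K p) = (\<Squnion>i. \<integral>\<^sup>+ x. U i x \<partial>K p)" if "p \<in> space N" for p
    unfolding SUP_apply using seq(1) \<open>incseq U\<close>
    by (intro nn_integral_monotone_convergence_SUP) (simp_all add: measurable_cong_sets[OF sets[OF that] refl])
  moreover have "(\<lambda>p. \<Squnion>i. \<integral>\<^sup>+ x. U i x \<partial>K p) \<in> borel_measurable N" by (intro borel_measurable_SUP seq) simp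
  ultimately show ?case by (rule measurable_eqI[rotated])
qed

text \<open>Integration against a measure that is itself given setwise by a time integral, for a kernel living on the
  smaller set \<open>D\<close>.\<close>

lemma nn_integral_mixture:
  fixes f :: "'a::euclidean_space \<Rightarrow> ennreal" and K :: "'t \<Rightarrow> 'a measure"
  assumes K: "\<And>t. t \<in> space N \<Longrightarrow> sets (K t) = sets (restrict_space borel D)"
    and em: "\<And>A. A \<in> sets (restrict_space borel D) \<Longrightarrow> (\<lambda>t. emeasure (K t) A) \<in> borel_measurable N"
    and G: "G \<in> sets borel" "G \<subseteq> D" and D: "D \<in> sets borel" "D \<subseteq> E" "E \<in> sets borel"
    and \<theta>: "\<theta> \<in> borel_measurable N"
    and S: "sets S = sets (restrict_space borel E)"
    and emS: "\<And>A. A \<in> sets S \<Longrightarrow> emeasure S A = c * (\<integral>\<^sup>+ t. emeasure (K t) (A \<inter> G) * \<theta> t \<partial>N)"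
    and f: "f \<in> borel_measurable S"
  shows "(\<integral>\<^sup>+ x. f x \<partial>S) = c * (\<integral>\<^sup>+ t. (\<integral>\<^sup>+ x. f x * indicator G x \<partial>K t) * \<theta> t \<partial>N)"
proof -
  have sp: "space S = E" using sets_eq_imp_space_eq[OF S] by (simp add: space_restrict_space)
  have spK: "space (K t) = D" if "t \<in> space N" for t
    using sets_eq_imp_space_eq[OF K[OF that]] by (simp add: space_restrict_space)
  have fm: "(\<lambda>x. f x * indicator G x) \<in> borel_measurable (restrict_space borel D)" if "f \<in> borel_measurable S" for f :: "'a \<Rightarrow> ennreal"
  proof (rule borel_measurable_times_ennreal)
    have "f \<in> borel_measurable (restrict_space borel E)" using that by (simp add: measurable_cong_sets[OF S refl])
    then show "f \<in> borel_measurable (restrict_space borel D)" by (rule measurable_restrict_mono[OF _ D(2)])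
    show "indicator G \<in> borel_measurable (restrict_space borel D)"
      by (rule measurable_restrict_space1) (use G in simp)
  qed
  have fmK: "(\<lambda>x. f x * indicator G x) \<in> borel_measurable (K t)" if "f \<in> borel_measurable S" "t \<in> space N" for f :: "'a \<Rightarrow> ennreal" and t
    using fm[OF that(1)] by (simp add: measurable_cong_sets[OF K[OF that(2)] refl])
  have im: "(\<lambda>t. (\<integral>\<^sup>+ x. f x * indicator G x \<partial>K t) * \<theta> t) \<in> borel_measurable N" if "f \<in> borel_measurable S" for f :: "'a \<Rightarrow> ennreal"
    by (intro borel_measurable_times_ennreal \<theta> measurable_kernel_nn_integral[OF K em fm[OF that]])
  show ?thesis using f
  proof (induction rule: borel_measurable_induct)
    case (cong f g)
    have "(\<integral>\<^sup>+ x. f x \<partial>S) = (\<integral>\<^sup>+ x. g x \<partial>S)" by (intro nn_integral_cong cong)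
    moreover have "(\<integral>\<^sup>+ x. f x * indicator G x \<partial>K t) = (\<integral>\<^sup>+ x. g x * indicator G x \<partial>K t)" if "t \<in> space N" for t
      using cong(3) D(2) by (intro nn_integral_cong) (auto simp: spK[OF that] sp)
    then have "(\<integral>\<^sup>+ t. (\<integral>\<^sup>+ x. f x * indicator G x \<partial>K t) * \<theta> t \<partial>N) = (\<integral>\<^sup>+ t. (\<integral>\<^sup>+ x. g x * indicator G x \<partial>K t) * \<theta> t \<partial>N)"
      by (intro nn_integral_cong) simp
    ultimately show ?case using cong(4) by simp
  next
    case (set A)
    have "A \<inter> G \<in> sets (restrict_space borel D)"
    proof -
      have "A \<in> sets borel" using set S D(3) by (auto simp: sets_restrict_space)
      then show ?thesis using G by (auto simp: sets_restrict_space intro!: image_eqI[of _ _ "A \<inter> G"])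
    qed
    then have "(\<integral>\<^sup>+ x. indicator A x * indicator G x \<partial>K t) = emeasure (K t) (A \<inter> G)" if "t \<in> space N" for t
      using K[OF that] by (subst indicator_inter_arith[symmetric]) simp
    then have "(\<integral>\<^sup>+ t. (\<integral>\<^sup>+ x. indicator A x * indicator G x \<partial>K t) * \<theta> t \<partial>N) = (\<integral>\<^sup>+ t. emeasure (K t) (A \<inter> G) * \<theta> t \<partial>N)"
      by (intro nn_integral_cong) simp
    then show ?case using emS[OF set] set by simp
  next
    case (mult u r)
    have "(\<integral>\<^sup>+ x. r * u x * indicator G x \<partial>K t) = r * (\<integral>\<^sup>+ x. u x * indicator G x \<partial>K t)" if "t \<in> space N" for t
      using fmK[OF mult(2) that] by (simp add: mult.assoc nn_integral_cmult)
    then have "(\<integral>\<^sup>+ t. (\<integral>\<^sup>+ x. r * u x * indicator G x \<partial>K t) * \<theta> t \<partial>N) = (\<integral>\<^sup>+ t. r * ((\<integral>\<^sup>+ x. u x * indicator G x \<partial>K t) * \<theta> t) \<partial>N)"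
      by (intro nn_integral_cong) (simp add: mult.assoc)
    also have "\<dots> = r * (\<integral>\<^sup>+ t. (\<integral>\<^sup>+ x. u x * indicator G x \<partial>K t) * \<theta> t \<partial>N)" by (rule nn_integral_cmult[OF im[OF mult(2)]])
    finally show ?case using mult by (simp add: nn_integral_cmult mult.left_commute)
  next
    case (add u v)
    have um: "u \<in> borel_measurable S" and vm: "v \<in> borel_measurable S" by (rule add)+
    have "(\<integral>\<^sup>+ x. (v x + u x) * indicator G x \<partial>K t) = (\<integral>\<^sup>+ x. v x * indicator G x \<partial>K t) + (\<integral>\<^sup>+ x. u x * indicator G x \<partial>K t)" if "t \<in> space N" for t
      unfolding distrib_right by (rule nn_integral_add[OF fmK[OF vm that] fmK[OF um that]])
    then have "(\<integral>\<^sup>+ t. (\<integral>\<^sup>+ x. (v x + u x) * indicator G x \<partial>K t) * \<theta> t \<partial>N)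
      = (\<integral>\<^sup>+ t. (\<integral>\<^sup>+ x. v x * indicator G x \<partial>K t) * \<theta> t + (\<integral>\<^sup>+ x. u x * indicator G x \<partial>K t) * \<theta> t \<partial>N)"
      by (intro nn_integral_cong) (simp add: distrib_right)
    also have "\<dots> = (\<integral>\<^sup>+ t. (\<integral>\<^sup>+ x. v x * indicator G x \<partial>K t) * \<theta> t \<partial>N) + (\<integral>\<^sup>+ t. (\<integral>\<^sup>+ x. u x * indicator G x \<partial>K t) * \<theta> t \<partial>N)"
      by (rule nn_integral_add[OF im[OF vm] im[OF um]])
    finally show ?case using add um vm by (simp add: nn_integral_add distrib_left)
  next
    case (seq U)
    have inc: "incseq (\<lambda>i x. U i x * indicator G x)"
      using \<open>incseq U\<close> by (auto simp: incseq_def le_fun_def intro!: mult_right_mono)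
    have "(\<integral>\<^sup>+ x. (\<Squnion>i. U i) x * indicator G x \<partial>K t) = (\<Squnion>i. \<integral>\<^sup>+ x. U i x * indicator G x \<partial>K t)" if "t \<in> space N" for t
      unfolding SUP_apply SUP_mult_right_ennreal
      by (rule nn_integral_monotone_convergence_SUP[OF inc fmK[OF seq(1) that]])
    then have "(\<integral>\<^sup>+ t. (\<integral>\<^sup>+ x. (\<Squnion>i. U i) x * indicator G x \<partial>K t) * \<theta> t \<partial>N)
      = (\<integral>\<^sup>+ t. (\<Squnion>i. (\<integral>\<^sup>+ x. U i x * indicator G x \<partial>K t) * \<theta> t) \<partial>N)"
      by (intro nn_integral_cong) (simp add: SUP_mult_right_ennreal)
    also have "\<dots> = (\<Squnion>i. \<integral>\<^sup>+ t. (\<integral>\<^sup>+ x. U i x * indicator G x \<partial>K t) * \<theta> t \<partial>N)"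
    proof (rule nn_integral_monotone_convergence_SUP[OF _ im[OF seq(1)]])
      show "incseq (\<lambda>i t. (\<integral>\<^sup>+ x. U i x * indicator G x \<partial>K t) * \<theta> t)"
        using \<open>incseq U\<close> by (auto simp: incseq_def le_fun_def intro!: mult_right_mono nn_integral_mono)
    qed
    finally have R: "(\<integral>\<^sup>+ t. (\<integral>\<^sup>+ x. (\<Squnion>i. U i) x * indicator G x \<partial>K t) * \<theta> t \<partial>N)
      = (\<Squnion>i. \<integral>\<^sup>+ t. (\<integral>\<^sup>+ x. U i x * indicator G x \<partial>K t) * \<theta> t \<partial>N)" .
    have "(\<integral>\<^sup>+ x. (\<Squnion>i. U i) x \<partial>S) = (\<Squnion>i. \<integral>\<^sup>+ x. U i x \<partial>S)"
      unfolding SUP_apply by (rule nn_integral_monotone_convergence_SUP[OF \<open>incseq U\<close> seq(1)])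
    then show ?case unfolding R using seq by (simp add: SUP_mult_left_ennreal)
  qed
qed

lemma weak_topology_limit:
  fixes f :: "'a::euclidean_space \<Rightarrow> real"
  assumes "limitin (weak_topology E) \<mu> \<nu> F" "continuous_on E f" "bounded (f ` E)"
  shows "((\<lambda>s. \<integral>x. f x \<partial>\<mu> s) \<longlongrightarrow> (\<integral>x. f x \<partial>\<nu>)) F"
proof -
  let ?I = "{f :: 'a \<Rightarrow> real. continuous_on E f \<and> bounded (f ` E)}"
  have f: "f \<in> ?I" using assms by simp
  have "continuous_map (weak_topology E) euclideanreal ((\<lambda>g. g f) \<circ> (\<lambda>\<mu>. \<lambda>f \<in> ?I. \<integral>x. f x \<partial>\<mu>))"
    unfolding weak_topology_def by (rule continuous_map_pullback[OF continuous_map_product_projection[OF f]])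
  from continuous_map_limit[OF this assms(1)] show ?thesis using f by (simp add: comp_def)
qed

context strip_setting
begin

abbreviation (input) "RD \<equiv> restrict_space borel D"

lemma X_finite: "\<omega> \<in> space M \<Longrightarrow> 0 \<le> t \<Longrightarrow> X t \<omega> \<in> finite_measures D"
  using measurable_space[OF measurable_X] by (simp add: space_finite_measure_algebra)

lemma sets_X: "\<omega> \<in> space M \<Longrightarrow> 0 \<le> t \<Longrightarrow> sets (X t \<omega>) = sets RD"
  and finite_X: "\<omega> \<in> space M \<Longrightarrow> 0 \<le> t \<Longrightarrow> finite_measure (X t \<omega>)"
  using X_finite by (auto simp: finite_measures_def)

lemma space_X: "\<omega> \<in> space M \<Longrightarrow> 0 \<le> t \<Longrightarrow> space (X t \<omega>) = D"
  using sets_eq_imp_space_eq[OF sets_X] by (simp add: space_restrict_space)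

lemma measurable_X_emeasure: "0 \<le> t \<Longrightarrow> A \<in> sets RD \<Longrightarrow> (\<lambda>\<omega>. emeasure (X t \<omega>) A) \<in> borel_measurable M"
  using measurable_compose[OF measurable_X measurable_emeasure_finite_measure_algebra] .

lemma measurable_X_integral:
  fixes f :: "'a \<Rightarrow> real"
  assumes t: "0 \<le> t" and f: "f \<in> borel_measurable RD" and nn: "\<And>x. x \<in> D \<Longrightarrow> 0 \<le> f x"
  shows "(\<lambda>\<omega>. \<integral>x. f x \<partial>X t \<omega>) \<in> borel_measurable M"
proof -
  have "(\<integral>x. f x \<partial>X t \<omega>) = enn2real (\<integral>\<^sup>+ x. ennreal (f x) \<partial>X t \<omega>)" if "\<omega> \<in> space M" for \<omega>
    using f nn by (intro integral_eq_nn_integral AE_I2) (auto simp: measurable_cong_sets[OF sets_X[OF that t] refl] space_X[OF that t])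
  moreover have "(\<lambda>\<omega>. \<integral>\<^sup>+ x. ennreal (f x) \<partial>X t \<omega>) \<in> borel_measurable M"
    by (rule measurable_kernel_nn_integral[OF sets_X[OF _ t] measurable_X_emeasure[OF t] measurable_compose[OF f measurable_ennreal]])
  then have "(\<lambda>\<omega>. enn2real (\<integral>\<^sup>+ x. ennreal (f x) \<partial>X t \<omega>)) \<in> borel_measurable M" by simp
  ultimately show ?thesis by (rule measurable_eqI[rotated])
qed

lemma measurable_X_joint_continuous:
  fixes f :: "'a \<Rightarrow> real"
  assumes cont: "continuous_on D f" and bd: "bounded (f ` D)" and nn: "\<And>x. x \<in> D \<Longrightarrow> 0 \<le> f x"
  shows "(\<lambda>p. \<integral>\<^sup>+ x. ennreal (f x) \<partial>X (max 0 (snd p)) (fst p)) \<in> borel_measurable (M \<Otimes>\<^sub>M borel)"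
proof -
  have fm: "f \<in> borel_measurable RD" using cont by (rule borel_measurable_continuous_on_restrict)
  have real: "(\<lambda>p. \<integral>x. f x \<partial>X (max 0 (snd p)) (fst p)) \<in> borel_measurable (M \<Otimes>\<^sub>M borel)"
  proof (rule borel_measurable_LIMSEQ_metric)
    fix n
    \<comment> \<open>grid points strictly to the right, as the paths are only right continuous\<close>
    show "(\<lambda>p. \<integral>x. f x \<partial>X (real (Suc (nat \<lfloor>max 0 (snd p) * real (Suc n)\<rfloor>)) / real (Suc n)) (fst p)) \<in> borel_measurable (M \<Otimes>\<^sub>M borel)"
    proof (rule measurable_compose_countable[where g = "\<lambda>p. nat \<lfloor>max 0 (snd p) * real (Suc n)\<rfloor>"])
      fix i :: nat
      show "(\<lambda>p. \<integral>x. f x \<partial>X (real (Suc i) / real (Suc n)) (fst p)) \<in> borel_measurable (M \<Otimes>\<^sub>M borel)"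
        by (rule measurable_compose[OF measurable_fst measurable_X_integral[OF _ fm nn]]) auto
    qed measurable
  next
    fix p assume "p \<in> space (M \<Otimes>\<^sub>M (borel :: real measure))"
    then have \<omega>: "fst p \<in> space M" by (auto simp: space_pair_measure)
    define u where "u = max 0 (snd p)"
    have u: "0 \<le> u" by (simp add: u_def)
    have eq: "real (Suc (nat \<lfloor>u * real (Suc n)\<rfloor>)) / real (Suc n) = grid n u + 1 / real (Suc n)" for n
      by (simp add: grid_def add_divide_distrib)
    have "(\<lambda>n. grid n u + 1 / real (Suc n)) \<longlonglongrightarrow> u"
      using tendsto_add[OF grid_tendsto[OF u] LIMSEQ_Suc[OF lim_1_over_n]] by simp
    moreover have "u < grid n u + 1 / real (Suc n)" for n
    proof -
      have "u * real (Suc n) < real_of_int \<lfloor>u * real (Suc n)\<rfloor> + 1" by linarith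
      also have "\<dots> = real (Suc (nat \<lfloor>u * real (Suc n)\<rfloor>))" using u by simp
      finally show ?thesis unfolding eq[symmetric] by (simp add: pos_less_divide_eq del: of_nat_Suc)
    qed
    ultimately have "filterlim (\<lambda>n. grid n u + 1 / real (Suc n)) (at_right u) sequentially"
      by (intro tendsto_imp_filterlim_at_right) auto
    from filterlim_compose[OF weak_topology_limit[OF right_continuous[OF \<omega> u] cont bd] this]
    show "(\<lambda>n. \<integral>x. f x \<partial>X (real (Suc (nat \<lfloor>max 0 (snd p) * real (Suc n)\<rfloor>)) / real (Suc n)) (fst p))
        \<longlonglongrightarrow> (\<integral>x. f x \<partial>X (max 0 (snd p)) (fst p))"
      unfolding u_def[symmetric] eq .
  qed
  have "(\<integral>\<^sup>+ x. ennreal (f x) \<partial>X (max 0 (snd p)) (fst p)) = ennreal (\<integral>x. f x \<partial>X (max 0 (snd p)) (fst p))"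
    if "p \<in> space (M \<Otimes>\<^sub>M borel)" for p
  proof -
    have \<omega>: "fst p \<in> space M" using that by (auto simp: space_pair_measure)
    have t: "0 \<le> max 0 (snd p)" by simp
    interpret finite_measure "X (max 0 (snd p)) (fst p)" by (rule finite_X[OF \<omega> t])
    obtain b where b: "\<And>x. x \<in> D \<Longrightarrow> \<bar>f x\<bar> \<le> b" using bd unfolding bounded_iff by auto
    have "integrable (X (max 0 (snd p)) (fst p)) f"
      using fm b by (intro integrable_const_bound[where B=b] AE_I2)
        (auto simp: measurable_cong_sets[OF sets_X[OF \<omega> t] refl] space_X[OF \<omega> t])
    then show ?thesis using nn by (intro nn_integral_eq_integral AE_I2) (auto simp: space_X[OF \<omega> t])
  qed
  then show ?thesis by (rule measurable_eqI[OF measurable_compose[OF real measurable_ennreal]])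
qed

text \<open>Indicators of open sets are increasing limits of continuous functions, and open sets generate the Borel
  sets; finiteness of the measures handles complements.\<close>

lemma measurable_X_joint_emeasure:
  assumes "A \<in> sets RD"
  shows "(\<lambda>p. emeasure (X (max 0 (snd p)) (fst p)) A) \<in> borel_measurable (M \<Otimes>\<^sub>M borel)"
proof -
  let ?N = "M \<Otimes>\<^sub>M (borel :: real measure)"
  let ?K = "\<lambda>p. X (max 0 (snd p)) (fst p)"
  have setsK: "sets (?K p) = sets RD" and finK: "finite_measure (?K p)" and spK: "space (?K p) = D" if "p \<in> space ?N" for p
    using that sets_X finite_X space_X by (auto simp: space_pair_measure)
  have inD: "A \<inter> D \<in> sets RD" if "A \<in> sets borel" for A
    using that by (auto simp: sets_restrict_space intro!: image_eqI[of _ _ A])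
  have opens: "(\<lambda>p. emeasure (?K p) (U \<inter> D)) \<in> borel_measurable ?N" if U: "open U" for U
  proof -
    define V where "V = U \<inter> D"
    have V: "open V" "V \<subseteq> D" using U open_D by (auto simp: V_def)
    have Vc: "- V \<noteq> {}" using compl_D_ne V(2) by auto
    define f where "f k x = min 1 (real k * infdist x (- V))" for k x
    have fnn: "0 \<le> f k x" for k x by (simp add: f_def infdist_nonneg)
    have "(\<lambda>p. \<integral>\<^sup>+ x. ennreal (f k x) \<partial>?K p) \<in> borel_measurable ?N" for k
    proof (rule measurable_X_joint_continuous[OF _ _ fnn])
      show "continuous_on D (f k)" unfolding f_def by (intro continuous_intros)
      show "bounded (f k ` D)" using fnn by (auto simp: bounded_iff f_def intro!: exI[of _ 1])
    qed
    then have SUPm: "(\<lambda>p. \<Squnion>k. \<integral>\<^sup>+ x. ennreal (f k x) \<partial>?K p) \<in> borel_measurable ?N" by simp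
    have sup: "(\<Squnion>k. ennreal (f k x)) = indicator V x" for x
    proof (cases "x \<in> V")
      case True
      have "closed (- V)" using V(1) by (simp add: closed_def)
      then have "infdist x (- V) \<noteq> 0" using in_closed_iff_infdist_zero[of "- V" x] Vc True by auto
      then have pos: "0 < infdist x (- V)" using infdist_nonneg[of x "- V"] by linarith
      then obtain k where "1 < real k * infdist x (- V)" using reals_Archimedean3 by blast
      then have "f k x = 1" by (simp add: f_def)
      then have "1 \<le> (\<Squnion>k. ennreal (f k x))" by (intro SUP_upper2[of k]) auto
      moreover have "(\<Squnion>k. ennreal (f k x)) \<le> 1" by (intro SUP_least) (simp add: f_def)
      ultimately show ?thesis using True by simp
    next
      case False
      then show ?thesis by (simp add: f_def)
    qed
    have "emeasure (?K p) (U \<inter> D) = (\<Squnion>k. \<integral>\<^sup>+ x. ennreal (f k x) \<partial>?K p)" if p: "p \<in> space ?N" for p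
    proof -
      have fm: "(\<lambda>x. ennreal (f k x)) \<in> borel_measurable (?K p)" for k
      proof -
        have "continuous_on UNIV (f k)" unfolding f_def by (intro continuous_intros)
        then have "f k \<in> borel_measurable RD" by (intro measurable_restrict_space1 borel_measurable_continuous_onI)
        then show ?thesis by (simp add: measurable_cong_sets[OF setsK[OF p] refl])
      qed
      have "emeasure (?K p) (U \<inter> D) = (\<integral>\<^sup>+ x. indicator V x \<partial>?K p)"
        using inD[of U] U by (simp add: V_def setsK[OF p])
      also have "\<dots> = (\<integral>\<^sup>+ x. (\<Squnion>k. ennreal (f k x)) \<partial>?K p)" by (simp add: sup)
      also have "\<dots> = (\<Squnion>k. \<integral>\<^sup>+ x. ennreal (f k x) \<partial>?K p)"
      proof (rule nn_integral_monotone_convergence_SUP[OF _ fm])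
        have "f j x \<le> f k x" if "j \<le> k" for j k x
          unfolding f_def using that by (intro min.mono mult_right_mono) (auto simp: infdist_nonneg)
        then show "incseq (\<lambda>k x. ennreal (f k x))" by (auto simp: incseq_def le_fun_def intro!: ennreal_leI)
      qed
      finally show ?thesis .
    qed
    then show ?thesis by (rule measurable_eqI[OF SUPm])
  qed
  have "(\<lambda>p. emeasure (?K p) (A \<inter> D)) \<in> borel_measurable ?N" if "A \<in> sigma_sets UNIV {S. open S}" for A
  proof (rule sigma_sets_induct_disjoint[OF _ _ that])
    show "Int_stable {S :: 'a set. open S}" by (auto simp: Int_stable_def)
    show "{S. open S} \<subseteq> Pow UNIV" by simp
    show "(\<lambda>p. emeasure (?K p) (U \<inter> D)) \<in> borel_measurable ?N" if "U \<in> {S. open S}" for U using opens that by simp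
    show "(\<lambda>p. emeasure (?K p) ({} \<inter> D)) \<in> borel_measurable ?N" by simp
  next
    fix A assume A: "A \<in> sigma_sets UNIV {S :: 'a set. open S}" and IH: "(\<lambda>p. emeasure (?K p) (A \<inter> D)) \<in> borel_measurable ?N"
    have Ab: "A \<in> sets borel" using A by (simp add: borel_def)
    have "emeasure (?K p) ((UNIV - A) \<inter> D) = emeasure (?K p) (UNIV \<inter> D) - emeasure (?K p) (A \<inter> D)" if p: "p \<in> space ?N" for p
    proof -
      interpret finite_measure "?K p" by (rule finK[OF p])
      have "emeasure (?K p) (UNIV \<inter> D - A \<inter> D) = emeasure (?K p) (UNIV \<inter> D) - emeasure (?K p) (A \<inter> D)"
        by (rule emeasure_Diff) (use inD[OF Ab] inD[of UNIV] in \<open>auto simp: setsK[OF p]\<close>)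
      moreover have "UNIV \<inter> D - A \<inter> D = (UNIV - A) \<inter> D" by auto
      ultimately show ?thesis by simp
    qed
    moreover have "(\<lambda>p. emeasure (?K p) (UNIV \<inter> D) - emeasure (?K p) (A \<inter> D)) \<in> borel_measurable ?N"
      by (intro borel_measurable_minus_ennreal opens IH) simp
    ultimately show "(\<lambda>p. emeasure (?K p) ((UNIV - A) \<inter> D)) \<in> borel_measurable ?N" by (rule measurable_eqI[rotated])
  next
    fix F :: "nat \<Rightarrow> 'a set" assume F: "disjoint_family F" "range F \<subseteq> sigma_sets UNIV {S. open S}"
      and IH: "\<And>i. (\<lambda>p. emeasure (?K p) (F i \<inter> D)) \<in> borel_measurable ?N"
    have Fb: "F i \<in> sets borel" for i using F(2) by (auto simp: borel_def)
    have "emeasure (?K p) (\<Union>(range F) \<inter> D) = (\<Sum>i. emeasure (?K p) (F i \<inter> D))" if p: "p \<in> space ?N" for p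
    proof -
      have "(\<Sum>i. emeasure (?K p) (F i \<inter> D)) = emeasure (?K p) (\<Union>i. F i \<inter> D)"
        by (rule suminf_emeasure) (use F(1) inD[OF Fb] in \<open>auto simp: setsK[OF p] disjoint_family_on_def\<close>)
      moreover have "(\<Union>i. F i \<inter> D) = \<Union>(range F) \<inter> D" by auto
      ultimately show ?thesis by simp
    qed
    moreover have "(\<lambda>p. \<Sum>i. emeasure (?K p) (F i \<inter> D)) \<in> borel_measurable ?N"
      using IH by (intro borel_measurable_suminf_order)
    ultimately show "(\<lambda>p. emeasure (?K p) (\<Union>(range F) \<inter> D)) \<in> borel_measurable ?N" by (rule measurable_eqI[rotated])
  qed
  moreover obtain A' where "A' \<in> sets borel" "A = A' \<inter> D" using assms by (auto simp: sets_restrict_space)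
  ultimately show ?thesis by (simp add: borel_def)
qed

lemma measurable_X_joint_integral:
  assumes "f \<in> borel_measurable RD"
  shows "(\<lambda>p. \<integral>\<^sup>+ x. f x \<partial>X (max 0 (snd p)) (fst p)) \<in> borel_measurable (M \<Otimes>\<^sub>M borel)"
  by (rule measurable_kernel_nn_integral[OF _ measurable_X_joint_emeasure assms])
    (auto simp: space_pair_measure sets_X)

definition occupation :: "('a \<Rightarrow> ennreal) \<Rightarrow> 'w \<Rightarrow> ennreal" where
  "occupation f \<omega> = (\<integral>\<^sup>+ t. (\<integral>\<^sup>+ x. f x \<partial>X t \<omega>) * indicator {0..} t \<partial>lborel)"

lemma occupation_eq: "occupation f \<omega> = (\<integral>\<^sup>+ t. (\<integral>\<^sup>+ x. f x \<partial>X (max 0 t) \<omega>) * indicator {0..} t \<partial>lborel)"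
proof -
  have "(\<integral>\<^sup>+ x. f x \<partial>X t \<omega>) * indicator {0..} t = (\<integral>\<^sup>+ x. f x \<partial>X (max 0 t) \<omega>) * indicator {0..} t" for t :: real
    by (cases "0 \<le> t") simp_all
  then show ?thesis unfolding occupation_def by presburger
qed

lemma measurable_occupation:
  assumes "f \<in> borel_measurable RD"
  shows "occupation f \<in> borel_measurable M"
proof -
  have "(\<lambda>p. (\<integral>\<^sup>+ x. f x \<partial>X (max 0 (snd p)) (fst p)) * indicator {0..} (snd p)) \<in> borel_measurable (M \<Otimes>\<^sub>M (borel :: real measure))"
    by (intro borel_measurable_times_ennreal measurable_X_joint_integral assms measurable_compose[OF measurable_snd]) simp
  then have "(\<lambda>p. (\<integral>\<^sup>+ x. f x \<partial>X (max 0 (snd p)) (fst p)) * indicator {0..} (snd p)) \<in> borel_measurable (M \<Otimes>\<^sub>M (lborel :: real measure))"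
    by (subst measurable_cong_sets[OF sets_pair_measure_cong[OF refl sets_lborel] refl])
  from lborel.borel_measurable_nn_integral_fst[OF this]
  show ?thesis unfolding occupation_eq[abs_def] by simp
qed

lemma measurable_X_time:
  assumes \<omega>: "\<omega> \<in> space M" and f: "f \<in> borel_measurable RD"
  shows "(\<lambda>t. \<integral>\<^sup>+ x. f x \<partial>X (max 0 t) \<omega>) \<in> borel_measurable borel"
  using measurable_compose[OF measurable_Pair1'[OF \<omega>] measurable_X_joint_integral[OF f]] by simp

lemma measurable_X_time_emeasure:
  assumes \<omega>: "\<omega> \<in> space M" and A: "A \<in> sets RD"
  shows "(\<lambda>t. emeasure (X (max 0 t) \<omega>) A) \<in> borel_measurable borel"
  using measurable_compose[OF measurable_Pair1'[OF \<omega>] measurable_X_joint_emeasure[OF A]] by simp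

lemma occupation_cmult:
  assumes \<omega>: "\<omega> \<in> space M" and f: "f \<in> borel_measurable RD"
  shows "occupation (\<lambda>x. c * f x) \<omega> = c * occupation f \<omega>"
proof -
  have "(\<integral>\<^sup>+ x. c * f x \<partial>X (max 0 t) \<omega>) = c * (\<integral>\<^sup>+ x. f x \<partial>X (max 0 t) \<omega>)" for t
    using f by (intro nn_integral_cmult) (simp add: measurable_cong_sets[OF sets_X[OF \<omega>] refl])
  then have "occupation (\<lambda>x. c * f x) \<omega> = (\<integral>\<^sup>+ t. c * ((\<integral>\<^sup>+ x. f x \<partial>X (max 0 t) \<omega>) * indicator {0..} t) \<partial>lborel)"
    unfolding occupation_eq by (simp add: mult.assoc)
  also have "\<dots> = c * occupation f \<omega>"
    unfolding occupation_eq using measurable_X_time[OF \<omega> f] by (intro nn_integral_cmult) simp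
  finally show ?thesis .
qed

lemma sets_strip_occupation: "sets (strip_occupation D X \<epsilon> \<omega>) = sets (restrict_space borel (closure D))"
  unfolding strip_occupation_def using sets.space_closed[of "restrict_space borel (closure D)"]
  by (simp add: space_restrict_space) (metis sets.sigma_sets_eq space_restrict_space inf_top_right space_borel)

lemma strip_Int_sets:
  assumes "A \<in> sets (restrict_space borel (closure D))" shows "A \<inter> inner_strip D \<epsilon> \<in> sets RD"
proof -
  have "A \<in> sets borel" using assms by (auto simp: sets_restrict_space)
  moreover have "inner_strip D \<epsilon> \<subseteq> D" by (auto simp: inner_strip_def)
  ultimately show ?thesis
    using sets.Int[OF \<open>A \<in> sets borel\<close> inner_strip_borel[of \<epsilon>]] by (auto simp: sets_restrict_space intro!: image_eqI[of _ _ "A \<inter> inner_strip D \<epsilon>"])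
qed

lemma emeasure_strip_occupation:
  assumes \<omega>: "\<omega> \<in> space M" and A: "A \<in> sets (restrict_space borel (closure D))"
  shows "emeasure (strip_occupation D X \<epsilon> \<omega>) A
    = ennreal (1 / \<epsilon>\<^sup>2) * (\<integral>\<^sup>+ t. emeasure (X (max 0 t) \<omega>) (A \<inter> inner_strip D \<epsilon>) * indicator {0..} t \<partial>lborel)"
proof -
  define m where "m A = ennreal (1 / \<epsilon>\<^sup>2) * (\<integral>\<^sup>+ t. emeasure (X t \<omega>) (A \<inter> inner_strip D \<epsilon>) * indicator {0..} t \<partial>lborel)" for A
  have m: "m A = ennreal (1 / \<epsilon>\<^sup>2) * (\<integral>\<^sup>+ t. emeasure (X (max 0 t) \<omega>) (A \<inter> inner_strip D \<epsilon>) * indicator {0..} t \<partial>lborel)" for A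
  proof -
    have "emeasure (X t \<omega>) S * indicator {0..} t = emeasure (X (max 0 t) \<omega>) S * indicator {0..} t" for S and t :: real
      by (cases "0 \<le> t") simp_all
    then show ?thesis unfolding m_def by presburger
  qed
  have "emeasure (strip_occupation D X \<epsilon> \<omega>) A = m A"
    unfolding strip_occupation_def m_def[abs_def, symmetric]
  proof (rule emeasure_measure_of_sigma)
    show "sigma_algebra (closure D) (sets (restrict_space borel (closure D)))"
      using sets.sigma_algebra_axioms[of "restrict_space borel (closure D)"] by (simp add: space_restrict_space)
    show "positive (sets (restrict_space borel (closure D))) m" by (simp add: positive_def m_def)
    show "A \<in> sets (restrict_space borel (closure D))" by (rule A)
    show "countably_additive (sets (restrict_space borel (closure D))) m"
    proof (rule countably_additiveI)
      fix F :: "nat \<Rightarrow> 'a set" assume F: "range F \<subseteq> sets (restrict_space borel (closure D))" "disjoint_family F"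
      have Fs: "F i \<inter> inner_strip D \<epsilon> \<in> sets RD" for i using F(1) by (intro strip_Int_sets) auto
      have tm: "(\<lambda>t. emeasure (X (max 0 t) \<omega>) (F i \<inter> inner_strip D \<epsilon>) * indicator {0..} t) \<in> borel_measurable lborel" for i
        using measurable_X_time_emeasure[OF \<omega> Fs, of i] by simp
      have "emeasure (X (max 0 t) \<omega>) (\<Union>(range F) \<inter> inner_strip D \<epsilon>) = (\<Sum>i. emeasure (X (max 0 t) \<omega>) (F i \<inter> inner_strip D \<epsilon>))" for t
      proof -
        have "(\<Sum>i. emeasure (X (max 0 t) \<omega>) (F i \<inter> inner_strip D \<epsilon>)) = emeasure (X (max 0 t) \<omega>) (\<Union>i. F i \<inter> inner_strip D \<epsilon>)"
          by (rule suminf_emeasure) (use Fs F(2) in \<open>auto simp: sets_X[OF \<omega>] disjoint_family_on_def\<close>)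
        moreover have "(\<Union>i. F i \<inter> inner_strip D \<epsilon>) = \<Union>(range F) \<inter> inner_strip D \<epsilon>" by auto
        ultimately show ?thesis by simp
      qed
      then have "(\<integral>\<^sup>+ t. emeasure (X (max 0 t) \<omega>) (\<Union>(range F) \<inter> inner_strip D \<epsilon>) * indicator {0..} t \<partial>lborel)
        = (\<integral>\<^sup>+ t. (\<Sum>i. emeasure (X (max 0 t) \<omega>) (F i \<inter> inner_strip D \<epsilon>) * indicator {0..} t) \<partial>lborel)"
        by simp
      also have "\<dots> = (\<Sum>i. \<integral>\<^sup>+ t. emeasure (X (max 0 t) \<omega>) (F i \<inter> inner_strip D \<epsilon>) * indicator {0..} t \<partial>lborel)"
        by (rule nn_integral_suminf[OF tm])
      finally show "(\<Sum>i. m (F i)) = m (\<Union>(range F))" unfolding m by simp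
    qed
  qed
  then show ?thesis unfolding m .
qed

lemma nn_integral_strip_occupation:
  assumes \<omega>: "\<omega> \<in> space M" and f: "f \<in> borel_measurable (restrict_space borel (closure D))"
  shows "(\<integral>\<^sup>+ x. f x \<partial>strip_occupation D X \<epsilon> \<omega>)
    = ennreal (1 / \<epsilon>\<^sup>2) * occupation (\<lambda>x. f x * indicator (inner_strip D \<epsilon>) x) \<omega>"
  unfolding occupation_eq
proof (rule nn_integral_mixture[where D = D and E = "closure D"])
  show "sets (X (max 0 t) \<omega>) = sets RD" for t by (rule sets_X[OF \<omega>]) simp
  show "(\<lambda>t. emeasure (X (max 0 t) \<omega>) A) \<in> borel_measurable lborel" if "A \<in> sets RD" for A
    using measurable_X_time_emeasure[OF \<omega> that] by simp
  show "inner_strip D \<epsilon> \<subseteq> D" by (auto simp: inner_strip_def)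
  show "emeasure (strip_occupation D X \<epsilon> \<omega>) A = ennreal (1 / \<epsilon>\<^sup>2) * (\<integral>\<^sup>+ t. emeasure (X (max 0 t) \<omega>) (A \<inter> inner_strip D \<epsilon>) * indicator {0..} t \<partial>lborel)"
    if "A \<in> sets (strip_occupation D X \<epsilon> \<omega>)" for A
    using that unfolding sets_strip_occupation by (rule emeasure_strip_occupation[OF \<omega>])
  show "f \<in> borel_measurable (strip_occupation D X \<epsilon> \<omega>)"
    using f by (simp add: measurable_cong_sets[OF sets_strip_occupation refl])
qed (auto simp: sets_strip_occupation closure_subset)

end

section \<open>Convergence of Laplace functionals and convergence in probability\<close>

lemma exp_neg_bounds: "0 \<le> exp_neg a" "exp_neg a \<le> 1"
  by (auto simp: exp_neg_def)

lemma exp_neg_finite: "a < \<infinity> \<Longrightarrow> exp_neg a = exp (- enn2real a)"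
  by (auto simp: exp_neg_def)

lemma exp_neg_add: "exp_neg (a + b) = exp_neg a * exp_neg b"
proof (cases "a = \<infinity> \<or> b = \<infinity>")
  case True
  then show ?thesis by (auto simp: exp_neg_def)
next
  case False
  then have "a < top" "b < top" by (auto simp: top.not_eq_extremum)
  then show ?thesis using False by (simp add: exp_neg_def enn2real_plus exp_add[symmetric])
qed

lemma measurable_exp_neg: "exp_neg \<in> borel_measurable borel"
  unfolding exp_neg_def[abs_def] by measurable

text \<open>The formula also covers functions that are not integrable, for which the integral is \<open>0\<close>, and so yields measurability
  in parameters without exceptional sets.\<close>

lemma integral_eq_nn_parts:
  assumes "f \<in> borel_measurable N"
  shows "(\<integral>x. f x \<partial>N) = (if (\<integral>\<^sup>+ x. ennreal (f x) \<partial>N) < \<infinity> \<and> (\<integral>\<^sup>+ x. ennreal (- f x) \<partial>N) < \<infinity>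
    then enn2real (\<integral>\<^sup>+ x. ennreal (f x) \<partial>N) - enn2real (\<integral>\<^sup>+ x. ennreal (- f x) \<partial>N) else 0)"
proof (cases "integrable N f")
  case True
  then show ?thesis using real_lebesgue_integral_def[OF True] unfolding real_integrable_def
    by (simp add: top.not_eq_extremum)
next
  case False
  then have "\<not> ((\<integral>\<^sup>+ x. ennreal (f x) \<partial>N) < \<infinity> \<and> (\<integral>\<^sup>+ x. ennreal (- f x) \<partial>N) < \<infinity>)"
    using assms unfolding real_integrable_def by (auto simp: top.not_eq_extremum)
  then show ?thesis using not_integrable_integral_eq[OF False] by (simp only: if_False)
qed

text \<open>Where \<open>z\<close> is bounded, \<open>e\<^bsup>-z\<^esub>\<close> is bounded away from \<open>0\<close>, and a difference of size \<open>\<delta>\<close> remains visible after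
  the exponential.\<close>

lemma exp_difference_lower_bound:
  fixes y z \<delta> K :: real
  assumes "z \<le> K" "\<delta> < \<bar>y - z\<bar>" "0 < \<delta>"
  shows "(exp (- K) * (1 - exp (- \<delta>)))\<^sup>2 \<le> (exp (- y) - exp (- z))\<^sup>2"
proof -
  have main: "exp (- K) * (1 - exp (- \<delta>)) \<le> exp (- u) - exp (- v)" if "u \<le> K" "u + \<delta> \<le> v" for u v :: real
  proof -
    have "exp (- v) \<le> exp (- u) * exp (- \<delta>)" using that by (simp add: exp_add[symmetric])
    moreover have "exp (- K) * (1 - exp (- \<delta>)) \<le> exp (- u) * (1 - exp (- \<delta>))"
      using that assms(3) by (intro mult_right_mono) auto
    ultimately show ?thesis by (simp add: algebra_simps)
  qed
  have c: "0 \<le> exp (- K) * (1 - exp (- \<delta>))" using assms(3) by simp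
  show ?thesis
  proof (cases "z + \<delta> \<le> y")
    case True
    from power_mono[OF main[OF assms(1) True] c, of 2] show ?thesis by (simp add: power2_commute)
  next
    case False
    then have "y \<le> K" "y + \<delta> \<le> z" using assms by linarith+
    from power_mono[OF main[OF this] c, of 2] show ?thesis .
  qed
qed

text \<open>The exponential compresses large values, but the limit is almost surely finite: off an event of small
  probability it is at most some \<open>K\<close>, and there \<open>exp_difference_lower_bound\<close> and Markov's inequality apply.\<close>

lemma (in prob_space) tendsto_in_prob_of_exp_neg:
  assumes U: "\<And>i. U i \<in> borel_measurable M" and V: "V \<in> borel_measurable M"
    and V_fin: "AE \<omega> in M. V \<omega> < \<infinity>" and U_fin: "\<forall>\<^sub>F i in F. AE \<omega> in M. U i \<omega> < \<infinity>"
    and lim: "((\<lambda>i. \<integral>\<omega>. (exp_neg (U i \<omega>) - exp_neg (V \<omega>))\<^sup>2 \<partial>M) \<longlongrightarrow> 0) F"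
    and \<delta>: "0 < \<delta>"
  shows "((\<lambda>i. measure M {\<omega> \<in> space M. \<delta> < \<bar>enn2real (U i \<omega>) - enn2real (V \<omega>)\<bar>}) \<longlongrightarrow> 0) F"
proof (rule tendstoI)
  fix \<eta> :: real assume \<eta>: "0 < \<eta>"
  note [measurable] = U V measurable_exp_neg
  have "(\<lambda>k. measure M {\<omega> \<in> space M. real k < enn2real (V \<omega>)}) \<longlonglongrightarrow> measure M (\<Inter>k. {\<omega> \<in> space M. real k < enn2real (V \<omega>)})"
    by (rule finite_Lim_measure_decseq) (auto simp: decseq_def)
  moreover have "(\<Inter>k. {\<omega> \<in> space M. real k < enn2real (V \<omega>)}) = {}"
  proof -
    have "\<exists>k. \<not> real k < enn2real (V \<omega>)" for \<omega> using reals_Archimedean2[of "enn2real (V \<omega>)"] by (metis less_asym)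
    then show ?thesis by auto
  qed
  ultimately have "(\<lambda>k. measure M {\<omega> \<in> space M. real k < enn2real (V \<omega>)}) \<longlonglongrightarrow> 0" by simp
  then have "\<forall>\<^sub>F k in sequentially. measure M {\<omega> \<in> space M. real k < enn2real (V \<omega>)} < \<eta> / 2"
    by (rule order_tendstoD) (use \<eta> in simp)
  then obtain K where K: "measure M {\<omega> \<in> space M. real K < enn2real (V \<omega>)} < \<eta> / 2"
    by (auto simp: eventually_sequentially)
  define c where "c = (exp (- real K) * (1 - exp (- \<delta>)))\<^sup>2"
  have c: "0 < c" using \<delta> by (simp add: c_def)
  have "\<forall>\<^sub>F i in F. (\<integral>\<omega>. (exp_neg (U i \<omega>) - exp_neg (V \<omega>))\<^sup>2 \<partial>M) < c * (\<eta> / 2)"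
    using order_tendstoD(2)[OF lim, of "c * (\<eta> / 2)"] c \<eta> by simp
  with U_fin show "\<forall>\<^sub>F i in F. dist (measure M {\<omega> \<in> space M. \<delta> < \<bar>enn2real (U i \<omega>) - enn2real (V \<omega>)\<bar>}) 0 < \<eta>"
  proof eventually_elim
    case (elim i)
    let ?d = "\<lambda>\<omega>. (exp_neg (U i \<omega>) - exp_neg (V \<omega>))\<^sup>2"
    let ?A = "{\<omega> \<in> space M. \<delta> < \<bar>enn2real (U i \<omega>) - enn2real (V \<omega>)\<bar>}"
    let ?V = "{\<omega> \<in> space M. real K < enn2real (V \<omega>)}" and ?C = "{\<omega> \<in> space M. c \<le> ?d \<omega>}"
    have "integrable M ?d"
    proof (rule integrable_const_bound[where B=1])
      have "(exp_neg a - exp_neg b)\<^sup>2 \<le> 1" for a b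
        unfolding abs_square_le_1 using exp_neg_bounds[of a] exp_neg_bounds[of b] by linarith
      then show "AE \<omega> in M. norm (?d \<omega>) \<le> 1" by simp
    qed measurable
    from integral_Markov_inequality_measure[OF this, of "space M" c]
    have "c * measure M ?C \<le> (\<integral>\<omega>. ?d \<omega> \<partial>M)" using c by (simp add: field_simps)
    then have "c * measure M ?C < c * (\<eta> / 2)" using elim(2) by (rule le_less_trans)
    then have C: "measure M ?C < \<eta> / 2" using c by simp
    have "measure M ?A \<le> measure M (?V \<union> ?C)"
    proof (rule finite_measure_mono_AE)
      show "AE \<omega> in M. \<omega> \<in> ?A \<longrightarrow> \<omega> \<in> ?V \<union> ?C"
        using elim(1) V_fin
      proof eventually_elim
        case (elim \<omega>)
        show ?case
          using exp_difference_lower_bound[of "enn2real (V \<omega>)" "real K" \<delta> "enn2real (U i \<omega>)"] \<delta> elim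
          by (cases "enn2real (V \<omega>) \<le> real K") (auto simp: exp_neg_finite c_def)
      qed
    qed measurable
    also have "\<dots> \<le> measure M ?V + measure M ?C" by (rule measure_Un_le) measurable
    also have "\<dots> < \<eta>" using K C by simp
    finally show ?case by simp
  qed
qed

context strip_setting
begin

definition strip_mass :: "('a \<Rightarrow> real) \<Rightarrow> real \<Rightarrow> 'w \<Rightarrow> ennreal" where
  "strip_mass \<phi> \<epsilon> \<omega> = (\<integral>\<^sup>+ x. ennreal (\<phi> x) \<partial>strip_occupation D X \<epsilon> \<omega>)"

definition exit_mass :: "('a \<Rightarrow> real) \<Rightarrow> 'w \<Rightarrow> ennreal" where
  "exit_mass \<phi> \<omega> = (\<integral>\<^sup>+ x. ennreal (\<phi> x) \<partial>XD \<omega>)"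

lemma measurable_continuous_closure:
  "continuous_on (closure D) \<phi> \<Longrightarrow> (\<lambda>x. ennreal (\<phi> x)) \<in> borel_measurable (restrict_space borel (closure D))"
  for \<phi> :: "'a \<Rightarrow> real"
  by (rule measurable_compose[OF borel_measurable_continuous_on_restrict measurable_ennreal])

lemma measurable_strip_density:
  "f \<in> borel_measurable (restrict_space borel (closure D)) \<Longrightarrow> (\<lambda>x. f x * indicator (inner_strip D \<epsilon>) x) \<in> borel_measurable RD"
  for f :: "'a \<Rightarrow> ennreal"
  by (rule borel_measurable_times_ennreal[OF measurable_restrict_mono[OF _ closure_subset]
      measurable_restrict_space1[OF borel_measurable_indicator[OF inner_strip_borel]]])

lemma measurable_strip_mass:
  assumes "continuous_on (closure D) \<phi>" shows "strip_mass \<phi> \<epsilon> \<in> borel_measurable M"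
proof (rule measurable_eqI)
  note m = measurable_continuous_closure[OF assms]
  show "(\<lambda>\<omega>. ennreal (1 / \<epsilon>\<^sup>2) * occupation (\<lambda>x. ennreal (\<phi> x) * indicator (inner_strip D \<epsilon>) x) \<omega>) \<in> borel_measurable M"
    by (intro borel_measurable_times_ennreal borel_measurable_const measurable_occupation measurable_strip_density m)
  show "strip_mass \<phi> \<epsilon> \<omega> = ennreal (1 / \<epsilon>\<^sup>2) * occupation (\<lambda>x. ennreal (\<phi> x) * indicator (inner_strip D \<epsilon>) x) \<omega>"
    if "\<omega> \<in> space M" for \<omega>
    unfolding strip_mass_def by (rule nn_integral_strip_occupation[OF that m])
qed

lemma sets_XD: "\<omega> \<in> space M \<Longrightarrow> sets (XD \<omega>) = sets (restrict_space borel (frontier D))"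
  and finite_XD: "\<omega> \<in> space M \<Longrightarrow> finite_measure (XD \<omega>)"
  using measurable_space[OF measurable_XD] by (auto simp: space_finite_measure_algebra finite_measures_def)

lemma space_XD: "\<omega> \<in> space M \<Longrightarrow> space (XD \<omega>) = frontier D"
  using sets_eq_imp_space_eq[OF sets_XD] by (simp add: space_restrict_space)

lemma measurable_frontier:
  "continuous_on (closure D) \<phi> \<Longrightarrow> \<phi> \<in> borel_measurable (restrict_space borel (frontier D))"
  for \<phi> :: "'a \<Rightarrow> real"
  by (rule borel_measurable_continuous_on_restrict, erule continuous_on_subset) (simp add: frontier_def)

lemma measurable_exit_mass:
  assumes "continuous_on (closure D) \<phi>" shows "exit_mass \<phi> \<in> borel_measurable M"
  unfolding exit_mass_def[abs_def]
  by (rule measurable_kernel_nn_integral[OF sets_XD _ measurable_compose[OF measurable_frontier[OF assms] measurable_ennreal]])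
    (assumption, rule measurable_compose[OF measurable_XD measurable_emeasure_finite_measure_algebra])

lemma closure_bound:
  fixes \<phi> :: "'a \<Rightarrow> real"
  assumes "continuous_on (closure D) \<phi>"
  obtains F where "0 < F" "\<And>y. y \<in> closure D \<Longrightarrow> \<bar>\<phi> y\<bar> \<le> F"
proof -
  have "compact (\<phi> ` closure D)" using bounded_D by (intro compact_continuous_image assms) (simp add: compact_closure)
  then have "bounded (\<phi> ` closure D)" by (rule compact_imp_bounded)
  then show ?thesis using that unfolding bounded_pos by auto
qed

lemma nn_integral_bounded_finite:
  fixes \<phi> :: "'a \<Rightarrow> real"
  assumes "continuous_on (closure D) \<phi>" "finite_measure N" "space N \<subseteq> closure D"
  shows "(\<integral>\<^sup>+ x. ennreal (\<phi> x) \<partial>N) < \<infinity>"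
proof -
  obtain F where F: "0 < F" "\<And>y. y \<in> closure D \<Longrightarrow> \<bar>\<phi> y\<bar> \<le> F" using closure_bound[OF assms(1)] by blast
  have "(\<integral>\<^sup>+ x. ennreal (\<phi> x) \<partial>N) \<le> (\<integral>\<^sup>+ x. ennreal F \<partial>N)"
    using F(2) assms(3) by (intro nn_integral_mono ennreal_leI) (auto dest!: abs_le_D1)
  also have "\<dots> = ennreal F * emeasure N (space N)" by simp
  also have "\<dots> < \<infinity>" using finite_measure.finite_emeasure_space[OF assms(2)] by (simp add: ennreal_mult_less_top top.not_eq_extremum)
  finally show ?thesis .
qed

lemma exit_mass_finite:
  assumes "continuous_on (closure D) \<phi>" "\<omega> \<in> space M" shows "exit_mass \<phi> \<omega> < \<infinity>"
  unfolding exit_mass_def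
  by (rule nn_integral_bounded_finite[OF assms(1) finite_XD[OF assms(2)]]) (simp add: space_XD[OF assms(2)] frontier_def)

text \<open>The joint law of occupation and exit measure, specialised to the functionals \<open>a U\<^sub>\<epsilon> + b V\<close>.\<close>

lemma strip_exit_laplace:
  assumes \<phi>: "continuous_on (closure D) \<phi>" "\<And>y. y \<in> closure D \<Longrightarrow> 0 \<le> \<phi> y" and ab: "0 \<le> a" "0 \<le> b"
  shows "\<exists>w. exit_equation D \<psi> W B (\<lambda>y. a / \<epsilon>\<^sup>2 * (indicator (inner_strip D \<epsilon>) y * \<phi> y)) (\<lambda>y. b * \<phi> y) w \<and>
    (\<forall>\<mu>\<in>finite_measures D.
      (\<integral>\<omega>. exp_neg (ennreal a * strip_mass \<phi> \<epsilon> \<omega> + ennreal b * exit_mass \<phi> \<omega>) \<partial>P \<mu>) = exp (- (\<integral>x. w x \<partial>\<mu>)))"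
proof -
  let ?f = "\<lambda>y. a / \<epsilon>\<^sup>2 * (indicator (inner_strip D \<epsilon>) y * \<phi> y)"
  have c: "0 \<le> a / \<epsilon>\<^sup>2" using ab by simp
  obtain w where w: "exit_equation D \<psi> W B ?f (\<lambda>y. b * \<phi> y) w"
    and L: "\<And>\<mu>. \<mu> \<in> finite_measures D \<Longrightarrow>
      (\<integral>\<omega>. exp_neg (occupation (\<lambda>x. ennreal (?f x)) \<omega> + (\<integral>\<^sup>+ x. ennreal (b * \<phi> x) \<partial>XD \<omega>)) \<partial>P \<mu>) = exp (- (\<integral>x. w x \<partial>\<mu>))"
    using joint_law[OF strip_density_bounded_borel(1)[OF \<phi> c] strip_density_bounded_borel(2)[OF \<phi> ab(2)]]
    unfolding occupation_def by blast
  have occ: "occupation (\<lambda>x. ennreal (?f x)) \<omega> = ennreal a * strip_mass \<phi> \<epsilon> \<omega>" if \<omega>: "\<omega> \<in> space M" for \<omega>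
  proof -
    note m = measurable_continuous_closure[OF \<phi>(1)]
    have "ennreal (?f x) = ennreal (a / \<epsilon>\<^sup>2) * (ennreal (\<phi> x) * indicator (inner_strip D \<epsilon>) x)" for x
    proof (cases "x \<in> inner_strip D \<epsilon>")
      case True
      then have "0 \<le> \<phi> x" using \<phi>(2) closure_subset by (auto simp: inner_strip_def)
      then show ?thesis using True ennreal_mult[OF c] by simp
    qed simp
    then have "occupation (\<lambda>x. ennreal (?f x)) \<omega> = ennreal (a / \<epsilon>\<^sup>2) * occupation (\<lambda>x. ennreal (\<phi> x) * indicator (inner_strip D \<epsilon>) x) \<omega>"
      using occupation_cmult[OF \<omega> measurable_strip_density[OF m]] by simp
    also have "ennreal (a / \<epsilon>\<^sup>2) = ennreal a * ennreal (1 / \<epsilon>\<^sup>2)" using ab by (simp add: ennreal_mult[symmetric])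
    finally show ?thesis unfolding strip_mass_def nn_integral_strip_occupation[OF \<omega> m] by (simp add: mult.assoc)
  qed
  have ex: "(\<integral>\<^sup>+ x. ennreal (b * \<phi> x) \<partial>XD \<omega>) = ennreal b * exit_mass \<phi> \<omega>" if \<omega>: "\<omega> \<in> space M" for \<omega>
  proof -
    have "(\<integral>\<^sup>+ x. ennreal (b * \<phi> x) \<partial>XD \<omega>) = (\<integral>\<^sup>+ x. ennreal b * ennreal (\<phi> x) \<partial>XD \<omega>)"
      using \<phi>(2) ab(2) by (intro nn_integral_cong) (simp add: ennreal_mult space_XD[OF \<omega>] frontier_def)
    also have "\<dots> = ennreal b * exit_mass \<phi> \<omega>" unfolding exit_mass_def
      using measurable_compose[OF measurable_frontier[OF \<phi>(1)] measurable_ennreal]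
      by (intro nn_integral_cmult) (simp add: measurable_cong_sets[OF sets_XD[OF \<omega>] refl])
    finally show ?thesis .
  qed
  have "(\<integral>\<omega>. exp_neg (ennreal a * strip_mass \<phi> \<epsilon> \<omega> + ennreal b * exit_mass \<phi> \<omega>) \<partial>P \<mu>) = exp (- (\<integral>x. w x \<partial>\<mu>))"
    if \<mu>: "\<mu> \<in> finite_measures D" for \<mu>
    unfolding L[OF \<mu>, symmetric] using sets_eq_imp_space_eq[OF sets_P[OF \<mu>]]
    by (intro Bochner_Integration.integral_cong refl) (simp only: occ ex)
  then show ?thesis using w by blast
qed

text \<open>In the limit, occupation of the strip and exit measure are indistinguishable: only \<open>a + b\<close> matters.\<close>

lemma joint_laplace_tendsto:
  assumes \<phi>: "continuous_on (closure D) \<phi>" "\<And>y. y \<in> closure D \<Longrightarrow> 0 \<le> \<phi> y" and ab: "0 \<le> a" "0 \<le> b"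
    and \<mu>: "\<mu> \<in> finite_measures D"
  shows "((\<lambda>\<epsilon>. \<integral>\<omega>. exp_neg (ennreal a * strip_mass \<phi> \<epsilon> \<omega> + ennreal b * exit_mass \<phi> \<omega>) \<partial>P \<mu>)
    \<longlongrightarrow> (\<integral>\<omega>. exp_neg (ennreal (a + b) * exit_mass \<phi> \<omega>) \<partial>P \<mu>)) (at_right 0)"
  unfolding tendsto_at_iff_sequentially comp_def
proof (intro allI impI)
  fix E :: "nat \<Rightarrow> real" assume E: "\<forall>i. E i \<in> {0<..} - {0}" "E \<longlonglongrightarrow> 0"
  obtain \<epsilon>0 where \<epsilon>0: "0 < \<epsilon>0"
    "\<And>x \<epsilon>. x \<in> D \<Longrightarrow> 0 < \<epsilon> \<Longrightarrow> \<epsilon> \<le> \<epsilon>0 \<Longrightarrow> (\<integral>y. indicator (inner_strip D \<epsilon>) y \<partial>green x) \<le> 8 * \<epsilon>^2"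
    using strip_green_bound[OF R_pos tangent] by metis
  \<comment> \<open>a shift of the sequence makes the bound on strip occupations available for all members\<close>
  obtain N where N: "\<And>i. N \<le> i \<Longrightarrow> E i < \<epsilon>0"
    using order_tendstoD(2)[OF E(2) \<epsilon>0(1)] by (auto simp: eventually_sequentially)
  let ?E = "\<lambda>i. E (i + N)"
  have "\<forall>i. \<exists>w. exit_equation D \<psi> W B (\<lambda>y. a / (?E i)\<^sup>2 * (indicator (inner_strip D (?E i)) y * \<phi> y)) (\<lambda>y. b * \<phi> y) w \<and>
    (\<forall>\<mu>\<in>finite_measures D.
      (\<integral>\<omega>. exp_neg (ennreal a * strip_mass \<phi> (?E i) \<omega> + ennreal b * exit_mass \<phi> \<omega>) \<partial>P \<mu>) = exp (- (\<integral>x. w x \<partial>\<mu>)))"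
    by (intro allI strip_exit_laplace[OF \<phi> ab])
  from choice[OF this] obtain wn where
    wn: "\<And>i. exit_equation D \<psi> W B (\<lambda>y. a / (?E i)\<^sup>2 * (indicator (inner_strip D (?E i)) y * \<phi> y)) (\<lambda>y. b * \<phi> y) (wn i)"
    and Ln: "\<And>i. (\<integral>\<omega>. exp_neg (ennreal a * strip_mass \<phi> (?E i) \<omega> + ennreal b * exit_mass \<phi> \<omega>) \<partial>P \<mu>) = exp (- (\<integral>x. wn i x \<partial>\<mu>))"
    using \<mu> by blast
  have ab': "0 \<le> a + b" using ab by simp
  obtain w where w: "exit_equation D \<psi> W B (\<lambda>_. 0) (\<lambda>y. (a + b) * \<phi> y) w"
    and L: "(\<integral>\<omega>. exp_neg (ennreal (a + b) * exit_mass \<phi> \<omega>) \<partial>P \<mu>) = exp (- (\<integral>x. w x \<partial>\<mu>))"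
    using strip_exit_laplace[OF \<phi> order_refl ab'] \<mu> by auto
  have "(\<lambda>i. \<integral>x. wn i x \<partial>\<mu>) \<longlonglongrightarrow> (\<integral>x. w x \<partial>\<mu>)"
  proof (rule solution_tendsto[OF \<phi> ab _ _ _ wn w \<mu>])
    show "0 < ?E n" for n using E(1) by simp
    show "?E \<longlonglongrightarrow> 0" using E(2) by (rule LIMSEQ_ignore_initial_segment)
    show "(\<integral>y. indicator (inner_strip D (?E n)) y \<partial>green x) \<le> 8 * (?E n)\<^sup>2" if "x \<in> D" for n x
      using \<epsilon>0(2)[OF that] E(1) N[of "n + N"] by simp
  qed
  then have "(\<lambda>i. exp (- (\<integral>x. wn i x \<partial>\<mu>))) \<longlonglongrightarrow> exp (- (\<integral>x. w x \<partial>\<mu>))" by (intro tendsto_intros)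
  then show "(\<lambda>i. \<integral>\<omega>. exp_neg (ennreal a * strip_mass \<phi> (E i) \<omega> + ennreal b * exit_mass \<phi> \<omega>) \<partial>P \<mu>)
    \<longlonglongrightarrow> (\<integral>\<omega>. exp_neg (ennreal (a + b) * exit_mass \<phi> \<omega>) \<partial>P \<mu>)"
    unfolding Ln[symmetric] L[symmetric] by (rule LIMSEQ_offset)
qed

text \<open>The square \<open>e\<^bsup>-2U\<^esub> - 2 e\<^bsup>-U-V\<^esub> + e\<^bsup>-2V\<^esub>\<close> consists of joint Laplace functionals with \<open>a + b = 2\<close>, whose limits
  cancel.\<close>

lemma exp_strip_mass_L2_tendsto:
  assumes \<phi>: "continuous_on (closure D) \<phi>" "\<And>y. y \<in> closure D \<Longrightarrow> 0 \<le> \<phi> y" and \<mu>: "\<mu> \<in> finite_measures D"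
  shows "((\<lambda>\<epsilon>. \<integral>\<omega>. (exp_neg (strip_mass \<phi> \<epsilon> \<omega>) - exp_neg (exit_mass \<phi> \<omega>))\<^sup>2 \<partial>P \<mu>) \<longlongrightarrow> 0) (at_right 0)"
proof -
  interpret P: prob_space "P \<mu>" by (rule prob_space_P[OF \<mu>])
  have [measurable]: "strip_mass \<phi> \<epsilon> \<in> borel_measurable (P \<mu>)" "exit_mass \<phi> \<in> borel_measurable (P \<mu>)" for \<epsilon>
    using measurable_strip_mass[OF \<phi>(1)] measurable_exit_mass[OF \<phi>(1)]
    by (simp_all add: measurable_cong_sets[OF sets_P[OF \<mu>] refl])
  note [measurable] = measurable_exp_neg
  let ?u = "\<lambda>\<epsilon> \<omega>. exp_neg (strip_mass \<phi> \<epsilon> \<omega>)" and ?v = "\<lambda>\<omega>. exp_neg (exit_mass \<phi> \<omega>)"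
  have int: "integrable (P \<mu>) (\<lambda>\<omega>. exp_neg (f \<omega>) * exp_neg (g \<omega>))"
    if [measurable]: "f \<in> borel_measurable (P \<mu>)" "g \<in> borel_measurable (P \<mu>)" for f g
  proof (rule P.integrable_const_bound[where B=1])
    have "exp_neg a * exp_neg b \<le> 1" "0 \<le> exp_neg a * exp_neg b" for a b
      using exp_neg_bounds by (simp_all add: mult_le_one)
    then show "AE \<omega> in P \<mu>. norm (exp_neg (f \<omega>) * exp_neg (g \<omega>)) \<le> 1" by simp
  qed measurable
  have two: "exp_neg (2 * a) = exp_neg a * exp_neg a" for a by (simp add: mult_2 exp_neg_add)
  have eq: "(\<integral>\<omega>. (?u \<epsilon> \<omega> - ?v \<omega>)\<^sup>2 \<partial>P \<mu>) =
    (\<integral>\<omega>. exp_neg (ennreal 2 * strip_mass \<phi> \<epsilon> \<omega> + ennreal 0 * exit_mass \<phi> \<omega>) \<partial>P \<mu>)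
    - 2 * (\<integral>\<omega>. exp_neg (ennreal 1 * strip_mass \<phi> \<epsilon> \<omega> + ennreal 1 * exit_mass \<phi> \<omega>) \<partial>P \<mu>)
    + (\<integral>\<omega>. exp_neg (ennreal (1 + 1) * exit_mass \<phi> \<omega>) \<partial>P \<mu>)" for \<epsilon>
  proof -
    have "(\<integral>\<omega>. (?u \<epsilon> \<omega> - ?v \<omega>)\<^sup>2 \<partial>P \<mu>) = (\<integral>\<omega>. ?u \<epsilon> \<omega> * ?u \<epsilon> \<omega> - 2 * (?u \<epsilon> \<omega> * ?v \<omega>) + ?v \<omega> * ?v \<omega> \<partial>P \<mu>)"
      by (simp add: power2_eq_square algebra_simps)
    also have "\<dots> = (\<integral>\<omega>. ?u \<epsilon> \<omega> * ?u \<epsilon> \<omega> \<partial>P \<mu>) - 2 * (\<integral>\<omega>. ?u \<epsilon> \<omega> * ?v \<omega> \<partial>P \<mu>) + (\<integral>\<omega>. ?v \<omega> * ?v \<omega> \<partial>P \<mu>)"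
      by (simp add: int)
    finally show ?thesis by (simp add: two exp_neg_add)
  qed
  have "((\<lambda>\<epsilon>. \<integral>\<omega>. (?u \<epsilon> \<omega> - ?v \<omega>)\<^sup>2 \<partial>P \<mu>) \<longlongrightarrow>
    (\<integral>\<omega>. exp_neg (ennreal (2 + 0) * exit_mass \<phi> \<omega>) \<partial>P \<mu>) - 2 * (\<integral>\<omega>. exp_neg (ennreal (1 + 1) * exit_mass \<phi> \<omega>) \<partial>P \<mu>)
    + (\<integral>\<omega>. exp_neg (ennreal (1 + 1) * exit_mass \<phi> \<omega>) \<partial>P \<mu>)) (at_right 0)"
    unfolding eq
    by (intro tendsto_add tendsto_diff tendsto_mult tendsto_const joint_laplace_tendsto[OF \<phi> _ _ \<mu>]) simp_all
  then show ?thesis by simp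
qed

lemma space_strip_occupation: "space (strip_occupation D X \<epsilon> \<omega>) = closure D"
  using sets_eq_imp_space_eq[OF sets_strip_occupation] by (simp add: space_restrict_space)

text \<open>With \<open>U\<close> the total mass, \<open>P(U < \<infinity>) \<ge> E e\<^bsup>-\<kappa>U\<^esub> = exp (- \<integral>w d\<mu>)\<close> for every \<open>\<kappa> > 0\<close>, and the bound \<open>w \<le> 8 \<kappa>\<close> by
  the linear part of the equation lets the right-hand side tend to \<open>1\<close>.\<close>

lemma finite_strip_occupation:
  assumes \<mu>: "\<mu> \<in> finite_measures D"
  shows "\<forall>\<^sub>F \<epsilon> in at_right 0. AE \<omega> in P \<mu>. finite_measure (strip_occupation D X \<epsilon> \<omega>)"
proof -
  interpret P: prob_space "P \<mu>" by (rule prob_space_P[OF \<mu>])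
  interpret \<mu>: finite_measure \<mu> using \<mu> by (simp add: finite_measures_def)
  have sp\<mu>: "space \<mu> = D" using \<mu> sets_eq_imp_space_eq[of \<mu> RD] by (simp add: finite_measures_def space_restrict_space)
  obtain \<epsilon>0 where \<epsilon>0: "0 < \<epsilon>0"
    "\<And>x \<epsilon>. x \<in> D \<Longrightarrow> 0 < \<epsilon> \<Longrightarrow> \<epsilon> \<le> \<epsilon>0 \<Longrightarrow> (\<integral>y. indicator (inner_strip D \<epsilon>) y \<partial>green x) \<le> 8 * \<epsilon>^2"
    using strip_green_bound[OF R_pos tangent] by metis
  have one: "continuous_on (closure D) (\<lambda>_. 1 :: real)" "0 \<le> (1::real)" by auto
  have "AE \<omega> in P \<mu>. finite_measure (strip_occupation D X \<epsilon> \<omega>)" if \<epsilon>: "0 < \<epsilon>" "\<epsilon> \<le> \<epsilon>0" for \<epsilon>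
  proof -
    let ?U = "strip_mass (\<lambda>_. 1) \<epsilon>"
    have [measurable]: "?U \<in> borel_measurable (P \<mu>)"
      using measurable_strip_mass[OF one(1)] by (simp add: measurable_cong_sets[OF sets_P[OF \<mu>] refl])
    note [measurable] = measurable_exp_neg
    let ?A = "{\<omega> \<in> space (P \<mu>). ?U \<omega> < \<infinity>}"
    have low: "exp (- (\<kappa> * (8 * measure \<mu> D))) \<le> measure (P \<mu>) ?A" if \<kappa>: "0 < \<kappa>" for \<kappa>
    proof -
      have \<kappa>0: "0 \<le> \<kappa>" using \<kappa> by simp
      obtain w where w: "exit_equation D \<psi> W B (\<lambda>y. \<kappa> / \<epsilon>\<^sup>2 * (indicator (inner_strip D \<epsilon>) y * 1)) (\<lambda>y. 0 * 1) w"
        and L: "(\<integral>\<omega>. exp_neg (ennreal \<kappa> * ?U \<omega> + ennreal 0 * exit_mass (\<lambda>_. 1) \<omega>) \<partial>P \<mu>) = exp (- (\<integral>x. w x \<partial>\<mu>))"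
        using strip_exit_laplace[OF one \<kappa>0 order_refl] \<mu> by blast
      have c: "0 \<le> \<kappa> / \<epsilon>\<^sup>2" using \<kappa> by simp
      note W = exit_equation_real[OF w strip_density_bounded_borel(1)[OF one c] strip_density_bounded_borel(2)[OF one order_refl] \<psi>_0 \<psi>_mono]
      have wb: "0 \<le> w x \<and> w x \<le> 8 * \<kappa>" if x: "x \<in> D" for x
      proof -
        have "w x \<le> \<kappa> / \<epsilon>\<^sup>2 * (\<integral>y. indicator (inner_strip D \<epsilon>) y \<partial>green x)"
          using W(3)[OF x] unfolding linear_part_strip by simp
        also have "\<dots> \<le> \<kappa> / \<epsilon>\<^sup>2 * (8 * \<epsilon>\<^sup>2)" by (rule mult_left_mono[OF \<epsilon>0(2)[OF x \<epsilon>] c])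
        finally show ?thesis using W(3)[OF x] \<epsilon> by simp
      qed
      have "(\<integral>x. w x \<partial>\<mu>) \<le> (\<integral>x. 8 * \<kappa> \<partial>\<mu>)"
      proof (rule integral_mono_AE)
        have "w \<in> borel_measurable \<mu>"
          using w \<mu> by (simp add: exit_equation_def finite_measures_def measurable_cong_sets[of \<mu> RD])
        then show "integrable \<mu> w" using wb by (intro \<mu>.integrable_const_bound[where B="8 * \<kappa>"] AE_I2) (auto simp: sp\<mu>)
        show "AE x in \<mu>. w x \<le> 8 * \<kappa>" using wb by (intro AE_I2) (simp add: sp\<mu>)
      qed simp
      then have "exp (- (\<kappa> * (8 * measure \<mu> D))) \<le> exp (- (\<integral>x. w x \<partial>\<mu>))" by (simp add: sp\<mu> mult_ac)
      also have "\<dots> = (\<integral>\<omega>. exp_neg (ennreal \<kappa> * ?U \<omega>) \<partial>P \<mu>)" using L by simp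
      also have "\<dots> \<le> (\<integral>\<omega>. indicator ?A \<omega> \<partial>P \<mu>)"
      proof (rule integral_mono_AE)
        show "integrable (P \<mu>) (\<lambda>\<omega>. exp_neg (ennreal \<kappa> * ?U \<omega>))"
          by (rule P.integrable_const_bound[where B=1]) (auto simp: exp_neg_bounds)
        show "integrable (P \<mu>) (indicator ?A :: _ \<Rightarrow> real)"
          by (rule P.integrable_const_bound[where B=1]) (auto simp: indicator_def)
        show "AE \<omega> in P \<mu>. exp_neg (ennreal \<kappa> * ?U \<omega>) \<le> indicator ?A \<omega>"
        proof (rule AE_I2)
          fix \<omega> assume "\<omega> \<in> space (P \<mu>)"
          then show "exp_neg (ennreal \<kappa> * ?U \<omega>) \<le> indicator ?A \<omega>"
            using \<kappa> exp_neg_bounds[of "ennreal \<kappa> * ?U \<omega>"]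
            by (cases "?U \<omega> = \<infinity>") (auto simp: exp_neg_def ennreal_mult_top top.not_eq_extremum)
        qed
      qed
      also have "\<dots> = measure (P \<mu>) ?A" by simp
      finally show ?thesis .
    qed
    have "((\<lambda>\<kappa>. exp (- (\<kappa> * (8 * measure \<mu> D)))) \<longlongrightarrow> exp (- (0 * (8 * measure \<mu> D)))) (at_right 0)"
      by (intro tendsto_intros)
    moreover have "\<forall>\<^sub>F \<kappa> in at_right 0. exp (- (\<kappa> * (8 * measure \<mu> D))) \<le> measure (P \<mu>) ?A"
      using low by (auto simp: eventually_at_right_field intro!: exI[of _ 1])
    ultimately have "1 \<le> measure (P \<mu>) ?A" by (intro tendsto_upperbound[of _ 1 "at_right (0::real)"]) auto
    then have "measure (P \<mu>) ?A = 1" using P.prob_le_1[of ?A] by linarith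
    moreover have "?A \<in> sets (P \<mu>)" by measurable
    ultimately have "AE \<omega> in P \<mu>. \<omega> \<in> ?A" using P.prob_eq_1 by blast
    then show ?thesis
    proof eventually_elim
      case (elim \<omega>)
      then show ?case
        by (intro finite_measureI) (simp add: strip_mass_def top.not_eq_extremum)
    qed
  qed
  then show ?thesis using \<epsilon>0(1) by (auto simp: eventually_at_right_field intro!: exI[of _ \<epsilon>0])
qed

lemma strip_mass_tendsto_in_prob:
  assumes \<phi>: "continuous_on (closure D) \<phi>" "\<And>y. y \<in> closure D \<Longrightarrow> 0 \<le> \<phi> y" and \<mu>: "\<mu> \<in> finite_measures D" and \<delta>: "0 < \<delta>"
  shows "((\<lambda>\<epsilon>. measure (P \<mu>) {\<omega> \<in> space (P \<mu>). \<delta> < \<bar>enn2real (strip_mass \<phi> \<epsilon> \<omega>) - enn2real (exit_mass \<phi> \<omega>)\<bar>}) \<longlongrightarrow> 0) (at_right 0)"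
proof -
  interpret P: prob_space "P \<mu>" by (rule prob_space_P[OF \<mu>])
  show ?thesis
  proof (rule P.tendsto_in_prob_of_exp_neg[OF _ _ _ _ exp_strip_mass_L2_tendsto[OF \<phi> \<mu>] \<delta>])
    show "strip_mass \<phi> \<epsilon> \<in> borel_measurable (P \<mu>)" "exit_mass \<phi> \<in> borel_measurable (P \<mu>)" for \<epsilon>
      using measurable_strip_mass[OF \<phi>(1)] measurable_exit_mass[OF \<phi>(1)]
      by (simp_all add: measurable_cong_sets[OF sets_P[OF \<mu>] refl])
    show "AE \<omega> in P \<mu>. exit_mass \<phi> \<omega> < \<infinity>"
      using exit_mass_finite[OF \<phi>(1)] sets_eq_imp_space_eq[OF sets_P[OF \<mu>]] by (intro AE_I2) simp
    show "\<forall>\<^sub>F \<epsilon> in at_right 0. AE \<omega> in P \<mu>. strip_mass \<phi> \<epsilon> \<omega> < \<infinity>"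
      using finite_strip_occupation[OF \<mu>]
    proof eventually_elim
      case (elim \<epsilon>)
      then show ?case
      proof eventually_elim
        case (elim \<omega>)
        show ?case unfolding strip_mass_def by (rule nn_integral_bounded_finite[OF \<phi>(1) elim]) (simp add: space_strip_occupation)
      qed
    qed
  qed
qed

lemma strip_integral_converges_in_prob:
  fixes \<phi> :: "'a \<Rightarrow> real"
  assumes \<phi>: "continuous_on (closure D) \<phi>" and \<mu>: "\<mu> \<in> finite_measures D"
  shows "converges_in_prob (P \<mu>) (\<lambda>\<epsilon> \<omega>. \<integral>x. \<phi> x \<partial>strip_occupation D X \<epsilon> \<omega>) (\<lambda>\<omega>. \<integral>x. \<phi> x \<partial>XD \<omega>) (at_right 0)"
proof -
  interpret P: prob_space "P \<mu>" by (rule prob_space_P[OF \<mu>])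
  note spP = sets_eq_imp_space_eq[OF sets_P[OF \<mu>]]
  \<comment> \<open>\<open>ennreal\<close> truncates negative numbers, so the mass of \<open>p\<close> equals that of \<open>\<phi>\<close> and the mass of \<open>m\<close> that of \<open>- \<phi>\<close>\<close>
  define p m where "p x = max 0 (\<phi> x)" and "m x = max 0 (- \<phi> x)" for x
  have pm: "continuous_on (closure D) p" "continuous_on (closure D) m"
    unfolding p_def m_def by (intro continuous_intros \<phi>)+
  have nn: "0 \<le> p x" "0 \<le> m x" for x by (auto simp: p_def m_def)
  have en: "ennreal (p x) = ennreal (\<phi> x)" "ennreal (m x) = ennreal (- \<phi> x)" for x
    by (auto simp: p_def m_def max_def ennreal_neg)
  have [measurable]: "strip_mass p \<epsilon> \<in> borel_measurable (P \<mu>)" "strip_mass m \<epsilon> \<in> borel_measurable (P \<mu>)"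
    "exit_mass p \<in> borel_measurable (P \<mu>)" "exit_mass m \<in> borel_measurable (P \<mu>)" for \<epsilon>
    using measurable_strip_mass[OF pm(1)] measurable_exit_mass[OF pm(1)] measurable_strip_mass[OF pm(2)] measurable_exit_mass[OF pm(2)]
    by (simp_all add: measurable_cong_sets[OF sets_P[OF \<mu>] refl])
  have "\<phi> \<in> borel_measurable (strip_occupation D X \<epsilon> \<omega>)" for \<epsilon> \<omega>
    using borel_measurable_continuous_on_restrict[OF \<phi>] by (simp add: measurable_cong_sets[OF sets_strip_occupation refl])
  from integral_eq_nn_parts[OF this]
  have Y: "(\<integral>x. \<phi> x \<partial>strip_occupation D X \<epsilon> \<omega>) = (if strip_mass p \<epsilon> \<omega> < \<infinity> \<and> strip_mass m \<epsilon> \<omega> < \<infinity>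
    then enn2real (strip_mass p \<epsilon> \<omega>) - enn2real (strip_mass m \<epsilon> \<omega>) else 0)" for \<epsilon> \<omega>
    unfolding strip_mass_def en .
  have "\<phi> \<in> borel_measurable (XD \<omega>)" if "\<omega> \<in> space M" for \<omega>
    using measurable_frontier[OF \<phi>] by (simp add: measurable_cong_sets[OF sets_XD[OF that] refl])
  from integral_eq_nn_parts[OF this]
  have Z: "(\<integral>x. \<phi> x \<partial>XD \<omega>) = enn2real (exit_mass p \<omega>) - enn2real (exit_mass m \<omega>)" if "\<omega> \<in> space M" for \<omega>
    using exit_mass_finite[OF pm(1) that] exit_mass_finite[OF pm(2) that] that unfolding exit_mass_def en by simp
  have Ym: "(\<lambda>\<omega>. \<integral>x. \<phi> x \<partial>strip_occupation D X \<epsilon> \<omega>) \<in> borel_measurable (P \<mu>)" for \<epsilon>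
    unfolding Y by measurable
  have "(\<lambda>\<omega>. enn2real (exit_mass p \<omega>) - enn2real (exit_mass m \<omega>)) \<in> borel_measurable (P \<mu>)" by measurable
  then have Zm: "(\<lambda>\<omega>. \<integral>x. \<phi> x \<partial>XD \<omega>) \<in> borel_measurable (P \<mu>)"
    by (rule measurable_eqI) (simp add: Z spP)
  have "((\<lambda>\<epsilon>. measure (P \<mu>) {\<omega> \<in> space (P \<mu>). \<delta> < \<bar>(\<integral>x. \<phi> x \<partial>strip_occupation D X \<epsilon> \<omega>) - (\<integral>x. \<phi> x \<partial>XD \<omega>)\<bar>}) \<longlongrightarrow> 0) (at_right 0)"
    if \<delta>: "0 < \<delta>" for \<delta>
  proof -
    let ?A = "\<lambda>q \<epsilon>. {\<omega> \<in> space (P \<mu>). \<delta> / 2 < \<bar>enn2real (strip_mass q \<epsilon> \<omega>) - enn2real (exit_mass q \<omega>)\<bar>}"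
    let ?C = "\<lambda>\<epsilon>. {\<omega> \<in> space (P \<mu>). \<delta> < \<bar>(\<integral>x. \<phi> x \<partial>strip_occupation D X \<epsilon> \<omega>) - (\<integral>x. \<phi> x \<partial>XD \<omega>)\<bar>}"
    have \<delta>2: "0 < \<delta> / 2" using \<delta> by simp
    have lim: "((\<lambda>\<epsilon>. measure (P \<mu>) (?A p \<epsilon>) + measure (P \<mu>) (?A m \<epsilon>)) \<longlongrightarrow> 0) (at_right 0)"
      using tendsto_add[OF strip_mass_tendsto_in_prob[OF pm(1) nn(1) \<mu> \<delta>2] strip_mass_tendsto_in_prob[OF pm(2) nn(2) \<mu> \<delta>2]] by simp
    have "\<forall>\<^sub>F \<epsilon> in at_right 0. measure (P \<mu>) (?C \<epsilon>) \<le> measure (P \<mu>) (?A p \<epsilon>) + measure (P \<mu>) (?A m \<epsilon>)"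
      using finite_strip_occupation[OF \<mu>]
    proof eventually_elim
      case (elim \<epsilon>)
      have "measure (P \<mu>) (?C \<epsilon>) \<le> measure (P \<mu>) (?A p \<epsilon> \<union> ?A m \<epsilon>)"
      proof (rule P.finite_measure_mono_AE)
        show "AE \<omega> in P \<mu>. \<omega> \<in> ?C \<epsilon> \<longrightarrow> \<omega> \<in> ?A p \<epsilon> \<union> ?A m \<epsilon>"
          using elim
        proof eventually_elim
          case (elim \<omega>)
          have fin: "strip_mass p \<epsilon> \<omega> < \<infinity>" "strip_mass m \<epsilon> \<omega> < \<infinity>"
            unfolding strip_mass_def
            by (rule nn_integral_bounded_finite[OF _ elim]; simp add: pm space_strip_occupation)+
          show ?case
          proof
            assume \<omega>: "\<omega> \<in> ?C \<epsilon>"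
            then have "\<omega> \<in> space M" by (simp add: spP)
            have split: "\<delta> / 2 < \<bar>a - c\<bar> \<or> \<delta> / 2 < \<bar>b - d\<bar>" if "\<delta> < \<bar>(a - b) - (c - d)\<bar>" for a b c d :: real
              using that by linarith
            from \<omega> fin have "\<delta> < \<bar>(enn2real (strip_mass p \<epsilon> \<omega>) - enn2real (strip_mass m \<epsilon> \<omega>))
              - (enn2real (exit_mass p \<omega>) - enn2real (exit_mass m \<omega>))\<bar>"
              using \<open>\<omega> \<in> space M\<close> by (simp add: Y Z)
            from split[OF this] show "\<omega> \<in> ?A p \<epsilon> \<union> ?A m \<epsilon>" using \<omega> by simp
          qed
        qed
      qed measurable
      also have "\<dots> \<le> measure (P \<mu>) (?A p \<epsilon>) + measure (P \<mu>) (?A m \<epsilon>)" by (rule measure_Un_le) measurable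
      finally show ?case .
    qed
    then show ?thesis by (rule tendsto_sandwich[OF _ _ tendsto_const lim, rotated]) simp
  qed
  then show ?thesis unfolding converges_in_prob_def using Ym Zm by simp
qed

lemma strip_occupation_weakly_converges:
  assumes \<mu>: "\<mu> \<in> finite_measures D"
  shows "weakly_converges_in_prob (P \<mu>) (closure D) (\<lambda>\<epsilon>. strip_occupation D X \<epsilon>) XD (at_right 0)"
  unfolding weakly_converges_in_prob_def
  using finite_strip_occupation[OF \<mu>] strip_integral_converges_in_prob[OF _ \<mu>] finite_XD
    sets_eq_imp_space_eq[OF sets_P[OF \<mu>]] by auto

end

theorem proposition2p1:
  fixes D :: "'a::euclidean_space set"
    and n :: "real measure"
    and W :: "'a \<Rightarrow> 'v measure"
    and B :: "real \<Rightarrow> 'v \<Rightarrow> 'a"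
    and M :: "'w measure"
    and P :: "'a measure \<Rightarrow> 'w measure"
    and X :: "real \<Rightarrow> 'w \<Rightarrow> 'a measure"
    and XD :: "'w \<Rightarrow> 'a measure"
    and \<mu> :: "'a measure"
  assumes "DIM('a) \<ge> 2"
    and "bounded D"
    and "C2_domain D"
    and "sets n = sets (restrict_space borel {0<..})"
    and "sigma_finite_measure n"
    and "(\<integral>\<^sup>+ r. ennreal (min r (r\<^sup>2)) \<partial>n) < \<infinity>"
    and "super_brownian_motion D W B (branching_mechanism n) M P X"
    and "exit_measure D W B (branching_mechanism n) M P X XD"
    and "\<mu> \<in> finite_measures D"
  shows "weakly_converges_in_prob (P \<mu>) (closure D)
           (\<lambda>\<epsilon>. strip_occupation D X \<epsilon>) XD (at_right 0)"
proof -
  obtain R where R: "0 < R" "\<And>z. z \<in> frontier D \<Longrightarrow> tangent_balls D R z"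
    using C2_domain_tangent_balls[OF \<open>C2_domain D\<close> \<open>bounded D\<close>] by metis
  obtain l where l: "0 \<le> l" "\<And>u v C. 0 \<le> u \<Longrightarrow> u \<le> v \<Longrightarrow> v \<le> C \<Longrightarrow>
      branching_mechanism n u \<le> branching_mechanism n v \<and>
      branching_mechanism n v - branching_mechanism n u \<le> max 1 C * l * (v - u)"
    using branching_mechanism_increment[OF assms(4) assms(6)] by metis
  interpret exit_measure D W B "branching_mechanism n" M P X XD by fact
  have "open D" using \<open>C2_domain D\<close> by (simp add: C2_domain_def)
  then interpret strip_setting D W B "branching_mechanism n" M P X XD R l
    using R l \<open>bounded D\<close> branching_mechanism_0 by unfold_locales auto
  show ?thesis by (rule strip_occupation_weakly_converges[OF assms(9)])
qed

end
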